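(* Let $K$ be a field and let $\Gamma$ be a $K$-algebra whose enveloping algebra $\Gamma^e=\Gamma\otimes\Gamma^o$ is a Noetherian domain. Let $\mathcal{A}$ be a good construction of $K$-algebras. Then each algebra $A\in\mathcal{A}(\Gamma)$ is a Noetherian domain, and so is $D^e=D\otimes D^o$, where $D=\mathrm{Frac}(A)$. Hence the following hold for $D$ and for every $\Delta=\{\delta_1,\ldots,\delta_t\}$ which is either a finite set of commuting $K$-derivations or a finite set of commuting $K$-automorphisms of $D$: 1. $D$ satisfies the ascending chain condition on division $K$-subalgebras, or equivalently, every division $K$-subalgebra of $D$ is a finitely generated division $K$-algebra. 2. The group of eigenvalues $\mathrm{Ev}(\Delta)$ is a finitely generated abelian group, and so $\mathrm{Ev}(\Delta)=\mathcal{T}\oplus\mathbb{Z}^r$, where $r$ is the rank of $\mathrm{Ev}(\Delta)$ and $\mathcal{T}$ is a finite abelian group. 3. The eigen-algebra $D(\Delta)$ is a Noetherian domain isomorphic to an iterated skew Laurent extension: $D_{\mathcal{T}}:=\bigoplus_{\lambda\in\mathcal{T}}D_\lambda$ is a division algebra of right and left dimension $|\mathcal{T}|$ over the division algebra $D_0$, and $D(\Delta)$ is isomorphic to an iterated skew Laurent extension $D_{\mathcal{T}}[x_1,x_1^{-1};\sigma_1]\cdots[x_r,x_r^{-1};\sigma_r]$. 4. For each subgroup $F$ of $\mathrm{Ev}(\Delta)$, $\mathcal{F}(F):=\bigoplus_{\lambda\in F}D_\lambda$ is a Noetherian domain whose quotient division algebra $\mathrm{Frac}(\mathcal{F}(F))$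 is $\Delta$-invariant and satisfies $\mathrm{Ev}(\mathrm{Frac}(\mathcal{F}(F)))=F$; any $\Delta$-eigenvector $v\in\mathrm{Frac}(\mathcal{F}(F))_\lambda$ has the form $u^{-1}w$ for some $0\neq u\in D_\mu$, $w\in D_{\lambda+\mu}$, with $\lambda,\mu\in F$.
   Context: Notation: $\otimes=\otimes_K$; "Noetherian" for rings means left and right Noetherian. $A^o$ is the opposite algebra of $A$ (multiplication $a*b=ba$). For a Noetherian domain $A$, $\mathrm{Frac}(A)$ is its quotient division algebra. A construction $\mathcal{A}$ of $K$-algebras attaches to each $K$-algebra $\Gamma$ a set (class) $\mathcal{A}(\Gamma)$ of $K$-algebras. It is good if: (G1) if $\Gamma$ is a Noetherian domain then so is each algebra in $\mathcal{A}(\Gamma)$; (G2) $\mathcal{A}(\Gamma)^o\subseteq\mathcal{A}(\Gamma^o)$, where $\mathcal{A}(\Gamma)^o:=\{A^o\mid A\in\mathcal{A}(\Gamma)\}$; (G3) $\mathcal{A}(\Gamma)\otimes\mathcal{A}(\Gamma')\subseteq\mathcal{A}(\Gamma\otimes\Gamma')$, where $\mathcal{A}(\Gamma)\otimes\mathcal{A}(\Gamma'):=\{A\otimes A'\mid A\in\mathcal{A}(\Gamma),A'\in\mathcal{A}(\Gamma')\}$; for all $K$-algebras $\Gamma,\Gamma'$. A division $K$-algebra $E$ is a finitely generated division algebra if there are finitely many elements $x_1,\ldots,x_n\in E$ such that $E$ is the only division $K$-subalgebra of $E$ containing $x_1,\ldots,x_n$. Eigenvalues. In the derivation case $\mathrm{Ev}(\Delta):=\{\lambda\in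 K^t \mid \delta_i(u)=\lambda_iu,\ i=1,\ldots,t,\ \text{for some } 0\ne u\in D\}$, an additive subgroup of $K^t$. In the automorphism case $\mathrm{Ev}(\Delta):=\{\lambda\in (K^* )^t\mid \delta_i(u)=\lambda_iu,\ i=1,\ldots,t,\ \text{for some } 0\neq u\in D\}$, a multiplicative subgroup of $(K^* )^t$, $K^*=K\setminus\{0\}$; its operation is also written additively, so $\lambda+\mu$ means the componentwise product and $0$ means $(1,\ldots,1)$. For $\lambda\in\mathrm{Ev}(\Delta)$, $D_\lambda:=\{u\in D\mid\delta_i(u)=\lambda_iu,\ i=1,\ldots,t\}$; in particular $D_0$ is the division subalgebra of $\Delta$-constants. The eigen-algebra is $D(\Delta):=\bigoplus_{\lambda\in\mathrm{Ev}(\Delta)}D_\lambda\subseteq D$. For a $\Delta$-invariant division subalgebra $E\subseteq D$, $\mathrm{Ev}(E)$ and $E_\lambda$ are defined in the same way with $E$ in place of $D$; $\mathrm{Frac}(\mathcal{F}(F))$ is viewed inside $D$. The rank of an abelian group $G$ is $\dim_{\mathbb{Q}}(\mathbb{Q}\otimes_{\mathbb{Z}}G)$; $\mathcal{T}$ is the torsion subgroup of $\mathrm{Ev}(\Delta)$. For a ring $R$ and an automorphism $\sigma$ of $R$, the skew Laurent extension $R[x,x^{-1};\sigma]$ is generated by $R$ and $x^{\pm1}$ subject to $x^{\pm1}a=\sigma^{\pm1}(a)x^{\pm1}$ for $a\in R$ (free as a left $R$-module on the powers of $x$). Iterated skew Laurent extensions are defined inductively by $A_n=A_{n-1}[x_n,x_n^{-1};\sigma_n]$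 with $\sigma_n$ an automorphism of $A_{n-1}$, $A_0=R$. *)

theory Defs
  imports "HOL-Algebra.Algebra"
begin

section \<open>Noncommutative rings and algebras over a field\<close>

text \<open>
  The locales \<open>algebra\<close>, \<open>domain\<close>, \<open>field\<close>, \<open>noetherian_ring\<close> and \<open>noetherian_domain\<close> of HOL-Algebra are for commutative
  (or two-sided) notions.  A subset \<open>E\<close> of \<open>D\<close> with the operations of \<open>D\<close> is \<open>D\<lparr>carrier := E\<rparr>\<close>.
\<close>

locale k_algebra =
  fixes K :: "'k ring" and A :: "('k, 'a) module"
  assumes field: "field K"
    and ring: "ring A"
    and module: "module K A"
    and smult_mult_left: "\<lbrakk>c \<in> carrier K; x \<in> carrier A; y \<in> carrier A\<rbrakk> \<Longrightarrow>
      (c \<odot>\<^bsub>A\<^esub> x) \<otimes>\<^bsub>A\<^esub> y = c \<odot>\<^bsub>A\<^esub> (x \<otimes>\<^bsub>A\<^esub> y)"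
    and smult_mult_right: "\<lbrakk>c \<in> carrier K; x \<in> carrier A; y \<in> carrier A\<rbrakk> \<Longrightarrow>
      x \<otimes>\<^bsub>A\<^esub> (c \<odot>\<^bsub>A\<^esub> y) = c \<odot>\<^bsub>A\<^esub> (x \<otimes>\<^bsub>A\<^esub> y)"

definition left_ideal :: "'a set \<Rightarrow> ('a, 'm) ring_scheme \<Rightarrow> bool" where
  "left_ideal I A \<longleftrightarrow> additive_subgroup I A \<and> (\<forall>a\<in>carrier A. \<forall>x\<in>I. a \<otimes>\<^bsub>A\<^esub> x \<in> I)"

definition right_ideal :: "'a set \<Rightarrow> ('a, 'm) ring_scheme \<Rightarrow> bool" where
  "right_ideal I A \<longleftrightarrow> additive_subgroup I A \<and> (\<forall>a\<in>carrier A. \<forall>x\<in>I. x \<otimes>\<^bsub>A\<^esub> a \<in> I)"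

definition acc_on :: "('a set \<Rightarrow> bool) \<Rightarrow> bool" where
  "acc_on P \<longleftrightarrow> (\<forall>I :: nat \<Rightarrow> 'a set.
     (\<forall>n. P (I n)) \<and> (\<forall>n. I n \<subseteq> I (Suc n)) \<longrightarrow> (\<exists>n. \<forall>m\<ge>n. I m = I n))"

definition nc_noetherian_domain :: "('a, 'm) ring_scheme \<Rightarrow> bool" where
  "nc_noetherian_domain A \<longleftrightarrow> ring A \<and> \<one>\<^bsub>A\<^esub> \<noteq> \<zero>\<^bsub>A\<^esub> \<and>
     (\<forall>x\<in>carrier A. \<forall>y\<in>carrier A. x \<otimes>\<^bsub>A\<^esub> y = \<zero>\<^bsub>A\<^esub> \<longrightarrow> x = \<zero>\<^bsub>A\<^esub> \<or> y = \<zero>\<^bsub>A\<^esub>) \<and>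
     acc_on (\<lambda>I. left_ideal I A) \<and> acc_on (\<lambda>I. right_ideal I A)"

definition opposite :: "('k, 'a) module \<Rightarrow> ('k, 'a) module" where
  "opposite A = A\<lparr>monoid.mult := (\<lambda>x y. y \<otimes>\<^bsub>A\<^esub> x)\<rparr>"

definition algebra_hom :: "'k ring \<Rightarrow> ('k, 'a) module \<Rightarrow> ('k, 'b) module \<Rightarrow> ('a \<Rightarrow> 'b) set" where
  "algebra_hom K A B = {h \<in> ring_hom A B.
     \<forall>c\<in>carrier K. \<forall>x\<in>carrier A. h (c \<odot>\<^bsub>A\<^esub> x) = c \<odot>\<^bsub>B\<^esub> h x}"

definition algebra_iso :: "'k ring \<Rightarrow> ('k, 'a) module \<Rightarrow> ('k, 'b) module \<Rightarrow> ('a \<Rightarrow> 'b) set" where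
  "algebra_iso K A B = {h \<in> algebra_hom K A B. bij_betw h (carrier A) (carrier B)}"

definition division_algebra :: "'k ring \<Rightarrow> ('k, 'a) module \<Rightarrow> bool" where
  "division_algebra K D \<longleftrightarrow> k_algebra K D \<and> \<one>\<^bsub>D\<^esub> \<noteq> \<zero>\<^bsub>D\<^esub> \<and> Units D = carrier D - {\<zero>\<^bsub>D\<^esub>}"

definition division_subalgebra :: "'k ring \<Rightarrow> ('k, 'a) module \<Rightarrow> 'a set \<Rightarrow> bool" where
  "division_subalgebra K D E \<longleftrightarrow> E \<subseteq> carrier D \<and> division_algebra K (D\<lparr>carrier := E\<rparr>)"

definition fg_division_algebra :: "'k ring \<Rightarrow> ('k, 'a) module \<Rightarrow> bool" where
  "fg_division_algebra K E \<longleftrightarrow> division_algebra K E \<and>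
     (\<exists>Y. finite Y \<and> Y \<subseteq> carrier E \<and>
        (\<forall>E'. division_subalgebra K E E' \<and> Y \<subseteq> E' \<longrightarrow> E' = carrier E))"

text \<open>
  \<open>D = Frac(A)\<close>, with embedding \<open>i : A \<rightarrow> D\<close>.  A (left and right) Noetherian domain is a left and a
  right Ore domain, so its left and right quotient rings exist and coincide.
\<close>

definition quotient_division_algebra ::
    "'k ring \<Rightarrow> ('k, 'a) module \<Rightarrow> ('k, 'd) module \<Rightarrow> ('a \<Rightarrow> 'd) \<Rightarrow> bool" where
  "quotient_division_algebra K A D i \<longleftrightarrow>
     k_algebra K A \<and> division_algebra K D \<and> i \<in> algebra_hom K A D \<and> inj_on i (carrier A) \<and>
     (\<forall>d\<in>carrier D.
        (\<exists>s\<in>carrier A - {\<zero>\<^bsub>A\<^esub>}. \<exists>a\<in>carrier A. d = inv\<^bsub>D\<^esub> (i s) \<otimes>\<^bsub>D\<^esub> i a) \<and>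
        (\<exists>s\<in>carrier A - {\<zero>\<^bsub>A\<^esub>}. \<exists>a\<in>carrier A. d = i a \<otimes>\<^bsub>D\<^esub> inv\<^bsub>D\<^esub> (i s)))"

text \<open>The quotient division algebra, inside \<open>D\<close>, of a Noetherian subdomain \<open>S\<close> of \<open>D\<close>.\<close>

definition fractions :: "('k, 'a) module \<Rightarrow> 'a set \<Rightarrow> 'a set" where
  "fractions D S = {inv\<^bsub>D\<^esub> u \<otimes>\<^bsub>D\<^esub> w | u w. u \<in> S \<and> u \<noteq> \<zero>\<^bsub>D\<^esub> \<and> w \<in> S}"


section \<open>Tensor products\<close>

text \<open>
  The balanced tensor product of two abelian groups \<open>M\<close>, \<open>N\<close> with scalars \<open>S\<close> acting on \<open>M\<close> by \<open>l\<close>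
  and on \<open>N\<close> by \<open>r\<close>: the free abelian group on \<open>M \<times> N\<close> modulo the subgroup generated by the
  biadditivity and balancing relations.
\<close>

definition tensor_free :: "('a, 'm) monoid_scheme \<Rightarrow> ('b, 'n) monoid_scheme \<Rightarrow> ('a \<times> 'b \<Rightarrow>\<^sub>0 int) monoid" where
  "tensor_free M N = free_Abelian_group (carrier M \<times> carrier N)"

definition tensor_relations ::
    "('a, 'm) monoid_scheme \<Rightarrow> ('b, 'n) monoid_scheme \<Rightarrow> 's set \<Rightarrow> ('s \<Rightarrow> 'a \<Rightarrow> 'a) \<Rightarrow> ('s \<Rightarrow> 'b \<Rightarrow> 'b)
      \<Rightarrow> ('a \<times> 'b \<Rightarrow>\<^sub>0 int) set" where
  "tensor_relations M N S l r = generate (tensor_free M N)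
    ({frag_of (x \<otimes>\<^bsub>M\<^esub> x', y) - frag_of (x, y) - frag_of (x', y) | x x' y.
        x \<in> carrier M \<and> x' \<in> carrier M \<and> y \<in> carrier N} \<union>
     {frag_of (x, y \<otimes>\<^bsub>N\<^esub> y') - frag_of (x, y) - frag_of (x, y') | x y y'.
        x \<in> carrier M \<and> y \<in> carrier N \<and> y' \<in> carrier N} \<union>
     {frag_of (l s x, y) - frag_of (x, r s y) | s x y.
        s \<in> S \<and> x \<in> carrier M \<and> y \<in> carrier N})"

definition tensor_group ::
    "('a, 'm) monoid_scheme \<Rightarrow> ('b, 'n) monoid_scheme \<Rightarrow> 's set \<Rightarrow> ('s \<Rightarrow> 'a \<Rightarrow> 'a) \<Rightarrow> ('s \<Rightarrow> 'b \<Rightarrow> 'b)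
      \<Rightarrow> ('a \<times> 'b \<Rightarrow>\<^sub>0 int) set monoid" where
  "tensor_group M N S l r = tensor_free M N Mod tensor_relations M N S l r"

text \<open>Action on the tensor product of an endomorphism \<open>\<phi>\<close> of the first factor.\<close>

definition tensor_act_left ::
    "('a, 'm) monoid_scheme \<Rightarrow> ('b, 'n) monoid_scheme \<Rightarrow> 's set \<Rightarrow> ('s \<Rightarrow> 'a \<Rightarrow> 'a) \<Rightarrow> ('s \<Rightarrow> 'b \<Rightarrow> 'b)
      \<Rightarrow> ('a \<Rightarrow> 'a) \<Rightarrow> ('a \<times> 'b \<Rightarrow>\<^sub>0 int) set \<Rightarrow> ('a \<times> 'b \<Rightarrow>\<^sub>0 int) set" where
  "tensor_act_left M N S l r \<phi> P = (\<Union>f\<in>P. tensor_relations M N S l r #>\<^bsub>tensor_free M N\<^esub>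
      frag_extend (\<lambda>(x, y). frag_of (\<phi> x, y)) f)"

definition tensor_algebra ::
    "'k ring \<Rightarrow> ('k, 'a) module \<Rightarrow> ('k, 'b) module \<Rightarrow> ('k, ('a \<times> 'b \<Rightarrow>\<^sub>0 int) set) module" where
  "tensor_algebra K A B =
    (let M = add_monoid A; N = add_monoid B; S = carrier K; F = tensor_free M N;
         R = tensor_relations M N S (smult A) (smult B);
         T = tensor_group M N S (smult A) (smult B)
     in \<lparr>carrier = carrier T,
         monoid.mult = (\<lambda>P Q. \<Union>f\<in>P. \<Union>g\<in>Q. R #>\<^bsub>F\<^esub>
            frag_extend (\<lambda>(x, y). frag_extend (\<lambda>(x', y'). frag_of (x \<otimes>\<^bsub>A\<^esub> x', y \<otimes>\<^bsub>B\<^esub> y')) g) f),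
         one = R #>\<^bsub>F\<^esub> frag_of (\<one>\<^bsub>A\<^esub>, \<one>\<^bsub>B\<^esub>),
         ring.zero = \<one>\<^bsub>T\<^esub>,
         ring.add = monoid.mult T,
         smult = (\<lambda>c. tensor_act_left M N S (smult A) (smult B) (smult A c))\<rparr>)"

abbreviation enveloping_algebra ::
    "'k ring \<Rightarrow> ('k, 'a) module \<Rightarrow> ('k, ('a \<times> 'a \<Rightarrow>\<^sub>0 int) set) module" where
  "enveloping_algebra K A \<equiv> tensor_algebra K A (opposite A)"


section \<open>Good constructions\<close>

text \<open>
  The algebras under consideration are those with carrier in one (arbitrary) type \<open>'u\<close>.  The tensor
  products \<open>A \<otimes> A'\<close> and \<open>\<Gamma> \<otimes> \<Gamma>'\<close> live on another type, so (G3) is read up to isomorphism: some copy of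
  \<open>A \<otimes> A'\<close> is in the class of some copy of \<open>\<Gamma> \<otimes> \<Gamma>'\<close>.  For a construction that is invariant under
  isomorphism this is (G3) verbatim; in general it is (G3) for its closure under isomorphism.
\<close>

definition good_construction ::
    "'k ring \<Rightarrow> (('k, 'u) module \<Rightarrow> ('k, 'u) module set) \<Rightarrow> bool" where
  "good_construction K \<A> \<longleftrightarrow>
     (\<forall>\<Gamma>. k_algebra K \<Gamma> \<longrightarrow> (\<forall>A\<in>\<A> \<Gamma>. k_algebra K A)) \<and>
     (\<forall>\<Gamma>. k_algebra K \<Gamma> \<and> nc_noetherian_domain \<Gamma> \<longrightarrow> (\<forall>A\<in>\<A> \<Gamma>. nc_noetherian_domain A)) \<and>
     (\<forall>\<Gamma>. k_algebra K \<Gamma> \<longrightarrow> opposite ` \<A> \<Gamma> \<subseteq> \<A> (opposite \<Gamma>)) \<and>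
     (\<forall>\<Gamma> \<Gamma>'. k_algebra K \<Gamma> \<and> k_algebra K \<Gamma>' \<longrightarrow>
        (\<forall>A\<in>\<A> \<Gamma>. \<forall>A'\<in>\<A> \<Gamma>'. \<exists>G T. k_algebra K G \<and>
           algebra_iso K (tensor_algebra K \<Gamma> \<Gamma>') G \<noteq> {} \<and>
           algebra_iso K (tensor_algebra K A A') T \<noteq> {} \<and> T \<in> \<A> G))"


section \<open>Abelian groups and dimension\<close>

text \<open>
  \<open>V\<close> (an abelian group, written multiplicatively) has a basis with \<open>n\<close> elements with respect to the
  action \<open>act\<close> of the division ring with underlying set \<open>S\<close>; right actions are allowed.
\<close>

definition has_dimension ::
    "'s set \<Rightarrow> ('s \<Rightarrow> 'v \<Rightarrow> 'v) \<Rightarrow> ('v, 'm) monoid_scheme \<Rightarrow> nat \<Rightarrow> bool" where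
  "has_dimension S act V n \<longleftrightarrow> (\<exists>B \<subseteq> carrier V. finite B \<and> card B = n \<and>
     (\<forall>v\<in>carrier V. \<exists>!c. c \<in> B \<rightarrow>\<^sub>E S \<and> v = (\<Otimes>\<^bsub>V\<^esub>b\<in>B. act (c b) b)))"

definition rat_group :: "rat monoid" where
  "rat_group = \<lparr>carrier = UNIV, monoid.mult = (+), one = 0\<rparr>"

text \<open>\<open>r = dim\<^sub>\<rat> (\<rat> \<otimes>\<^sub>\<int> G)\<close>\<close>

definition has_rank :: "('g, 'm) monoid_scheme \<Rightarrow> nat \<Rightarrow> bool" where
  "has_rank G r \<longleftrightarrow>
     (let l = (\<lambda>(n :: int) (q :: rat). of_int n * q); a = (\<lambda>n g. g [^]\<^bsub>G\<^esub> n)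
      in has_dimension (UNIV :: rat set)
           (\<lambda>q. tensor_act_left rat_group G (UNIV :: int set) l a ((*) q))
           (tensor_group rat_group G UNIV l a) r)"

definition fg_abelian_group :: "('g, 'm) monoid_scheme \<Rightarrow> bool" where
  "fg_abelian_group G \<longleftrightarrow> comm_group G \<and> (\<exists>Y \<subseteq> carrier G. finite Y \<and> generate G Y = carrier G)"

definition torsion :: "('g, 'm) monoid_scheme \<Rightarrow> 'g set" where
  "torsion G = {x \<in> carrier G. \<exists>n :: nat. n > 0 \<and> x [^]\<^bsub>G\<^esub> n = \<one>\<^bsub>G\<^esub>}"


section \<open>Skew Laurent extensions\<close>

definition auto_power :: "('k, 'a) module \<Rightarrow> ('a \<Rightarrow> 'a) \<Rightarrow> int \<Rightarrow> 'a \<Rightarrow> 'a" where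
  "auto_power A \<sigma> n =
     (if n \<ge> 0 then \<sigma> ^^ nat n else inv_into (carrier A) \<sigma> ^^ nat (- n))"

text \<open>
  \<open>A[x, x\<^sup>-\<^sup>1; \<sigma>]\<close>: the function \<open>f\<close> stands for the sum of the \<open>f n x\<^sup>n\<close>; the product is determined by
  \<open>x\<^sup>n a = \<sigma>\<^sup>n(a) x\<^sup>n\<close>.
\<close>

definition skew_laurent :: "('k, 'a) module \<Rightarrow> ('a \<Rightarrow> 'a) \<Rightarrow> ('k, int \<Rightarrow> 'a) module" where
  "skew_laurent A \<sigma> =
    \<lparr>carrier = {f. (\<forall>n. f n \<in> carrier A) \<and> finite {n. f n \<noteq> \<zero>\<^bsub>A\<^esub>}},
     monoid.mult = (\<lambda>f g n. \<Oplus>\<^bsub>A\<^esub>i\<in>{i. f i \<noteq> \<zero>\<^bsub>A\<^esub>}. f i \<otimes>\<^bsub>A\<^esub> auto_power A \<sigma> i (g (n - i))),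
     one = (\<lambda>n. if n = 0 then \<one>\<^bsub>A\<^esub> else \<zero>\<^bsub>A\<^esub>),
     ring.zero = (\<lambda>n. \<zero>\<^bsub>A\<^esub>),
     ring.add = (\<lambda>f g n. f n \<oplus>\<^bsub>A\<^esub> g n),
     smult = (\<lambda>c f n. c \<odot>\<^bsub>A\<^esub> f n)\<rparr>"

text \<open>
  \<open>S\<close> is isomorphic, as a \<open>K\<close>-algebra, to some \<open>R[x\<^sub>1, x\<^sub>1\<^sup>-\<^sup>1; \<sigma>\<^sub>1] \<dots> [x\<^sub>n, x\<^sub>n\<^sup>-\<^sup>1; \<sigma>\<^sub>n]\<close>.  Every stage is
  replaced by an isomorphic copy on one type, as the type of \<open>skew_laurent\<close> grows.
\<close>

inductive iterated_skew_laurent ::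
    "'k ring \<Rightarrow> ('k, 'a) module \<Rightarrow> nat \<Rightarrow> ('k, 's) module \<Rightarrow> bool"
  for K :: "'k ring" and R :: "('k, 'a) module" where
  base: "\<lbrakk>k_algebra K S; algebra_iso K R S \<noteq> {}\<rbrakk> \<Longrightarrow> iterated_skew_laurent K R 0 S"
| step: "\<lbrakk>iterated_skew_laurent K R n A; \<sigma> \<in> algebra_iso K A A;
          k_algebra K S; algebra_iso K (skew_laurent A \<sigma>) S \<noteq> {}\<rbrakk>
         \<Longrightarrow> iterated_skew_laurent K R (Suc n) S"


section \<open>Eigenvalues\<close>

text \<open>
  \<open>\<Delta>\<close> is given by \<open>\<delta> 1, \<dots>, \<delta> t\<close>.  The group \<open>H\<close> is the additive group of \<open>K\<close> in the case of
  derivations and the unit group of \<open>K\<close> in the case of automorphisms; the ambient group of the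
  eigenvalues is \<open>H\<^sup>t\<close>.
\<close>

definition derivations :: "'k ring \<Rightarrow> ('k, 'a) module \<Rightarrow> ('a \<Rightarrow> 'a) set" where
  "derivations K D = {d \<in> carrier D \<rightarrow> carrier D.
     (\<forall>x\<in>carrier D. \<forall>y\<in>carrier D. d (x \<oplus>\<^bsub>D\<^esub> y) = d x \<oplus>\<^bsub>D\<^esub> d y \<and>
        d (x \<otimes>\<^bsub>D\<^esub> y) = d x \<otimes>\<^bsub>D\<^esub> y \<oplus>\<^bsub>D\<^esub> x \<otimes>\<^bsub>D\<^esub> d y) \<and>
     (\<forall>c\<in>carrier K. \<forall>x\<in>carrier D. d (c \<odot>\<^bsub>D\<^esub> x) = c \<odot>\<^bsub>D\<^esub> d x)}"

definition commuting_maps :: "('k, 'a) module \<Rightarrow> nat \<Rightarrow> (nat \<Rightarrow> 'a \<Rightarrow> 'a) \<Rightarrow> bool" where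
  "commuting_maps D t \<delta> \<longleftrightarrow>
     (\<forall>i\<in>{1..t}. \<forall>j\<in>{1..t}. \<forall>x\<in>carrier D. \<delta> i (\<delta> j x) = \<delta> j (\<delta> i x))"

definition invariant :: "nat \<Rightarrow> (nat \<Rightarrow> 'a \<Rightarrow> 'a) \<Rightarrow> 'a set \<Rightarrow> bool" where
  "invariant t \<delta> E \<longleftrightarrow> (\<forall>i\<in>{1..t}. \<delta> i ` E \<subseteq> E)"

definition eigenspace ::
    "('k, 'a) module \<Rightarrow> nat \<Rightarrow> (nat \<Rightarrow> 'a \<Rightarrow> 'a) \<Rightarrow> (nat \<Rightarrow> 'k) \<Rightarrow> 'a set" where
  "eigenspace D t \<delta> l = {u \<in> carrier D. \<forall>i\<in>{1..t}. \<delta> i u = l i \<odot>\<^bsub>D\<^esub> u}"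

definition weight_group :: "'k monoid \<Rightarrow> nat \<Rightarrow> (nat \<Rightarrow> 'k) monoid" where
  "weight_group H t = product_group {1..t} (\<lambda>i. H)"

definition eigenvalues ::
    "'k monoid \<Rightarrow> ('k, 'a) module \<Rightarrow> nat \<Rightarrow> (nat \<Rightarrow> 'a \<Rightarrow> 'a) \<Rightarrow> (nat \<Rightarrow> 'k) set" where
  "eigenvalues H D t \<delta> =
     {l \<in> carrier (weight_group H t). \<exists>u \<in> eigenspace D t \<delta> l. u \<noteq> \<zero>\<^bsub>D\<^esub>}"

definition eigenvalue_group ::
    "'k monoid \<Rightarrow> ('k, 'a) module \<Rightarrow> nat \<Rightarrow> (nat \<Rightarrow> 'a \<Rightarrow> 'a) \<Rightarrow> (nat \<Rightarrow> 'k) monoid" where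
  "eigenvalue_group H D t \<delta> = (weight_group H t)\<lparr>carrier := eigenvalues H D t \<delta>\<rparr>"

text \<open>The sum of the eigenspaces with eigenvalue in \<open>L\<close>, and the statement that this sum is direct.\<close>

definition eigen_sum ::
    "('k, 'a) module \<Rightarrow> nat \<Rightarrow> (nat \<Rightarrow> 'a \<Rightarrow> 'a) \<Rightarrow> (nat \<Rightarrow> 'k) set \<Rightarrow> 'a set" where
  "eigen_sum D t \<delta> L = {\<Oplus>\<^bsub>D\<^esub>l\<in>M. f l | M f.
     finite M \<and> M \<subseteq> L \<and> (\<forall>l\<in>M. f l \<in> eigenspace D t \<delta> l)}"

definition eigen_sum_direct ::
    "('k, 'a) module \<Rightarrow> nat \<Rightarrow> (nat \<Rightarrow> 'a \<Rightarrow> 'a) \<Rightarrow> (nat \<Rightarrow> 'k) set \<Rightarrow> bool" where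
  "eigen_sum_direct D t \<delta> L \<longleftrightarrow> (\<forall>M f.
     finite M \<and> M \<subseteq> L \<and> (\<forall>l\<in>M. f l \<in> eigenspace D t \<delta> l) \<and> (\<Oplus>\<^bsub>D\<^esub>l\<in>M. f l) = \<zero>\<^bsub>D\<^esub>
       \<longrightarrow> (\<forall>l\<in>M. f l = \<zero>\<^bsub>D\<^esub>))"

end

theory Submission
  imports Defs
begin

text \<open>
  If \<open>A \<otimes> A\<^sup>o\<close> is a Noetherian domain and \<open>D = Frac A\<close>, then \<open>D \<otimes> D\<^sup>o\<close> is a localization of \<open>A \<otimes> A\<^sup>o\<close>,
  hence again a Noetherian domain.  For a division subalgebra \<open>E\<close> of \<open>D\<close>, the kernel of
  \<open>D \<otimes> D\<^sup>o \<rightarrow> D \<otimes>\<^sub>E D\<close> is a left ideal, which contains \<open>e \<otimes> 1 - 1 \<otimes> e\<close> exactly for \<open>e \<in> E\<close>; this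
  turns the chain condition on left ideals into the one on division subalgebras.

  The nonzero eigenspaces are one-dimensional over \<open>D\<^sub>0\<close> on both sides and multiply like the group of
  eigenvalues.  A strictly increasing chain of subgroups \<open>F\<close> would give a strictly increasing chain of
  division subalgebras \<open>Frac (\<F>(F))\<close>, since the eigenvalues of \<open>Frac (\<F>(F))\<close> are exactly \<open>F\<close>;
  so the group of eigenvalues is finitely generated.  Each free generator contributes one skew
  Laurent variable, and \<open>\<F>(F)\<close> is Noetherian by Hilbert's basis theorem.
\<close>

section \<open>Chain conditions and opposite rings\<close>

text \<open>A threatening circularity fixes the order of the argument. The fractions of
  \<open>\<F>(F)\<close> form a division algebra only by the Ore condition, which comes from the
  Noetherian property, and that is proved by induction over finitely many generators of
  \<open>F\<close>. So the chain argument that bounds the group of eigenvalues runs over finitely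
  generated subgroups only, and a maximal choice among them turns out to exhaust the given subgroup.

  Neither \<open>D \<otimes>\<^sub>E D\<close> nor a basis of an algebra is ever formed. Elements of
  a tensor product are tested by maps built from linear functionals, which Zorn's lemma supplies
  over any division ring: the slices \<open>id \<otimes> f\<close> over \<open>K\<close>, and the
  maps \<open>x \<otimes> y \<mapsto> x f(y)\<close> with \<open>f\<close> left linear over
  \<open>E\<close>.

  Work is done on the left only; the right-hand version is the left-hand one for the opposite
  algebras.

  Derivations and automorphisms differ in how an eigenvector is multiplied or inverted. Both are
  reduced to independent subspaces, indexed by a commutative group, whose nonzero elements are units
  with inverses of the opposite degree; nearly all claims about eigenvalues are proved at that
  level.\<close>

lemma acc_on_maximal:
  assumes acc: "acc_on P" and ne: "F \<noteq> {}" and P: "\<And>Z. Z \<in> F \<Longrightarrow> P Z"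
  obtains M where "M \<in> F" "\<And>Z. Z \<in> F \<Longrightarrow> M \<subseteq> Z \<Longrightarrow> Z = M"
proof (rule ccontr)
  assume "\<not> thesis"
  then have "\<forall>M\<in>F. \<exists>Z\<in>F. M \<subset> Z"
    using that by (metis psubsetI)
  then obtain s where s: "\<And>M. M \<in> F \<Longrightarrow> s M \<in> F \<and> M \<subset> s M"
    by metis
  obtain Z0 where Z0: "Z0 \<in> F"
    using ne by blast
  define I where "I n = (s ^^ n) Z0" for n
  have IF: "I n \<in> F" for n
    by (induction n) (use Z0 s in \<open>auto simp: I_def\<close>)
  have IS: "I n \<subset> I (Suc n)" for n
    using s[OF IF[of n]] by (simp add: I_def)
  then obtain n where "\<forall>m\<ge>n. I m = I n"
    using acc[unfolded acc_on_def, rule_format, of I] IF P by blast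
  then have "I (Suc n) = I n"
    by (meson le_SucI order_refl)
  then show False
    using IS[of n] by simp
qed

text \<open>One device for every descent of a chain condition. Injectivity of \<open>\<Phi>\<close>
  is asked on comparable pairs only, which is all that a chain provides. It is applied to ideals of
  a tensor factor, of a ring of fractions and of an isomorphic ring, and to division
  subalgebras.\<close>

lemma acc_on_transfer:
  assumes acc: "acc_on Q" and PQ: "\<And>I. P I \<Longrightarrow> Q (\<Phi> I)"
    and mono: "\<And>I J. P I \<Longrightarrow> P J \<Longrightarrow> I \<subseteq> J \<Longrightarrow> \<Phi> I \<subseteq> \<Phi> J"
    and inj: "\<And>I J. P I \<Longrightarrow> P J \<Longrightarrow> I \<subseteq> J \<Longrightarrow> \<Phi> I = \<Phi> J \<Longrightarrow> I = J"
  shows "acc_on P"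
  unfolding acc_on_def
proof (intro allI impI, elim conjE)
  fix I :: "nat \<Rightarrow> 'b set"
  assume P: "\<forall>n. P (I n)" and I: "\<forall>n. I n \<subseteq> I (Suc n)"
  obtain n where n: "\<forall>m\<ge>n. \<Phi> (I m) = \<Phi> (I n)"
    using acc[unfolded acc_on_def, rule_format, of "\<lambda>n. \<Phi> (I n)"] PQ mono P I by meson
  have "I n \<subseteq> I m" if "m \<ge> n" for m
    using I that by (meson lift_Suc_mono_le)
  then have "\<forall>m\<ge>n. I m = I n"
    using inj P n by metis
  then show "\<exists>n. \<forall>m\<ge>n. I m = I n" ..
qed

section \<open>Opposite algebras\<close>

lemma opposite_simps [simp]:
  "carrier (opposite A) = carrier A" "\<zero>\<^bsub>opposite A\<^esub> = \<zero>\<^bsub>A\<^esub>" "\<one>\<^bsub>opposite A\<^esub> = \<one>\<^bsub>A\<^esub>"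
  "(\<oplus>\<^bsub>opposite A\<^esub>) = (\<oplus>\<^bsub>A\<^esub>)" "x \<otimes>\<^bsub>opposite A\<^esub> y = y \<otimes>\<^bsub>A\<^esub> x" "(\<odot>\<^bsub>opposite A\<^esub>) = (\<odot>\<^bsub>A\<^esub>)"
  "add_monoid (opposite A) = add_monoid A" "opposite (opposite A) = A"
  by (simp_all add: opposite_def)

lemma opposite_update_carrier: "opposite (A\<lparr>carrier := E\<rparr>) = (opposite A)\<lparr>carrier := E\<rparr>"
  by (simp add: opposite_def)

lemma finsum_opposite [simp]: "finsum (opposite A) f M = finsum A f M"
  by (simp add: finsum_def)

lemma Units_opposite [simp]: "Units (opposite A) = Units A"
  by (auto simp: Units_def)

lemma m_inv_opposite [simp]: "inv\<^bsub>opposite A\<^esub> x = inv\<^bsub>A\<^esub> x"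
  unfolding m_inv_def by (auto intro!: arg_cong[where f = The])

lemma ring_opposite: "ring A \<Longrightarrow> ring (opposite A)"
proof (rule ringI)
  assume "ring A"
  then interpret ring A .
  show "abelian_group (opposite A)"
  proof (rule abelian_groupI)
    show "\<exists>y\<in>carrier (opposite A). y \<oplus>\<^bsub>opposite A\<^esub> x = \<zero>\<^bsub>opposite A\<^esub>" if "x \<in> carrier (opposite A)" for x
      using that by (intro bexI[of _ "\<ominus>\<^bsub>A\<^esub> x"]) (simp_all add: l_neg)
  qed (simp_all add: a_ac)
  show "Group.monoid (opposite A)"
    by (rule monoidI) (auto simp: m_assoc)
qed (auto dest: ring.ring_simprules)

lemma k_algebra_opposite:
  assumes "k_algebra K A" shows "k_algebra K (opposite A)"
proof -
  interpret k_algebra K A by fact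
  interpret M: module K A by (rule module)
  have r: "ring (opposite A)" by (rule ring_opposite[OF ring])
  have "module K (opposite A)"
    by (rule moduleI)
       (auto simp: M.is_cring ring.is_abelian_group[OF r] M.smult_l_distr M.smult_r_distr M.smult_assoc1)
  then show ?thesis
    by (auto simp: k_algebra_def field r smult_mult_left smult_mult_right)
qed

lemma left_ideal_opposite: "left_ideal I (opposite A) \<longleftrightarrow> right_ideal I A"
  by (simp add: left_ideal_def right_ideal_def additive_subgroup_def)

lemma right_ideal_opposite: "right_ideal I (opposite A) \<longleftrightarrow> left_ideal I A"
  by (simp add: left_ideal_def right_ideal_def additive_subgroup_def)

lemma nc_noetherian_domain_opposite:
  "nc_noetherian_domain A \<Longrightarrow> nc_noetherian_domain (opposite A)"
  unfolding nc_noetherian_domain_def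
  by (auto simp: ring_opposite left_ideal_opposite right_ideal_opposite)

lemma division_algebra_opposite:
  "division_algebra K D \<Longrightarrow> division_algebra K (opposite D)"
  by (simp add: division_algebra_def k_algebra_opposite)

section \<open>Ideals and subalgebras described by closure conditions\<close>

lemma left_idealI:
  assumes "ring A" "I \<subseteq> carrier A" "\<zero>\<^bsub>A\<^esub> \<in> I" "\<And>x y. x \<in> I \<Longrightarrow> y \<in> I \<Longrightarrow> x \<oplus>\<^bsub>A\<^esub> y \<in> I"
    and m: "\<And>a x. a \<in> carrier A \<Longrightarrow> x \<in> I \<Longrightarrow> a \<otimes>\<^bsub>A\<^esub> x \<in> I"
  shows "left_ideal I A"
proof -
  interpret ring A by fact
  \<comment> \<open>Absorption yields negatives, because \<open>- x = (- 1) x\<close>; so a left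
    ideal is recognised by sums and products alone.\<close>
  have "\<ominus>\<^bsub>A\<^esub> x \<in> I" if "x \<in> I" for x
    using m[of "\<ominus>\<^bsub>A\<^esub> \<one>\<^bsub>A\<^esub>" x] that assms(2) by (auto simp: l_minus)
  then have "additive_subgroup I A"
    using assms by (intro additive_subgroup.intro subgroup.intro) (auto simp: a_inv_def)
  with m show ?thesis
    by (simp add: left_ideal_def)
qed

lemma left_idealD:
  assumes "left_ideal I A" "ring A"
  shows "I \<subseteq> carrier A" "\<zero>\<^bsub>A\<^esub> \<in> I" "\<And>x y. x \<in> I \<Longrightarrow> y \<in> I \<Longrightarrow> x \<oplus>\<^bsub>A\<^esub> y \<in> I"
    "\<And>x y. x \<in> I \<Longrightarrow> y \<in> I \<Longrightarrow> x \<ominus>\<^bsub>A\<^esub> y \<in> I"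
    "\<And>a x. a \<in> carrier A \<Longrightarrow> x \<in> I \<Longrightarrow> a \<otimes>\<^bsub>A\<^esub> x \<in> I"
proof -
  interpret ring A by fact
  interpret additive_subgroup I A using assms(1) by (simp add: left_ideal_def)
  show 1: "I \<subseteq> carrier A" "\<zero>\<^bsub>A\<^esub> \<in> I" "\<And>x y. x \<in> I \<Longrightarrow> y \<in> I \<Longrightarrow> x \<oplus>\<^bsub>A\<^esub> y \<in> I"
    by (auto simp: a_subset)
  show m: "\<And>a x. a \<in> carrier A \<Longrightarrow> x \<in> I \<Longrightarrow> a \<otimes>\<^bsub>A\<^esub> x \<in> I"
    using assms(1) by (simp add: left_ideal_def)
  show "x \<ominus>\<^bsub>A\<^esub> y \<in> I" if "x \<in> I" "y \<in> I" for x y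
    using m[of "\<ominus>\<^bsub>A\<^esub> \<one>\<^bsub>A\<^esub>" y] that 1 by (auto simp: l_minus a_minus_def)
qed

text \<open>Additive inverses come for free from multiplication by the scalar \<open>-1\<close>.\<close>

lemma k_algebra_subset:
  assumes A: "k_algebra K A" and sub: "E \<subseteq> carrier A" "\<one>\<^bsub>A\<^esub> \<in> E"
    and add: "\<And>x y. x \<in> E \<Longrightarrow> y \<in> E \<Longrightarrow> x \<oplus>\<^bsub>A\<^esub> y \<in> E"
    and mult: "\<And>x y. x \<in> E \<Longrightarrow> y \<in> E \<Longrightarrow> x \<otimes>\<^bsub>A\<^esub> y \<in> E"
    and smult: "\<And>c x. c \<in> carrier K \<Longrightarrow> x \<in> E \<Longrightarrow> c \<odot>\<^bsub>A\<^esub> x \<in> E"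
  shows "k_algebra K (A\<lparr>carrier := E\<rparr>)"
proof -
  interpret k_algebra K A by fact
  interpret ring A by (rule ring)
  interpret M: module K A by (rule module)
  have neg: "\<ominus>\<^bsub>A\<^esub> x \<in> E" if "x \<in> E" for x
    using smult[of "\<ominus>\<^bsub>K\<^esub> \<one>\<^bsub>K\<^esub>" x] that sub by (auto simp: M.smult_l_minus)
  have "\<zero>\<^bsub>A\<^esub> \<in> E"
    using add[OF sub(2) neg[OF sub(2)]] by (simp add: r_neg)
  have E: "x \<in> carrier A" if "x \<in> E" for x
    using sub that by blast
  have ag: "abelian_group (A\<lparr>carrier := E\<rparr>)"
  proof (rule abelian_groupI)
    show "\<exists>y\<in>carrier (A\<lparr>carrier := E\<rparr>). y \<oplus>\<^bsub>A\<lparr>carrier := E\<rparr>\<^esub> x = \<zero>\<^bsub>A\<lparr>carrier := E\<rparr>\<^esub>"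
      if "x \<in> carrier (A\<lparr>carrier := E\<rparr>)" for x
      using that neg[of x] by (intro bexI[of _ "\<ominus>\<^bsub>A\<^esub> x"]) (simp_all add: l_neg E)
  qed (use add \<open>\<zero>\<^bsub>A\<^esub> \<in> E\<close> in \<open>simp_all add: E a_ac\<close>)
  have mo: "Group.monoid (A\<lparr>carrier := E\<rparr>)"
    by (rule monoidI) (auto simp: E mult sub m_assoc)
  have "ring (A\<lparr>carrier := E\<rparr>)"
    by (rule ringI[OF ag mo]) (auto simp: E l_distr r_distr)
  moreover have "module K (A\<lparr>carrier := E\<rparr>)"
    by (rule moduleI[OF M.R.is_cring ag])
       (auto simp: E smult M.smult_l_distr M.smult_r_distr M.smult_assoc1)
  ultimately show ?thesis
    by (simp add: k_algebra_def E field smult_mult_left smult_mult_right)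
qed

lemma division_algebra_subset:
  assumes D: "division_algebra K D" and sub: "E \<subseteq> carrier D" "\<one>\<^bsub>D\<^esub> \<in> E"
    and add: "\<And>x y. x \<in> E \<Longrightarrow> y \<in> E \<Longrightarrow> x \<oplus>\<^bsub>D\<^esub> y \<in> E"
    and mult: "\<And>x y. x \<in> E \<Longrightarrow> y \<in> E \<Longrightarrow> x \<otimes>\<^bsub>D\<^esub> y \<in> E"
    and smult: "\<And>c x. c \<in> carrier K \<Longrightarrow> x \<in> E \<Longrightarrow> c \<odot>\<^bsub>D\<^esub> x \<in> E"
    and inv: "\<And>x. x \<in> E \<Longrightarrow> x \<noteq> \<zero>\<^bsub>D\<^esub> \<Longrightarrow> inv\<^bsub>D\<^esub> x \<in> E"
  shows "division_subalgebra K D E"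
proof -
  have kD: "k_algebra K D" and ne: "\<one>\<^bsub>D\<^esub> \<noteq> \<zero>\<^bsub>D\<^esub>" and U: "Units D = carrier D - {\<zero>\<^bsub>D\<^esub>}"
    using D by (auto simp: division_algebra_def)
  interpret ring D by (rule k_algebra.ring[OF kD])
  have k: "k_algebra K (D\<lparr>carrier := E\<rparr>)"
    by (rule k_algebra_subset[OF kD]) fact+
  then interpret E: ring "D\<lparr>carrier := E\<rparr>"
    by (rule k_algebra.ring)
  have "x \<in> Units (D\<lparr>carrier := E\<rparr>)" if "x \<in> E" "x \<noteq> \<zero>\<^bsub>D\<^esub>" for x
  proof -
    have "x \<in> Units D" using that sub U by auto
    then show ?thesis
      using that inv[OF that] unfolding Units_def[of "D\<lparr>carrier := E\<rparr>"]
      by (auto intro!: bexI[of _ "inv\<^bsub>D\<^esub> x"])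
  qed
  moreover have "\<zero>\<^bsub>D\<^esub> \<notin> Units (D\<lparr>carrier := E\<rparr>)"
    using sub ne by (auto simp: Units_def)
  ultimately have "Units (D\<lparr>carrier := E\<rparr>) = E - {\<zero>\<^bsub>D\<^esub>}"
    using E.Units_closed by auto
  with k ne sub show ?thesis
    by (simp add: division_subalgebra_def division_algebra_def)
qed

text \<open>An inverse formed in \<open>E\<close> is a two-sided inverse in \<open>D\<close>, so
  uniqueness of inverses identifies the two. The last clause matters because \<open>m_inv\<close>
  depends on the carrier, and a quotient division algebra inside \<open>D\<close> is described with
  the inverse of the smaller structure.\<close>

lemma division_subalgebraD:
  assumes D: "division_algebra K D" and "division_subalgebra K D E"
  shows "E \<subseteq> carrier D" "\<zero>\<^bsub>D\<^esub> \<in> E" "\<one>\<^bsub>D\<^esub> \<in> E"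
    "\<And>x y. x \<in> E \<Longrightarrow> y \<in> E \<Longrightarrow> x \<oplus>\<^bsub>D\<^esub> y \<in> E" "\<And>x y. x \<in> E \<Longrightarrow> y \<in> E \<Longrightarrow> x \<otimes>\<^bsub>D\<^esub> y \<in> E"
    "\<And>c x. c \<in> carrier K \<Longrightarrow> x \<in> E \<Longrightarrow> c \<odot>\<^bsub>D\<^esub> x \<in> E"
    "\<And>x. x \<in> E \<Longrightarrow> x \<noteq> \<zero>\<^bsub>D\<^esub> \<Longrightarrow> inv\<^bsub>D\<^esub> x \<in> E"
    "\<And>x. x \<in> E \<Longrightarrow> x \<noteq> \<zero>\<^bsub>D\<^esub> \<Longrightarrow> inv\<^bsub>D\<lparr>carrier := E\<rparr>\<^esub> x = inv\<^bsub>D\<^esub> x"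
proof -
  have k: "k_algebra K (D\<lparr>carrier := E\<rparr>)" and U: "Units (D\<lparr>carrier := E\<rparr>) = E - {\<zero>\<^bsub>D\<^esub>}"
    and sub: "E \<subseteq> carrier D"
    using assms by (auto simp: division_subalgebra_def division_algebra_def)
  interpret D: ring D using D by (auto simp: division_algebra_def intro: k_algebra.ring)
  interpret E: ring "D\<lparr>carrier := E\<rparr>" by (rule k_algebra.ring[OF k])
  interpret M: module K "D\<lparr>carrier := E\<rparr>" by (rule k_algebra.module[OF k])
  show "E \<subseteq> carrier D" by fact
  show "\<zero>\<^bsub>D\<^esub> \<in> E" "\<one>\<^bsub>D\<^esub> \<in> E" "\<And>x y. x \<in> E \<Longrightarrow> y \<in> E \<Longrightarrow> x \<oplus>\<^bsub>D\<^esub> y \<in> E"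
    "\<And>x y. x \<in> E \<Longrightarrow> y \<in> E \<Longrightarrow> x \<otimes>\<^bsub>D\<^esub> y \<in> E" "\<And>c x. c \<in> carrier K \<Longrightarrow> x \<in> E \<Longrightarrow> c \<odot>\<^bsub>D\<^esub> x \<in> E"
    using E.zero_closed E.one_closed E.a_closed E.m_closed M.smult_closed by simp_all
  have *: "inv\<^bsub>D\<lparr>carrier := E\<rparr>\<^esub> x \<in> E \<and> inv\<^bsub>D\<lparr>carrier := E\<rparr>\<^esub> x = inv\<^bsub>D\<^esub> x" if "x \<in> E" "x \<noteq> \<zero>\<^bsub>D\<^esub>" for x
  proof -
    have u: "x \<in> Units (D\<lparr>carrier := E\<rparr>)" using that U by simp
    then have "inv\<^bsub>D\<lparr>carrier := E\<rparr>\<^esub> x \<in> E"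
      using E.Units_inv_closed by simp
    moreover have "inv\<^bsub>D\<^esub> x = inv\<^bsub>D\<lparr>carrier := E\<rparr>\<^esub> x"
      by (rule D.inv_char) (use E.Units_r_inv[OF u] E.Units_l_inv[OF u] that sub calculation in auto)
    ultimately show ?thesis by simp
  qed
  then show "\<And>x. x \<in> E \<Longrightarrow> x \<noteq> \<zero>\<^bsub>D\<^esub> \<Longrightarrow> inv\<^bsub>D\<^esub> x \<in> E"
    "\<And>x. x \<in> E \<Longrightarrow> x \<noteq> \<zero>\<^bsub>D\<^esub> \<Longrightarrow> inv\<^bsub>D\<lparr>carrier := E\<rparr>\<^esub> x = inv\<^bsub>D\<^esub> x"
    by metis+
qed

section \<open>Linear functionals over a division ring\<close>

text \<open>Vector spaces over a division ring that may be noncommutative. Two instances occur: a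
  \<open>K\<close>-algebra over \<open>K\<close>, and \<open>D\<close> over one of its division
  subalgebras acting by left multiplication.\<close>

locale left_space = S: ring S + V: abelian_group V
  for S :: "('s, 'p) ring_scheme" and V :: "('v, 'q) ring_scheme" (structure)
    and act :: "'s \<Rightarrow> 'v \<Rightarrow> 'v"  (infixr \<open>\<bullet>\<close> 75) +
  assumes division: "Units S = carrier S - {\<zero>\<^bsub>S\<^esub>}"
    and act_closed [simp, intro]: "c \<in> carrier S \<Longrightarrow> x \<in> carrier V \<Longrightarrow> c \<bullet> x \<in> carrier V"
    and act_assoc: "c \<in> carrier S \<Longrightarrow> d \<in> carrier S \<Longrightarrow> x \<in> carrier V \<Longrightarrow> (c \<otimes>\<^bsub>S\<^esub> d) \<bullet> x = c \<bullet> d \<bullet> x"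
    and act_one [simp]: "x \<in> carrier V \<Longrightarrow> \<one>\<^bsub>S\<^esub> \<bullet> x = x"
    and act_l_distr: "c \<in> carrier S \<Longrightarrow> d \<in> carrier S \<Longrightarrow> x \<in> carrier V \<Longrightarrow> (c \<oplus>\<^bsub>S\<^esub> d) \<bullet> x = c \<bullet> x \<oplus> d \<bullet> x"
    and act_r_distr: "c \<in> carrier S \<Longrightarrow> x \<in> carrier V \<Longrightarrow> y \<in> carrier V \<Longrightarrow> c \<bullet> (x \<oplus> y) = c \<bullet> x \<oplus> c \<bullet> y"
begin

definition subspace :: "'v set \<Rightarrow> bool" where
  "subspace W \<longleftrightarrow> W \<subseteq> carrier V \<and> \<zero> \<in> W \<and> (\<forall>x\<in>W. \<forall>y\<in>W. x \<oplus> y \<in> W) \<and> (\<forall>c\<in>carrier S. \<forall>x\<in>W. c \<bullet> x \<in> W)"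

definition functional :: "('v \<Rightarrow> 's) \<Rightarrow> bool" where
  "functional f \<longleftrightarrow> f \<in> carrier V \<rightarrow> carrier S \<and>
     (\<forall>x\<in>carrier V. \<forall>y\<in>carrier V. f (x \<oplus> y) = f x \<oplus>\<^bsub>S\<^esub> f y) \<and>
     (\<forall>c\<in>carrier S. \<forall>x\<in>carrier V. f (c \<bullet> x) = c \<otimes>\<^bsub>S\<^esub> f x)"

lemma act_zero [simp]: "x \<in> carrier V \<Longrightarrow> \<zero>\<^bsub>S\<^esub> \<bullet> x = \<zero>"
  using act_l_distr[of "\<zero>\<^bsub>S\<^esub>" "\<zero>\<^bsub>S\<^esub>" x] V.add.r_cancel_one' by auto

lemma act_minus: "x \<in> carrier V \<Longrightarrow> c \<in> carrier S \<Longrightarrow> (\<ominus>\<^bsub>S\<^esub> c) \<bullet> x = \<ominus> (c \<bullet> x)"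
  using act_l_distr[of "\<ominus>\<^bsub>S\<^esub> c" c x] by (metis S.a_inv_closed S.l_neg V.minus_equality act_closed act_zero)

lemma subspace_minus: "subspace W \<Longrightarrow> x \<in> W \<Longrightarrow> y \<in> W \<Longrightarrow> x \<ominus> y \<in> W"
  using act_minus[of y "\<one>\<^bsub>S\<^esub>"] unfolding subspace_def a_minus_def
  by (metis S.a_inv_closed S.one_closed act_one subsetD)

text \<open>A subspace maximal among those that contain \<open>W\<close> and miss \<open>d\<close>
  has the line through \<open>d\<close> as a complement; the functional reads off the coefficient of
  \<open>d\<close>. This replaces the choice of a basis.\<close>

lemma functional_exists:
  assumes W: "subspace W" and d: "d \<in> carrier V" "d \<notin> W"
  obtains f where "functional f" "\<And>w. w \<in> W \<Longrightarrow> f w = \<zero>\<^bsub>S\<^esub>" "f d = \<one>\<^bsub>S\<^esub>"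
proof -
  define \<U> where "\<U> = {U. subspace U \<and> W \<subseteq> U \<and> d \<notin> U}"
  have "\<exists>M\<in>\<U>. \<forall>Z\<in>\<U>. M \<subseteq> Z \<longrightarrow> Z = M"
  proof (rule subset_Zorn_nonempty)
    show "\<U> \<noteq> {}" using W d by (auto simp: \<U>_def)
    fix C assume ne: "C \<noteq> {}" and C: "subset.chain \<U> C"
    then have sub: "\<And>U. U \<in> C \<Longrightarrow> subspace U \<and> W \<subseteq> U \<and> d \<notin> U" and
      lin: "\<And>U U'. U \<in> C \<Longrightarrow> U' \<in> C \<Longrightarrow> U \<subseteq> U' \<or> U' \<subseteq> U"
      by (auto simp: \<U>_def subset.chain_def)
    have "x \<oplus> y \<in> \<Union> C" if xy: "x \<in> \<Union> C" "y \<in> \<Union> C" for x y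
    proof -
      obtain U U' where "U \<in> C" "x \<in> U" "U' \<in> C" "y \<in> U'"
        using xy by blast
      then obtain U where "U \<in> C" "x \<in> U" "y \<in> U"
        using lin[of U U'] by blast
      then show ?thesis using sub unfolding subspace_def by blast
    qed
    moreover have "U \<subseteq> carrier V" "\<zero> \<in> U" if "U \<in> C" for U
      using sub[OF that] by (simp_all add: subspace_def)
    then have "\<Union> C \<subseteq> carrier V \<and> \<zero> \<in> \<Union> C"
      using ne by blast
    moreover have "c \<bullet> x \<in> \<Union> C" if "c \<in> carrier S" "x \<in> \<Union> C" for c x
    proof -
      obtain U where "U \<in> C" "x \<in> U"
        using \<open>x \<in> \<Union> C\<close> by blast
      then show ?thesis
        using sub[of U] \<open>c \<in> carrier S\<close> by (intro UnionI[of U]) (auto simp: subspace_def)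
    qed
    ultimately have "subspace (\<Union> C)"
      by (simp add: subspace_def)
    then show "\<Union> C \<in> \<U>"
      using sub ne by (auto simp: \<U>_def)
  qed
  then obtain M where "M \<in> \<U>" and max': "\<And>U. U \<in> \<U> \<Longrightarrow> M \<subseteq> U \<Longrightarrow> U = M"
    by blast
  then have M: "subspace M" "W \<subseteq> M" "d \<notin> M"
    by (simp_all add: \<U>_def)
  have max: "U = M" if "subspace U" "d \<notin> U" "M \<subseteq> U" for U
    by (rule max') (use that M in \<open>auto simp: \<U>_def\<close>)
  have MV: "x \<in> carrier V" if "x \<in> M" for x
    using M that by (auto simp: subspace_def)
  have Mc: "\<zero> \<in> M" "\<And>x y. x \<in> M \<Longrightarrow> y \<in> M \<Longrightarrow> x \<oplus> y \<in> M" "\<And>c x. c \<in> carrier S \<Longrightarrow> x \<in> M \<Longrightarrow> c \<bullet> x \<in> M"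
    using M by (auto simp: subspace_def)
  have ex: "\<exists>c\<in>carrier S. \<exists>m\<in>M. x = m \<oplus> c \<bullet> d" if x: "x \<in> carrier V" for x
  proof (cases "x \<in> M")
    case True
    then show ?thesis using d MV by (intro bexI[of _ "\<zero>\<^bsub>S\<^esub>"] bexI[of _ x]) auto
  next
    case False
    \<comment> \<open>Enlarging \<open>M\<close> by \<open>x\<close> must capture \<open>d\<close>,
      by maximality. The coefficient of \<open>x\<close> in the resulting relation is nonzero
      because \<open>d \<notin> M\<close>, so the relation can be solved for
      \<open>x\<close>.\<close>
    define U where "U = {m \<oplus> c \<bullet> x | m c. m \<in> M \<and> c \<in> carrier S}"
    have "subspace U"
      unfolding subspace_def
    proof (intro conjI ballI)
      show "U \<subseteq> carrier V" using MV x by (auto simp: U_def)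
      show "\<zero> \<in> U" unfolding U_def using Mc(1) x by (force intro: exI[of _ \<zero>] exI[of _ "\<zero>\<^bsub>S\<^esub>"])
    next
      fix y z assume "y \<in> U" "z \<in> U"
      then obtain m c n e where *: "y = m \<oplus> c \<bullet> x" "z = n \<oplus> e \<bullet> x" "m \<in> M" "n \<in> M" "c \<in> carrier S" "e \<in> carrier S"
        by (auto simp: U_def)
      then have "y \<oplus> z = (m \<oplus> n) \<oplus> (c \<oplus>\<^bsub>S\<^esub> e) \<bullet> x"
        using x MV by (simp add: act_l_distr V.a_ac)
      then show "y \<oplus> z \<in> U" unfolding U_def using * Mc by blast
    next
      fix e y assume "e \<in> carrier S" "y \<in> U"
      then obtain m c where *: "y = m \<oplus> c \<bullet> x" "m \<in> M" "c \<in> carrier S" by (auto simp: U_def)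
      then have "e \<bullet> y = e \<bullet> m \<oplus> (e \<otimes>\<^bsub>S\<^esub> c) \<bullet> x"
        using x MV \<open>e \<in> carrier S\<close> by (simp add: act_r_distr act_assoc)
      then show "e \<bullet> y \<in> U" unfolding U_def using * Mc \<open>e \<in> carrier S\<close> by blast
    qed
    moreover have "M \<subseteq> U"
    proof
      fix m assume "m \<in> M"
      then have "m = m \<oplus> \<zero>\<^bsub>S\<^esub> \<bullet> x" using x MV by simp
      then show "m \<in> U" using \<open>m \<in> M\<close> unfolding U_def by blast
    qed
    moreover have "x \<in> U"
    proof -
      have "x = \<zero> \<oplus> \<one>\<^bsub>S\<^esub> \<bullet> x" using x by simp
      then show ?thesis using Mc(1) unfolding U_def by blast
    qed
    ultimately have "d \<in> U" using max False by metis
    then obtain m c where *: "d = m \<oplus> c \<bullet> x" "m \<in> M" "c \<in> carrier S" by (auto simp: U_def)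
    have "c \<noteq> \<zero>\<^bsub>S\<^esub>" using * M(3) x MV by auto
    then have c: "c \<in> Units S" using division *(3) by simp
    define b where "b = inv\<^bsub>S\<^esub> c"
    have b: "b \<in> carrier S" "b \<otimes>\<^bsub>S\<^esub> c = \<one>\<^bsub>S\<^esub>" using c by (auto simp: b_def)
    have "b \<bullet> d = b \<bullet> m \<oplus> x"
      using * b x MV by (simp add: act_r_distr act_assoc[symmetric])
    then have "x = (\<zero> \<ominus> b \<bullet> m) \<oplus> b \<bullet> d"
      using b x MV *(2) by (simp add: a_minus_def V.a_assoc[symmetric] V.l_neg)
    moreover have "\<zero> \<ominus> b \<bullet> m \<in> M"
      by (intro subspace_minus[OF M(1)] Mc * b)
    ultimately show ?thesis using b(1) by (intro bexI)
  qed
  \<comment> \<open>Two different coefficients would give \<open>(c - e) d \<in> M\<close> with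
    \<open>c - e\<close> a unit, and \<open>d\<close> itself would lie in \<open>M\<close>.\<close>
  have uniq: "c = e" if eq: "m \<oplus> c \<bullet> d = n \<oplus> e \<bullet> d" and m: "m \<in> M" "n \<in> M" and c: "c \<in> carrier S" "e \<in> carrier S" for m n c e
  proof (rule ccontr)
    assume "c \<noteq> e"
    then have "c \<ominus>\<^bsub>S\<^esub> e \<noteq> \<zero>\<^bsub>S\<^esub>" using c by (simp add: S.r_right_minus_eq)
    then have u: "c \<ominus>\<^bsub>S\<^esub> e \<in> Units S" using c division by simp
    have "(c \<ominus>\<^bsub>S\<^esub> e) \<bullet> d = c \<bullet> d \<ominus> e \<bullet> d"
      using c d by (simp add: a_minus_def act_l_distr act_minus)
    also have "\<dots> = n \<ominus> m"
    proof -
      have "c \<bullet> d = (\<ominus> m) \<oplus> (n \<oplus> e \<bullet> d)"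
        using eq m c d MV V.r_neg1[of m "c \<bullet> d"] by simp
      then have "c \<bullet> d = (n \<ominus> m) \<oplus> e \<bullet> d"
        using m c d MV by (simp add: a_minus_def V.a_ac)
      then show ?thesis
        using m c d MV by (simp add: a_minus_def V.a_assoc V.r_neg)
    qed
    finally have "(c \<ominus>\<^bsub>S\<^esub> e) \<bullet> d \<in> M" using subspace_minus[OF M(1)] m by simp
    then have "inv\<^bsub>S\<^esub> (c \<ominus>\<^bsub>S\<^esub> e) \<bullet> (c \<ominus>\<^bsub>S\<^esub> e) \<bullet> d \<in> M" using Mc u by simp
    then show False
      using M(3) d u c by (simp add: act_assoc[symmetric])
  qed
  define f where "f x = (THE c. c \<in> carrier S \<and> (\<exists>m\<in>M. x = m \<oplus> c \<bullet> d))" for x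
  have fI: "f (m \<oplus> c \<bullet> d) = c" if "m \<in> M" "c \<in> carrier S" for m c
    unfolding f_def by (rule the_equality) (use that uniq[of m c _ _, symmetric] in auto)
  show thesis
  proof (rule that)
    show "functional f"
      unfolding functional_def
    proof (intro conjI ballI funcsetI)
      show "f x \<in> carrier S" if "x \<in> carrier V" for x
        using ex[OF that] fI by auto
    next
      fix x y assume "x \<in> carrier V" "y \<in> carrier V"
      then obtain m c n e where *: "x = m \<oplus> c \<bullet> d" "y = n \<oplus> e \<bullet> d" "m \<in> M" "n \<in> M" "c \<in> carrier S" "e \<in> carrier S"
        using ex by metis
      then have "x \<oplus> y = (m \<oplus> n) \<oplus> (c \<oplus>\<^bsub>S\<^esub> e) \<bullet> d"
        using d MV by (simp add: act_l_distr V.a_ac)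
      then show "f (x \<oplus> y) = f x \<oplus>\<^bsub>S\<^esub> f y"
        using * fI Mc by simp
    next
      fix e x assume "e \<in> carrier S" "x \<in> carrier V"
      then obtain m c where *: "x = m \<oplus> c \<bullet> d" "m \<in> M" "c \<in> carrier S"
        using ex by metis
      then have "e \<bullet> x = e \<bullet> m \<oplus> (e \<otimes>\<^bsub>S\<^esub> c) \<bullet> d"
        using d MV \<open>e \<in> carrier S\<close> by (simp add: act_r_distr act_assoc)
      then show "f (e \<bullet> x) = e \<otimes>\<^bsub>S\<^esub> f x"
        using * fI Mc \<open>e \<in> carrier S\<close> by simp
    qed
    show "f w = \<zero>\<^bsub>S\<^esub>" if "w \<in> W" for w
      using fI[of w "\<zero>\<^bsub>S\<^esub>"] that M MV d by auto
    show "f d = \<one>\<^bsub>S\<^esub>"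
      using fI[of \<zero> "\<one>\<^bsub>S\<^esub>"] Mc d by simp
  qed
qed

end

section \<open>Tensor products\<close>

lemma frag_extend_fun_add: "frag_extend (\<lambda>p. b p + c p) x = frag_extend b x + frag_extend c x"
  by (simp add: frag_extend_def frag_cmul_distrib2 sum.distrib)

lemma frag_extend_fun_zero: "frag_extend (\<lambda>p. 0) x = 0"
  by (rule frag_extend_eq_0) simp

lemma frag_extend_fun_minus: "frag_extend (\<lambda>p. - b p) x = - frag_extend b x"
  using frag_extend_fun_add[of "\<lambda>p. - b p" b x] by (simp add: frag_extend_fun_zero eq_neg_iff_add_eq_0)

lemma frag_extend_fun_diff: "frag_extend (\<lambda>p. b p - c p) x = frag_extend b x - frag_extend c x"
  using frag_extend_fun_add[of b "\<lambda>p. - c p"] by (simp add: frag_extend_fun_minus)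

text \<open>Interchange of a double sum. It identifies the reversed product on a tensor product with
  the product on the tensor product of the opposites.\<close>

lemma frag_extend_commute:
  "frag_extend (\<lambda>p. frag_extend (\<lambda>q. b p q) g) f = frag_extend (\<lambda>q. frag_extend (\<lambda>p. b p q) f) g"
  using subset_UNIV
proof (induction g rule: frag_induction)
  case (diff x y)
  then show ?case
    by (simp add: frag_extend_diff frag_extend_fun_diff)
qed (simp_all add: frag_extend_fun_zero)

text \<open>The scalars form a bare set with two actions, so that one construction serves both for
  algebras over \<open>K\<close> and for the rationals tensored with an abelian group over the
  integers.\<close>

locale tensor = M: comm_group M + N: comm_group N
  for M :: "('a, 'm) monoid_scheme" and N :: "('b, 'n) monoid_scheme" +
  fixes S :: "'s set" and l :: "'s \<Rightarrow> 'a \<Rightarrow> 'a" and r :: "'s \<Rightarrow> 'b \<Rightarrow> 'b"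
  assumes l_closed: "s \<in> S \<Longrightarrow> x \<in> carrier M \<Longrightarrow> l s x \<in> carrier M"
    and r_closed: "s \<in> S \<Longrightarrow> y \<in> carrier N \<Longrightarrow> r s y \<in> carrier N"
begin

abbreviation "F \<equiv> tensor_free M N"
abbreviation "R \<equiv> tensor_relations M N S l r"
abbreviation "T \<equiv> tensor_group M N S l r"

definition relators :: "('a \<times> 'b \<Rightarrow>\<^sub>0 int) set" where
  "relators = {frag_of (x \<otimes>\<^bsub>M\<^esub> x', y) - frag_of (x, y) - frag_of (x', y) | x x' y.
        x \<in> carrier M \<and> x' \<in> carrier M \<and> y \<in> carrier N} \<union>
     {frag_of (x, y \<otimes>\<^bsub>N\<^esub> y') - frag_of (x, y) - frag_of (x, y') | x y y'.
        x \<in> carrier M \<and> y \<in> carrier N \<and> y' \<in> carrier N} \<union>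
     {frag_of (l s x, y) - frag_of (x, r s y) | s x y.
        s \<in> S \<and> x \<in> carrier M \<and> y \<in> carrier N}"

lemma R_generate: "R = generate F relators"
  by (simp add: tensor_relations_def relators_def)

sublocale F: comm_group F
  by (simp add: tensor_free_def abelian_free_Abelian_group)

lemma F_simps [simp]:
  "f \<in> carrier F \<longleftrightarrow> Poly_Mapping.keys f \<subseteq> carrier M \<times> carrier N" "\<one>\<^bsub>F\<^esub> = 0" "f \<otimes>\<^bsub>F\<^esub> g = f + g"
  by (simp_all add: tensor_free_def)

lemma F_inv [simp]: "f \<in> carrier F \<Longrightarrow> inv\<^bsub>F\<^esub> f = - f"
  by (simp add: tensor_free_def)

lemma relators_cases [consumes 1, case_names left right scalar]:
  assumes "f \<in> relators"
  obtains x x' y where "f = frag_of (x \<otimes>\<^bsub>M\<^esub> x', y) - frag_of (x, y) - frag_of (x', y)"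
      "x \<in> carrier M" "x' \<in> carrier M" "y \<in> carrier N"
  | x y y' where "f = frag_of (x, y \<otimes>\<^bsub>N\<^esub> y') - frag_of (x, y) - frag_of (x, y')"
      "x \<in> carrier M" "y \<in> carrier N" "y' \<in> carrier N"
  | s x y where "f = frag_of (l s x, y) - frag_of (x, r s y)" "s \<in> S" "x \<in> carrier M" "y \<in> carrier N"
  using assms unfolding relators_def by blast

lemma F_closed:
  "f \<in> carrier F \<Longrightarrow> g \<in> carrier F \<Longrightarrow> f + g \<in> carrier F"
  "f \<in> carrier F \<Longrightarrow> g \<in> carrier F \<Longrightarrow> f - g \<in> carrier F"
  "f \<in> carrier F \<Longrightarrow> - f \<in> carrier F" "0 \<in> carrier F"
  "frag_of (x, y) \<in> carrier F \<longleftrightarrow> x \<in> carrier M \<and> y \<in> carrier N"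
  using keys_add[of f g] keys_diff[of f g] by auto

lemma relators_carrier: "relators \<subseteq> carrier F"
proof
  fix f assume "f \<in> relators"
  then show "f \<in> carrier F"
    by (cases rule: relators_cases)
       (simp_all only: F_closed M.m_closed N.m_closed l_closed r_closed simp_thms)
qed

lemma R_subgroup: "subgroup R F"
  unfolding R_generate by (rule F.generate_is_subgroup[OF relators_carrier])

lemma R_carrier: "f \<in> R \<Longrightarrow> f \<in> carrier F"
  using subgroup.subset[OF R_subgroup] by blast

lemma R_zero: "0 \<in> R"
  using subgroup.one_closed[OF R_subgroup] by simp

lemma R_add: "f \<in> R \<Longrightarrow> g \<in> R \<Longrightarrow> f + g \<in> R"
  using subgroup.m_closed[OF R_subgroup] by simp

lemma R_minus: "f \<in> R \<Longrightarrow> - f \<in> R"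
  using subgroup.m_inv_closed[OF R_subgroup, of f] R_carrier[of f] by simp

lemma R_diff: "f \<in> R \<Longrightarrow> g \<in> R \<Longrightarrow> f - g \<in> R"
  using R_add[of f "- g"] R_minus by simp

lemma R_induct [consumes 1, case_names relator zero minus add]:
  assumes "f \<in> R" and "\<And>f. f \<in> relators \<Longrightarrow> P f" "P 0"
    "\<And>f. f \<in> carrier F \<Longrightarrow> P f \<Longrightarrow> P (- f)"
    "\<And>f g. f \<in> carrier F \<Longrightarrow> g \<in> carrier F \<Longrightarrow> P f \<Longrightarrow> P g \<Longrightarrow> P (f + g)"
  shows "P f"
proof -
  have "f \<in> carrier F \<and> P f"
    using assms(1) unfolding R_generate
  proof (induction rule: generate.induct)
    case one then show ?case using assms(3) by simp
  next
    case (incl h) then show ?case using assms(2) relators_carrier by blast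
  next
    case (inv h)
    then have "h \<in> carrier F" using relators_carrier by blast
    then show ?case using assms(2,4) inv F_closed(3) by (metis F_inv)
  next
    case (eng h1 h2) then show ?case using assms(5) F_closed(1) by (metis F_simps(3))
  qed
  then show ?thesis ..
qed

lemma F_induct [consumes 1, case_names zero diff pure]:
  assumes "f \<in> carrier F" and "P 0"
    "\<And>f g. f \<in> carrier F \<Longrightarrow> g \<in> carrier F \<Longrightarrow> P f \<Longrightarrow> P g \<Longrightarrow> P (f - g)"
    "\<And>x y. x \<in> carrier M \<Longrightarrow> y \<in> carrier N \<Longrightarrow> P (frag_of (x, y))"
  shows "P f"
  by (rule free_Abelian_group_induct[where S = "carrier M \<times> carrier N"]) (use assms in auto)

definition cls :: "('a \<times> 'b \<Rightarrow>\<^sub>0 int) \<Rightarrow> ('a \<times> 'b \<Rightarrow>\<^sub>0 int) set" where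
  "cls f = R #>\<^bsub>F\<^esub> f"

lemma mem_cls_iff: "g \<in> cls f \<longleftrightarrow> g - f \<in> R"
  by (force simp: cls_def r_coset_def)

lemma cls_eq_iff: "f \<in> carrier F \<Longrightarrow> g \<in> carrier F \<Longrightarrow> cls f = cls g \<longleftrightarrow> f - g \<in> R"
proof
  assume "f - g \<in> R"
  then have "h - f \<in> R \<longleftrightarrow> h - g \<in> R" for h
    using R_add[of "h - f" "f - g"] R_diff[of "h - g" "f - g"] by auto
  then show "cls f = cls g" by (auto simp: mem_cls_iff)
qed (metis R_zero diff_self mem_cls_iff)

lemma carrier_T: "carrier T = cls ` carrier F"
  by (simp add: tensor_group_def carrier_FactGroup cls_def)

lemma cls_mem: "f \<in> cls f"
  by (simp add: mem_cls_iff R_zero)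

lemma cls_closed: "f \<in> carrier F \<Longrightarrow> cls f \<in> carrier T"
  by (simp only: carrier_T imageI)

lemma mem_cls_carrier: "f \<in> carrier F \<Longrightarrow> g \<in> cls f \<Longrightarrow> g \<in> carrier F"
  using F_closed(1)[of "g - f" f] R_carrier[of "g - f"] by (simp only: mem_cls_iff diff_add_cancel)

lemma one_T: "\<one>\<^bsub>T\<^esub> = cls 0"
  using F.coset_mult_one[OF subgroup.subset[OF R_subgroup]] by (simp add: tensor_group_def cls_def)

sublocale T: comm_group T
  unfolding tensor_group_def by (rule F.abelian_FactGroup[OF R_subgroup])

lemma mult_T: "f \<in> carrier F \<Longrightarrow> g \<in> carrier F \<Longrightarrow> cls f \<otimes>\<^bsub>T\<^esub> cls g = cls (f + g)"
proof -
  interpret normal R F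
    using F.normal_iff_subgroup R_subgroup by blast
  assume "f \<in> carrier F" "g \<in> carrier F"
  then show ?thesis
    using rcos_sum[of f g] by (simp add: tensor_group_def cls_def)
qed

definition pure :: "'a \<Rightarrow> 'b \<Rightarrow> ('a \<times> 'b \<Rightarrow>\<^sub>0 int) set" where
  "pure x y = cls (frag_of (x, y))"

lemma pure_closed [simp, intro]: "x \<in> carrier M \<Longrightarrow> y \<in> carrier N \<Longrightarrow> pure x y \<in> carrier T"
  by (simp add: pure_def cls_closed)

lemma relators_in_R: "f \<in> relators \<Longrightarrow> f \<in> R"
  unfolding R_generate by (rule generate.incl)

lemma pure_left: 
  assumes "x \<in> carrier M" "x' \<in> carrier M" "y \<in> carrier N"
  shows "pure (x \<otimes>\<^bsub>M\<^esub> x') y = pure x y \<otimes>\<^bsub>T\<^esub> pure x' y"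
proof -
  have "frag_of (x \<otimes>\<^bsub>M\<^esub> x', y) - frag_of (x, y) - frag_of (x', y) \<in> R"
    by (rule relators_in_R) (use assms in \<open>auto simp: relators_def\<close>)
  then show ?thesis
    unfolding pure_def using assms
    by (subst mult_T) (simp_all only: F_closed cls_eq_iff M.m_closed simp_thms diff_diff_eq)
qed

lemma pure_right: 
  assumes "x \<in> carrier M" "y \<in> carrier N" "y' \<in> carrier N"
  shows "pure x (y \<otimes>\<^bsub>N\<^esub> y') = pure x y \<otimes>\<^bsub>T\<^esub> pure x y'"
proof -
  have "frag_of (x, y \<otimes>\<^bsub>N\<^esub> y') - frag_of (x, y) - frag_of (x, y') \<in> R"
    by (rule relators_in_R) (use assms in \<open>auto simp: relators_def\<close>)
  then show ?thesis
    unfolding pure_def using assms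
    by (subst mult_T) (simp_all only: F_closed cls_eq_iff N.m_closed simp_thms diff_diff_eq)
qed

lemma pure_scalar: 
  assumes "s \<in> S" "x \<in> carrier M" "y \<in> carrier N"
  shows "pure (l s x) y = pure x (r s y)"
proof -
  have "frag_of (l s x, y) - frag_of (x, r s y) \<in> R"
    by (rule relators_in_R) (use assms in \<open>auto simp: relators_def\<close>)
  then show ?thesis
    unfolding pure_def using assms
    by (simp only: F_closed cls_eq_iff l_closed r_closed simp_thms)
qed

lemma pure_one: "y \<in> carrier N \<Longrightarrow> pure \<one>\<^bsub>M\<^esub> y = \<one>\<^bsub>T\<^esub>" "x \<in> carrier M \<Longrightarrow> pure x \<one>\<^bsub>N\<^esub> = \<one>\<^bsub>T\<^esub>"
  using pure_left[of "\<one>\<^bsub>M\<^esub>" "\<one>\<^bsub>M\<^esub>" y] pure_right[of x "\<one>\<^bsub>N\<^esub>" "\<one>\<^bsub>N\<^esub>"] T.l_cancel_one' by auto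

lemma pure_inv: "x \<in> carrier M \<Longrightarrow> y \<in> carrier N \<Longrightarrow> inv\<^bsub>T\<^esub> (pure x y) = pure (inv\<^bsub>M\<^esub> x) y"
  using pure_left[of "inv\<^bsub>M\<^esub> x" x y] by (intro T.inv_equality) (auto simp: pure_one)

text \<open>The inverse of an elementary tensor is an elementary tensor, so products of such
  elements suffice. As the free group is reached by differences, the claim is proved for a class and
  its inverse together.\<close>

lemma tensor_induct [consumes 1, case_names pure mult]:
  assumes P: "t \<in> carrier T" and pure: "\<And>x y. x \<in> carrier M \<Longrightarrow> y \<in> carrier N \<Longrightarrow> P (pure x y)"
    and mult: "\<And>s t. s \<in> carrier T \<Longrightarrow> t \<in> carrier T \<Longrightarrow> P s \<Longrightarrow> P t \<Longrightarrow> P (s \<otimes>\<^bsub>T\<^esub> t)"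
  shows "P t"
proof -
  have one: "P \<one>\<^bsub>T\<^esub>"
    using pure[of "\<one>\<^bsub>M\<^esub>" "\<one>\<^bsub>N\<^esub>"] by (simp add: pure_one)
  have "P (cls f) \<and> P (inv\<^bsub>T\<^esub> (cls f))" if "f \<in> carrier F" for f
    using that
  proof (induction rule: F_induct)
    case zero
    then show ?case using one by (simp flip: one_T)
  next
    case (diff f g)
    have "cls (f - g) = cls f \<otimes>\<^bsub>T\<^esub> inv\<^bsub>T\<^esub> (cls g)"
      using mult_T[of "f - g" g] diff(1,2) F_closed(2)[OF diff(1,2)] cls_closed
      by (intro T.inv_solve_right[THEN iffD2]) (auto simp del: F_simps(1))
    then show ?case
      using diff mult cls_closed by (simp add: T.inv_mult_group del: F_simps(1))
  next
    case (pure x y)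
    then show ?case
      using assms(2) pure_inv[of x y] by (simp flip: pure_def)
  qed
  then show ?thesis using P by (auto simp: carrier_T)
qed

text \<open>The extension to the free abelian group kills every relator and hence factors through
  the quotient. Slice maps, evaluations, induced homomorphisms and the coordinates used for the rank
  all arise in this way.\<close>

lemma tensor_lift:
  assumes H: "comm_group H"
    and \<phi>: "\<And>x y. x \<in> carrier M \<Longrightarrow> y \<in> carrier N \<Longrightarrow> \<phi> x y \<in> carrier H"
    and left: "\<And>x x' y. x \<in> carrier M \<Longrightarrow> x' \<in> carrier M \<Longrightarrow> y \<in> carrier N \<Longrightarrow> \<phi> (x \<otimes>\<^bsub>M\<^esub> x') y = \<phi> x y \<otimes>\<^bsub>H\<^esub> \<phi> x' y"
    and right: "\<And>x y y'. x \<in> carrier M \<Longrightarrow> y \<in> carrier N \<Longrightarrow> y' \<in> carrier N \<Longrightarrow> \<phi> x (y \<otimes>\<^bsub>N\<^esub> y') = \<phi> x y \<otimes>\<^bsub>H\<^esub> \<phi> x y'"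
    and scalar: "\<And>s x y. s \<in> S \<Longrightarrow> x \<in> carrier M \<Longrightarrow> y \<in> carrier N \<Longrightarrow> \<phi> (l s x) y = \<phi> x (r s y)"
  obtains h where "h \<in> hom T H" "\<And>x y. x \<in> carrier M \<Longrightarrow> y \<in> carrier N \<Longrightarrow> h (pure x y) = \<phi> x y"
proof -
  interpret H: comm_group H by fact
  obtain k where k: "k \<in> hom F H" "\<And>p. p \<in> carrier M \<times> carrier N \<Longrightarrow> k (frag_of p) = case_prod \<phi> p"
    using H.free_Abelian_group_universal[of "case_prod \<phi>" "carrier M \<times> carrier N"] \<phi>
    unfolding tensor_free_def by (metis (no_types, lifting) SigmaE case_prod_conv image_subsetI)
  interpret k: group_hom F H k
    by (simp add: group_hom_def group_hom_axioms_def k F.is_group H.is_group)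
  have kd: "k (f - g) = k f \<otimes>\<^bsub>H\<^esub> inv\<^bsub>H\<^esub> (k g)" if "f \<in> carrier F" "g \<in> carrier F" for f g
  proof -
    have "k (f \<otimes>\<^bsub>F\<^esub> inv\<^bsub>F\<^esub> g) = k f \<otimes>\<^bsub>H\<^esub> inv\<^bsub>H\<^esub> (k g)"
      using that by (simp only: k.hom_mult k.hom_inv F.inv_closed)
    then show ?thesis using that by (simp add: F_inv[OF that(2)])
  qed
  have "relators \<subseteq> kernel F H k"
  proof
    fix f assume f: "f \<in> relators"
    then have fc: "f \<in> carrier F" using relators_carrier by blast
    have "k f = \<one>\<^bsub>H\<^esub>"
      using f
    proof (cases rule: relators_cases)
      case (left x x' y)
      then show ?thesis
        using assms(3)[of x x' y] \<phi> by (simp add: kd F_closed k H.m_ac del: F_simps(1))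
    next
      case (right x y y')
      then show ?thesis
        using assms(4)[of x y y'] \<phi> by (simp add: kd F_closed k H.m_ac del: F_simps(1))
    next
      case (scalar s x y)
      then show ?thesis
        using assms(5)[of s x y] \<phi> r_closed l_closed by (simp add: kd F_closed k del: F_simps(1))
    qed
    with fc show "f \<in> kernel F H k" by (simp add: kernel_def)
  qed
  then have "R \<subseteq> kernel F H k"
    unfolding R_generate by (rule F.generate_subgroup_incl) (rule k.subgroup_kernel)
  moreover have "R \<lhd> F" using F.normal_iff_subgroup R_subgroup by blast
  ultimately obtain h where "h \<in> hom T H" "\<And>f. f \<in> carrier F \<Longrightarrow> h (cls f) = k f"
    using k.FactGroup_universal_kernel unfolding tensor_group_def cls_def by blast
  then show thesis
    using that k(2) unfolding pure_def by (metis F_closed(5) SigmaI case_prod_conv)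
qed

text \<open>Operations on classes are defined as unions over representatives; such a union collapses
  once all representatives give the same class.\<close>

lemma UN_cls:
  assumes "f \<in> carrier F" "\<And>g. g \<in> cls f \<Longrightarrow> h g = h f"
  shows "(\<Union>g\<in>cls f. h g) = h f"
  using assms cls_mem by blast

text \<open>Being additive and commuting with the scalars, \<open>\<phi>\<close> turns a relator
  into a relator of the same kind, so the class of the image does not depend on the
  representative.\<close>

lemma tensor_act_left_cls:
  assumes \<phi>: "\<phi> \<in> hom M M" and comm: "\<And>s x. s \<in> S \<Longrightarrow> x \<in> carrier M \<Longrightarrow> \<phi> (l s x) = l s (\<phi> x)"
  defines "e \<equiv> frag_extend (\<lambda>(x, y). frag_of (\<phi> x, y))"
  assumes f: "f \<in> carrier F"
  shows "tensor_act_left M N S l r \<phi> (cls f) = cls (e f)" "e f \<in> carrier F"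
proof -
  have c: "\<phi> x \<in> carrier M" if "x \<in> carrier M" for x
    using \<phi> that by (rule hom_in_carrier)
  have eF: "e g \<in> carrier F" if "g \<in> carrier F" for g
    using that
    by (induction rule: F_induct) (simp_all only: e_def frag_extend_0 frag_extend_diff frag_extend_of F_closed case_prod_conv c simp_thms)
  have eR: "e g \<in> R" if "g \<in> R" for g
    using that
  proof (induction rule: R_induct)
    case (relator g)
    then have "e g \<in> relators"
    proof (cases rule: relators_cases)
      case (left x x' y)
      then have "e g = frag_of (\<phi> x \<otimes>\<^bsub>M\<^esub> \<phi> x', y) - frag_of (\<phi> x, y) - frag_of (\<phi> x', y)"
        by (simp add: e_def frag_extend_diff hom_mult[OF \<phi>])
      with left c show ?thesis unfolding relators_def by blast
    next
      case (right x y y')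
      then have "e g = frag_of (\<phi> x, y \<otimes>\<^bsub>N\<^esub> y') - frag_of (\<phi> x, y) - frag_of (\<phi> x, y')"
        by (simp add: e_def frag_extend_diff)
      with right c show ?thesis unfolding relators_def by blast
    next
      case (scalar s x y)
      then have "e g = frag_of (l s (\<phi> x), y) - frag_of (\<phi> x, r s y)"
        by (simp add: e_def frag_extend_diff comm)
      with scalar c show ?thesis unfolding relators_def by blast
    qed
    then show ?case by (rule relators_in_R)
  qed (simp_all add: e_def frag_extend_minus frag_extend_add R_zero R_minus R_add)
  have "cls (e g) = cls (e f)" if "g \<in> cls f" for g
    using eR[of "g - f"] that mem_cls_carrier[OF f that] f eF
    by (subst cls_eq_iff) (simp_all add: mem_cls_iff e_def frag_extend_diff del: F_simps(1))
  from UN_cls[of f "\<lambda>g. cls (e g)", OF f this] show "tensor_act_left M N S l r \<phi> (cls f) = cls (e f)"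
    unfolding tensor_act_left_def cls_def[symmetric] e_def by simp
  show "e f \<in> carrier F" by (rule eF[OF f])
qed

lemma tensor_act_left_hom:
  assumes "\<phi> \<in> hom M M" "\<And>s x. s \<in> S \<Longrightarrow> x \<in> carrier M \<Longrightarrow> \<phi> (l s x) = l s (\<phi> x)"
  shows "tensor_act_left M N S l r \<phi> \<in> hom T T"
    and "x \<in> carrier M \<Longrightarrow> y \<in> carrier N \<Longrightarrow> tensor_act_left M N S l r \<phi> (pure x y) = pure (\<phi> x) y"
proof -
  note * = tensor_act_left_cls[OF assms]
  show "tensor_act_left M N S l r \<phi> \<in> hom T T"
  proof (rule homI)
    fix P assume "P \<in> carrier T"
    then obtain f where f: "f \<in> carrier F" "P = cls f" by (auto simp: carrier_T simp del: F_simps(1))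
    show "tensor_act_left M N S l r \<phi> P \<in> carrier T"
      unfolding f(2) by (subst *(1)) (use f(1) in \<open>auto intro!: cls_closed *(2) simp del: F_simps(1)\<close>)
  next
    fix P Q assume "P \<in> carrier T" "Q \<in> carrier T"
    then obtain f g where f: "f \<in> carrier F" "P = cls f" and g: "g \<in> carrier F" "Q = cls g"
      by (auto simp: carrier_T simp del: F_simps(1))
    show "tensor_act_left M N S l r \<phi> (P \<otimes>\<^bsub>T\<^esub> Q) = tensor_act_left M N S l r \<phi> P \<otimes>\<^bsub>T\<^esub> tensor_act_left M N S l r \<phi> Q"
      unfolding f(2) g(2) mult_T[OF f(1) g(1)]
      using f(1) g(1) F_closed(1)[OF f(1) g(1)]
      by (simp add: * mult_T frag_extend_add del: F_simps(1))
  qed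
  show "tensor_act_left M N S l r \<phi> (pure x y) = pure (\<phi> x) y" if "x \<in> carrier M" "y \<in> carrier N"
    using *(1)[of "frag_of (x, y)"] that unfolding pure_def by simp
qed

end

section \<open>Additive maps and algebra homomorphisms\<close>

lemma add_hom_simps:
  assumes "h \<in> hom (add_monoid A) (add_monoid B)"
  shows "x \<in> carrier A \<Longrightarrow> h x \<in> carrier B"
    and "x \<in> carrier A \<Longrightarrow> y \<in> carrier A \<Longrightarrow> h (x \<oplus>\<^bsub>A\<^esub> y) = h x \<oplus>\<^bsub>B\<^esub> h y"
  using hom_in_carrier[OF assms, of x] hom_mult[OF assms, of x y] by simp_all

lemma add_hom_zero:
  assumes "h \<in> hom (add_monoid A) (add_monoid B)" "abelian_group A" "abelian_group B"
  shows "h \<zero>\<^bsub>A\<^esub> = \<zero>\<^bsub>B\<^esub>"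
  using hom_one[OF assms(1) abelian_group.a_group[OF assms(2)] abelian_group.a_group[OF assms(3)]] by simp

lemma add_homI:
  assumes "\<And>x. x \<in> carrier A \<Longrightarrow> h x \<in> carrier B"
    "\<And>x y. x \<in> carrier A \<Longrightarrow> y \<in> carrier A \<Longrightarrow> h (x \<oplus>\<^bsub>A\<^esub> y) = h x \<oplus>\<^bsub>B\<^esub> h y"
  shows "h \<in> hom (add_monoid A) (add_monoid B)"
  using assms by (simp add: hom_def Pi_def)

lemma algebra_homD:
  assumes "h \<in> algebra_hom K A B"
  shows "x \<in> carrier A \<Longrightarrow> h x \<in> carrier B"
    and "x \<in> carrier A \<Longrightarrow> y \<in> carrier A \<Longrightarrow> h (x \<oplus>\<^bsub>A\<^esub> y) = h x \<oplus>\<^bsub>B\<^esub> h y"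
    and "x \<in> carrier A \<Longrightarrow> y \<in> carrier A \<Longrightarrow> h (x \<otimes>\<^bsub>A\<^esub> y) = h x \<otimes>\<^bsub>B\<^esub> h y"
    and "h \<one>\<^bsub>A\<^esub> = \<one>\<^bsub>B\<^esub>"
    and "c \<in> carrier K \<Longrightarrow> x \<in> carrier A \<Longrightarrow> h (c \<odot>\<^bsub>A\<^esub> x) = c \<odot>\<^bsub>B\<^esub> h x"
  using assms by (auto simp: algebra_hom_def ring_hom_def)

lemma algebra_hom_opposite: "h \<in> algebra_hom K A B \<Longrightarrow> h \<in> algebra_hom K (opposite A) (opposite B)"
  by (auto simp: algebra_hom_def ring_hom_def)

section \<open>Spans of finite lists\<close>

context left_space
begin

text \<open>Recursion on a list, because slices will separate tensors by induction on the list of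
  their second factors.\<close>

fun list_span :: "'v list \<Rightarrow> 'v set" where
  "list_span [] = {\<zero>}"
| "list_span (v # vs) = {c \<bullet> v \<oplus> w | c w. c \<in> carrier S \<and> w \<in> list_span vs}"

lemma subspace_list_span: "set vs \<subseteq> carrier V \<Longrightarrow> subspace (list_span vs)"
proof (induction vs)
  case Nil
  have "c \<bullet> \<zero> = \<zero>" if "c \<in> carrier S" for c
    using that act_r_distr[of c \<zero> \<zero>] V.add.r_cancel_one' by auto
  then show ?case by (simp add: subspace_def)
next
  case (Cons v vs)
  then have v: "v \<in> carrier V" and s: "subspace (list_span vs)" by auto
  then have W: "w \<in> carrier V" if "w \<in> list_span vs" for w
    using that by (auto simp: subspace_def)
  from s have Wc: "\<zero> \<in> list_span vs" "\<And>x y. x \<in> list_span vs \<Longrightarrow> y \<in> list_span vs \<Longrightarrow> x \<oplus> y \<in> list_span vs"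
    "\<And>c x. c \<in> carrier S \<Longrightarrow> x \<in> list_span vs \<Longrightarrow> c \<bullet> x \<in> list_span vs"
    by (auto simp: subspace_def)
  show ?case
    unfolding subspace_def
  proof (intro conjI ballI)
    show "list_span (v # vs) \<subseteq> carrier V" using v W by auto
    have "\<zero> = \<zero>\<^bsub>S\<^esub> \<bullet> v \<oplus> \<zero>" using v by simp
    then show "\<zero> \<in> list_span (v # vs)" using Wc(1) by auto
  next
    fix x y assume "x \<in> list_span (v # vs)" "y \<in> list_span (v # vs)"
    then obtain c w d u where *: "x = c \<bullet> v \<oplus> w" "y = d \<bullet> v \<oplus> u" "c \<in> carrier S" "d \<in> carrier S"
      "w \<in> list_span vs" "u \<in> list_span vs" by auto
    then have "x \<oplus> y = (c \<oplus>\<^bsub>S\<^esub> d) \<bullet> v \<oplus> (w \<oplus> u)"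
      using v W by (simp add: act_l_distr V.a_ac)
    then show "x \<oplus> y \<in> list_span (v # vs)"
      using * Wc(2) by auto
  next
    fix d x assume d: "d \<in> carrier S" and "x \<in> list_span (v # vs)"
    then obtain c w where *: "x = c \<bullet> v \<oplus> w" "c \<in> carrier S" "w \<in> list_span vs" by auto
    then have "d \<bullet> x = (d \<otimes>\<^bsub>S\<^esub> c) \<bullet> v \<oplus> d \<bullet> w"
      using v W d by (simp add: act_r_distr act_assoc)
    then show "d \<bullet> x \<in> list_span (v # vs)"
      using * d Wc(3) by auto
  qed
qed

lemma list_span_mem: "set vs \<subseteq> carrier V \<Longrightarrow> v \<in> set vs \<Longrightarrow> v \<in> list_span vs"
proof (induction vs)
  case (Cons u vs)
  then have s: "subspace (list_span vs)" and u: "u \<in> carrier V" by (auto simp: subspace_list_span)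
  show ?case
  proof (cases "v = u")
    case True
    have "u = \<one>\<^bsub>S\<^esub> \<bullet> u \<oplus> \<zero>" using u by simp
    then show ?thesis using True s by (auto simp: subspace_def)
  next
    case False
    then have "v \<in> list_span vs" using Cons by auto
    moreover have "v = \<zero>\<^bsub>S\<^esub> \<bullet> u \<oplus> v" using u Cons False by auto
    ultimately show ?thesis by (auto simp del: act_zero)
  qed
qed simp

end

lemma k_algebra_left_space: "k_algebra K A \<Longrightarrow> left_space K A (smult A)"
proof -
  assume "k_algebra K A"
  then interpret k_algebra K A .
  interpret M: module K A by (rule module)
  interpret F: field K by (rule field)
  show ?thesis
    by unfold_locales (auto simp: F.field_Units M.smult_l_distr M.smult_r_distr M.smult_assoc1)
qed

text \<open>Its use is contrapositive: along an injective homomorphism a vector outside a span stays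
  outside the span of the images, where functionals on the larger algebra can detect it.\<close>

lemma algebra_hom_list_span:
  assumes A: "k_algebra K A" and B: "k_algebra K B" and j: "j \<in> algebra_hom K A B"
    and vs: "set vs \<subseteq> carrier A" and w: "w \<in> left_space.list_span K B (smult B) (map j vs)"
  shows "\<exists>v. v \<in> carrier A \<and> v \<in> left_space.list_span K A (smult A) vs \<and> w = j v"
proof -
  interpret A: left_space K A "smult A" by (rule k_algebra_left_space[OF A])
  interpret B: left_space K B "smult B" by (rule k_algebra_left_space[OF B])
  have hz: "j \<zero>\<^bsub>A\<^esub> = \<zero>\<^bsub>B\<^esub>"
    by (rule add_hom_zero[OF add_homI]) (auto simp: algebra_homD[OF j] A.V.abelian_group_axioms B.V.abelian_group_axioms)
  show ?thesis
    using vs w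
  proof (induction vs arbitrary: w)
    case Nil
    then show ?case using hz by auto
  next
    case (Cons v vs)
    then obtain c u where u: "w = c \<odot>\<^bsub>B\<^esub> j v \<oplus>\<^bsub>B\<^esub> u" "c \<in> carrier K" "u \<in> B.list_span (map j vs)"
      by auto
    then obtain u' where "u' \<in> carrier A" "u' \<in> A.list_span vs" "u = j u'"
      using Cons by auto
    then show ?case
      using u Cons.prems by (intro exI[of _ "c \<odot>\<^bsub>A\<^esub> v \<oplus>\<^bsub>A\<^esub> u'"]) (auto simp: algebra_homD[OF j])
  qed
qed

section \<open>The tensor product of two algebras\<close>

locale tensor_alg = A: k_algebra K A + B: k_algebra K B
  for K :: "'k ring" and A :: "('k, 'a) module" and B :: "('k, 'b) module"
begin

sublocale A: ring A by (rule A.ring)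
sublocale B: ring B by (rule B.ring)
sublocale AM: module K A by (rule A.module)
sublocale BV: left_space K B "smult B" by (rule k_algebra_left_space[OF B.k_algebra_axioms])

sublocale tensor "add_monoid A" "add_monoid B" "carrier K" "smult A" "smult B"
  by (rule tensor.intro)
     (auto simp: tensor_axioms_def A.a_comm_group B.a_comm_group)

text \<open>The product on representatives, written as a double extension so that it is biadditive
  by construction. That it descends to classes then means that \<open>R\<close> absorbs
  multiplication from both sides.\<close>

definition frag_mult :: "('a \<times> 'b \<Rightarrow>\<^sub>0 int) \<Rightarrow> ('a \<times> 'b \<Rightarrow>\<^sub>0 int) \<Rightarrow> 'a \<times> 'b \<Rightarrow>\<^sub>0 int" where
  "frag_mult f g =
     frag_extend (\<lambda>(x, y). frag_extend (\<lambda>(x', y'). frag_of (x \<otimes>\<^bsub>A\<^esub> x', y \<otimes>\<^bsub>B\<^esub> y')) g) f"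

lemma frag_mult_simps:
  "frag_mult (f + f') g = frag_mult f g + frag_mult f' g"
  "frag_mult f (g + g') = frag_mult f g + frag_mult f g'"
  "frag_mult (f - f') g = frag_mult f g - frag_mult f' g"
  "frag_mult f (g - g') = frag_mult f g - frag_mult f g'"
  "frag_mult (- f) g = - frag_mult f g" "frag_mult 0 g = 0" "frag_mult f 0 = 0"
  "frag_mult (frag_of (x, y)) (frag_of (x', y')) = frag_of (x \<otimes>\<^bsub>A\<^esub> x', y \<otimes>\<^bsub>B\<^esub> y')"
  by (simp_all add: frag_mult_def frag_extend_add frag_extend_diff frag_extend_minus case_prod_unfold
        frag_extend_fun_add frag_extend_fun_diff frag_extend_fun_zero)

lemma frag_mult_closed:
  assumes "f \<in> carrier F" "g \<in> carrier F" shows "frag_mult f g \<in> carrier F"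
  using assms(1)
proof (induction rule: F_induct)
  case (pure x y)
  show ?case
    using assms(2)
    by (induction rule: F_induct) (use pure in \<open>simp_all add: frag_mult_simps F_closed del: F_simps(1)\<close>)
qed (simp_all add: frag_mult_simps F_closed del: F_simps(1))

text \<open>Right multiplication by a generator carries each relator to a relator of the same kind,
  and additivity in both arguments does the rest. The companion for the other side is this lemma for
  the opposite algebras.\<close>

lemma frag_mult_left_R:
  assumes "f \<in> R" "g \<in> carrier F" shows "frag_mult f g \<in> R"
  using assms(1)
proof (induction rule: R_induct)
  case (relator f)
  show ?case
    using assms(2)
  proof (induction rule: F_induct)
    case (pure a b)
    then have ab: "a \<in> carrier A" "b \<in> carrier B" by auto
    from relator have "frag_mult f (frag_of (a, b)) \<in> relators"
    proof (cases rule: relators_cases)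
      case (left x x' y)
      then have "frag_mult f (frag_of (a, b)) = frag_of ((x \<otimes>\<^bsub>A\<^esub> a) \<oplus>\<^bsub>A\<^esub> (x' \<otimes>\<^bsub>A\<^esub> a), y \<otimes>\<^bsub>B\<^esub> b)
        - frag_of (x \<otimes>\<^bsub>A\<^esub> a, y \<otimes>\<^bsub>B\<^esub> b) - frag_of (x' \<otimes>\<^bsub>A\<^esub> a, y \<otimes>\<^bsub>B\<^esub> b)"
        using ab by (simp add: frag_mult_simps A.l_distr)
      moreover have "x \<otimes>\<^bsub>A\<^esub> a \<in> carrier A" "x' \<otimes>\<^bsub>A\<^esub> a \<in> carrier A" "y \<otimes>\<^bsub>B\<^esub> b \<in> carrier B"
        using ab left by auto
      ultimately show ?thesis unfolding relators_def monoid.simps partial_object.simps by blast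
    next
      case (right x y y')
      then have "frag_mult f (frag_of (a, b)) = frag_of (x \<otimes>\<^bsub>A\<^esub> a, (y \<otimes>\<^bsub>B\<^esub> b) \<oplus>\<^bsub>B\<^esub> (y' \<otimes>\<^bsub>B\<^esub> b))
        - frag_of (x \<otimes>\<^bsub>A\<^esub> a, y \<otimes>\<^bsub>B\<^esub> b) - frag_of (x \<otimes>\<^bsub>A\<^esub> a, y' \<otimes>\<^bsub>B\<^esub> b)"
        using ab by (simp add: frag_mult_simps B.l_distr)
      moreover have "x \<otimes>\<^bsub>A\<^esub> a \<in> carrier A" "y' \<otimes>\<^bsub>B\<^esub> b \<in> carrier B" "y \<otimes>\<^bsub>B\<^esub> b \<in> carrier B"
        using ab right by auto
      ultimately show ?thesis unfolding relators_def monoid.simps partial_object.simps by blast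
    next
      case (scalar c x y)
      then have "frag_mult f (frag_of (a, b)) = frag_of (c \<odot>\<^bsub>A\<^esub> (x \<otimes>\<^bsub>A\<^esub> a), y \<otimes>\<^bsub>B\<^esub> b)
        - frag_of (x \<otimes>\<^bsub>A\<^esub> a, c \<odot>\<^bsub>B\<^esub> (y \<otimes>\<^bsub>B\<^esub> b))"
        using ab by (simp add: frag_mult_simps A.smult_mult_left B.smult_mult_left)
      moreover have "x \<otimes>\<^bsub>A\<^esub> a \<in> carrier A" "y \<otimes>\<^bsub>B\<^esub> b \<in> carrier B"
        using ab scalar by auto
      ultimately show ?thesis using \<open>c \<in> carrier K\<close>
        unfolding relators_def monoid.simps partial_object.simps by blast
    qed
    then show ?case by (rule relators_in_R)
  qed (simp_all add: frag_mult_simps R_zero R_diff)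
qed (simp_all add: frag_mult_simps R_zero R_minus R_add)

end

lemma tensor_alg_opposite: "tensor_alg K A B \<Longrightarrow> tensor_alg K (opposite A) (opposite B)"
  by (simp add: tensor_alg_def k_algebra_opposite)

lemma frag_mult_opposite:
  assumes "tensor_alg K A B"
  shows "tensor_alg.frag_mult (opposite A) (opposite B) g f = tensor_alg.frag_mult A B f g"
proof -
  interpret tensor_alg K A B by fact
  interpret O: tensor_alg K "opposite A" "opposite B" by (rule tensor_alg_opposite) fact
  show ?thesis
    unfolding frag_mult_def O.frag_mult_def case_prod_unfold
    by (subst frag_extend_commute) simp
qed

context tensor_alg
begin

abbreviation TA :: "('k, ('a \<times> 'b \<Rightarrow>\<^sub>0 int) set) module" where "TA \<equiv> tensor_algebra K A B"

lemma frag_mult_right_R: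
  assumes "f \<in> carrier F" "g \<in> R" shows "frag_mult f g \<in> R"
proof -
  interpret O: tensor_alg K "opposite A" "opposite B" by (rule tensor_alg_opposite) unfold_locales
  show ?thesis
    using O.frag_mult_left_R[of g f] assms by (simp add: frag_mult_opposite[OF tensor_alg_axioms])
qed

lemma carrier_TA: "carrier TA = carrier T"
  and add_TA: "(\<oplus>\<^bsub>TA\<^esub>) = (\<otimes>\<^bsub>T\<^esub>)"
  and zero_TA: "\<zero>\<^bsub>TA\<^esub> = \<one>\<^bsub>T\<^esub>"
  and one_TA: "\<one>\<^bsub>TA\<^esub> = pure \<one>\<^bsub>A\<^esub> \<one>\<^bsub>B\<^esub>"
  by (simp_all add: tensor_algebra_def Let_def pure_def cls_def)

lemma hom_TA: "hom T G = hom (add_monoid TA) G"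
  by (simp add: hom_def carrier_TA add_TA)

lemma mult_TA_cls:
  assumes "f \<in> carrier F" "g \<in> carrier F"
  shows "cls f \<otimes>\<^bsub>TA\<^esub> cls g = cls (frag_mult f g)"
proof -
  have "cls (frag_mult f' g') = cls (frag_mult f g)" if "f' \<in> cls f" "g' \<in> cls g" for f' g'
  proof -
    have c: "f' \<in> carrier F" "g' \<in> carrier F" using that mem_cls_carrier assms by metis+
    have "frag_mult (f' - f) g' + frag_mult f (g' - g) \<in> R"
      using that c assms by (intro R_add frag_mult_left_R frag_mult_right_R) (simp_all add: mem_cls_iff)
    then show ?thesis
      using c assms by (subst cls_eq_iff) (simp_all add: frag_mult_closed frag_mult_simps del: F_simps(1))
  qed
  moreover have "f \<in> cls f" "g \<in> cls g" by (rule cls_mem)+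
  ultimately have "(\<Union>f\<in>cls f. \<Union>g\<in>cls g. cls (frag_mult f g)) = cls (frag_mult f g)"
    by blast
  then show ?thesis
    by (simp add: tensor_algebra_def Let_def cls_def frag_mult_def)
qed

lemma pure_mult:
  "a \<in> carrier A \<Longrightarrow> b \<in> carrier B \<Longrightarrow> a' \<in> carrier A \<Longrightarrow> b' \<in> carrier B \<Longrightarrow>
    pure a b \<otimes>\<^bsub>TA\<^esub> pure a' b' = pure (a \<otimes>\<^bsub>A\<^esub> a') (b \<otimes>\<^bsub>B\<^esub> b')"
  unfolding pure_def by (subst mult_TA_cls) (simp_all add: frag_mult_simps)

lemma TA_induct [consumes 1, case_names pure add]:
  assumes "t \<in> carrier TA" and "\<And>x y. x \<in> carrier A \<Longrightarrow> y \<in> carrier B \<Longrightarrow> P (pure x y)"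
    and "\<And>s t. s \<in> carrier TA \<Longrightarrow> t \<in> carrier TA \<Longrightarrow> P s \<Longrightarrow> P t \<Longrightarrow> P (s \<oplus>\<^bsub>TA\<^esub> t)"
  shows "P t"
  using assms(1) unfolding carrier_TA
  by (induction rule: tensor_induct) (use assms(2,3) in \<open>auto simp: add_TA carrier_TA\<close>)

lemma pure_closed_TA [simp, intro]: "a \<in> carrier A \<Longrightarrow> b \<in> carrier B \<Longrightarrow> pure a b \<in> carrier TA"
  by (simp add: carrier_TA)

lemma carrier_TA_cases:
  assumes "x \<in> carrier TA" obtains f where "f \<in> carrier F" "x = cls f"
  using assms that unfolding carrier_TA carrier_T by blast

lemma abelian_group_TA: "abelian_group TA"
  by (rule abelian_groupI) (auto simp: carrier_TA add_TA zero_TA T.m_ac intro: T.l_inv_ex)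

lemma ring_TA: "ring TA"
proof -
  interpret TA: abelian_group TA by (rule abelian_group_TA)
  have closed: "x \<otimes>\<^bsub>TA\<^esub> y \<in> carrier TA" if "x \<in> carrier TA" "y \<in> carrier TA" for x y
    using that by (elim carrier_TA_cases) (simp add: carrier_TA mult_TA_cls cls_closed frag_mult_closed del: F_simps(1))
  have ld: "(x \<oplus>\<^bsub>TA\<^esub> y) \<otimes>\<^bsub>TA\<^esub> z = x \<otimes>\<^bsub>TA\<^esub> z \<oplus>\<^bsub>TA\<^esub> y \<otimes>\<^bsub>TA\<^esub> z"
    if "x \<in> carrier TA" "y \<in> carrier TA" "z \<in> carrier TA" for x y z
    using that by (elim carrier_TA_cases)
      (simp add: mult_TA_cls frag_mult_closed mult_T add_TA F_closed frag_mult_simps del: F_simps(1))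
  have rd: "z \<otimes>\<^bsub>TA\<^esub> (x \<oplus>\<^bsub>TA\<^esub> y) = z \<otimes>\<^bsub>TA\<^esub> x \<oplus>\<^bsub>TA\<^esub> z \<otimes>\<^bsub>TA\<^esub> y"
    if "x \<in> carrier TA" "y \<in> carrier TA" "z \<in> carrier TA" for x y z
    using that by (elim carrier_TA_cases)
      (simp add: mult_TA_cls frag_mult_closed mult_T add_TA F_closed frag_mult_simps del: F_simps(1))
  have "Group.monoid TA"
  proof (rule monoidI)
    show "\<one>\<^bsub>TA\<^esub> \<in> carrier TA" by (simp add: one_TA)
    show "\<one>\<^bsub>TA\<^esub> \<otimes>\<^bsub>TA\<^esub> x = x" if "x \<in> carrier TA" for x
      using that by (induction rule: TA_induct) (simp_all add: rd one_TA pure_mult)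
    show "x \<otimes>\<^bsub>TA\<^esub> \<one>\<^bsub>TA\<^esub> = x" if "x \<in> carrier TA" for x
      using that by (induction rule: TA_induct) (simp_all add: ld one_TA pure_mult)
    \<comment> \<open>Distributivity is already available on both sides, so three nested inductions
      reduce associativity to elementary tensors.\<close>
    show "x \<otimes>\<^bsub>TA\<^esub> y \<otimes>\<^bsub>TA\<^esub> z = x \<otimes>\<^bsub>TA\<^esub> (y \<otimes>\<^bsub>TA\<^esub> z)"
      if x: "x \<in> carrier TA" and y: "y \<in> carrier TA" and z: "z \<in> carrier TA" for x y z
      using x
    proof (induction rule: TA_induct)
      case (pure a b)
      note ab = this
      show ?case using y
      proof (induction rule: TA_induct)
        case (pure a' b')
        note ab' = this
        show ?case using z
        proof (induction rule: TA_induct)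
          case (pure a'' b'')
          then show ?case using ab ab' by (simp add: pure_mult A.m_assoc B.m_assoc)
        next
          case (add s t)
          then show ?case using ab ab' by (simp add: rd closed)
        qed
      next
        case (add s t)
        then show ?case using ab z by (simp add: rd ld closed)
      qed
    next
      case (add s t)
      then show ?case using y z by (simp add: ld closed)
    qed
  qed (rule closed)
  then show ?thesis
    using ld rd by (intro ringI abelian_group_TA) auto
qed

sublocale TA: ring TA by (rule ring_TA)

lemma pure_add_left: "a \<in> carrier A \<Longrightarrow> a' \<in> carrier A \<Longrightarrow> b \<in> carrier B \<Longrightarrow>
    pure (a \<oplus>\<^bsub>A\<^esub> a') b = pure a b \<oplus>\<^bsub>TA\<^esub> pure a' b"
  using pure_left[of a a' b] by (simp add: add_TA)

lemma pure_add_right: "a \<in> carrier A \<Longrightarrow> b \<in> carrier B \<Longrightarrow> b' \<in> carrier B \<Longrightarrow>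
    pure a (b \<oplus>\<^bsub>B\<^esub> b') = pure a b \<oplus>\<^bsub>TA\<^esub> pure a b'"
  using pure_right[of a b b'] by (simp add: add_TA)

lemma pure_zero: "b \<in> carrier B \<Longrightarrow> pure \<zero>\<^bsub>A\<^esub> b = \<zero>\<^bsub>TA\<^esub>" "a \<in> carrier A \<Longrightarrow> pure a \<zero>\<^bsub>B\<^esub> = \<zero>\<^bsub>TA\<^esub>"
  using pure_one(1)[of b] pure_one(2)[of a] by (simp_all add: zero_TA)

lemma pure_smult: "c \<in> carrier K \<Longrightarrow> a \<in> carrier A \<Longrightarrow> b \<in> carrier B \<Longrightarrow> pure (c \<odot>\<^bsub>A\<^esub> a) b = pure a (c \<odot>\<^bsub>B\<^esub> b)"
  using pure_scalar[of c a b] by simp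

lemma TA_lift:
  assumes H: "abelian_group H"
    and "\<And>x y. x \<in> carrier A \<Longrightarrow> y \<in> carrier B \<Longrightarrow> \<phi> x y \<in> carrier H"
    and "\<And>x x' y. x \<in> carrier A \<Longrightarrow> x' \<in> carrier A \<Longrightarrow> y \<in> carrier B \<Longrightarrow> \<phi> (x \<oplus>\<^bsub>A\<^esub> x') y = \<phi> x y \<oplus>\<^bsub>H\<^esub> \<phi> x' y"
    and "\<And>x y y'. x \<in> carrier A \<Longrightarrow> y \<in> carrier B \<Longrightarrow> y' \<in> carrier B \<Longrightarrow> \<phi> x (y \<oplus>\<^bsub>B\<^esub> y') = \<phi> x y \<oplus>\<^bsub>H\<^esub> \<phi> x y'"
    and "\<And>c x y. c \<in> carrier K \<Longrightarrow> x \<in> carrier A \<Longrightarrow> y \<in> carrier B \<Longrightarrow> \<phi> (c \<odot>\<^bsub>A\<^esub> x) y = \<phi> x (c \<odot>\<^bsub>B\<^esub> y)"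
  obtains h where "h \<in> hom (add_monoid TA) (add_monoid H)" "\<And>x y. x \<in> carrier A \<Longrightarrow> y \<in> carrier B \<Longrightarrow> h (pure x y) = \<phi> x y"
proof -
  have "comm_group (add_monoid H)" by (rule abelian_group.a_comm_group[OF H])
  from tensor_lift[OF this, of \<phi>] show thesis
    using assms that unfolding hom_TA by auto
qed

text \<open>The map \<open>id \<otimes> f : A \<otimes> B \<rightarrow> A\<close> for a linear functional \<open>f\<close> on \<open>B\<close>.\<close>

definition is_slice :: "('b \<Rightarrow> 'k) \<Rightarrow> (('a \<times> 'b \<Rightarrow>\<^sub>0 int) set \<Rightarrow> 'a) \<Rightarrow> bool" where
  "is_slice f h \<longleftrightarrow> h \<in> hom (add_monoid TA) (add_monoid A) \<and>
     (\<forall>x\<in>carrier A. \<forall>y\<in>carrier B. h (pure x y) = f y \<odot>\<^bsub>A\<^esub> x)"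

lemma slice_exists:
  assumes "BV.functional f" obtains h where "is_slice f h"
proof -
  have f: "f y \<in> carrier K" "y' \<in> carrier B \<Longrightarrow> f (y \<oplus>\<^bsub>B\<^esub> y') = f y \<oplus>\<^bsub>K\<^esub> f y'"
    "c \<in> carrier K \<Longrightarrow> f (c \<odot>\<^bsub>B\<^esub> y) = c \<otimes>\<^bsub>K\<^esub> f y" if "y \<in> carrier B" for y y' c
    using assms that by (auto simp: BV.functional_def)
  have bal: "f y \<odot>\<^bsub>A\<^esub> (c \<odot>\<^bsub>A\<^esub> x) = f (c \<odot>\<^bsub>B\<^esub> y) \<odot>\<^bsub>A\<^esub> x" if "c \<in> carrier K" "x \<in> carrier A" "y \<in> carrier B" for c x y
    using that f by (simp add: AM.smult_assoc1[symmetric] AM.R.m_comm)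
  obtain h where "h \<in> hom (add_monoid TA) (add_monoid A)"
    "\<And>x y. x \<in> carrier A \<Longrightarrow> y \<in> carrier B \<Longrightarrow> h (pure x y) = f y \<odot>\<^bsub>A\<^esub> x"
    by (rule TA_lift[of A "\<lambda>x y. f y \<odot>\<^bsub>A\<^esub> x"])
      (simp_all add: f(1,2) bal A.is_abelian_group AM.smult_r_distr AM.smult_l_distr)
  then have "is_slice f h" by (simp add: is_slice_def)
  then show thesis by (rule that)
qed

text \<open>Sums of elementary tensors whose second factors are prescribed, one for each entry of
  the list. It is this list that shrinks when a summand turns out to vanish or to be
  redundant.\<close>

fun combinations :: "'b list \<Rightarrow> ('a \<times> 'b \<Rightarrow>\<^sub>0 int) set set" where
  "combinations [] = {\<zero>\<^bsub>TA\<^esub>}"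
| "combinations (b # bs) = {pure a b \<oplus>\<^bsub>TA\<^esub> z | a z. a \<in> carrier A \<and> z \<in> combinations bs}"

lemma combinations_carrier: "set bs \<subseteq> carrier B \<Longrightarrow> z \<in> combinations bs \<Longrightarrow> z \<in> carrier TA"
  by (induction bs arbitrary: z) auto

lemma combinations_add:
  "set bs \<subseteq> carrier B \<Longrightarrow> y \<in> combinations bs \<Longrightarrow> z \<in> combinations bs \<Longrightarrow> y \<oplus>\<^bsub>TA\<^esub> z \<in> combinations bs"
proof (induction bs arbitrary: y z)
  case (Cons b bs)
  then obtain a y' a' z' where *: "y = pure a b \<oplus>\<^bsub>TA\<^esub> y'" "z = pure a' b \<oplus>\<^bsub>TA\<^esub> z'" "a \<in> carrier A" "a' \<in> carrier A"
    "y' \<in> combinations bs" "z' \<in> combinations bs" by auto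
  then have "y \<oplus>\<^bsub>TA\<^esub> z = pure (a \<oplus>\<^bsub>A\<^esub> a') b \<oplus>\<^bsub>TA\<^esub> (y' \<oplus>\<^bsub>TA\<^esub> z')"
    using Cons.prems combinations_carrier[of bs y'] combinations_carrier[of bs z']
    by (simp add: pure_add_left TA.a_ac)
  moreover have "y' \<oplus>\<^bsub>TA\<^esub> z' \<in> combinations bs"
    using * Cons by auto
  ultimately show ?case
    using *(3,4) unfolding combinations.simps by blast
qed simp

lemma combinations_append:
  "set bs \<subseteq> carrier B \<Longrightarrow> set cs \<subseteq> carrier B \<Longrightarrow> y \<in> combinations bs \<Longrightarrow> z \<in> combinations cs \<Longrightarrow>
    y \<oplus>\<^bsub>TA\<^esub> z \<in> combinations (bs @ cs)"
proof (induction bs arbitrary: y)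
  case Nil
  then show ?case using combinations_carrier[of cs z] by (simp)
next
  case (Cons b bs)
  then obtain a y' where *: "y = pure a b \<oplus>\<^bsub>TA\<^esub> y'" "a \<in> carrier A" "y' \<in> combinations bs" by auto
  then have "y \<oplus>\<^bsub>TA\<^esub> z = pure a b \<oplus>\<^bsub>TA\<^esub> (y' \<oplus>\<^bsub>TA\<^esub> z)"
    using Cons.prems combinations_carrier[of bs y'] combinations_carrier[of cs z] by (simp add: TA.a_assoc)
  then show ?case using * Cons by auto
qed

lemma combinations_exists:
  assumes "x \<in> carrier TA" shows "\<exists>bs. set bs \<subseteq> carrier B \<and> x \<in> combinations bs"
  using assms
proof (induction rule: TA_induct)
  case (pure a b)
  then have "pure a b = pure a b \<oplus>\<^bsub>TA\<^esub> \<zero>\<^bsub>TA\<^esub>" by (simp)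
  then have "pure a b \<in> combinations [b]" using pure unfolding combinations.simps by blast
  then show ?case using pure by (intro exI[of _ "[b]"]) simp
next
  case (add s t)
  then obtain bs cs where "set bs \<subseteq> carrier B" "s \<in> combinations bs" "set cs \<subseteq> carrier B" "t \<in> combinations cs"
    by blast
  then show ?case using combinations_append by (intro exI[of _ "bs @ cs"]) auto
qed

lemma combinations_span:
  "set bs \<subseteq> carrier B \<Longrightarrow> b \<in> BV.list_span bs \<Longrightarrow> a \<in> carrier A \<Longrightarrow> pure a b \<in> combinations bs"
proof (induction bs arbitrary: b)
  case Nil
  then show ?case by (simp add: pure_zero)
next
  case (Cons v vs)
  then obtain c w where *: "b = c \<odot>\<^bsub>B\<^esub> v \<oplus>\<^bsub>B\<^esub> w" "c \<in> carrier K" "w \<in> BV.list_span vs" by auto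
  moreover have "w \<in> carrier B"
    using BV.subspace_list_span[of vs] * Cons.prems by (auto simp: BV.subspace_def)
  ultimately have "pure a b = pure (c \<odot>\<^bsub>A\<^esub> a) v \<oplus>\<^bsub>TA\<^esub> pure a w"
    using Cons.prems by (simp add: pure_add_right pure_smult)
  then show ?case using * Cons by auto
qed

text \<open>Elements of \<open>A \<otimes> B\<close> are separated by the slice maps; even the functionals that extend along
  an injection of \<open>B\<close> suffice.\<close>

lemma slices_separate:
  assumes B': "k_algebra K B'" and j: "j \<in> algebra_hom K B B'" "inj_on j (carrier B)"
    and x: "x \<in> carrier TA"
    and zero: "\<And>f h. left_space.functional K B' (smult B') f \<Longrightarrow> is_slice (f \<circ> j) h \<Longrightarrow> h x = \<zero>\<^bsub>A\<^esub>"
  shows "x = \<zero>\<^bsub>TA\<^esub>"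
proof -
  interpret BV': left_space K B' "smult B'" by (rule k_algebra_left_space[OF B'])
  have ex: "\<exists>h. is_slice (f \<circ> j) h" if "BV'.functional f" for f
  proof -
    have "BV.functional (f \<circ> j)"
      using that by (auto simp: BV.functional_def BV'.functional_def algebra_homD[OF j(1)])
    then show ?thesis using slice_exists by blast
  qed
  obtain bs where "set bs \<subseteq> carrier B" "x \<in> combinations bs"
    using combinations_exists[OF x] by blast
  then show ?thesis
    using zero
  proof (induction bs arbitrary: x)
    case (Cons b bs)
    then obtain a z where x: "x = pure a b \<oplus>\<^bsub>TA\<^esub> z" and a: "a \<in> carrier A" and z: "z \<in> combinations bs"
      and b: "b \<in> carrier B" and bs: "set bs \<subseteq> carrier B" by auto
    have zT: "z \<in> carrier TA" by (rule combinations_carrier[OF bs z])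
    have "x \<in> combinations bs"
    \<comment> \<open>Either \<open>b\<close> is redundant and its summand is absorbed by the
      others, or some functional kills the images of the remaining second factors and is
      \<open>1\<close> at \<open>j b\<close>. In the second case the slice of \<open>x\<close> is
      the coefficient \<open>a\<close>, which must therefore be zero.\<close>
    proof (cases "b \<in> BV.list_span bs")
      case True
      then show ?thesis
        unfolding x by (intro combinations_add bs combinations_span a z)
    next
      case False
      have jbs: "set (map j bs) \<subseteq> carrier B'" using bs algebra_homD(1)[OF j(1)] by auto
      have "j b \<notin> BV'.list_span (map j bs)"
      proof
        assume "j b \<in> BV'.list_span (map j bs)"
        then obtain v where "v \<in> carrier B" "v \<in> BV.list_span bs" "j b = j v"
          using algebra_hom_list_span[OF B.k_algebra_axioms B' j(1) bs] by blast
        then show False using False j(2) b by (metis inj_onD)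
      qed
      then obtain f where f: "BV'.functional f" "\<And>w. w \<in> BV'.list_span (map j bs) \<Longrightarrow> f w = \<zero>\<^bsub>K\<^esub>" "f (j b) = \<one>\<^bsub>K\<^esub>"
        using BV'.functional_exists[OF BV'.subspace_list_span[OF jbs]] algebra_homD(1)[OF j(1) b] by blast
      obtain h where h: "is_slice (f \<circ> j) h" using ex[OF f(1)] by blast
      then have hh: "h \<in> hom (add_monoid TA) (add_monoid A)"
        and hp: "\<And>x y. x \<in> carrier A \<Longrightarrow> y \<in> carrier B \<Longrightarrow> h (pure x y) = f (j y) \<odot>\<^bsub>A\<^esub> x"
        by (auto simp: is_slice_def)
      have h0: "h \<zero>\<^bsub>TA\<^esub> = \<zero>\<^bsub>A\<^esub>"
        by (rule add_hom_zero[OF hh TA.is_abelian_group A.is_abelian_group])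
      have "h z' = \<zero>\<^bsub>A\<^esub>" if "z' \<in> combinations cs" "set cs \<subseteq> set bs" for z' cs
        using that
      proof (induction cs arbitrary: z')
        case (Cons c cs)
        then obtain a' y where *: "z' = pure a' c \<oplus>\<^bsub>TA\<^esub> y" "a' \<in> carrier A" "y \<in> combinations cs" by auto
        have "f (j c) = \<zero>\<^bsub>K\<^esub>"
          by (rule f(2), rule BV'.list_span_mem[OF jbs]) (use Cons.prems in auto)
        moreover have "c \<in> carrier B" "y \<in> carrier TA"
          using Cons.prems bs * combinations_carrier[of cs y] by auto
        ultimately show ?case
          using Cons * by (simp add: add_hom_simps[OF hh] hp)
      qed (simp add: h0)
      from this[OF z] have "h x = a"
        unfolding x using a b zT by (simp add: add_hom_simps[OF hh] hp f(3))
      then have "a = \<zero>\<^bsub>A\<^esub>" using Cons.prems(3)[OF f(1) h] by simp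
      then show ?thesis using x z zT b by (simp add: pure_zero)
    qed
    then show ?case by (rule Cons.IH[OF bs _ Cons.prems(3)])
  qed simp
qed

end

text \<open>An equality of structures, not merely an isomorphism: the carrier and the relations do
  not involve the multiplications, and reversing the product is the interchange of a double
  sum.\<close>

lemma tensor_algebra_opposite:
  assumes "tensor_alg K A B"
  shows "opposite (tensor_algebra K A B) = tensor_algebra K (opposite A) (opposite B)"
proof -
  interpret tensor_alg K A B by fact
  interpret O: tensor_alg K "opposite A" "opposite B" by (rule tensor_alg_opposite) fact
  have "(\<lambda>P Q. \<Union>f\<in>Q. \<Union>g\<in>P. R #>\<^bsub>F\<^esub> frag_mult f g) =
    (\<lambda>P Q. \<Union>f\<in>P. \<Union>g\<in>Q. R #>\<^bsub>F\<^esub> O.frag_mult f g)"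
    unfolding frag_mult_opposite[OF tensor_alg_axioms] by (intro ext) blast
  then show ?thesis
    unfolding opposite_def[of "tensor_algebra K A B"]
    by (simp add: tensor_algebra_def Let_def frag_mult_def O.frag_mult_def)
qed

text \<open>For injectivity, the slice of \<open>h x\<close> at a functional \<open>f\<close> on
  \<open>B'\<close> is the image under \<open>i\<close> of the slice of \<open>x\<close> at
  \<open>f \<circ> j\<close>. If \<open>h x\<close> is zero, all these slices of \<open>x\<close>
  vanish, and they separate the elements of \<open>A \<otimes> B\<close>.\<close>

lemma tensor_map:
  assumes "tensor_alg K A B" "tensor_alg K A' B'"
    and i: "i \<in> algebra_hom K A A'" and j: "j \<in> algebra_hom K B B'"
  obtains h where "h \<in> ring_hom (tensor_algebra K A B) (tensor_algebra K A' B')"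
    "\<And>x y. x \<in> carrier A \<Longrightarrow> y \<in> carrier B \<Longrightarrow> h (tensor.pure (add_monoid A) (add_monoid B) (carrier K) (smult A) (smult B) x y)
        = tensor.pure (add_monoid A') (add_monoid B') (carrier K) (smult A') (smult B') (i x) (j y)"
    "inj_on i (carrier A) \<Longrightarrow> inj_on j (carrier B) \<Longrightarrow> inj_on h (carrier (tensor_algebra K A B))"
proof -
  interpret tensor_alg K A B by fact
  interpret T': tensor_alg K A' B' by fact
  note i' = algebra_homD[OF i] and j' = algebra_homD[OF j]
  obtain h where h: "h \<in> hom (add_monoid TA) (add_monoid T'.TA)"
    and hp: "\<And>x y. x \<in> carrier A \<Longrightarrow> y \<in> carrier B \<Longrightarrow> h (pure x y) = T'.pure (i x) (j y)"
    by (rule TA_lift[of T'.TA "\<lambda>x y. T'.pure (i x) (j y)"])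
       (auto simp: i' j' T'.pure_add_left T'.pure_add_right T'.pure_smult T'.TA.is_abelian_group)
  note h' = add_hom_simps[OF h]
  have hr: "h \<in> ring_hom TA T'.TA"
  proof (rule ring_hom_memI)
    show "h (x \<otimes>\<^bsub>TA\<^esub> y) = h x \<otimes>\<^bsub>T'.TA\<^esub> h y" if x: "x \<in> carrier TA" and y: "y \<in> carrier TA" for x y
      using x
    proof (induction rule: TA_induct)
      case (pure a b)
      note ab = this
      show ?case
        using y
      proof (induction rule: TA_induct)
        case (pure a' b')
        then show ?case using ab by (simp add: pure_mult T'.pure_mult hp i' j')
      next
        case (add s t)
        then show ?case using ab by (simp add: h' TA.r_distr T'.TA.r_distr)
      qed
    next
      case (add s t)
      then show ?case using y by (simp add: h' TA.l_distr T'.TA.l_distr)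
    qed
    show "h \<one>\<^bsub>TA\<^esub> = \<one>\<^bsub>T'.TA\<^esub>"
      by (simp add: one_TA T'.one_TA hp i' j')
  qed (use h' in auto)
  have "inj_on h (carrier TA)" if inj: "inj_on i (carrier A)" "inj_on j (carrier B)"
  proof -
    have ker: "x = \<zero>\<^bsub>TA\<^esub>" if x: "x \<in> carrier TA" and hx: "h x = \<zero>\<^bsub>T'.TA\<^esub>" for x
    proof (rule slices_separate[OF T'.B.k_algebra_axioms j inj(2) x])
      fix f k assume f: "T'.BV.functional f" and k: "is_slice (f \<circ> j) k"
      obtain k' where k': "T'.is_slice f k'" using T'.slice_exists[OF f] by blast
      note k1 = k[unfolded is_slice_def, THEN conjunct1] and k1' = k'[unfolded T'.is_slice_def, THEN conjunct1]
      have fj: "f (j y) \<in> carrier K" if "y \<in> carrier B" for y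
        using f that j' by (auto simp: T'.BV.functional_def)
      have "k' (h t) = i (k t)" if "t \<in> carrier TA" for t
        using that
      proof (induction rule: TA_induct)
        case (pure a b)
        then show ?case
          using k k' i' j' fj by (simp add: hp is_slice_def T'.is_slice_def)
      next
        case (add s t)
        then show ?case
          by (simp add: h' add_hom_simps[OF k1] add_hom_simps[OF k1'] i')
      qed
      from this[OF x] have "i (k x) = \<zero>\<^bsub>A'\<^esub>"
        using hx add_hom_zero[OF k1' T'.TA.is_abelian_group T'.A.is_abelian_group] by simp
      moreover have "i \<zero>\<^bsub>A\<^esub> = \<zero>\<^bsub>A'\<^esub>"
        by (rule add_hom_zero[OF add_homI]) (auto simp: i' A.is_abelian_group T'.A.is_abelian_group)
      ultimately show "k x = \<zero>\<^bsub>A\<^esub>"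
        using inj(1) add_hom_simps(1)[OF k1 x] by (metis A.zero_closed inj_onD)
    qed
    show ?thesis
    proof (rule inj_onI)
      fix x y assume xy: "x \<in> carrier TA" "y \<in> carrier TA" "h x = h y"
      have "h (x \<ominus>\<^bsub>TA\<^esub> y) \<oplus>\<^bsub>T'.TA\<^esub> h y = h x"
        using xy by (simp add: h'(2)[symmetric] a_minus_def TA.a_assoc TA.l_neg)
      then have "h (x \<ominus>\<^bsub>TA\<^esub> y) = \<zero>\<^bsub>T'.TA\<^esub>"
        using xy h'(1) T'.TA.add.r_cancel_one[of "h y" "h (x \<ominus>\<^bsub>TA\<^esub> y)"] by (simp)
      then have "x \<ominus>\<^bsub>TA\<^esub> y = \<zero>\<^bsub>TA\<^esub>" using ker xy by simp
      then show "x = y" using xy by (simp add: TA.r_right_minus_eq)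
    qed
  qed
  then show thesis
    using that hr hp by blast
qed

section \<open>Noetherian conditions under tensor products and localization\<close>

context tensor_alg
begin

lemma functional_one:
  assumes "\<one>\<^bsub>B\<^esub> \<noteq> \<zero>\<^bsub>B\<^esub>"
  obtains f where "BV.functional f" "f \<one>\<^bsub>B\<^esub> = \<one>\<^bsub>K\<^esub>"
proof -
  have "BV.subspace {\<zero>\<^bsub>B\<^esub>}"
    using BV.subspace_list_span[of "[]"] by simp
  then show thesis
    using BV.functional_exists[of "{\<zero>\<^bsub>B\<^esub>}" "\<one>\<^bsub>B\<^esub>"] that assms by auto
qed

text \<open>Moving \<open>b\<close> into the functional, \<open>f' y = f (b y)\<close>, turns a
  slice of the product into \<open>a\<close> times a slice. Hence the elements with all slices in a
  given left ideal form a left ideal again.\<close>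

lemma slice_mult:
  assumes f: "BV.functional f" and h: "is_slice f h" and b: "b \<in> carrier B" and a: "a \<in> carrier A"
  shows "\<exists>f' h'. BV.functional f' \<and> is_slice f' h' \<and>
    (\<forall>x\<in>carrier TA. h (pure a b \<otimes>\<^bsub>TA\<^esub> x) = a \<otimes>\<^bsub>A\<^esub> h' x)"
proof -
  define f' where "f' y = f (b \<otimes>\<^bsub>B\<^esub> y)" for y
  have ff: "f y \<in> carrier K" "y' \<in> carrier B \<Longrightarrow> f (y \<oplus>\<^bsub>B\<^esub> y') = f y \<oplus>\<^bsub>K\<^esub> f y'"
    "c \<in> carrier K \<Longrightarrow> f (c \<odot>\<^bsub>B\<^esub> y) = c \<otimes>\<^bsub>K\<^esub> f y" if "y \<in> carrier B" for y y' c
    using f that by (auto simp: BV.functional_def)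
  have f': "BV.functional f'"
    unfolding BV.functional_def f'_def using b ff by (auto simp: B.r_distr B.smult_mult_right)
  then obtain h' where h': "is_slice f' h'" by (rule slice_exists)
  note hh = h[unfolded is_slice_def, THEN conjunct1] and hh' = h'[unfolded is_slice_def, THEN conjunct1]
  have "h (pure a b \<otimes>\<^bsub>TA\<^esub> x) = a \<otimes>\<^bsub>A\<^esub> h' x" if "x \<in> carrier TA" for x
    using that
  proof (induction rule: TA_induct)
    case (pure c d)
    then show ?case
      using a b h h' ff by (simp add: pure_mult is_slice_def f'_def A.smult_mult_right)
  next
    case (add s t)
    then show ?case
      using a b by (simp add: TA.r_distr add_hom_simps[OF hh] add_hom_simps[OF hh'] A.r_distr)
  qed
  with f' h' show ?thesis by blast
qed

text \<open>\<open>\<Phi> I\<close> plays the role of \<open>I \<otimes> B\<close>: the elements all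
  of whose slices lie in \<open>I\<close>. A functional with value \<open>1\<close> at the unit of
  \<open>B\<close> recovers \<open>a\<close> from \<open>a \<otimes> 1\<close>, so \<open>I\<close>
  can be read off from \<open>\<Phi> I\<close>.\<close>

lemma acc_left_ideal_factor:
  assumes acc: "acc_on (\<lambda>I. left_ideal I TA)" and ne: "\<one>\<^bsub>B\<^esub> \<noteq> \<zero>\<^bsub>B\<^esub>"
  shows "acc_on (\<lambda>I. left_ideal I A)"
proof (rule acc_on_transfer[OF acc])
  define \<Phi> where "\<Phi> I = {x \<in> carrier TA. \<forall>f h. BV.functional f \<longrightarrow> is_slice f h \<longrightarrow> h x \<in> I}" for I
  note sl = is_slice_def
  show "left_ideal (\<Phi> I) TA" if I: "left_ideal I A" for I
  proof (rule left_idealI[OF TA.ring_axioms])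
    note I' = left_idealD[OF I A.ring_axioms]
    show "\<Phi> I \<subseteq> carrier TA" by (auto simp: \<Phi>_def)
    have "h \<zero>\<^bsub>TA\<^esub> = \<zero>\<^bsub>A\<^esub>" if "is_slice f h" for f h
      by (rule add_hom_zero[OF _ TA.is_abelian_group A.is_abelian_group]) (use that in \<open>simp add: sl\<close>)
    then show "\<zero>\<^bsub>TA\<^esub> \<in> \<Phi> I" using I'(2) by (auto simp: \<Phi>_def)
    show add: "x \<oplus>\<^bsub>TA\<^esub> y \<in> \<Phi> I" if "x \<in> \<Phi> I" "y \<in> \<Phi> I" for x y
      using that I'(3) by (auto simp: \<Phi>_def sl add_hom_simps)
    show "z \<otimes>\<^bsub>TA\<^esub> x \<in> \<Phi> I" if z: "z \<in> carrier TA" and x: "x \<in> \<Phi> I" for z x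
      using z
    proof (induction rule: TA_induct)
      case (pure a b)
      have "x \<in> carrier TA" using x by (simp add: \<Phi>_def)
      have "h (pure a b \<otimes>\<^bsub>TA\<^esub> x) \<in> I" if fh: "BV.functional f" "is_slice f h" for f h
      proof -
        obtain f' h' where "BV.functional f'" "is_slice f' h'" "h (pure a b \<otimes>\<^bsub>TA\<^esub> x) = a \<otimes>\<^bsub>A\<^esub> h' x"
          using slice_mult[OF fh pure(2,1)] \<open>x \<in> carrier TA\<close> by blast
        then show ?thesis using x I'(5) pure by (simp add: \<Phi>_def)
      qed
      then show ?case using pure \<open>x \<in> carrier TA\<close> by (simp add: \<Phi>_def)
    next
      case (add s t)
      then show ?case
        using x \<open>\<And>x y. x \<in> \<Phi> I \<Longrightarrow> y \<in> \<Phi> I \<Longrightarrow> x \<oplus>\<^bsub>TA\<^esub> y \<in> \<Phi> I\<close>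
        by (simp add: TA.l_distr \<Phi>_def)
    qed
  qed
  show "\<Phi> I \<subseteq> \<Phi> J" if "I \<subseteq> J" for I J
    using that by (auto simp: \<Phi>_def)
  show "I = J" if I: "left_ideal I A" and J: "left_ideal J A" and "I \<subseteq> J" "\<Phi> I = \<Phi> J" for I J
  proof
    show "J \<subseteq> I"
    proof
      fix a assume a: "a \<in> J"
      note J' = left_idealD[OF J A.ring_axioms]
      have aA: "a \<in> carrier A" using a J' by blast
      have "h (pure a \<one>\<^bsub>B\<^esub>) \<in> J" if "BV.functional f" "is_slice f h" for f h
      proof -
        have "f \<one>\<^bsub>B\<^esub> \<in> carrier K" using that by (auto simp: BV.functional_def)
        then have "h (pure a \<one>\<^bsub>B\<^esub>) = (f \<one>\<^bsub>B\<^esub> \<odot>\<^bsub>A\<^esub> \<one>\<^bsub>A\<^esub>) \<otimes>\<^bsub>A\<^esub> a"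
          using that aA by (simp add: sl A.smult_mult_left)
        then show ?thesis using J'(5) a \<open>f \<one>\<^bsub>B\<^esub> \<in> carrier K\<close> by simp
      qed
      then have "pure a \<one>\<^bsub>B\<^esub> \<in> \<Phi> J" using aA by (simp add: \<Phi>_def)
      then have *: "pure a \<one>\<^bsub>B\<^esub> \<in> \<Phi> I" using that by simp
      obtain f where f: "BV.functional f" "f \<one>\<^bsub>B\<^esub> = \<one>\<^bsub>K\<^esub>" using functional_one[OF ne] .
      obtain h where h: "is_slice f h" using slice_exists[OF f(1)] .
      have "h (pure a \<one>\<^bsub>B\<^esub>) = a" using h f(2) aA by (simp add: sl)
      moreover have "h (pure a \<one>\<^bsub>B\<^esub>) \<in> I" using * f(1) h unfolding \<Phi>_def by blast
      ultimately show "a \<in> I" by simp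
    qed
  qed (use that in blast)
qed

end

text \<open>\<open>A\<close> sits in the tensor product as the elements
  \<open>a \<otimes> 1\<close>, and a slice at a functional with \<open>f 1 = 1\<close> retracts
  onto it. The condition on right ideals is the one on left ideals for the opposites.\<close>

lemma nc_noetherian_domain_factor:
  assumes AB: "tensor_alg K A B" and TA: "nc_noetherian_domain (tensor_algebra K A B)"
  shows "nc_noetherian_domain A"
proof -
  interpret tensor_alg K A B by fact
  interpret O: tensor_alg K "opposite A" "opposite B" by (rule tensor_alg_opposite) fact
  have acc: "acc_on (\<lambda>I. left_ideal I TA)" and accO: "acc_on (\<lambda>I. left_ideal I O.TA)"
    and one: "\<one>\<^bsub>TA\<^esub> \<noteq> \<zero>\<^bsub>TA\<^esub>"
    and dom: "\<And>x y. x \<in> carrier TA \<Longrightarrow> y \<in> carrier TA \<Longrightarrow> x \<otimes>\<^bsub>TA\<^esub> y = \<zero>\<^bsub>TA\<^esub> \<Longrightarrow> x = \<zero>\<^bsub>TA\<^esub> \<or> y = \<zero>\<^bsub>TA\<^esub>"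
    using TA by (auto simp: nc_noetherian_domain_def left_ideal_opposite simp flip: tensor_algebra_opposite[OF AB])
  have neA: "\<one>\<^bsub>A\<^esub> \<noteq> \<zero>\<^bsub>A\<^esub>" and neB: "\<one>\<^bsub>B\<^esub> \<noteq> \<zero>\<^bsub>B\<^esub>"
    using one pure_zero by (auto simp: one_TA)
  obtain f where f: "BV.functional f" "f \<one>\<^bsub>B\<^esub> = \<one>\<^bsub>K\<^esub>" using functional_one[OF neB] .
  obtain h where h: "is_slice f h" using slice_exists[OF f(1)] .
  have h1: "h (pure a \<one>\<^bsub>B\<^esub>) = a" if "a \<in> carrier A" for a
    using h f(2) that by (simp add: is_slice_def)
  have h0: "h \<zero>\<^bsub>TA\<^esub> = \<zero>\<^bsub>A\<^esub>"
    using h1[of "\<zero>\<^bsub>A\<^esub>"] by (simp add: pure_zero)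
  have "x = \<zero>\<^bsub>A\<^esub> \<or> y = \<zero>\<^bsub>A\<^esub>" if "x \<in> carrier A" "y \<in> carrier A" "x \<otimes>\<^bsub>A\<^esub> y = \<zero>\<^bsub>A\<^esub>" for x y
  proof -
    have "pure x \<one>\<^bsub>B\<^esub> \<otimes>\<^bsub>TA\<^esub> pure y \<one>\<^bsub>B\<^esub> = \<zero>\<^bsub>TA\<^esub>"
      using that by (simp add: pure_mult pure_zero)
    then show ?thesis using dom[of "pure x \<one>\<^bsub>B\<^esub>" "pure y \<one>\<^bsub>B\<^esub>"] h0 h1 that by (metis B.one_closed pure_closed_TA)
  qed
  then show ?thesis
    using acc_left_ideal_factor[OF acc neB] O.acc_left_ideal_factor[OF accO] neA neB
    by (simp add: nc_noetherian_domain_def A.ring_axioms left_ideal_opposite)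
qed

text \<open>Written as \<open>j s x = j a\<close>, without a prescribed set of denominators: any
  \<open>s\<close> that becomes a unit may serve.\<close>

definition left_fractions :: "('r, 'm) ring_scheme \<Rightarrow> ('t, 'n) ring_scheme \<Rightarrow> ('r \<Rightarrow> 't) \<Rightarrow> bool" where
  "left_fractions R T j \<longleftrightarrow>
     (\<forall>x\<in>carrier T. \<exists>s\<in>carrier R. \<exists>a\<in>carrier R. j s \<in> Units T \<and> j s \<otimes>\<^bsub>T\<^esub> x = j a)"

text \<open>A left ideal of \<open>T\<close> is determined by its preimage in \<open>R\<close>: if
  \<open>j s x = j a\<close> with \<open>j s\<close> a unit, then \<open>x\<close> lies in the ideal
  exactly when \<open>j a\<close> does.\<close>

lemma acc_left_ideal_fractions:
  assumes R: "ring R" and T: "ring T" and j: "j \<in> ring_hom R T" and fr: "left_fractions R T j"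
    and acc: "acc_on (\<lambda>I. left_ideal I R)"
  shows "acc_on (\<lambda>I. left_ideal I T)"
proof (rule acc_on_transfer[OF acc])
  interpret R: ring R by fact
  interpret T: ring T by fact
  define \<Phi> where "\<Phi> I = {r \<in> carrier R. j r \<in> I}" for I
  show "left_ideal (\<Phi> I) R" if I: "left_ideal I T" for I
    using left_idealD[OF I T] ring_hom_closed[OF j] ring_hom_mult[OF j] ring_hom_add[OF j] ring_hom_zero[OF j R T]
    by (intro left_idealI[OF R]) (auto simp: \<Phi>_def)
  show "\<Phi> I \<subseteq> \<Phi> J" if "I \<subseteq> J" for I J
    using that by (auto simp: \<Phi>_def)
  show "I = J" if I: "left_ideal I T" and J: "left_ideal J T" and "I \<subseteq> J" "\<Phi> I = \<Phi> J" for I J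
  proof
    show "J \<subseteq> I"
    proof
      fix x assume x: "x \<in> J"
      then have xT: "x \<in> carrier T" using left_idealD(1)[OF J T] by blast
      then obtain s a where s: "s \<in> carrier R" "a \<in> carrier R" "j s \<in> Units T" "j s \<otimes>\<^bsub>T\<^esub> x = j a"
        using fr by (auto simp: left_fractions_def)
      then have "j a \<in> J" using left_idealD(5)[OF J T, of "j s" x] x ring_hom_closed[OF j] by simp
      then have "j a \<in> I" using \<open>\<Phi> I = \<Phi> J\<close> s(2) by (auto simp: \<Phi>_def)
      then have "inv\<^bsub>T\<^esub> j s \<otimes>\<^bsub>T\<^esub> (j s \<otimes>\<^bsub>T\<^esub> x) \<in> I"
        unfolding s(4) using left_idealD(5)[OF I T] s(3) by simp
      then show "x \<in> I"
        using s(3) xT by (simp add: T.m_assoc[symmetric] T.Units_closed)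
    qed
  qed fact
qed

text \<open>For zero divisors the denominator of \<open>x\<close> is cleared on the left and that of
  \<open>y\<close> on the right. Then \<open>j (a b) = j s (x y) j t\<close>, so
  \<open>x y = 0\<close> forces \<open>a b = 0\<close> in the domain \<open>R\<close>.\<close>

lemma nc_noetherian_domain_fractions:
  fixes R :: "('k, 'r) module" and T :: "('k, 't) module"
  assumes R: "nc_noetherian_domain R" and T: "ring T" "\<one>\<^bsub>T\<^esub> \<noteq> \<zero>\<^bsub>T\<^esub>"
    and j: "j \<in> ring_hom R T" "inj_on j (carrier R)"
    and fr: "left_fractions R T j" "left_fractions (opposite R) (opposite T) j"
  shows "nc_noetherian_domain T"
proof -
  have Rr: "ring R" and accl: "acc_on (\<lambda>I. left_ideal I R)" and accr: "acc_on (\<lambda>I. left_ideal I (opposite R))"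
    using R by (auto simp: nc_noetherian_domain_def left_ideal_opposite)
  interpret R: ring R by fact
  interpret T: ring T by fact
  have "x = \<zero>\<^bsub>T\<^esub> \<or> y = \<zero>\<^bsub>T\<^esub>" if xy: "x \<in> carrier T" "y \<in> carrier T" "x \<otimes>\<^bsub>T\<^esub> y = \<zero>\<^bsub>T\<^esub>" for x y
  proof -
    obtain s a where s: "s \<in> carrier R" "a \<in> carrier R" "j s \<in> Units T" "j s \<otimes>\<^bsub>T\<^esub> x = j a"
      using fr(1) xy by (auto simp: left_fractions_def)
    obtain t b where t: "t \<in> carrier R" "b \<in> carrier R" "j t \<in> Units T" "y \<otimes>\<^bsub>T\<^esub> j t = j b"
      using fr(2) xy by (auto simp: left_fractions_def)
    have "j (a \<otimes>\<^bsub>R\<^esub> b) = j s \<otimes>\<^bsub>T\<^esub> (x \<otimes>\<^bsub>T\<^esub> y) \<otimes>\<^bsub>T\<^esub> j t"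
      using s(1-3) t(1-3) xy(1,2) ring_hom_mult[OF j(1)] by (simp add: T.m_assoc T.Units_closed flip: s(4) t(4))
    also have "\<dots> = j \<zero>\<^bsub>R\<^esub>"
      using xy s(3) t(3) ring_hom_zero[OF j(1) Rr T(1)] by (simp add: T.Units_closed)
    finally have "a \<otimes>\<^bsub>R\<^esub> b = \<zero>\<^bsub>R\<^esub>"
      using j(2) s t by (auto dest: inj_onD)
    then consider "j a = \<zero>\<^bsub>T\<^esub>" | "j b = \<zero>\<^bsub>T\<^esub>"
      using R s(2) t(2) ring_hom_zero[OF j(1) Rr T(1)] unfolding nc_noetherian_domain_def by metis
    then show ?thesis
    proof cases
      case 1
      then have "inv\<^bsub>T\<^esub> j s \<otimes>\<^bsub>T\<^esub> (j s \<otimes>\<^bsub>T\<^esub> x) = \<zero>\<^bsub>T\<^esub>" using s by simp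
      then show ?thesis using s(3) xy by (simp add: T.m_assoc[symmetric] T.Units_closed)
    next
      case 2
      then have "y \<otimes>\<^bsub>T\<^esub> j t \<otimes>\<^bsub>T\<^esub> inv\<^bsub>T\<^esub> j t = \<zero>\<^bsub>T\<^esub>" using t by simp
      then show ?thesis using t(3) xy by (simp add: T.m_assoc T.Units_closed)
    qed
  qed
  moreover have "acc_on (\<lambda>I. left_ideal I T)"
    by (rule acc_left_ideal_fractions[OF Rr T(1) j(1) fr(1) accl])
  moreover have "acc_on (\<lambda>I. left_ideal I (opposite T))"
    by (rule acc_left_ideal_fractions[OF ring_opposite[OF Rr] ring_opposite[OF T(1)] _ fr(2) accr])
       (use j(1) in \<open>auto simp: ring_hom_def\<close>)
  ultimately show ?thesis
    using T by (simp add: nc_noetherian_domain_def left_ideal_opposite)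
qed

text \<open>Writing \<open>j s (j t)^-1\<close> as a left fraction with denominator \<open>u\<close>
  and numerator \<open>v\<close> produces a common left multiple of \<open>j s\<close> and
  \<open>j t\<close> that is still a unit.\<close>

lemma left_fractions_common:
  assumes R: "ring R" and T: "ring T" and j: "j \<in> ring_hom R T" and fr: "left_fractions R T j"
    and st: "s \<in> carrier R" "t \<in> carrier R" "j s \<in> Units T" "j t \<in> Units T"
  obtains u v where "u \<in> carrier R" "v \<in> carrier R" "j u \<otimes>\<^bsub>T\<^esub> j s \<in> Units T" "j u \<otimes>\<^bsub>T\<^esub> j s = j v \<otimes>\<^bsub>T\<^esub> j t"
proof -
  interpret R: ring R by fact
  interpret T: ring T by fact
  have c: "j s \<in> carrier T" "j t \<in> carrier T" using st by auto
  then obtain u v where uv: "u \<in> carrier R" "v \<in> carrier R" "j u \<in> Units T" "j u \<otimes>\<^bsub>T\<^esub> (j s \<otimes>\<^bsub>T\<^esub> inv\<^bsub>T\<^esub> j t) = j v"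
    using fr[unfolded left_fractions_def, rule_format, of "j s \<otimes>\<^bsub>T\<^esub> inv\<^bsub>T\<^esub> j t"] st by auto
  have "j v \<otimes>\<^bsub>T\<^esub> j t = j u \<otimes>\<^bsub>T\<^esub> j s"
    unfolding uv(4)[symmetric] using c st uv(3) by (simp add: T.m_assoc T.Units_closed)
  then show thesis using uv(1-3) st by (intro that[of u v]) simp_all
qed

text \<open>A sum of elementary tensors needs a single denominator, and this is kept an elementary
  tensor of units so that it is visibly a unit. Common denominators are therefore found in each
  factor separately.\<close>

lemma tensor_left_fractions:
  assumes AB: "tensor_alg K A B" and DE: "tensor_alg K D E"
    and i: "i \<in> algebra_hom K A D" and j: "j \<in> algebra_hom K B E"
    and fi: "left_fractions A D i" and fj: "left_fractions B E j"
    and h: "h \<in> ring_hom (tensor_algebra K A B) (tensor_algebra K D E)"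
    and hp: "\<And>x y. x \<in> carrier A \<Longrightarrow> y \<in> carrier B \<Longrightarrow> h (tensor.pure (add_monoid A) (add_monoid B) (carrier K) (smult A) (smult B) x y)
        = tensor.pure (add_monoid D) (add_monoid E) (carrier K) (smult D) (smult E) (i x) (j y)"
  shows "left_fractions (tensor_algebra K A B) (tensor_algebra K D E) h"
proof -
  interpret tensor_alg K A B by fact
  interpret T': tensor_alg K D E by fact
  note i' = algebra_homD[OF i] and j' = algebra_homD[OF j]
  have ir: "i \<in> ring_hom A D" and jr: "j \<in> ring_hom B E"
    using i j by (auto simp: algebra_hom_def)
  have unit: "T'.pure x y \<in> Units T'.TA" if "x \<in> Units D" "y \<in> Units E" for x y
  proof -
    have c: "x \<in> carrier D" "y \<in> carrier E" using that by auto
    then show ?thesis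
      unfolding Units_def using that
      by (intro CollectI conjI bexI[of _ "T'.pure (inv\<^bsub>D\<^esub> x) (inv\<^bsub>E\<^esub> y)"]) (simp_all add: T'.pure_mult T'.one_TA)
  qed
  have "\<exists>s\<in>carrier A. \<exists>s'\<in>carrier B. \<exists>y\<in>carrier TA. i s \<in> Units D \<and> j s' \<in> Units E \<and>
     T'.pure (i s) (j s') \<otimes>\<^bsub>T'.TA\<^esub> x = h y" if "x \<in> carrier T'.TA" for x
    using that
  proof (induction rule: T'.TA_induct)
    case (pure d e)
    obtain s a where s: "s \<in> carrier A" "a \<in> carrier A" "i s \<in> Units D" "i s \<otimes>\<^bsub>D\<^esub> d = i a"
      using fi pure by (auto simp: left_fractions_def)
    obtain t b where t: "t \<in> carrier B" "b \<in> carrier B" "j t \<in> Units E" "j t \<otimes>\<^bsub>E\<^esub> e = j b"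
      using fj pure by (auto simp: left_fractions_def)
    have "T'.pure (i s) (j t) \<otimes>\<^bsub>T'.TA\<^esub> T'.pure d e = h (pure a b)"
      using s t pure by (simp add: T'.pure_mult hp i' j')
    then show ?case using s t pure_closed_TA[of a b] by blast
  next
    case (add x y)
    then obtain s s' x' t t' y' where s: "s \<in> carrier A" "s' \<in> carrier B" "x' \<in> carrier TA" "i s \<in> Units D" "j s' \<in> Units E"
       "T'.pure (i s) (j s') \<otimes>\<^bsub>T'.TA\<^esub> x = h x'"
      and t: "t \<in> carrier A" "t' \<in> carrier B" "y' \<in> carrier TA" "i t \<in> Units D" "j t' \<in> Units E"
       "T'.pure (i t) (j t') \<otimes>\<^bsub>T'.TA\<^esub> y = h y'"
      by blast
    obtain u v where u: "u \<in> carrier A" "v \<in> carrier A" "i u \<otimes>\<^bsub>D\<^esub> i s \<in> Units D" "i u \<otimes>\<^bsub>D\<^esub> i s = i v \<otimes>\<^bsub>D\<^esub> i t"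
      using left_fractions_common[OF A.ring T'.A.ring ir fi s(1) t(1) s(4) t(4)] .
    obtain u' v' where u': "u' \<in> carrier B" "v' \<in> carrier B" "j u' \<otimes>\<^bsub>E\<^esub> j s' \<in> Units E" "j u' \<otimes>\<^bsub>E\<^esub> j s' = j v' \<otimes>\<^bsub>E\<^esub> j t'"
      using left_fractions_common[OF B.ring T'.B.ring jr fj s(2) t(2) s(5) t(5)] .
    \<comment> \<open>The common denominator has two factorizations, one through the denominator of
      \<open>x\<close> and one through that of \<open>y\<close>; each of them clears one
      summand.\<close>
    let ?p = "T'.pure (i u \<otimes>\<^bsub>D\<^esub> i s) (j u' \<otimes>\<^bsub>E\<^esub> j s')"
    have c: "i s \<in> carrier D" "j s' \<in> carrier E" "i u \<in> carrier D" "j u' \<in> carrier E"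
      "i t \<in> carrier D" "j t' \<in> carrier E" "i v \<in> carrier D" "j v' \<in> carrier E"
      using s t u u' i' j' by auto
    have "?p = T'.pure (i u) (j u') \<otimes>\<^bsub>T'.TA\<^esub> T'.pure (i s) (j s')"
      using c by (simp add: T'.pure_mult)
    then have x: "?p \<otimes>\<^bsub>T'.TA\<^esub> x = h (pure u u' \<otimes>\<^bsub>TA\<^esub> x')"
      using c add.hyps s u u' by (simp add: T'.TA.m_assoc ring_hom_mult[OF h] hp)
    have "?p = T'.pure (i v) (j v') \<otimes>\<^bsub>T'.TA\<^esub> T'.pure (i t) (j t')"
      using c u(4) u'(4) by (simp add: T'.pure_mult)
    then have y: "?p \<otimes>\<^bsub>T'.TA\<^esub> y = h (pure v v' \<otimes>\<^bsub>TA\<^esub> y')"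
      using c add.hyps t u u' by (simp add: T'.TA.m_assoc ring_hom_mult[OF h] hp)
    have "?p \<otimes>\<^bsub>T'.TA\<^esub> (x \<oplus>\<^bsub>T'.TA\<^esub> y) = h (pure u u' \<otimes>\<^bsub>TA\<^esub> x' \<oplus>\<^bsub>TA\<^esub> pure v v' \<otimes>\<^bsub>TA\<^esub> y')"
      using c add.hyps s t u u' x y by (simp add: T'.TA.r_distr ring_hom_add[OF h])
    moreover have "i (u \<otimes>\<^bsub>A\<^esub> s) = i u \<otimes>\<^bsub>D\<^esub> i s" "j (u' \<otimes>\<^bsub>B\<^esub> s') = j u' \<otimes>\<^bsub>E\<^esub> j s'"
      using u u' s i' j' by auto
    ultimately show ?case
      using u(1-3) u'(1-3) s(1-3) t(1-3)
      by (intro bexI[of _ "u \<otimes>\<^bsub>A\<^esub> s"] bexI[of _ "u' \<otimes>\<^bsub>B\<^esub> s'"] bexI[of _ "pure u u' \<otimes>\<^bsub>TA\<^esub> x' \<oplus>\<^bsub>TA\<^esub> pure v v' \<otimes>\<^bsub>TA\<^esub> y'"]) simp_all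
  qed
  then show ?thesis
    unfolding left_fractions_def using unit hp pure_closed_TA by metis
qed

lemma quotient_left_fractions:
  assumes "quotient_division_algebra K A D \<iota>"
  shows "left_fractions A D \<iota>" "left_fractions (opposite A) (opposite D) \<iota>"
proof -
  have D: "division_algebra K D" and i: "\<iota> \<in> algebra_hom K A D" "inj_on \<iota> (carrier A)" and A: "k_algebra K A"
    and fr: "\<forall>d\<in>carrier D.
        (\<exists>s\<in>carrier A - {\<zero>\<^bsub>A\<^esub>}. \<exists>a\<in>carrier A. d = inv\<^bsub>D\<^esub> (\<iota> s) \<otimes>\<^bsub>D\<^esub> \<iota> a) \<and>
        (\<exists>s\<in>carrier A - {\<zero>\<^bsub>A\<^esub>}. \<exists>a\<in>carrier A. d = \<iota> a \<otimes>\<^bsub>D\<^esub> inv\<^bsub>D\<^esub> (\<iota> s))"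
    using assms by (auto simp: quotient_division_algebra_def)
  interpret A: ring A by (rule k_algebra.ring[OF A])
  interpret D: ring D using D by (auto simp: division_algebra_def intro: k_algebra.ring)
  have i0: "\<iota> \<zero>\<^bsub>A\<^esub> = \<zero>\<^bsub>D\<^esub>"
    using i(1) ring_hom_zero[of \<iota> A D] by (simp add: algebra_hom_def A.ring_axioms D.ring_axioms)
  have U: "\<iota> s \<in> Units D" if "s \<in> carrier A - {\<zero>\<^bsub>A\<^esub>}" for s
  proof -
    have "\<iota> s \<noteq> \<zero>\<^bsub>D\<^esub>" using that i(2) i0 by (metis A.zero_closed DiffE inj_onD singletonI)
    then show ?thesis using that D algebra_homD(1)[OF i(1)] by (simp add: division_algebra_def)
  qed
  note c = algebra_homD(1)[OF i(1)]
  show "left_fractions A D \<iota>"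
    unfolding left_fractions_def
  proof
    fix x assume "x \<in> carrier D"
    then obtain s a where s: "s \<in> carrier A - {\<zero>\<^bsub>A\<^esub>}" "a \<in> carrier A" "x = inv\<^bsub>D\<^esub> (\<iota> s) \<otimes>\<^bsub>D\<^esub> \<iota> a"
      using fr by blast
    then have "\<iota> s \<otimes>\<^bsub>D\<^esub> x = \<iota> a" using U[of s] c[of a] c[of s] by (simp add: D.m_assoc[symmetric])
    then show "\<exists>s\<in>carrier A. \<exists>a\<in>carrier A. \<iota> s \<in> Units D \<and> \<iota> s \<otimes>\<^bsub>D\<^esub> x = \<iota> a"
      using s U by blast
  qed
  show "left_fractions (opposite A) (opposite D) \<iota>"
    unfolding left_fractions_def
  proof
    fix x assume "x \<in> carrier (opposite D)"
    then obtain s a where s: "s \<in> carrier A - {\<zero>\<^bsub>A\<^esub>}" "a \<in> carrier A" "x = \<iota> a \<otimes>\<^bsub>D\<^esub> inv\<^bsub>D\<^esub> (\<iota> s)"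
      using fr by (metis opposite_simps(1))
    then have "x \<otimes>\<^bsub>D\<^esub> \<iota> s = \<iota> a" using U[of s] c[of a] c[of s] by (simp add: D.m_assoc)
    then show "\<exists>s\<in>carrier (opposite A). \<exists>a\<in>carrier (opposite A). \<iota> s \<in> Units (opposite D) \<and> \<iota> s \<otimes>\<^bsub>opposite D\<^esub> x = \<iota> a"
      using s U by auto
  qed
qed

text \<open>Passing to the opposite exchanges the two factors, so the right-hand fraction condition
  is the left-hand one for \<open>A\<^sup>o \<otimes> A\<close>, with the fraction conditions on the
  factors exchanged as well. Injectivity of the comparison map also shows that the larger algebra is
  nonzero.\<close>

lemma nc_noetherian_domain_enveloping_quotient:
  assumes A: "nc_noetherian_domain (enveloping_algebra K A)" and q: "quotient_division_algebra K A D \<iota>"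
  shows "nc_noetherian_domain (enveloping_algebra K D)"
proof -
  have kA: "k_algebra K A" and D: "division_algebra K D" and i: "\<iota> \<in> algebra_hom K A D" "inj_on \<iota> (carrier A)"
    using q by (auto simp: quotient_division_algebra_def)
  then have kD: "k_algebra K D" by (simp add: division_algebra_def)
  have AA: "tensor_alg K A (opposite A)" and DD: "tensor_alg K D (opposite D)"
    by (simp_all add: tensor_alg_def kA kD k_algebra_opposite)
  interpret tensor_alg K A "opposite A" by (rule AA)
  interpret T': tensor_alg K D "opposite D" by (rule DD)
  interpret O: tensor_alg K "opposite A" A using tensor_alg_opposite[OF AA] by simp
  interpret O': tensor_alg K "opposite D" D using tensor_alg_opposite[OF DD] by simp
  have fr: "left_fractions A D \<iota>" "left_fractions (opposite A) (opposite D) \<iota>"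
    using quotient_left_fractions[OF q] .
  note io = algebra_hom_opposite[OF i(1)]
  obtain h where h: "h \<in> ring_hom TA T'.TA"
    and hp: "\<And>x y. x \<in> carrier A \<Longrightarrow> y \<in> carrier (opposite A) \<Longrightarrow> h (pure x y) = T'.pure (\<iota> x) (\<iota> y)"
    and inj: "inj_on h (carrier TA)"
    using tensor_map[OF AA DD i(1) io] i(2) by auto
  have l: "left_fractions TA T'.TA h"
    by (rule tensor_left_fractions[OF AA DD i(1) io fr h hp])
  have TO: "opposite TA = O.TA" "opposite T'.TA = O'.TA"
    using tensor_algebra_opposite[OF AA] tensor_algebra_opposite[OF DD] by simp_all
  have hO: "h \<in> ring_hom O.TA O'.TA"
    using h unfolding TO[symmetric] by (auto simp: ring_hom_def)
  have hpO: "h (O.pure x y) = O'.pure (\<iota> x) (\<iota> y)" if "x \<in> carrier (opposite A)" "y \<in> carrier A" for x y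
    using hp[of x y] that by simp
  have r: "left_fractions (opposite TA) (opposite T'.TA) h"
    unfolding TO
    by (rule tensor_left_fractions[OF O.tensor_alg_axioms O'.tensor_alg_axioms io i(1) fr(2,1) hO hpO])
  have "\<one>\<^bsub>T'.TA\<^esub> \<noteq> \<zero>\<^bsub>T'.TA\<^esub>"
  proof
    assume "\<one>\<^bsub>T'.TA\<^esub> = \<zero>\<^bsub>T'.TA\<^esub>"
    then have "h \<one>\<^bsub>TA\<^esub> = h \<zero>\<^bsub>TA\<^esub>"
      using ring_hom_one[OF h] ring_hom_zero[OF h TA.ring_axioms T'.TA.ring_axioms] by simp
    then have "\<one>\<^bsub>TA\<^esub> = \<zero>\<^bsub>TA\<^esub>" using inj by (auto dest: inj_onD)
    then show False using A by (simp add: nc_noetherian_domain_def)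
  qed
  then show ?thesis
    by (rule nc_noetherian_domain_fractions[OF A T'.TA.ring_axioms _ h inj l r])
qed

section \<open>Division subalgebras of a division algebra with Noetherian enveloping algebra\<close>

lemma acc_division_subalgebra:
  assumes D: "division_algebra K D" and acc: "acc_on (\<lambda>I. left_ideal I (enveloping_algebra K D))"
  shows "acc_on (division_subalgebra K D)"
proof (rule acc_on_transfer[OF acc])
  have kD: "k_algebra K D" and DU: "Units D = carrier D - {\<zero>\<^bsub>D\<^esub>}" and ne: "\<one>\<^bsub>D\<^esub> \<noteq> \<zero>\<^bsub>D\<^esub>"
    using D by (auto simp: division_algebra_def)
  interpret tensor_alg K D "opposite D" by (simp add: tensor_alg_def kD k_algebra_opposite)
  define lin where "lin E f \<longleftrightarrow> f \<in> hom (add_monoid D) (add_monoid D) \<and> (\<forall>e\<in>E. \<forall>x\<in>carrier D. f (e \<otimes>\<^bsub>D\<^esub> x) = e \<otimes>\<^bsub>D\<^esub> f x)" for E f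
  define ev where "ev f h \<longleftrightarrow> h \<in> hom (add_monoid TA) (add_monoid D) \<and>
    (\<forall>x\<in>carrier D. \<forall>y\<in>carrier D. h (pure x y) = x \<otimes>\<^bsub>D\<^esub> f y)" for f h
  \<comment> \<open>The kernel of \<open>D \<otimes> D\<^sup>o \<rightarrow> D \<otimes>\<^sub>E D\<close>, described by the left \<open>E\<close>-linear maps \<open>f : D \<rightarrow> D\<close>.\<close>
  define \<Phi> where "\<Phi> E = {x \<in> carrier TA. \<forall>f h. lin E f \<longrightarrow> ev f h \<longrightarrow> h x = \<zero>\<^bsub>D\<^esub>}" for E
  note linD = lin_def and evD = ev_def
  have ev_ex: "\<exists>h. ev f h" if E: "division_subalgebra K D E" and f: "lin E f" for E f
  proof -
    note fh = f[unfolded lin_def, THEN conjunct1]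
    \<comment> \<open>The scalar \<open>c\<close> acts as multiplication by \<open>c 1\<close>,
      which lies in \<open>E\<close>; so linearity over \<open>E\<close> contains linearity over
      \<open>K\<close>, as the balancing condition demands.\<close>
    have "f (c \<odot>\<^bsub>D\<^esub> y) = c \<odot>\<^bsub>D\<^esub> f y" if "c \<in> carrier K" "y \<in> carrier D" for c y
    proof -
      have "c \<odot>\<^bsub>D\<^esub> \<one>\<^bsub>D\<^esub> \<in> E" using division_subalgebraD[OF D E] that by blast
      then have "f ((c \<odot>\<^bsub>D\<^esub> \<one>\<^bsub>D\<^esub>) \<otimes>\<^bsub>D\<^esub> y) = (c \<odot>\<^bsub>D\<^esub> \<one>\<^bsub>D\<^esub>) \<otimes>\<^bsub>D\<^esub> f y" using f that by (simp add: lin_def)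
      then show ?thesis using that add_hom_simps(1)[OF fh] by (simp add: A.smult_mult_left)
    qed
    then obtain h where "h \<in> hom (add_monoid TA) (add_monoid D)"
      "\<And>x y. x \<in> carrier D \<Longrightarrow> y \<in> carrier (opposite D) \<Longrightarrow> h (pure x y) = x \<otimes>\<^bsub>D\<^esub> f y"
      using TA_lift[of D "\<lambda>x y. x \<otimes>\<^bsub>D\<^esub> f y"] add_hom_simps[OF fh]
      by (auto simp: A.is_abelian_group A.l_distr A.r_distr A.smult_mult_left A.smult_mult_right)
    then show ?thesis by (auto simp: ev_def)
  qed
  show "left_ideal (\<Phi> E) TA" if E: "division_subalgebra K D E" for E
  proof (rule left_idealI[OF TA.ring_axioms])
    note E' = division_subalgebraD[OF D E]
    show "\<Phi> E \<subseteq> carrier TA" by (auto simp: \<Phi>_def)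
    have "h \<zero>\<^bsub>TA\<^esub> = \<zero>\<^bsub>D\<^esub>" if "ev f h" for f h
      by (rule add_hom_zero[OF _ TA.is_abelian_group A.is_abelian_group]) (use that in \<open>simp add: ev_def\<close>)
    then show "\<zero>\<^bsub>TA\<^esub> \<in> \<Phi> E" by (auto simp: \<Phi>_def)
    show "x \<oplus>\<^bsub>TA\<^esub> y \<in> \<Phi> E" if "x \<in> \<Phi> E" "y \<in> \<Phi> E" for x y
    proof -
      have "h (x \<oplus>\<^bsub>TA\<^esub> y) = \<zero>\<^bsub>D\<^esub>" if f: "lin E f" and h: "ev f h" for f h
      proof -
        have "h (x \<oplus>\<^bsub>TA\<^esub> y) = h x \<oplus>\<^bsub>D\<^esub> h y"
          using h \<open>x \<in> \<Phi> E\<close> \<open>y \<in> \<Phi> E\<close> by (simp add: ev_def \<Phi>_def add_hom_simps)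
        moreover have "h x = \<zero>\<^bsub>D\<^esub>" "h y = \<zero>\<^bsub>D\<^esub>"
          using \<open>x \<in> \<Phi> E\<close> \<open>y \<in> \<Phi> E\<close> f h by (simp_all add: \<Phi>_def)
        ultimately show ?thesis by simp
      qed
      then show ?thesis using that by (simp add: \<Phi>_def)
    qed
    show "z \<otimes>\<^bsub>TA\<^esub> x \<in> \<Phi> E" if z: "z \<in> carrier TA" and x: "x \<in> \<Phi> E" for z x
      using z
    proof (induction rule: TA_induct)
      case (pure a b)
      then have ab: "a \<in> carrier D" "b \<in> carrier D" by auto
      have xc: "x \<in> carrier TA" using x by (simp add: \<Phi>_def)
      have "h (pure a b \<otimes>\<^bsub>TA\<^esub> x) = \<zero>\<^bsub>D\<^esub>" if f: "lin E f" and h: "ev f h" for f h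
      proof -
        \<comment> \<open>The second factor is opposite, so multiplying by \<open>b\<close> there is
          right multiplication. This commutes with left multiplication by \<open>E\<close>, and
          evaluating \<open>(a \<otimes> b) t\<close> at \<open>f\<close> is \<open>a\<close> times
          evaluating \<open>t\<close> at \<open>f'\<close>.\<close>
        define f' where "f' y = f (y \<otimes>\<^bsub>D\<^esub> b)" for y
        note fh = f[unfolded lin_def, THEN conjunct1]
        have "f' \<in> hom (add_monoid D) (add_monoid D)"
          by (rule add_homI) (use ab in \<open>auto simp: f'_def A.l_distr add_hom_simps[OF fh]\<close>)
        moreover have "f' (e \<otimes>\<^bsub>D\<^esub> y) = e \<otimes>\<^bsub>D\<^esub> f' y" if "e \<in> E" "y \<in> carrier D" for e y
          using f that ab E'(1) by (auto simp: f'_def lin_def A.m_assoc)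
        ultimately have f': "lin E f'" by (simp add: lin_def)
        then obtain h' where h': "ev f' h'" using ev_ex[OF E] by blast
        note hh = h[unfolded ev_def, THEN conjunct1] and hh' = h'[unfolded ev_def, THEN conjunct1]
        have "h (pure a b \<otimes>\<^bsub>TA\<^esub> t) = a \<otimes>\<^bsub>D\<^esub> h' t" if "t \<in> carrier TA" for t
          using that
        proof (induction rule: TA_induct)
          case (pure c d)
          then show ?case
            using pure_mult[of a b c d] ab h h' add_hom_simps[OF fh] by (simp add: ev_def f'_def A.m_assoc)
        next
          case (add s t)
          then show ?case
            using pure_closed_TA[of a b] ab by (simp add: TA.r_distr add_hom_simps[OF hh] add_hom_simps[OF hh'] A.r_distr)
        qed
        from this[OF xc] have "h (pure a b \<otimes>\<^bsub>TA\<^esub> x) = a \<otimes>\<^bsub>D\<^esub> h' x" .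
        also have "h' x = \<zero>\<^bsub>D\<^esub>" using x f' h' unfolding \<Phi>_def by blast
        finally show ?thesis using ab by simp
      qed
      moreover have "pure a b \<otimes>\<^bsub>TA\<^esub> x \<in> carrier TA"
        by (intro TA.m_closed pure_closed_TA pure xc)
      ultimately show ?case unfolding \<Phi>_def by blast
    next
      case (add s t)
      then show ?case
        using x \<open>\<And>x y. x \<in> \<Phi> E \<Longrightarrow> y \<in> \<Phi> E \<Longrightarrow> x \<oplus>\<^bsub>TA\<^esub> y \<in> \<Phi> E\<close>
        by (simp add: TA.l_distr \<Phi>_def)
    qed
  qed
  \<comment> \<open>A larger \<open>E\<close> admits fewer linear maps, hence fewer
    conditions.\<close>
  show "\<Phi> E \<subseteq> \<Phi> E'" if "E \<subseteq> E'" for E E'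
    using that by (auto simp: \<Phi>_def lin_def)
  show "E = E'" if E: "division_subalgebra K D E" and E': "division_subalgebra K D E'" and sub: "E \<subseteq> E'"
    and eq: "\<Phi> E = \<Phi> E'" for E E'
  proof (rule ccontr)
    assume "E \<noteq> E'"
    then obtain e where e: "e \<in> E'" "e \<notin> E" using sub by blast
    note ED = division_subalgebraD[OF D E] and ED' = division_subalgebraD[OF D E']
    have eD: "e \<in> carrier D" using e ED'(1) by blast
    define p where "p = pure e \<one>\<^bsub>D\<^esub>"
    define q where "q = pure \<one>\<^bsub>D\<^esub> e"
    \<comment> \<open>On \<open>e \<otimes> 1 - 1 \<otimes> e\<close> the evaluation at
      \<open>f\<close> is \<open>e f(1) - f(e)\<close>, the failure of \<open>f\<close> to be linear
      for the scalar \<open>e\<close> at \<open>1\<close>.\<close>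
    define x where "x = p \<ominus>\<^bsub>TA\<^esub> q"
    have pq: "p \<in> carrier TA" "q \<in> carrier TA"
      using eD pure_closed_TA[of e "\<one>\<^bsub>D\<^esub>"] pure_closed_TA[of "\<one>\<^bsub>D\<^esub>" e] by (simp_all add: p_def q_def)
    then have xc: "x \<in> carrier TA" by (simp add: x_def)
    have hx: "h x = (e \<otimes>\<^bsub>D\<^esub> f \<one>\<^bsub>D\<^esub>) \<ominus>\<^bsub>D\<^esub> f e" if f: "f \<in> hom (add_monoid D) (add_monoid D)" and h: "ev f h" for f h
    proof -
      note hh = h[unfolded ev_def, THEN conjunct1]
      have "h x \<oplus>\<^bsub>D\<^esub> h q = h p"
        using pq by (simp add: add_hom_simps(2)[OF hh, symmetric] x_def a_minus_def TA.a_assoc TA.l_neg)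
      then have "h x \<oplus>\<^bsub>D\<^esub> f e = e \<otimes>\<^bsub>D\<^esub> f \<one>\<^bsub>D\<^esub>"
        using h eD add_hom_simps(1)[OF f] by (simp add: ev_def p_def q_def)
      then show ?thesis
        using add_hom_simps(1)[OF hh xc] add_hom_simps(1)[OF f] eD A.r_right_minus_eq
        by (metis A.add.inv_solve_right A.m_closed A.one_closed a_minus_def)
    qed
    have "h x = \<zero>\<^bsub>D\<^esub>" if f: "lin E' f" and h: "ev f h" for f h
    proof -
      have "f (e \<otimes>\<^bsub>D\<^esub> \<one>\<^bsub>D\<^esub>) = e \<otimes>\<^bsub>D\<^esub> f \<one>\<^bsub>D\<^esub>" using f e by (simp add: lin_def)
      then have "f e = e \<otimes>\<^bsub>D\<^esub> f \<one>\<^bsub>D\<^esub>" using eD by simp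
      moreover have "f e \<in> carrier D" using f eD add_hom_simps(1)[of f D D e] by (simp add: lin_def)
      ultimately show ?thesis using hx[OF _ h] f by (simp add: lin_def A.r_right_minus_eq)
    qed
    then have x: "x \<in> \<Phi> E" using xc eq by (simp add: \<Phi>_def)
    let ?S = "D\<lparr>carrier := E\<rparr>"
    have dS: "division_algebra K ?S" using E by (simp add: division_subalgebra_def)
    interpret EV: left_space ?S D "(\<otimes>\<^bsub>D\<^esub>)"
    proof (intro left_space.intro left_space_axioms.intro)
      show "ring ?S" using dS by (auto simp: division_algebra_def intro: k_algebra.ring)
      show "Units ?S = carrier ?S - {\<zero>\<^bsub>?S\<^esub>}" using dS by (simp add: division_algebra_def)
    qed (use ED(1) in \<open>auto simp: A.is_abelian_group A.m_assoc A.l_distr A.r_distr subset_eq\<close>)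
    \<comment> \<open>\<open>E\<close> is a subspace over itself that contains \<open>1\<close> and
      misses \<open>e\<close>. A functional vanishing on \<open>E\<close> with value
      \<open>1\<close> at \<open>e\<close> evaluates the test element to \<open>-1\<close>.\<close>
    have "EV.subspace E" using ED by (auto simp: EV.subspace_def)
    then obtain f where f: "EV.functional f" "\<And>w. w \<in> E \<Longrightarrow> f w = \<zero>\<^bsub>D\<^esub>" "f e = \<one>\<^bsub>D\<^esub>"
      using EV.functional_exists[of E e] eD e(2) by auto
    then have fE: "f y \<in> E" if "y \<in> carrier D" for y using that by (auto simp: EV.functional_def)
    have lf: "lin E f"
      using f(1) fE ED(1) by (auto simp: lin_def EV.functional_def intro!: add_homI)
    then obtain h where h: "ev f h" using ev_ex[OF E] by blast
    have "h x = \<ominus>\<^bsub>D\<^esub> \<one>\<^bsub>D\<^esub>"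
      using hx[OF _ h] lf f(2)[OF ED(3)] f(3) eD by (simp add: lin_def a_minus_def)
    moreover have "h x = \<zero>\<^bsub>D\<^esub>" using x lf h by (simp add: \<Phi>_def)
    ultimately show False using ne by (metis A.add.inv_eq_1_iff A.one_closed a_inv_def)
  qed
qed

text \<open>Among the division subalgebras generated by finite subsets of \<open>E\<close> there is
  a maximal one. Adjoining one more element of \<open>E\<close> does not enlarge it, so it contains
  all of \<open>E\<close>.\<close>

lemma fg_division_subalgebra:
  assumes D: "division_algebra K D" and acc: "acc_on (division_subalgebra K D)"
    and E: "division_subalgebra K D E"
  shows "fg_division_algebra K (D\<lparr>carrier := E\<rparr>)"
proof -
  define gen where "gen Y = \<Inter>{E'. division_subalgebra K D E' \<and> Y \<subseteq> E'}" for Y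
  have gen: "division_subalgebra K D (gen Y)" if "Y \<subseteq> E" for Y
  proof (rule division_algebra_subset[OF D])
    show "gen Y \<subseteq> carrier D" using E that division_subalgebraD(1)[OF D E] by (auto simp: gen_def)
  qed (auto simp: gen_def dest: division_subalgebraD[OF D])
  have mono: "gen Y \<subseteq> gen Y'" if "Y \<subseteq> Y'" for Y Y' using that by (auto simp: gen_def)
  obtain M where M: "M \<in> gen ` {Y. finite Y \<and> Y \<subseteq> E}"
    and max: "\<And>M'. M' \<in> gen ` {Y. finite Y \<and> Y \<subseteq> E} \<Longrightarrow> M \<subseteq> M' \<Longrightarrow> M' = M"
    by (rule acc_on_maximal[OF acc, of "gen ` {Y. finite Y \<and> Y \<subseteq> E}"]) (use gen in auto)
  then obtain Y where Y: "finite Y" "Y \<subseteq> E" "M = gen Y" by auto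
  have "E \<subseteq> gen Y"
  proof
    fix e assume "e \<in> E"
    then have "gen (insert e Y) = gen Y"
      using max[of "gen (insert e Y)"] Y mono[of Y "insert e Y"] by blast
    moreover have "e \<in> gen (insert e Y)" by (auto simp: gen_def)
    ultimately show "e \<in> gen Y" by simp
  qed
  have "E' = E" if "division_subalgebra K (D\<lparr>carrier := E\<rparr>) E'" "Y \<subseteq> E'" for E'
  proof
    show "E' \<subseteq> E" using that by (simp add: division_subalgebra_def)
    have "division_subalgebra K D E'"
      using that E by (auto simp: division_subalgebra_def)
    then show "E \<subseteq> E'" using \<open>E \<subseteq> gen Y\<close> that by (auto simp: gen_def)
  qed
  then show ?thesis
    using E Y unfolding fg_division_algebra_def division_subalgebra_def by auto
qed

section \<open>Fractions of Noetherian subalgebras\<close>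

text \<open>The diagonal is constant from some \<open>N0\<close> on, and by squeezing so are all
  entries with both indices at least \<open>N0\<close>. Only the finitely many rows below
  \<open>N0\<close> remain, each with its own bound. In the application \<open>n\<close> is a degree
  and \<open>m\<close> the position in a chain of ideals.\<close>

lemma acc_on_grid:
  assumes acc: "acc_on P" and P: "\<And>n m. P (L n m)"
    and mono: "\<And>n m. L n m \<subseteq> L (Suc n) m" "\<And>n m. L n m \<subseteq> L n (Suc m)"
  obtains N where "\<And>n m. m \<ge> N \<Longrightarrow> L n m = L n N"
proof -
  have m1: "L n m \<subseteq> L n' m" if "n \<le> n'" for n n' m
    using that mono(1) by (rule lift_Suc_mono_le[of "\<lambda>n. L n m", rotated])
  have m2: "L n m \<subseteq> L n m'" if "m \<le> m'" for n m m'
    using that mono(2) by (rule lift_Suc_mono_le[of "L n", rotated])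
  have "\<exists>N. \<forall>m\<ge>N. L m m = L N N"
    using acc[unfolded acc_on_def, rule_format, of "\<lambda>m. L m m"] P mono by blast
  then obtain N0 where N0: "\<And>m. m \<ge> N0 \<Longrightarrow> L m m = L N0 N0"
    by blast
  have "\<exists>N. \<forall>m\<ge>N. L n m = L n N" for n
    using acc[unfolded acc_on_def, rule_format, of "L n"] P mono by blast
  then obtain N1 where N1: "\<And>n m. m \<ge> N1 n \<Longrightarrow> L n m = L n (N1 n)"
    by metis
  define N where "N = Max (insert N0 (N1 ` {..<N0}))"
  have N: "N0 \<le> N" "n < N0 \<Longrightarrow> N1 n \<le> N" for n
    by (auto simp: N_def)
  have big: "L n m = L N0 N0" if "n \<ge> N0" "m \<ge> N0" for n m
  proof
    show "L n m \<subseteq> L N0 N0"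
      using m1[of n "max n m" m] m2[of m "max n m" "max n m"] N0[of "max n m"] that by auto
    show "L N0 N0 \<subseteq> L n m"
      using m1[of N0 n N0] m2[of N0 m n] that by auto
  qed
  have "L n m = L n N" if "m \<ge> N" for n m
  proof (cases "n < N0")
    case True
    then show ?thesis using N1[of n m] N1[of n N] N(2)[of n] that by simp
  next
    case False
    then show ?thesis using big[of n m] big[of n N] N(1) that by simp
  qed
  then show thesis by (rule that)
qed

text \<open>If \<open>Aa \<inter> Ab = 0\<close> then the sum of the left ideals \<open>Ab, Aba, Aba\<^sup>2, \<dots>\<close> is direct.\<close>

lemma left_ore:
  assumes A: "nc_noetherian_domain A" and ab: "a \<in> carrier A" "b \<in> carrier A" "a \<noteq> \<zero>\<^bsub>A\<^esub>"
  shows "\<exists>c\<in>carrier A. \<exists>d\<in>carrier A. c \<noteq> \<zero>\<^bsub>A\<^esub> \<and> c \<otimes>\<^bsub>A\<^esub> b = d \<otimes>\<^bsub>A\<^esub> a"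
proof (rule ccontr)
  assume contra: "\<not> ?thesis"
  have no: "c = \<zero>\<^bsub>A\<^esub>" if "c \<in> carrier A" "d \<in> carrier A" "c \<otimes>\<^bsub>A\<^esub> b = d \<otimes>\<^bsub>A\<^esub> a" for c d
    using that contra by blast
  have acc: "acc_on (\<lambda>I. left_ideal I A)" and Ar: "ring A" and one: "\<one>\<^bsub>A\<^esub> \<noteq> \<zero>\<^bsub>A\<^esub>"
    and dom: "\<And>x y. x \<in> carrier A \<Longrightarrow> y \<in> carrier A \<Longrightarrow> x \<otimes>\<^bsub>A\<^esub> y = \<zero>\<^bsub>A\<^esub> \<Longrightarrow> x = \<zero>\<^bsub>A\<^esub> \<or> y = \<zero>\<^bsub>A\<^esub>"
    using A by (auto simp: nc_noetherian_domain_def)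
  interpret A: ring A by (rule Ar)
  have b0: "b \<noteq> \<zero>\<^bsub>A\<^esub>"
    using no[of "\<one>\<^bsub>A\<^esub>" "\<zero>\<^bsub>A\<^esub>"] ab one by auto
  \<comment> \<open>\<open>J n\<close> is \<open>A b + A b a + ... + A b a^(n-1)\<close> in Horner
    form: a step multiplies by \<open>a\<close> on the right and adds \<open>A b\<close>.\<close>
  define J where "J = rec_nat {\<zero>\<^bsub>A\<^esub>} (\<lambda>_ I. {s \<otimes>\<^bsub>A\<^esub> b \<oplus>\<^bsub>A\<^esub> y \<otimes>\<^bsub>A\<^esub> a | s y. s \<in> carrier A \<and> y \<in> I})"
  have J0: "J 0 = {\<zero>\<^bsub>A\<^esub>}" and JS: "J (Suc n) = {s \<otimes>\<^bsub>A\<^esub> b \<oplus>\<^bsub>A\<^esub> y \<otimes>\<^bsub>A\<^esub> a | s y. s \<in> carrier A \<and> y \<in> J n}" for n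
    by (simp_all add: J_def)
  have ideal: "left_ideal (J n) A" for n
  proof (induction n)
    case 0
    show ?case by (rule left_idealI[OF Ar]) (auto simp: J0)
  next
    case (Suc n)
    note I = left_idealD[OF Suc Ar]
    show ?case
    proof (rule left_idealI[OF Ar])
      show "J (Suc n) \<subseteq> carrier A" using ab I(1) by (auto simp: JS)
      have "\<zero>\<^bsub>A\<^esub> = \<zero>\<^bsub>A\<^esub> \<otimes>\<^bsub>A\<^esub> b \<oplus>\<^bsub>A\<^esub> \<zero>\<^bsub>A\<^esub> \<otimes>\<^bsub>A\<^esub> a" using ab by simp
      then show "\<zero>\<^bsub>A\<^esub> \<in> J (Suc n)" unfolding JS using I(2) A.zero_closed by blast
    next
      fix x y assume "x \<in> J (Suc n)" "y \<in> J (Suc n)"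
      then obtain s t x' y' where *: "x = s \<otimes>\<^bsub>A\<^esub> b \<oplus>\<^bsub>A\<^esub> x' \<otimes>\<^bsub>A\<^esub> a" "y = t \<otimes>\<^bsub>A\<^esub> b \<oplus>\<^bsub>A\<^esub> y' \<otimes>\<^bsub>A\<^esub> a"
        "s \<in> carrier A" "t \<in> carrier A" "x' \<in> J n" "y' \<in> J n" unfolding JS by blast
      then have c: "x' \<in> carrier A" "y' \<in> carrier A" using I(1) by auto
      have "x \<oplus>\<^bsub>A\<^esub> y = (s \<oplus>\<^bsub>A\<^esub> t) \<otimes>\<^bsub>A\<^esub> b \<oplus>\<^bsub>A\<^esub> (x' \<oplus>\<^bsub>A\<^esub> y') \<otimes>\<^bsub>A\<^esub> a"
        using * c ab by (simp add: A.l_distr A.a_ac)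
      moreover have "s \<oplus>\<^bsub>A\<^esub> t \<in> carrier A" "x' \<oplus>\<^bsub>A\<^esub> y' \<in> J n" using * I(3) by auto
      ultimately show "x \<oplus>\<^bsub>A\<^esub> y \<in> J (Suc n)" unfolding JS by blast
    next
      fix z x assume z: "z \<in> carrier A" and "x \<in> J (Suc n)"
      then obtain s x' where *: "x = s \<otimes>\<^bsub>A\<^esub> b \<oplus>\<^bsub>A\<^esub> x' \<otimes>\<^bsub>A\<^esub> a" "s \<in> carrier A" "x' \<in> J n" unfolding JS by blast
      then have c: "x' \<in> carrier A" using I(1) by auto
      have "z \<otimes>\<^bsub>A\<^esub> x = (z \<otimes>\<^bsub>A\<^esub> s) \<otimes>\<^bsub>A\<^esub> b \<oplus>\<^bsub>A\<^esub> (z \<otimes>\<^bsub>A\<^esub> x') \<otimes>\<^bsub>A\<^esub> a"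
        using * c ab z by (simp add: A.r_distr A.m_assoc)
      moreover have "z \<otimes>\<^bsub>A\<^esub> s \<in> carrier A" "z \<otimes>\<^bsub>A\<^esub> x' \<in> J n" using * I(5) z by auto
      ultimately show "z \<otimes>\<^bsub>A\<^esub> x \<in> J (Suc n)" unfolding JS by blast
    qed
  qed
  have sub: "J n \<subseteq> J (Suc n)" for n
  proof (induction n)
    case 0
    then show ?case using left_idealD(2)[OF ideal[of "Suc 0"] Ar] by (simp add: J0)
  next
    case (Suc n)
    then show ?case unfolding JS[of "Suc n"] JS[of n] by blast
  qed
  \<comment> \<open>If \<open>y a\<close> lies in \<open>J (Suc n)\<close>, then comparing the parts
    in \<open>A b\<close> and \<open>A a\<close> and cancelling \<open>a\<close> gives
    \<open>y \<in> J n\<close>. So a repetition in the chain propagates down to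
    \<open>J 1 = J 0\<close>, which contradicts \<open>b \<noteq> 0\<close>.\<close>
  have desc: "J (Suc n) = J n" if eq: "J (Suc (Suc n)) = J (Suc n)" for n
  proof
    show "J (Suc n) \<subseteq> J n"
    proof
      fix y assume y: "y \<in> J (Suc n)"
      have yc: "y \<in> carrier A" using y left_idealD(1)[OF ideal Ar] by blast
      have "\<zero>\<^bsub>A\<^esub> \<otimes>\<^bsub>A\<^esub> b \<oplus>\<^bsub>A\<^esub> y \<otimes>\<^bsub>A\<^esub> a \<in> J (Suc (Suc n))"
        unfolding JS[of "Suc n"] using y A.zero_closed by blast
      then have "y \<otimes>\<^bsub>A\<^esub> a \<in> J (Suc n)" using eq yc ab by simp
      then obtain s y' where *: "y \<otimes>\<^bsub>A\<^esub> a = s \<otimes>\<^bsub>A\<^esub> b \<oplus>\<^bsub>A\<^esub> y' \<otimes>\<^bsub>A\<^esub> a" "s \<in> carrier A" "y' \<in> J n"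
        unfolding JS by blast
      have y'c: "y' \<in> carrier A" using *(3) left_idealD(1)[OF ideal Ar] by blast
      have "s \<otimes>\<^bsub>A\<^esub> b = (y \<ominus>\<^bsub>A\<^esub> y') \<otimes>\<^bsub>A\<^esub> a"
        using * y'c yc ab by (simp add: a_minus_def A.l_distr A.l_minus A.a_assoc A.r_neg)
      then have "s = \<zero>\<^bsub>A\<^esub>" using no[of s "y \<ominus>\<^bsub>A\<^esub> y'"] * yc y'c by simp
      then have "(y \<ominus>\<^bsub>A\<^esub> y') \<otimes>\<^bsub>A\<^esub> a = \<zero>\<^bsub>A\<^esub>"
        using \<open>s \<otimes>\<^bsub>A\<^esub> b = _\<close> ab by simp
      then have "y \<ominus>\<^bsub>A\<^esub> y' = \<zero>\<^bsub>A\<^esub>" using dom[of "y \<ominus>\<^bsub>A\<^esub> y'" a] yc y'c ab by simp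
      then show "y \<in> J n" using *(3) yc y'c by (simp add: A.r_right_minus_eq)
    qed
  qed (rule sub)
  obtain n where "\<And>m. m \<ge> n \<Longrightarrow> J m = J n"
    using acc ideal sub unfolding acc_on_def by metis
  then have "J (Suc n) = J n" by (meson le_SucI order_refl)
  then have "J (Suc 0) = J 0"
  proof (induction n)
    case (Suc n)
    then show ?case using desc by blast
  qed
  moreover have "\<one>\<^bsub>A\<^esub> \<otimes>\<^bsub>A\<^esub> b \<oplus>\<^bsub>A\<^esub> \<zero>\<^bsub>A\<^esub> \<otimes>\<^bsub>A\<^esub> a \<in> J (Suc 0)"
    unfolding JS J0 using A.one_closed by blast
  ultimately show False using b0 ab by (simp add: J0)
qed

section \<open>Division algebras and fractions inside them\<close>

locale division_alg =
  fixes K :: "'k ring" and D :: "('k, 'a) module" (structure)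
  assumes division_algebra: "division_algebra K D"
begin

sublocale k_algebra K D
  using division_algebra by (simp add: division_algebra_def)

sublocale ring D by (rule ring)

sublocale KD: module K D by (rule module)

lemma one_not_zero: "\<one> \<noteq> \<zero>"
  using division_algebra by (simp add: division_algebra_def)

lemma Units_D: "Units D = carrier D - {\<zero>}"
  using division_algebra by (simp add: division_algebra_def)

lemma inv_simps [simp]:
  assumes "x \<in> carrier D" "x \<noteq> \<zero>"
  shows "inv x \<in> carrier D" "x \<otimes> inv x = \<one>" "inv x \<otimes> x = \<one>" "inv x \<noteq> \<zero>"
proof -
  have u: "x \<in> Units D" using assms Units_D by simp
  then show *: "inv x \<in> carrier D" "x \<otimes> inv x = \<one>" "inv x \<otimes> x = \<one>" by auto
  show "inv x \<noteq> \<zero>" using * one_not_zero assms by auto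
qed

lemma inv_cancel [simp]:
  assumes "x \<in> carrier D" "x \<noteq> \<zero>" "y \<in> carrier D"
  shows "inv x \<otimes> (x \<otimes> y) = y" "x \<otimes> (inv x \<otimes> y) = y" "(y \<otimes> x) \<otimes> inv x = y" "(y \<otimes> inv x) \<otimes> x = y"
  using assms by (simp_all add: m_assoc[symmetric]) (simp_all add: m_assoc)

lemma no_zero_div: "x \<in> carrier D \<Longrightarrow> y \<in> carrier D \<Longrightarrow> x \<otimes> y = \<zero> \<Longrightarrow> x = \<zero> \<or> y = \<zero>"
  using inv_cancel(1)[of x y] by (cases "x = \<zero>") auto

lemma mult_eq_zero [simp]: "x \<in> carrier D \<Longrightarrow> y \<in> carrier D \<Longrightarrow> x \<otimes> y = \<zero> \<longleftrightarrow> x = \<zero> \<or> y = \<zero>"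
  using no_zero_div by auto

lemma inv_unique': "x \<in> carrier D \<Longrightarrow> y \<in> carrier D \<Longrightarrow> x \<otimes> y = \<one> \<Longrightarrow> inv x = y"
  using inv_cancel(1)[of x y] one_not_zero by (cases "x = \<zero>") auto

lemma subring_noetherian_domain:
  assumes "k_algebra K (D\<lparr>carrier := S\<rparr>)" "S \<subseteq> carrier D"
    "acc_on (\<lambda>I. left_ideal I (D\<lparr>carrier := S\<rparr>))" "acc_on (\<lambda>I. right_ideal I (D\<lparr>carrier := S\<rparr>))"
  shows "nc_noetherian_domain (D\<lparr>carrier := S\<rparr>)"
  using assms no_zero_div one_not_zero by (auto simp: nc_noetherian_domain_def k_algebra.ring subset_eq)

text \<open>Denominators are cleared: \<open>x = u^-1 w\<close> becomes \<open>u x \<in> S\<close>,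
  and closure properties become the search for a suitable \<open>u\<close>.\<close>

lemma fractions_iff:
  assumes S: "S \<subseteq> carrier D"
  shows "x \<in> fractions D S \<longleftrightarrow> x \<in> carrier D \<and> (\<exists>u\<in>S. u \<noteq> \<zero> \<and> u \<otimes> x \<in> S)"
proof
  assume "x \<in> fractions D S"
  then obtain u w where "x = inv u \<otimes> w" "u \<in> S" "u \<noteq> \<zero>" "w \<in> S"
    by (auto simp: fractions_def)
  then show "x \<in> carrier D \<and> (\<exists>u\<in>S. u \<noteq> \<zero> \<and> u \<otimes> x \<in> S)"
    using S by (auto simp: subset_eq)
next
  assume "x \<in> carrier D \<and> (\<exists>u\<in>S. u \<noteq> \<zero> \<and> u \<otimes> x \<in> S)"
  then obtain u where u: "x \<in> carrier D" "u \<in> S" "u \<noteq> \<zero>" "u \<otimes> x \<in> S" by blast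
  then have "x = inv u \<otimes> (u \<otimes> x)" using S by (auto simp: subset_eq)
  then show "x \<in> fractions D S" using u unfolding fractions_def by blast
qed

text \<open>A Noetherian domain satisfies the Ore condition on both sides. The left condition
  supplies denominators of sums and products; the right one, taken from the opposite algebra,
  rewrites left fractions as right fractions.\<close>

lemma fractions_division_algebra:
  assumes S: "S \<subseteq> carrier D" and kS: "k_algebra K (D\<lparr>carrier := S\<rparr>)" and nS: "nc_noetherian_domain (D\<lparr>carrier := S\<rparr>)"
  shows "division_subalgebra K D (fractions D S)"
    and "quotient_division_algebra K (D\<lparr>carrier := S\<rparr>) (D\<lparr>carrier := fractions D S\<rparr>) (\<lambda>x. x)"
    and "S \<subseteq> fractions D S"
proof -
  interpret S: k_algebra K "D\<lparr>carrier := S\<rparr>" by (rule kS)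
  interpret Sr: ring "D\<lparr>carrier := S\<rparr>" by (rule S.ring)
  interpret Sm: module K "D\<lparr>carrier := S\<rparr>" by (rule S.module)
  have c: "\<one> \<in> S" "\<zero> \<in> S" "\<And>x y. x \<in> S \<Longrightarrow> y \<in> S \<Longrightarrow> x \<oplus> y \<in> S" "\<And>x y. x \<in> S \<Longrightarrow> y \<in> S \<Longrightarrow> x \<otimes> y \<in> S"
    "\<And>k x. k \<in> carrier K \<Longrightarrow> x \<in> S \<Longrightarrow> k \<odot> x \<in> S"
    using Sr.one_closed Sr.zero_closed Sr.a_closed Sr.m_closed Sm.smult_closed by auto
  have SD: "x \<in> carrier D" if "x \<in> S" for x using that S by blast
  have ore: "\<exists>c\<in>S. \<exists>d\<in>S. c \<noteq> \<zero> \<and> c \<otimes> b = d \<otimes> a" if "a \<in> S" "b \<in> S" "a \<noteq> \<zero>" for a b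
    using left_ore[OF nS, of a b] that by auto
  have ore': "\<exists>c\<in>S. \<exists>d\<in>S. c \<noteq> \<zero> \<and> b \<otimes> c = a \<otimes> d" if "a \<in> S" "b \<in> S" "a \<noteq> \<zero>" for a b
    using left_ore[OF nc_noetherian_domain_opposite[OF nS], of a b] that by auto
  note fr = fractions_iff[OF S]
  show SQ: "S \<subseteq> fractions D S"
    using c one_not_zero SD by (auto simp: fr intro!: bexI[of _ \<one>])
  show Q: "division_subalgebra K D (fractions D S)"
  proof (rule division_algebra_subset[OF division_algebra])
    show "fractions D S \<subseteq> carrier D" by (auto simp: fr)
    show "\<one> \<in> fractions D S" using SQ c by blast
  next
    fix x y assume "x \<in> fractions D S" "y \<in> fractions D S"
    then obtain u v where u: "x \<in> carrier D" "u \<in> S" "u \<noteq> \<zero>" "u \<otimes> x \<in> S"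
      and v: "y \<in> carrier D" "v \<in> S" "v \<noteq> \<zero>" "v \<otimes> y \<in> S" by (auto simp: fr)
    \<comment> \<open>A common left multiple of the two denominators clears both summands.\<close>
    obtain c' d' where cd: "c' \<in> S" "d' \<in> S" "c' \<noteq> \<zero>" "c' \<otimes> u = d' \<otimes> v"
      using ore[OF v(2) u(2) v(3)] by blast
    have "(c' \<otimes> u) \<otimes> (x \<oplus> y) = c' \<otimes> (u \<otimes> x) \<oplus> (d' \<otimes> v) \<otimes> y"
      using u v cd(1-3) SD by (simp add: r_distr m_assoc flip: cd(4))
    also have "\<dots> = c' \<otimes> (u \<otimes> x) \<oplus> d' \<otimes> (v \<otimes> y)"
      using v cd SD by (simp add: m_assoc)
    finally have "(c' \<otimes> u) \<otimes> (x \<oplus> y) \<in> S" using c cd u v by simp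
    moreover have "c' \<otimes> u \<in> S" "c' \<otimes> u \<noteq> \<zero>" using c cd(1,3) u SD by simp_all
    ultimately show "x \<oplus> y \<in> fractions D S" using u v by (auto simp: fr)
    \<comment> \<open>For the product the denominator \<open>v\<close> has to pass the numerator
      \<open>u x\<close>: from \<open>c' (u x) = d' v\<close> follows
      \<open>(c' u) (x y) = d' (v y)\<close>.\<close>
    obtain c' d' where cd: "c' \<in> S" "d' \<in> S" "c' \<noteq> \<zero>" "c' \<otimes> (u \<otimes> x) = d' \<otimes> v"
      using ore[OF v(2) u(4) v(3)] by blast
    have "(c' \<otimes> u) \<otimes> (x \<otimes> y) = c' \<otimes> (u \<otimes> x) \<otimes> y"
      using u v cd(1-3) SD by (simp add: m_assoc)
    also have "\<dots> = d' \<otimes> (v \<otimes> y)"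
      unfolding cd(4) using v cd(1-3) SD by (simp add: m_assoc)
    finally have "(c' \<otimes> u) \<otimes> (x \<otimes> y) \<in> S" using c cd v by simp
    moreover have "c' \<otimes> u \<in> S" "c' \<otimes> u \<noteq> \<zero>" using c cd(1,3) u SD by simp_all
    ultimately show "x \<otimes> y \<in> fractions D S" using u v by (auto simp: fr)
  next
    fix k x assume k: "k \<in> carrier K" and "x \<in> fractions D S"
    then obtain u where u: "x \<in> carrier D" "u \<in> S" "u \<noteq> \<zero>" "u \<otimes> x \<in> S" by (auto simp: fr)
    then have "u \<otimes> (k \<odot> x) \<in> S" using k SD c by (simp add: smult_mult_right)
    then show "k \<odot> x \<in> fractions D S" using u k by (auto simp: fr)
  next
    fix x assume "x \<in> fractions D S" and x: "x \<noteq> \<zero>"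
    then obtain u where u: "x \<in> carrier D" "u \<in> S" "u \<noteq> \<zero>" "u \<otimes> x \<in> S" by (auto simp: fr)
    \<comment> \<open>The numerator \<open>u x\<close> is a denominator of the inverse, since
      \<open>(u x) x^-1 = u\<close>.\<close>
    then have "(u \<otimes> x) \<otimes> inv x \<in> S" "u \<otimes> x \<noteq> \<zero>" using x SD by simp_all
    then show "inv x \<in> fractions D S" using u x by (auto simp: fr)
  qed
  note Q' = division_subalgebraD[OF division_algebra Q]
  have "(\<exists>s\<in>S - {\<zero>}. \<exists>a\<in>S. x = inv\<^bsub>D\<lparr>carrier := fractions D S\<rparr>\<^esub> s \<otimes> a) \<and>
    (\<exists>s\<in>S - {\<zero>}. \<exists>a\<in>S. x = a \<otimes> inv\<^bsub>D\<lparr>carrier := fractions D S\<rparr>\<^esub> s)" if x: "x \<in> fractions D S" for x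
  proof -
    have iQ: "inv\<^bsub>D\<lparr>carrier := fractions D S\<rparr>\<^esub> s = inv s" if "s \<in> S - {\<zero>}" for s
      using Q'(8)[of s] that SQ by auto
    obtain u where u: "x \<in> carrier D" "u \<in> S" "u \<noteq> \<zero>" "u \<otimes> x \<in> S" using x by (auto simp: fr)
    have 1: "x = inv u \<otimes> (u \<otimes> x)" using u SD by simp
    obtain c' d' where cd: "c' \<in> S" "d' \<in> S" "c' \<noteq> \<zero>" "(u \<otimes> x) \<otimes> c' = u \<otimes> d'"
      using ore'[OF u(2,4,3)] by blast
    have "x \<otimes> c' = inv u \<otimes> ((u \<otimes> x) \<otimes> c')"
      using u cd(1) SD by (simp add: m_assoc)
    then have "x \<otimes> c' = d'" unfolding cd(4) using u cd SD by simp
    then have "x = d' \<otimes> inv c'" using inv_cancel(3)[of c' x] u cd SD by simp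
    then show ?thesis
      using 1 u cd iQ by (metis DiffI singletonD)
  qed
  then show "quotient_division_algebra K (D\<lparr>carrier := S\<rparr>) (D\<lparr>carrier := fractions D S\<rparr>) (\<lambda>x. x)"
    using kS Q SQ by (auto simp: quotient_division_algebra_def division_subalgebra_def algebra_hom_def ring_hom_def)
qed

end

lemma division_alg_opposite: "division_alg K D \<Longrightarrow> division_alg K (opposite D)"
  by (simp add: division_alg_def division_algebra_opposite)

section \<open>Graded subalgebras of a division algebra\<close>

text \<open>Building a subgroup by one generator at a time gives exactly the induction for the basis
  theorem, in which each step adjoins one homogeneous unit and its inverse.\<close>

inductive fg_subgroup :: "('g, 'm) monoid_scheme \<Rightarrow> 'g set \<Rightarrow> bool" for G where
  trivial: "fg_subgroup G {\<one>\<^bsub>G\<^esub>}"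
| adjoin: "fg_subgroup G F \<Longrightarrow> g \<in> carrier G \<Longrightarrow> fg_subgroup G {f \<otimes>\<^bsub>G\<^esub> g [^]\<^bsub>G\<^esub> (n :: int) | f n. f \<in> F}"

lemma (in comm_group) adjoin_subgroup:
  assumes F: "subgroup F G" and g: "g \<in> carrier G"
  shows "subgroup {f \<otimes> g [^] (n :: int) | f n. f \<in> F} G" (is "subgroup ?A G")
    and "F \<subseteq> {f \<otimes> g [^] (n :: int) | f n. f \<in> F}" and "g \<in> {f \<otimes> g [^] (n :: int) | f n. f \<in> F}"
proof -
  have FG: "f \<in> carrier G" if "f \<in> F" for f using that subgroup.subset[OF F] by blast
  show "subgroup ?A G"
  proof (rule subgroupI)
    show "?A \<subseteq> carrier G" using FG g by auto
    show "?A \<noteq> {}" using subgroup.one_closed[OF F] by blast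
    fix a b assume "a \<in> ?A" "b \<in> ?A"
    then obtain f n f' n' where *: "a = f \<otimes> g [^] (n :: int)" "b = f' \<otimes> g [^] (n' :: int)" "f \<in> F" "f' \<in> F" by blast
    have "a \<otimes> b = (f \<otimes> f') \<otimes> g [^] (n + n')"
      using * FG g by (simp add: int_pow_mult m_ac)
    then show "a \<otimes> b \<in> ?A" using * subgroup.m_closed[OF F] by blast
    have "inv a = inv f \<otimes> g [^] (- n)"
      using * FG g by (simp add: inv_mult int_pow_neg)
    then show "inv a \<in> ?A" using * subgroup.m_inv_closed[OF F] by blast
  qed
  show "F \<subseteq> ?A"
  proof
    fix f assume "f \<in> F"
    then have "f = f \<otimes> g [^] (0 :: int)" using FG by simp
    then show "f \<in> ?A" using \<open>f \<in> F\<close> by blast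
  qed
  have "g = \<one> \<otimes> g [^] (1 :: int)" using g by simp
  then show "g \<in> ?A" using subgroup.one_closed[OF F] by blast
qed

lemma (in comm_group) fg_subgroup_subgroup: "fg_subgroup G F \<Longrightarrow> subgroup F G"
  by (induction rule: fg_subgroup.induct) (blast intro: triv_subgroup adjoin_subgroup(1))+

text \<open>Connects the stepwise construction with \<open>generate\<close>, in terms of which
  finite generation of the eigenvalue group is stated.\<close>

lemma (in comm_group) fg_subgroup_generate:
  assumes "fg_subgroup G F"
  shows "\<exists>Y. finite Y \<and> Y \<subseteq> carrier G \<and> generate G Y = F"
  using assms
proof (induction rule: fg_subgroup.induct)
  case trivial
  then show ?case by (intro exI[of _ "{}"]) (simp add: generate_empty)
next
  case (adjoin F g)
  then obtain Y where Y: "finite Y" "Y \<subseteq> carrier G" "generate G Y = F" by blast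
  have F: "subgroup F G" by (rule fg_subgroup_subgroup[OF adjoin(1)])
  note A = adjoin_subgroup[OF F adjoin(2)]
  have Yg: "insert g Y \<subseteq> carrier G" using Y adjoin by simp
  note gen = generate_is_subgroup[OF Yg]
  have "generate G (insert g Y) = {f \<otimes> g [^] (n :: int) | f n. f \<in> F}"
  proof
    show "generate G (insert g Y) \<subseteq> {f \<otimes> g [^] (n :: int) | f n. f \<in> F}"
      by (rule generate_subgroup_incl[OF _ A(1)]) (use A Y in \<open>auto intro: generate.incl\<close>)
    have "F \<subseteq> generate G (insert g Y)" using mono_generate[of Y "insert g Y"] Y by blast
    moreover have "g [^] (n :: int) \<in> generate G (insert g Y)" for n
      by (rule subgroup_int_pow_closed[OF gen]) (simp add: generate.incl)
    ultimately show "{f \<otimes> g [^] (n :: int) | f n. f \<in> F} \<subseteq> generate G (insert g Y)"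
      using subgroup.m_closed[OF gen] by blast
  qed
  then show ?case using Y Yg by (intro exI[of _ "insert g Y"]) simp
qed

text \<open>What derivations and automorphisms have in common. \<open>D\<close> itself need not be
  graded: the \<open>V l\<close> are independent subspaces indexed by an ambient group, many of them
  possibly zero, and nonzero homogeneous elements have homogeneous inverses. Their sum is the graded
  algebra.\<close>

locale graded_division = division_alg K D + W: comm_group W
  for K :: "'k ring" and D :: "('k, 'a) module" (structure) and W :: "'w monoid" +
  fixes V :: "'w \<Rightarrow> 'a set"
  assumes V_carrier: "l \<in> carrier W \<Longrightarrow> V l \<subseteq> carrier D"
    and V_zero: "l \<in> carrier W \<Longrightarrow> \<zero> \<in> V l"
    and V_add: "l \<in> carrier W \<Longrightarrow> x \<in> V l \<Longrightarrow> y \<in> V l \<Longrightarrow> x \<oplus> y \<in> V l"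
    and V_smult: "l \<in> carrier W \<Longrightarrow> c \<in> carrier K \<Longrightarrow> x \<in> V l \<Longrightarrow> c \<odot> x \<in> V l"
    and V_one: "\<one> \<in> V \<one>\<^bsub>W\<^esub>"
    and V_mult: "l \<in> carrier W \<Longrightarrow> m \<in> carrier W \<Longrightarrow> x \<in> V l \<Longrightarrow> y \<in> V m \<Longrightarrow> x \<otimes> y \<in> V (l \<otimes>\<^bsub>W\<^esub> m)"
    and V_inv: "l \<in> carrier W \<Longrightarrow> x \<in> V l \<Longrightarrow> x \<noteq> \<zero> \<Longrightarrow> inv x \<in> V (inv\<^bsub>W\<^esub> l)"
    and V_direct: "finite M \<Longrightarrow> M \<subseteq> carrier W \<Longrightarrow> (\<And>l. l \<in> M \<Longrightarrow> f l \<in> V l) \<Longrightarrow> (\<Oplus>l\<in>M. f l) = \<zero> \<Longrightarrow>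
      l \<in> M \<Longrightarrow> f l = \<zero>"
begin

lemma VD: "l \<in> carrier W \<Longrightarrow> x \<in> V l \<Longrightarrow> x \<in> carrier D"
  using V_carrier by blast

lemma V_minus: "l \<in> carrier W \<Longrightarrow> x \<in> V l \<Longrightarrow> \<ominus> x \<in> V l"
  using V_smult[of l "\<ominus>\<^bsub>K\<^esub> \<one>\<^bsub>K\<^esub>" x] VD[of l x] by (simp add: KD.smult_l_minus)

definition sumV :: "'w set \<Rightarrow> 'a set" where
  "sumV L = {\<Oplus>l\<in>M. f l | M f. finite M \<and> M \<subseteq> L \<and> (\<forall>l\<in>M. f l \<in> V l)}"

text \<open>Finitely supported choices of components, set to zero outside the group so that two
  decompositions can be compared as functions.\<close>

definition family :: "('w \<Rightarrow> 'a) \<Rightarrow> bool" where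
  "family f \<longleftrightarrow> (\<forall>l\<in>carrier W. f l \<in> V l) \<and> (\<forall>l. l \<notin> carrier W \<longrightarrow> f l = \<zero>) \<and> finite {l. f l \<noteq> \<zero>}"

definition total :: "('w \<Rightarrow> 'a) \<Rightarrow> 'a" where
  "total f = (\<Oplus>l\<in>{l. f l \<noteq> \<zero>}. f l)"

lemma family_closed: "family f \<Longrightarrow> f l \<in> carrier D"
  by (cases "l \<in> carrier W") (auto simp: family_def VD)

lemma family_V: "family f \<Longrightarrow> l \<in> carrier W \<Longrightarrow> f l \<in> V l"
  by (simp add: family_def)

lemma family_supp: "family f \<Longrightarrow> f l \<noteq> \<zero> \<Longrightarrow> l \<in> carrier W"
  by (auto simp: family_def)

lemma total_eq:
  assumes f: "family f" and M: "finite M" "{l. f l \<noteq> \<zero>} \<subseteq> M"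
  shows "total f = (\<Oplus>l\<in>M. f l)"
  unfolding total_def
  by (rule add.finprod_mono_neutral_cong_left[OF M]) (use family_closed[OF f] in auto)

lemma family_add:
  assumes f: "family f" and g: "family g"
  shows "family (\<lambda>l. f l \<oplus> g l)" "total (\<lambda>l. f l \<oplus> g l) = total f \<oplus> total g"
proof -
  let ?M = "{l. f l \<noteq> \<zero>} \<union> {l. g l \<noteq> \<zero>}"
  have M: "finite ?M" using f g by (simp add: family_def)
  have sub: "{l. f l \<oplus> g l \<noteq> \<zero>} \<subseteq> ?M" by auto
  show fam: "family (\<lambda>l. f l \<oplus> g l)"
    using f g finite_subset[OF sub M] by (auto simp: family_def V_add)
  show "total (\<lambda>l. f l \<oplus> g l) = total f \<oplus> total g"
    unfolding total_eq[OF fam M sub] total_eq[OF f M Un_upper1] total_eq[OF g M Un_upper2]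
    by (rule finsum_addf) (use family_closed[OF f] family_closed[OF g] in auto)
qed

lemma family_minus:
  assumes f: "family f"
  shows "family (\<lambda>l. \<ominus> f l)" "total (\<lambda>l. \<ominus> f l) = \<ominus> total f"
proof -
  have eq: "{l. \<ominus> f l \<noteq> \<zero>} = {l. f l \<noteq> \<zero>}"
    using family_closed[OF f] by (metis minus_minus minus_zero)
  show fam: "family (\<lambda>l. \<ominus> f l)"
    unfolding family_def eq using f by (auto simp: family_def V_minus)
  have tc: "total h \<in> carrier D" if "family h" for h
    unfolding total_def by (rule finsum_closed) (use family_closed[OF that] in auto)
  have "total (\<lambda>l. \<ominus> f l) \<oplus> total f = total (\<lambda>l. \<ominus> f l \<oplus> f l)"
    using family_add(2)[OF fam f] by simp
  also have "(\<lambda>l. \<ominus> f l \<oplus> f l) = (\<lambda>l. \<zero>)"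
    using family_closed[OF f] by (simp add: l_neg)
  also have "total (\<lambda>l. \<zero>) = \<zero>" by (simp add: total_def)
  finally show "total (\<lambda>l. \<ominus> f l) = \<ominus> total f"
    using tc[OF f] tc[OF fam] minus_equality[of "total (\<lambda>l. \<ominus> f l)" "total f"] by simp
qed

lemma total_closed: "family f \<Longrightarrow> total f \<in> carrier D"
  unfolding total_def by (rule finsum_closed) (auto simp: family_closed)

text \<open>Directness is applied to the difference of the two families, over its support.\<close>

lemma total_inj:
  assumes f: "family f" and g: "family g" and eq: "total f = total g"
  shows "f = g"
proof
  fix l
  let ?h = "\<lambda>l. f l \<oplus> \<ominus> g l"
  note h = family_add[OF f family_minus(1)[OF g]]
  have "total ?h = \<zero>"
    unfolding h(2) family_minus(2)[OF g] eq using total_closed[OF g] by (simp add: r_neg)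
  have "?h l = \<zero>"
  proof (rule ccontr)
    assume "?h l \<noteq> \<zero>"
    then show False
      using V_direct[of "{l. ?h l \<noteq> \<zero>}" ?h l] \<open>total ?h = \<zero>\<close> h(1) unfolding total_def family_def by blast
  qed
  then show "f l = g l"
    using family_closed[OF f, of l] family_closed[OF g, of l] r_right_minus_eq[of "f l" "g l"]
    by (simp add: a_minus_def)
qed

lemma family_of:
  assumes M: "finite M" "M \<subseteq> carrier W" and f: "\<And>l. l \<in> M \<Longrightarrow> f l \<in> V l"
  shows "family (\<lambda>l. if l \<in> M then f l else \<zero>)" "total (\<lambda>l. if l \<in> M then f l else \<zero>) = (\<Oplus>l\<in>M. f l)"
proof -
  have sub: "{l. (if l \<in> M then f l else \<zero>) \<noteq> \<zero>} \<subseteq> M" by auto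
  show fam: "family (\<lambda>l. if l \<in> M then f l else \<zero>)"
    using M f finite_subset[OF sub M(1)] by (auto simp: family_def V_zero)
  show "total (\<lambda>l. if l \<in> M then f l else \<zero>) = (\<Oplus>l\<in>M. f l)"
    unfolding total_eq[OF fam M(1) sub]
    by (rule finsum_cong') (use f M VD in \<open>auto simp: subset_eq\<close>)
qed

abbreviation S :: "'a set" where "S \<equiv> sumV (carrier W)"

text \<open>The homogeneous components of \<open>x\<close>. The choice is unique by directness, and
  the value has a meaning only for \<open>x\<close> in \<open>S\<close>.\<close>

definition cmp :: "'a \<Rightarrow> 'w \<Rightarrow> 'a" where
  "cmp x = (SOME f. family f \<and> total f = x)"

lemma sumV_family:
  assumes "x \<in> sumV L" "L \<subseteq> carrier W"
  obtains f where "family f" "total f = x" "{l. f l \<noteq> \<zero>} \<subseteq> L"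
proof -
  obtain M f where *: "x = (\<Oplus>l\<in>M. f l)" "finite M" "M \<subseteq> L" "\<forall>l\<in>M. f l \<in> V l"
    using assms(1) unfolding sumV_def by blast
  show thesis
    by (rule that[of "\<lambda>l. if l \<in> M then f l else \<zero>"]) (use family_of[of M f] * assms(2) in auto)
qed

lemma cmp_total: "family f \<Longrightarrow> cmp (total f) = f"
  unfolding cmp_def by (rule some_equality) (auto intro: total_inj)

lemma cmp_family: "x \<in> S \<Longrightarrow> family (cmp x)" and total_cmp: "x \<in> S \<Longrightarrow> total (cmp x) = x"
  using sumV_family[of x "carrier W"] cmp_total by (metis order_refl)+

lemma cmp_closed: "x \<in> S \<Longrightarrow> cmp x l \<in> carrier D"
  and cmp_V: "x \<in> S \<Longrightarrow> l \<in> carrier W \<Longrightarrow> cmp x l \<in> V l"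
  and cmp_finite: "x \<in> S \<Longrightarrow> finite {l. cmp x l \<noteq> \<zero>}"
  and cmp_supp: "x \<in> S \<Longrightarrow> cmp x l \<noteq> \<zero> \<Longrightarrow> l \<in> carrier W"
  using cmp_family[of x] family_closed family_V by (auto simp: family_def)

lemma cmp_sum:
  assumes "x \<in> S" "finite M" "{l. cmp x l \<noteq> \<zero>} \<subseteq> M"
  shows "x = (\<Oplus>l\<in>M. cmp x l)"
  using total_eq[OF cmp_family[OF assms(1)] assms(2,3)] total_cmp[OF assms(1)] by simp

lemma family_total_sumV: "family f \<Longrightarrow> {l. f l \<noteq> \<zero>} \<subseteq> L \<Longrightarrow> total f \<in> sumV L"
  unfolding sumV_def total_def
  by (intro CollectI exI[of _ "{l. f l \<noteq> \<zero>}"] exI[of _ f]) (auto simp: family_def)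

lemma sumV_iff:
  assumes L: "L \<subseteq> carrier W"
  shows "x \<in> sumV L \<longleftrightarrow> x \<in> S \<and> {l. cmp x l \<noteq> \<zero>} \<subseteq> L"
proof
  assume "x \<in> sumV L"
  then obtain f where f: "family f" "total f = x" "{l. f l \<noteq> \<zero>} \<subseteq> L"
    using sumV_family L by blast
  then have "x \<in> S" using family_total_sumV[of f "carrier W"] L by blast
  then show "x \<in> S \<and> {l. cmp x l \<noteq> \<zero>} \<subseteq> L" using f cmp_total by auto
next
  assume "x \<in> S \<and> {l. cmp x l \<noteq> \<zero>} \<subseteq> L"
  then show "x \<in> sumV L"
    using family_total_sumV[OF cmp_family, of x L] total_cmp by simp
qed

lemma sumV_closed: "L \<subseteq> carrier W \<Longrightarrow> sumV L \<subseteq> carrier D"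
  using sumV_family total_closed by (metis subsetI)

lemma sumV_D: "x \<in> sumV L \<Longrightarrow> L \<subseteq> carrier W \<Longrightarrow> x \<in> carrier D"
  using sumV_closed by blast

lemma sumV_mono: "L \<subseteq> L' \<Longrightarrow> sumV L \<subseteq> sumV L'"
  unfolding sumV_def by blast

lemma S_carrier: "x \<in> S \<Longrightarrow> x \<in> carrier D"
  using sumV_closed by blast

lemma cmp_add:
  assumes "x \<in> S" "y \<in> S"
  shows "x \<oplus> y \<in> S" "cmp (x \<oplus> y) l = cmp x l \<oplus> cmp y l"
proof -
  note f = cmp_family[OF assms(1)] cmp_family[OF assms(2)]
  have *: "x \<oplus> y = total (\<lambda>l. cmp x l \<oplus> cmp y l)"
    using family_add(2)[OF f] total_cmp assms by simp
  show "x \<oplus> y \<in> S"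
    unfolding * by (rule family_total_sumV[OF family_add(1)[OF f]]) (use family_supp[OF family_add(1)[OF f]] in blast)
  show "cmp (x \<oplus> y) l = cmp x l \<oplus> cmp y l"
    unfolding * by (simp add: cmp_total[OF family_add(1)[OF f]])
qed

lemma V_sumV:
  assumes "l \<in> carrier W" "x \<in> V l"
  shows "l \<in> L \<Longrightarrow> x \<in> sumV L" "cmp x m = (if m = l then x else \<zero>)"
proof -
  note f = family_of[of "{l}" "\<lambda>_. x"]
  have x: "x \<in> carrier D" using assms VD by blast
  have t: "total (\<lambda>k. if k \<in> {l} then x else \<zero>) = x"
    using f(2) assms x by (simp add: finsum_insert)
  have fam: "family (\<lambda>k. if k \<in> {l} then x else \<zero>)" using f(1) assms by simp
  show "x \<in> sumV L" if "l \<in> L"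
    using family_total_sumV[OF fam, of L, unfolded t] that by (simp add: subset_eq)
  show "cmp x m = (if m = l then x else \<zero>)"
    using cmp_total[OF fam] unfolding t by simp
qed

lemma sumV_induct [consumes 2, case_names zero hom add]:
  assumes "x \<in> sumV L" "L \<subseteq> carrier W" "P \<zero>"
    and hom: "\<And>l x. l \<in> L \<Longrightarrow> l \<in> carrier W \<Longrightarrow> x \<in> V l \<Longrightarrow> P x"
    and add: "\<And>x y. x \<in> sumV L \<Longrightarrow> y \<in> sumV L \<Longrightarrow> P x \<Longrightarrow> P y \<Longrightarrow> P (x \<oplus> y)"
  shows "P x"
proof -
  obtain M f where *: "x = (\<Oplus>l\<in>M. f l)" "finite M" "M \<subseteq> L" "\<forall>l\<in>M. f l \<in> V l"
    using assms(1) unfolding sumV_def by blast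
  have "P (\<Oplus>l\<in>M. f l)"
    using *(2-4)
  proof (induction M rule: finite_induct)
    case (insert l M)
    have lW: "l \<in> carrier W" using insert.prems assms(2) by blast
    have "f l \<in> carrier D" "f \<in> M \<rightarrow> carrier D"
      using insert.prems assms(2) VD by auto
    then have "(\<Oplus>l\<in>insert l M. f l) = f l \<oplus> (\<Oplus>l\<in>M. f l)"
      using insert.hyps by (simp add: finsum_insert)
    moreover have "(\<Oplus>l\<in>M. f l) \<in> sumV L"
      unfolding sumV_def using insert by blast
    moreover have "f l \<in> sumV L" using V_sumV(1)[OF lW] insert.prems by auto
    moreover have "P (f l)" using hom[OF _ lW] insert.prems by auto
    ultimately show ?case using add insert by auto
  qed (use assms(3) in simp)
  then show ?thesis using * by simp
qed

lemma sumV_zero: "L \<subseteq> carrier W \<Longrightarrow> \<zero> \<in> sumV L"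
  unfolding sumV_def by (intro CollectI exI[of _ "{}"] exI[of _ "\<lambda>_. \<zero>"]) simp

lemma sumV_add:
  assumes "L \<subseteq> carrier W" "x \<in> sumV L" "y \<in> sumV L" shows "x \<oplus> y \<in> sumV L"
proof -
  have "{l. cmp x l \<oplus> cmp y l \<noteq> \<zero>} \<subseteq> {l. cmp x l \<noteq> \<zero>} \<union> {l. cmp y l \<noteq> \<zero>}" by auto
  then show ?thesis
    using assms cmp_add unfolding sumV_iff[OF assms(1)] by auto
qed

text \<open>Formulated for an arbitrary additive map that shifts degrees by \<open>m\<close>, so
  that multiplication by a homogeneous element from the left and from the right are both instances.
  Additivity leaves only homogeneous arguments to be checked.\<close>

lemma cmp_shift:
  assumes h: "h \<in> hom (add_monoid D) (add_monoid D)" and m: "m \<in> carrier W"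
    and hV: "\<And>l x. l \<in> carrier W \<Longrightarrow> x \<in> V l \<Longrightarrow> h x \<in> V (l \<otimes>\<^bsub>W\<^esub> m)"
    and x: "x \<in> S"
  shows "h x \<in> S \<and> (\<forall>l\<in>carrier W. cmp (h x) (l \<otimes>\<^bsub>W\<^esub> m) = h (cmp x l))"
  using x subset_refl
proof (induction x rule: sumV_induct)
  case zero
  have "h \<zero> = \<zero>" by (rule add_hom_zero[OF h]) unfold_locales
  moreover have "cmp \<zero> l = \<zero>" for l
    using V_sumV(2)[OF W.one_closed V_zero[OF W.one_closed], of l] by simp
  ultimately show ?case using sumV_zero[of "carrier W"] by simp
next
  case (hom k x)
  have h0: "h \<zero> = \<zero>" by (rule add_hom_zero[OF h]) unfold_locales
  have k: "k \<otimes>\<^bsub>W\<^esub> m \<in> carrier W" "h x \<in> V (k \<otimes>\<^bsub>W\<^esub> m)" using hom m hV by auto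
  show ?case
    using V_sumV(1)[OF k k(1)] V_sumV(2)[OF k] V_sumV(2)[OF hom(2,3)] h0 m hom by simp
next
  case (add x y)
  then show ?case
    using cmp_add S_carrier cmp_closed by (simp add: add_hom_simps[OF h])
qed

lemma cmp_lmult:
  assumes "m \<in> carrier W" "a \<in> V m" "x \<in> S" "l \<in> carrier W"
  shows "a \<otimes> x \<in> S" "cmp (a \<otimes> x) (l \<otimes>\<^bsub>W\<^esub> m) = a \<otimes> cmp x l"
proof -
  have a: "a \<in> carrier D" using assms VD by blast
  have "a \<otimes> x \<in> S \<and> (\<forall>l\<in>carrier W. cmp (a \<otimes> x) (l \<otimes>\<^bsub>W\<^esub> m) = a \<otimes> cmp x l)"
    by (rule cmp_shift[OF add_homI assms(1) _ assms(3)])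
      (use a V_mult[OF assms(1) _ assms(2)] W.m_comm[OF assms(1)] in \<open>auto simp: r_distr\<close>)
  then show "a \<otimes> x \<in> S" "cmp (a \<otimes> x) (l \<otimes>\<^bsub>W\<^esub> m) = a \<otimes> cmp x l" using assms by auto
qed

lemma cmp_rmult:
  assumes "m \<in> carrier W" "a \<in> V m" "x \<in> S" "l \<in> carrier W"
  shows "x \<otimes> a \<in> S" "cmp (x \<otimes> a) (l \<otimes>\<^bsub>W\<^esub> m) = cmp x l \<otimes> a"
proof -
  have a: "a \<in> carrier D" using assms VD by blast
  have "x \<otimes> a \<in> S \<and> (\<forall>l\<in>carrier W. cmp (x \<otimes> a) (l \<otimes>\<^bsub>W\<^esub> m) = cmp x l \<otimes> a)"
    by (rule cmp_shift[OF add_homI assms(1) _ assms(3)])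
      (use a assms V_mult in \<open>auto simp: l_distr\<close>)
  then show "x \<otimes> a \<in> S" "cmp (x \<otimes> a) (l \<otimes>\<^bsub>W\<^esub> m) = cmp x l \<otimes> a" using assms by auto
qed

lemma sumV_mult:
  assumes F: "L \<subseteq> carrier W" "L' \<subseteq> carrier W" "N \<subseteq> carrier W" and LN: "\<And>l l'. l \<in> L \<Longrightarrow> l' \<in> L' \<Longrightarrow> l \<otimes>\<^bsub>W\<^esub> l' \<in> N"
    and x: "x \<in> sumV L" and y: "y \<in> sumV L'"
  shows "x \<otimes> y \<in> sumV N"
proof -
  have yD: "y \<in> carrier D" using y F sumV_closed by blast
  show ?thesis
    using x F(1)
  proof (induction rule: sumV_induct)
    case zero
    then show ?case using sumV_zero F yD by simp
  next
    case (hom l x)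
    then have xD: "x \<in> carrier D" using VD by blast
    show ?case
      using y F(2)
    proof (induction rule: sumV_induct)
      case zero
      then show ?case using sumV_zero F xD by simp
    next
      case (hom l' y)
      then show ?case
        using V_mult[of l l' x y] V_sumV(1)[of "l \<otimes>\<^bsub>W\<^esub> l'" "x \<otimes> y" N] LN \<open>l \<in> L\<close> \<open>l \<in> carrier W\<close> \<open>x \<in> V l\<close> by simp
    next
      case (add y z)
      then have "y \<in> carrier D" "z \<in> carrier D" using sumV_D[OF _ F(2)] by simp_all
      then show ?case using add xD F(3) by (simp add: r_distr sumV_add)
    qed
  next
    case (add x z)
    then have "x \<in> carrier D" "z \<in> carrier D" using sumV_D[OF _ F(1)] by simp_all
    then show ?case using add yD F(3) by (simp add: l_distr sumV_add)
  qed
qed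

lemma sumV_smult:
  assumes L: "L \<subseteq> carrier W" and c: "c \<in> carrier K" and x: "x \<in> sumV L"
  shows "c \<odot> x \<in> sumV L"
  using x L
proof (induction x rule: sumV_induct)
  case zero
  then show ?case using c sumV_zero[OF L] by simp
next
  case (hom l x)
  then show ?case using c V_sumV(1)[OF hom(2) V_smult[OF hom(2) c hom(3)]] by simp
next
  case (add x y)
  then show ?case
    using sumV_D[OF _ L] c by (simp add: KD.smult_r_distr sumV_add[OF L])
qed

lemma k_algebra_sumV:
  assumes F: "subgroup F W" shows "k_algebra K (D\<lparr>carrier := sumV F\<rparr>)"
proof (rule k_algebra_subset[OF k_algebra_axioms])
  have FW: "F \<subseteq> carrier W" by (rule subgroup.subset[OF F])
  show "sumV F \<subseteq> carrier D" by (rule sumV_closed[OF FW])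
  show "\<one> \<in> sumV F" using V_sumV(1)[OF W.one_closed V_one] subgroup.one_closed[OF F] by blast
  show "x \<oplus> y \<in> sumV F" if "x \<in> sumV F" "y \<in> sumV F" for x y using that sumV_add[OF FW] by blast
  show "x \<otimes> y \<in> sumV F" if "x \<in> sumV F" "y \<in> sumV F" for x y
    by (rule sumV_mult[OF FW FW FW subgroup.m_closed[OF F] that])
  show "c \<odot> x \<in> sumV F" if "c \<in> carrier K" "x \<in> sumV F" for c x
    by (rule sumV_smult[OF FW that])
qed

text \<open>In the application \<open>W\<close> is the whole ambient group \<open>H^t\<close>, and
  \<open>wt\<close> is the set of eigenvalues that occur.\<close>

definition wt :: "'w set" where "wt = {l \<in> carrier W. \<exists>u\<in>V l. u \<noteq> \<zero>}"

lemma wt_subgroup: "subgroup wt W"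
proof (rule W.subgroupI)
  show "wt \<subseteq> carrier W" by (auto simp: wt_def)
  show "wt \<noteq> {}" using V_one one_not_zero by (auto simp: wt_def)
  show "inv\<^bsub>W\<^esub> l \<in> wt" if l: "l \<in> wt" for l
  proof -
    obtain u where "l \<in> carrier W" "u \<in> V l" "u \<noteq> \<zero>" using l by (auto simp: wt_def)
    then show ?thesis
      using V_inv[of l u] inv_simps(4)[of u] VD[of l u] by (auto simp: wt_def intro!: bexI[of _ "inv u"])
  qed
  show "l \<otimes>\<^bsub>W\<^esub> m \<in> wt" if lm: "l \<in> wt" "m \<in> wt" for l m
  proof -
    obtain u v where "l \<in> carrier W" "u \<in> V l" "u \<noteq> \<zero>" "m \<in> carrier W" "v \<in> V m" "v \<noteq> \<zero>"
      using lm by (auto simp: wt_def)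
    then show ?thesis
      using V_mult[of l m u v] VD[of l u] VD[of m v] by (auto simp: wt_def intro!: bexI[of _ "u \<otimes> v"])
  qed
qed

lemma sumV_wt: "L \<subseteq> carrier W \<Longrightarrow> x \<in> sumV L \<Longrightarrow> cmp x l \<noteq> \<zero> \<Longrightarrow> l \<in> L \<inter> wt"
  using cmp_V[of x l] cmp_supp[of x l] unfolding sumV_iff wt_def by blast

text \<open>If \<open>u v = w\<close> with \<open>v\<close> homogeneous, then every component \<open>u\<^sub>m\<close> of \<open>u\<close> satisfies \<open>u\<^sub>m v = w\<^sub>l\<^sub>m\<close>.\<close>

lemma fractions_homogeneous:
  assumes F: "subgroup F W" and v: "v \<in> fractions D (sumV F)" "v \<noteq> \<zero>" "l \<in> carrier W" "v \<in> V l"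
  shows "l \<in> F \<and> (\<exists>m\<in>F. \<exists>u\<in>V m. \<exists>w\<in>V (l \<otimes>\<^bsub>W\<^esub> m). u \<noteq> \<zero> \<and> v = inv u \<otimes> w)"
proof -
  have FW: "F \<subseteq> carrier W" by (rule subgroup.subset[OF F])
  obtain u where u: "u \<in> sumV F" "u \<noteq> \<zero>" "u \<otimes> v \<in> sumV F"
    using v(1) fractions_iff[OF sumV_closed[OF FW]] by blast
  have uS: "u \<in> S" using u(1) sumV_iff[OF FW] by blast
  have vD: "v \<in> carrier D" using v VD by blast
  have "\<exists>m. cmp u m \<noteq> \<zero>"
  proof (rule ccontr)
    assume "\<nexists>m. cmp u m \<noteq> \<zero>"
    then show False using cmp_sum[OF uS, of "{}"] u(2) by auto
  qed
  then obtain m where m: "cmp u m \<noteq> \<zero>" by blast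
  then have mF: "m \<in> F" using sumV_wt[OF FW u(1)] by blast
  then have mW: "m \<in> carrier W" using FW by blast
  have c: "cmp (u \<otimes> v) (m \<otimes>\<^bsub>W\<^esub> l) = cmp u m \<otimes> v" by (rule cmp_rmult(2)[OF v(3,4) uS mW])
  also have "\<dots> \<noteq> \<zero>" using m v(2) vD cmp_closed[OF uS] by simp
  \<comment> \<open>The product has a nonzero component in degree \<open>m l\<close>, so this degree
    lies in \<open>F\<close>; dividing by \<open>m \<in> F\<close> puts the degree of
    \<open>v\<close> into \<open>F\<close>.\<close>
  finally have mlF: "m \<otimes>\<^bsub>W\<^esub> l \<in> F" using sumV_wt[OF FW u(3)] by blast
  have "inv\<^bsub>W\<^esub> m \<otimes>\<^bsub>W\<^esub> (m \<otimes>\<^bsub>W\<^esub> l) \<in> F"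
    by (intro subgroup.m_closed[OF F] subgroup.m_inv_closed[OF F] mF mlF)
  then have lF: "l \<in> F" using mW v(3) by (simp add: W.m_assoc[symmetric])
  have "u \<otimes> v \<in> S" using u(3) sumV_iff[OF FW] by blast
  then have "cmp (u \<otimes> v) (m \<otimes>\<^bsub>W\<^esub> l) \<in> V (l \<otimes>\<^bsub>W\<^esub> m)"
    using cmp_V[of "u \<otimes> v" "m \<otimes>\<^bsub>W\<^esub> l"] mW v(3) by (simp add: W.m_comm)
  moreover have "v = inv (cmp u m) \<otimes> cmp (u \<otimes> v) (m \<otimes>\<^bsub>W\<^esub> l)"
    unfolding c using m vD cmp_closed[OF uS] by simp
  ultimately show ?thesis
    using lF mF m cmp_V[OF uS mW] by (intro conjI bexI[of _ m] bexI[of _ "cmp u m"] bexI[of _ "cmp (u \<otimes> v) (m \<otimes>\<^bsub>W\<^esub> l)"])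
qed

end

text \<open>Commutativity of \<open>W\<close> makes this a grading for the reversed product too. The
  right-hand versions of the Noetherian property and of the dimension formula are obtained from
  it.\<close>

lemma graded_division_opposite:
  assumes "graded_division K D W V" shows "graded_division K (opposite D) W V"
proof -
  interpret graded_division K D W V by fact
  have "y \<otimes>\<^bsub>D\<^esub> x \<in> V (l \<otimes>\<^bsub>W\<^esub> m)" if "l \<in> carrier W" "m \<in> carrier W" "x \<in> V l" "y \<in> V m" for l m x y
    using V_mult[of m l y x] that by (simp add: W.m_comm)
  then show ?thesis
    by (intro graded_division.intro graded_division_axioms.intro)
       (use V_carrier V_zero V_add V_smult V_one V_inv V_direct in
         \<open>auto simp: division_alg_opposite[OF division_alg_axioms] W.comm_group_axioms\<close>)
qed

lemma sumV_opposite: "graded_division K D W V \<Longrightarrow> graded_division.sumV (opposite D) V L = graded_division.sumV D V L"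
  by (simp add: graded_division.sumV_def graded_division.sumV_def[OF graded_division_opposite])

lemma (in comm_group) subgroup_comm_group: "subgroup H G \<Longrightarrow> comm_group (G\<lparr>carrier := H\<rparr>)"
  by (rule group.group_comm_groupI[OF subgroup_imp_group]) (auto dest: subgroup.mem_carrier intro: m_comm)

text \<open>Meant for the left ideals of a division ring, which are zero or everything.\<close>

lemma acc_on_two:
  assumes two: "\<And>I. P I \<Longrightarrow> I = A \<or> I = B" and "A \<subseteq> B"
  shows "acc_on P"
  unfolding acc_on_def
proof (intro allI impI, elim conjE)
  fix I :: "nat \<Rightarrow> 'a set" assume P: "\<forall>n. P (I n)" and sub: "\<forall>n. I n \<subseteq> I (Suc n)"
  show "\<exists>n. \<forall>m\<ge>n. I m = I n"
  proof (cases "\<exists>n. I n = B")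
    case True
    then obtain n where n: "I n = B" ..
    have "I m = B" if "m \<ge> n" for m
    proof -
      have "I n \<subseteq> I m" using sub that by (meson lift_Suc_mono_le)
      then show ?thesis using two[of "I m"] P n \<open>A \<subseteq> B\<close> by blast
    qed
    then show ?thesis using n by blast
  next
    case False
    then have "I m = A" for m using two[of "I m"] P by blast
    then show ?thesis by simp
  qed
qed

section \<open>Noetherian graded subalgebras\<close>

context graded_division
begin

definition left_noeth :: "'w set \<Rightarrow> bool" where
  "left_noeth F \<longleftrightarrow> acc_on (\<lambda>I. left_ideal I (D\<lparr>carrier := sumV F\<rparr>))"

lemma sumV_one: "sumV {\<one>\<^bsub>W\<^esub>} = V \<one>\<^bsub>W\<^esub>"
proof
  show "V \<one>\<^bsub>W\<^esub> \<subseteq> sumV {\<one>\<^bsub>W\<^esub>}" using V_sumV(1)[OF W.one_closed] by blast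
  show "sumV {\<one>\<^bsub>W\<^esub>} \<subseteq> V \<one>\<^bsub>W\<^esub>"
  proof
    fix x assume "x \<in> sumV {\<one>\<^bsub>W\<^esub>}"
    then show "x \<in> V \<one>\<^bsub>W\<^esub>"
      by (rule sumV_induct) (auto simp: V_zero intro: V_add)
  qed
qed

lemma sumV_closures:
  assumes "subgroup F W"
  shows "F \<subseteq> carrier W" "\<one> \<in> sumV F" "\<zero> \<in> sumV F" "\<And>x y. x \<in> sumV F \<Longrightarrow> y \<in> sumV F \<Longrightarrow> x \<oplus> y \<in> sumV F"
    "\<And>x y. x \<in> sumV F \<Longrightarrow> y \<in> sumV F \<Longrightarrow> x \<otimes> y \<in> sumV F" "\<And>x. x \<in> sumV F \<Longrightarrow> x \<in> carrier D"
    "\<And>x. x \<in> sumV F \<Longrightarrow> \<ominus> x \<in> sumV F" "ring (D\<lparr>carrier := sumV F\<rparr>)"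
    "\<And>l x. l \<in> F \<Longrightarrow> x \<in> V l \<Longrightarrow> x \<in> sumV F"
proof -
  interpret A: k_algebra K "D\<lparr>carrier := sumV F\<rparr>" by (rule k_algebra_sumV[OF assms])
  interpret Ar: ring "D\<lparr>carrier := sumV F\<rparr>" by (rule A.ring)
  show FW: "F \<subseteq> carrier W" by (rule subgroup.subset[OF assms])
  show "\<one> \<in> sumV F" "\<zero> \<in> sumV F" "\<And>x y. x \<in> sumV F \<Longrightarrow> y \<in> sumV F \<Longrightarrow> x \<oplus> y \<in> sumV F"
    "\<And>x y. x \<in> sumV F \<Longrightarrow> y \<in> sumV F \<Longrightarrow> x \<otimes> y \<in> sumV F"
    using Ar.one_closed Ar.zero_closed Ar.a_closed Ar.m_closed by auto
  show D: "x \<in> carrier D" if "x \<in> sumV F" for x using sumV_D[OF that FW] .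
  show "\<ominus> x \<in> sumV F" if "x \<in> sumV F" for x
    using sumV_smult[OF FW _ that, of "\<ominus>\<^bsub>K\<^esub> \<one>\<^bsub>K\<^esub>"] D[OF that] by (simp add: KD.smult_l_minus)
  show "ring (D\<lparr>carrier := sumV F\<rparr>)" by (rule Ar.ring_axioms)
  show "x \<in> sumV F" if "l \<in> F" "x \<in> V l" for l x
    using V_sumV(1)[of l x F] that FW by blast
qed

lemma left_ideal_sumV:
  assumes F: "subgroup F W" and I: "left_ideal I (D\<lparr>carrier := sumV F\<rparr>)"
  shows "I \<subseteq> sumV F" "\<zero> \<in> I" "\<And>x y. x \<in> I \<Longrightarrow> y \<in> I \<Longrightarrow> x \<oplus> y \<in> I"
    "\<And>a x. a \<in> sumV F \<Longrightarrow> x \<in> I \<Longrightarrow> a \<otimes> x \<in> I" "\<And>x. x \<in> I \<Longrightarrow> \<ominus> x \<in> I"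
proof -
  note I' = left_idealD[OF I sumV_closures(8)[OF F]]
  show "I \<subseteq> sumV F" "\<zero> \<in> I" "\<And>x y. x \<in> I \<Longrightarrow> y \<in> I \<Longrightarrow> x \<oplus> y \<in> I"
    using I'(1,2,3) by simp_all
  show m: "\<And>a x. a \<in> sumV F \<Longrightarrow> x \<in> I \<Longrightarrow> a \<otimes> x \<in> I" using I'(5) by simp
  show "\<ominus> x \<in> I" if "x \<in> I" for x
  proof -
    have "x \<in> carrier D" using that I'(1) sumV_closures(6)[OF F] by auto
    then show ?thesis using m[OF sumV_closures(7)[OF F sumV_closures(2)[OF F]] that] by (simp add: l_minus)
  qed
qed

lemma left_noeth_trivial: "left_noeth {\<one>\<^bsub>W\<^esub>}"
  unfolding left_noeth_def
proof (rule acc_on_two)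
  have F: "subgroup {\<one>\<^bsub>W\<^esub>} W" by (rule W.triv_subgroup)
  show "{\<zero>} \<subseteq> sumV {\<one>\<^bsub>W\<^esub>}" using sumV_closures(3)[OF F] by simp
  fix I assume I: "left_ideal I (D\<lparr>carrier := sumV {\<one>\<^bsub>W\<^esub>}\<rparr>)"
  note I' = left_ideal_sumV[OF F I]
  show "I = {\<zero>} \<or> I = sumV {\<one>\<^bsub>W\<^esub>}"
  proof (cases "I \<subseteq> {\<zero>}")
    case True
    then show ?thesis using I'(2) by blast
  next
    case False
    then obtain x where x: "x \<in> I" "x \<noteq> \<zero>" by blast
    then have xV: "x \<in> V \<one>\<^bsub>W\<^esub>" using I'(1) sumV_one by blast
    then have "inv x \<in> sumV {\<one>\<^bsub>W\<^esub>}" using V_inv[of "\<one>\<^bsub>W\<^esub>" x] x by (simp add: sumV_one)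
    then have "\<one> \<in> I" using I'(4)[of "inv x" x] x VD[OF W.one_closed xV] by simp
    then have "y \<in> I" if "y \<in> sumV {\<one>\<^bsub>W\<^esub>}" for y
      using I'(4)[OF that, of \<one>] sumV_closures(6)[OF F that] by simp
    then show ?thesis using I'(1) by blast
  qed
qed

lemma V_pow: "g \<in> carrier W \<Longrightarrow> u \<in> V g \<Longrightarrow> u [^] (n :: nat) \<in> V (g [^]\<^bsub>W\<^esub> n)"
  by (induction n) (auto simp: V_one V_mult)

lemma pow_commute: "x \<in> carrier D \<Longrightarrow> x \<otimes> x [^] (n :: nat) = x [^] n \<otimes> x"
  by (metis nat_pow_Suc nat_pow_Suc2)

lemma pow_nonzero: "u \<in> carrier D \<Longrightarrow> u \<noteq> \<zero> \<Longrightarrow> u [^] (n :: nat) \<noteq> \<zero>"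
  by (induction n) (auto simp: one_not_zero)

text \<open>The degrees \<open>l\<close> and its inverse cancel because \<open>W\<close> is
  commutative. With \<open>y = x^-1\<close> this says that a homogeneous unit normalizes
  \<open>sumV L\<close>, whatever \<open>L\<close> is.\<close>

lemma conj_sumV:
  assumes L: "L \<subseteq> carrier W" and l: "l \<in> carrier W" and x: "x \<in> V l" and y: "y \<in> V (inv\<^bsub>W\<^esub> l)" and a: "a \<in> sumV L"
  shows "x \<otimes> a \<otimes> y \<in> sumV L"
proof -
  have xy: "x \<in> carrier D" "y \<in> carrier D" using VD l x y by blast+
  show ?thesis
    using a L
  proof (induction a rule: sumV_induct)
    case zero
    then show ?case using xy sumV_zero[OF L] by simp
  next
    case (hom m a)
    have "x \<otimes> a \<otimes> y \<in> V (l \<otimes>\<^bsub>W\<^esub> m \<otimes>\<^bsub>W\<^esub> inv\<^bsub>W\<^esub> l)"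
      using hom l x y by (intro V_mult) auto
    also have "l \<otimes>\<^bsub>W\<^esub> m \<otimes>\<^bsub>W\<^esub> inv\<^bsub>W\<^esub> l = m"
      using hom(2) l by (simp add: W.m_comm[of l m] W.m_assoc)
    finally show ?case using V_sumV(1) hom by blast
  next
    case (add a b)
    then show ?case
      using xy sumV_D[OF _ L] by (simp add: l_distr r_distr sumV_add[OF L])
  qed
qed

text \<open>Hilbert's basis theorem.  Elements of \<open>sumV G\<close> are Laurent polynomials in the unit \<open>u\<close>, which
  normalizes \<open>sumV F\<close>; coefficients are written on the right, so that the leading coefficients of
  degree \<open>n\<close> of a left ideal form a left ideal that grows with \<open>n\<close>.\<close>

lemma left_noeth_adjoin:
  assumes F: "subgroup F W" and G: "subgroup G W" and FG: "F \<subseteq> G" and g: "g \<in> G" "g \<in> wt"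
    and gen: "\<And>x. x \<in> G \<Longrightarrow> \<exists>f\<in>F. \<exists>n :: int. x = f \<otimes>\<^bsub>W\<^esub> g [^]\<^bsub>W\<^esub> n"
    and noeth: "left_noeth F"
  shows "left_noeth G"
proof -
  note Fc = sumV_closures[OF F] and Gc = sumV_closures[OF G]
  have gW: "g \<in> carrier W" using g Gc(1) by blast
  obtain u where u: "u \<in> V g" "u \<noteq> \<zero>" using g(2) by (auto simp: wt_def)
  have uD: "u \<in> carrier D" using VD[OF gW u(1)] .
  have pD [simp]: "u [^] (n :: nat) \<in> carrier D" for n using uD by simp
  have p0 [simp]: "u [^] (n :: nat) \<noteq> \<zero>" for n by (rule pow_nonzero[OF uD u(2)])
  have pV: "u [^] (n :: nat) \<in> V (g [^]\<^bsub>W\<^esub> n)" for n by (rule V_pow[OF gW u(1)])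
  have piV: "inv (u [^] (n :: nat)) \<in> V (inv\<^bsub>W\<^esub> (g [^]\<^bsub>W\<^esub> n))" for n
    using V_inv[OF _ pV[of n] p0] gW by simp
  have gG: "g [^]\<^bsub>W\<^esub> (n :: nat) \<in> G" for n
    by (induction n) (use subgroup.one_closed[OF G] subgroup.m_closed[OF G _ g(1)] in auto)
  have pS: "u [^] (n :: nat) \<in> sumV G" "inv (u [^] (n :: nat)) \<in> sumV G" for n
    using Gc(9)[OF gG pV] Gc(9)[OF subgroup.m_inv_closed[OF G gG] piV] by auto
  have RS: "sumV F \<subseteq> sumV G" by (rule sumV_mono[OF FG])
  \<comment> \<open>Coefficients cross a power of \<open>u\<close> at the price of a conjugation,
    which does not leave \<open>sumV F\<close>.\<close>
  have conj: "\<exists>s'\<in>sumV F. s \<otimes> u [^] n = u [^] n \<otimes> s'" if s: "s \<in> sumV F" for s and n :: nat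
  proof (rule bexI)
    show "inv (u [^] n) \<otimes> s \<otimes> u [^] n \<in> sumV F"
      using conj_sumV[OF Fc(1) _ piV[of n] _ s, of "u [^] n"] pV[of n] gW by simp
    show "s \<otimes> u [^] n = u [^] n \<otimes> (inv (u [^] n) \<otimes> s \<otimes> u [^] n)"
      using Fc(6)[OF s] by (simp add: m_assoc)
  qed
  \<comment> \<open>\<open>Q n\<close> consists of the polynomials in \<open>u\<close> of degree
    below \<open>n\<close> with right coefficients in \<open>sumV F\<close>. Such an expression need
    not be unique, as a power of \<open>g\<close> may lie in \<open>F\<close>.\<close>
  define Q where "Q = rec_nat {\<zero>} (\<lambda>n Q. {x \<oplus> u [^] n \<otimes> r | x r. x \<in> Q \<and> r \<in> sumV F})"
  have Q0: "Q 0 = {\<zero>}" and QS: "Q (Suc n) = {x \<oplus> u [^] n \<otimes> r | x r. x \<in> Q n \<and> r \<in> sumV F}" for n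
    by (simp_all add: Q_def)
  have Qsub: "x \<in> sumV G" if "x \<in> Q n" for x n
    using that
  proof (induction n arbitrary: x)
    case (Suc n)
    then obtain y r where "x = y \<oplus> u [^] n \<otimes> r" "y \<in> Q n" "r \<in> sumV F" unfolding QS by blast
    then show ?case using Suc.IH[of y] RS Gc(4,5) pS(1)[of n] by blast
  qed (simp add: Q0 Gc(3))
  have QD: "x \<in> carrier D" if "x \<in> Q n" for x n using Gc(6)[OF Qsub[OF that]] .
  have Qz: "\<zero> \<in> Q n" for n
  proof (induction n)
    case (Suc n)
    have "\<zero> = \<zero> \<oplus> u [^] n \<otimes> \<zero>" by simp
    then show ?case using Suc Fc(3) unfolding QS by blast
  qed (simp add: Q0)
  have Qsuc: "x \<in> Q (Suc n)" if "x \<in> Q n" for x n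
  proof -
    have "x = x \<oplus> u [^] n \<otimes> \<zero>" using QD[OF that] by simp
    then show ?thesis using that Fc(3) unfolding QS by blast
  qed
  have Qmono: "x \<in> Q n" if "x \<in> Q m" "m \<le> n" for x m n
    using that(2,1) by (induction rule: dec_induct) (auto intro: Qsuc)
  have Qadd: "x \<oplus> y \<in> Q n" if "x \<in> Q n" "y \<in> Q n" for x y n
    using that
  proof (induction n arbitrary: x y)
    case (Suc n)
    then obtain x' r y' s where *: "x = x' \<oplus> u [^] n \<otimes> r" "y = y' \<oplus> u [^] n \<otimes> s" "x' \<in> Q n" "y' \<in> Q n"
      "r \<in> sumV F" "s \<in> sumV F" unfolding QS by blast
    then have "x \<oplus> y = (x' \<oplus> y') \<oplus> u [^] n \<otimes> (r \<oplus> s)"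
      using QD[of x' n] QD[of y' n] Fc(6) by (simp add: r_distr a_ac)
    then show ?case unfolding QS using Suc.IH[of x' y'] * Fc(4) by blast
  qed (simp add: Q0)
  have Qlmult: "s \<otimes> x \<in> Q n" if "s \<in> sumV F" "x \<in> Q n" for s x n
    using that
  proof (induction n arbitrary: x)
    case (Suc n)
    then obtain x' r where *: "x = x' \<oplus> u [^] n \<otimes> r" "x' \<in> Q n" "r \<in> sumV F" unfolding QS by blast
    obtain s' where s': "s' \<in> sumV F" "s \<otimes> u [^] n = u [^] n \<otimes> s'" using conj[OF Suc.prems(1)] by blast
    have c: "s \<in> carrier D" "s' \<in> carrier D" "r \<in> carrier D" "x' \<in> carrier D"
      using Fc(6) Suc.prems(1) s' * QD by auto
    have "s \<otimes> x = s \<otimes> x' \<oplus> (s \<otimes> u [^] n) \<otimes> r"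
      using *(1) c by (simp add: r_distr m_assoc)
    also have "\<dots> = s \<otimes> x' \<oplus> u [^] n \<otimes> (s' \<otimes> r)"
      unfolding s'(2) using c by (simp add: m_assoc)
    finally show ?case unfolding QS using Suc.IH[OF Suc.prems(1) *(2)] Fc(5)[OF s'(1) *(3)] by blast
  qed (use Fc(6) in \<open>simp add: Q0\<close>)
  have Qu: "u \<otimes> x \<in> Q (Suc n)" if "x \<in> Q n" for x n
    using that
  proof (induction n arbitrary: x)
    case 0
    then show ?case using Qz[of "Suc 0"] uD by (simp add: Q0)
  next
    case (Suc n)
    then obtain x' r where *: "x = x' \<oplus> u [^] n \<otimes> r" "x' \<in> Q n" "r \<in> sumV F" unfolding QS[of n] by blast
    then have "u \<otimes> x = u \<otimes> x' \<oplus> u [^] Suc n \<otimes> r"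
      using QD[of x' n] Fc(6)[of r] uD by (simp add: r_distr m_assoc[symmetric] pow_commute)
    then show ?case unfolding QS[of "Suc n"] using Suc.IH[OF *(2)] *(3) by blast
  qed
  have Qpow: "u [^] m \<otimes> x \<in> Q (n + m)" if "x \<in> Q n" for x n and m :: nat
  proof (induction m)
    case 0
    then show ?case using that QD[OF that] by simp
  next
    case (Suc m)
    then have "u \<otimes> (u [^] m \<otimes> x) \<in> Q (n + Suc m)" using Qu by simp
    then show ?case using uD QD[OF that] by (simp add: m_assoc[symmetric] pow_commute)
  qed
  have term_mem: "u [^] n \<otimes> r \<in> Q (Suc n)" if "r \<in> sumV F" for r and n :: nat
  proof -
    have "u [^] n \<otimes> r = \<zero> \<oplus> u [^] n \<otimes> r" using Fc(6)[OF that] by simp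
    then show ?thesis unfolding QS using Qz that by blast
  qed
  \<comment> \<open>Multiplying by a large power of \<open>u\<close> removes the negative exponents,
    so every element of \<open>sumV G\<close> becomes a polynomial. Nothing is lost for left ideals,
    since \<open>u\<close> is a unit of \<open>sumV G\<close>.\<close>
  have reach: "\<exists>N :: nat. \<exists>k. u [^] N \<otimes> x \<in> Q k" if "x \<in> sumV G" for x
    using that Gc(1)
  proof (induction rule: sumV_induct)
    case zero
    then show ?case using Qz[of 0] by (intro exI[of _ 0] exI[of _ 0]) simp
  next
    case (hom l x)
    then obtain f n where fn: "l = f \<otimes>\<^bsub>W\<^esub> g [^]\<^bsub>W\<^esub> (n :: int)" "f \<in> F" using gen by blast
    have fW: "f \<in> carrier W" using fn Fc(1) by blast
    have xD: "x \<in> carrier D" using hom VD by blast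
    show ?case
    proof (cases n)
      case (nonneg k)
      have "inv\<^bsub>W\<^esub> (g [^]\<^bsub>W\<^esub> k) \<otimes>\<^bsub>W\<^esub> l = f"
        using fn(1) fW gW by (simp add: nonneg int_pow_int W.m_ac)
      then have "inv (u [^] k) \<otimes> x \<in> V f"
        using V_mult[OF _ hom(2) piV[of k] hom(3)] gW by simp
      then have "u [^] k \<otimes> (inv (u [^] k) \<otimes> x) \<in> Q (Suc k)" by (intro term_mem Fc(9)[OF fn(2)])
      then have "u [^] (0 :: nat) \<otimes> x \<in> Q (Suc k)" using xD by simp
      then show ?thesis by blast
    next
      case (neg k)
      have "g [^]\<^bsub>W\<^esub> Suc k \<otimes>\<^bsub>W\<^esub> l = f"
        unfolding fn(1) neg using fW gW by (simp add: W.int_pow_neg int_pow_int W.m_lcomm del: nat_pow_Suc of_nat_Suc)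
      then have "u [^] Suc k \<otimes> x \<in> V f"
        using V_mult[OF _ hom(2) pV[of "Suc k"] hom(3)] gW by simp
      then have "u [^] (0 :: nat) \<otimes> (u [^] Suc k \<otimes> x) \<in> Q (Suc 0)" by (intro term_mem Fc(9)[OF fn(2)])
      then have "u [^] Suc k \<otimes> x \<in> Q (Suc 0)" using xD pD[of "Suc k"] by (simp del: nat_pow_Suc)
      then show ?thesis by blast
    qed
  next
    case (add x y)
    then obtain N k M j where *: "u [^] (N :: nat) \<otimes> x \<in> Q k" "u [^] (M :: nat) \<otimes> y \<in> Q j" by blast
    have c: "x \<in> carrier D" "y \<in> carrier D" using add Gc(6) by auto
    have "u [^] M \<otimes> (u [^] N \<otimes> x) \<in> Q (k + M + j + N)" "u [^] N \<otimes> (u [^] M \<otimes> y) \<in> Q (k + M + j + N)"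
      by (rule Qmono[OF Qpow[OF *(1)]], simp) (rule Qmono[OF Qpow[OF *(2)]], simp)
    then have "u [^] (M + N) \<otimes> x \<oplus> u [^] (N + M) \<otimes> y \<in> Q (k + M + j + N)"
      using c uD by (simp add: Qadd m_assoc[symmetric] nat_pow_mult)
    then have "u [^] (M + N) \<otimes> (x \<oplus> y) \<in> Q (k + M + j + N)"
      using c by (simp add: r_distr add.commute)
    then show ?case by blast
  qed
  define lead where "lead n I = {r \<in> sumV F. \<exists>x\<in>Q n. x \<oplus> u [^] n \<otimes> r \<in> I}" for n :: nat and I
  have lead_ideal: "left_ideal (lead n I) (D\<lparr>carrier := sumV F\<rparr>)" if I: "left_ideal I (D\<lparr>carrier := sumV G\<rparr>)" for n I
  proof (rule left_idealI[OF Fc(8)])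
    note I' = left_ideal_sumV[OF G I]
    show "lead n I \<subseteq> carrier (D\<lparr>carrier := sumV F\<rparr>)" by (auto simp: lead_def)
    have "\<zero> \<oplus> u [^] n \<otimes> \<zero> \<in> I" using I'(2) by simp
    then show "\<zero>\<^bsub>D\<lparr>carrier := sumV F\<rparr>\<^esub> \<in> lead n I" using Qz[of n] Fc(3) unfolding lead_def by (auto intro!: bexI[of _ \<zero>])
  next
    note I' = left_ideal_sumV[OF G I]
    fix r s assume "r \<in> lead n I" "s \<in> lead n I"
    then obtain x y where *: "r \<in> sumV F" "s \<in> sumV F" "x \<in> Q n" "y \<in> Q n" "x \<oplus> u [^] n \<otimes> r \<in> I" "y \<oplus> u [^] n \<otimes> s \<in> I"
      by (auto simp: lead_def)
    have "(x \<oplus> u [^] n \<otimes> r) \<oplus> (y \<oplus> u [^] n \<otimes> s) = (x \<oplus> y) \<oplus> u [^] n \<otimes> (r \<oplus> s)"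
      using QD[OF *(3)] QD[OF *(4)] Fc(6)[OF *(1)] Fc(6)[OF *(2)] by (simp add: r_distr a_ac)
    then show "r \<oplus>\<^bsub>D\<lparr>carrier := sumV F\<rparr>\<^esub> s \<in> lead n I"
      using I'(3)[OF *(5,6)] Qadd[OF *(3,4)] Fc(4)[OF *(1,2)] by (auto simp: lead_def)
  next
    note I' = left_ideal_sumV[OF G I]
    fix a r assume a: "a \<in> carrier (D\<lparr>carrier := sumV F\<rparr>)" and "r \<in> lead n I"
    then obtain x where *: "r \<in> sumV F" "x \<in> Q n" "x \<oplus> u [^] n \<otimes> r \<in> I"
      by (auto simp: lead_def)
    \<comment> \<open>Coefficients stand to the right of \<open>u^n\<close>, so a leading
      coefficient is multiplied by \<open>a\<close> when the polynomial is multiplied by the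
      conjugate \<open>u^n a u^-n\<close>.\<close>
    let ?b = "u [^] n \<otimes> a \<otimes> inv (u [^] n)"
    have aF: "a \<in> sumV F" using a by simp
    have aD: "a \<in> carrier D" using Fc(6)[OF aF] .
    have bF: "?b \<in> sumV F"
      using conj_sumV[OF Fc(1) _ pV[of n] piV[of n] aF] gW by simp
    have "?b \<otimes> (x \<oplus> u [^] n \<otimes> r) = ?b \<otimes> x \<oplus> u [^] n \<otimes> (a \<otimes> r)"
      using QD[OF *(2)] Fc(6)[OF *(1)] aD by (simp add: r_distr m_assoc)
    moreover have "?b \<otimes> (x \<oplus> u [^] n \<otimes> r) \<in> I" using I'(4)[OF subsetD[OF RS bF] *(3)] .
    ultimately have "?b \<otimes> x \<oplus> u [^] n \<otimes> (a \<otimes> r) \<in> I" by simp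
    then show "a \<otimes>\<^bsub>D\<lparr>carrier := sumV F\<rparr>\<^esub> r \<in> lead n I"
      using Qlmult[OF bF *(2)] Fc(5)[OF aF *(1)] by (auto simp: lead_def)
  qed
  have lead_suc: "lead n I \<subseteq> lead (Suc n) I" if I: "left_ideal I (D\<lparr>carrier := sumV G\<rparr>)" for n I
  proof
    note I' = left_ideal_sumV[OF G I]
    fix r assume "r \<in> lead n I"
    then obtain x where *: "r \<in> sumV F" "x \<in> Q n" "x \<oplus> u [^] n \<otimes> r \<in> I"
      by (auto simp: lead_def)
    have "u \<otimes> (x \<oplus> u [^] n \<otimes> r) \<in> I" using I'(4)[OF _ *(3), of u] pS(1)[of 1] uD by simp
    moreover have "u \<otimes> (x \<oplus> u [^] n \<otimes> r) = u \<otimes> x \<oplus> u [^] Suc n \<otimes> r"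
      using QD[OF *(2)] Fc(6)[OF *(1)] uD by (simp add: r_distr m_assoc[symmetric] pow_commute)
    ultimately show "r \<in> lead (Suc n) I" using Qu[OF *(2)] *(1) unfolding lead_def by auto
  qed
  \<comment> \<open>Given a polynomial in \<open>J\<close>, subtracting a member of \<open>I\<close>
    with the same leading coefficient lowers the degree; the difference stays in \<open>J\<close>
    and lies in \<open>I\<close> by induction.\<close>
  have lead_inj: "J \<subseteq> I" if I: "left_ideal I (D\<lparr>carrier := sumV G\<rparr>)" and J: "left_ideal J (D\<lparr>carrier := sumV G\<rparr>)"
    and IJ: "I \<subseteq> J" and eq: "\<And>n. lead n J = lead n I" for I J
  proof
    note I' = left_ideal_sumV[OF G I] and J' = left_ideal_sumV[OF G J]
    have *: "x \<in> I" if "x \<in> J" "x \<in> Q n" for x n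
      using that
    proof (induction n arbitrary: x)
      case (Suc n)
      then obtain y r where y: "x = y \<oplus> u [^] n \<otimes> r" "y \<in> Q n" "r \<in> sumV F" unfolding QS by blast
      then have "r \<in> lead n J" using Suc.prems(1) unfolding lead_def by blast
      then have "r \<in> lead n I" using eq by simp
      then obtain z where z: "z \<in> Q n" "z \<oplus> u [^] n \<otimes> r \<in> I" by (auto simp: lead_def)
      have c: "y \<in> carrier D" "z \<in> carrier D" "r \<in> carrier D" using QD y z Fc(6) by auto
      have m: "\<ominus> z \<in> Q n"
        using Qlmult[OF Fc(7)[OF Fc(2)] z(1)] c by (simp add: l_minus)
      have e: "y \<oplus> \<ominus> z = x \<oplus> \<ominus> (z \<oplus> u [^] n \<otimes> r)"
        using y(1) c by (simp add: minus_add a_ac r_neg r_neg2 r_neg1)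
      have "x \<oplus> \<ominus> (z \<oplus> u [^] n \<otimes> r) \<in> J"
        using Suc.prems(1) IJ z(2) J'(3,5) by blast
      then have yz: "y \<oplus> \<ominus> z \<in> I" using Suc.IH[of "y \<oplus> \<ominus> z"] Qadd[OF y(2) m] unfolding e by simp
      have "x = (y \<oplus> \<ominus> z) \<oplus> (z \<oplus> u [^] n \<otimes> r)"
        using y(1) c by (simp add: a_ac r_neg1 r_neg2)
      then show ?case using I'(3)[OF yz z(2)] by simp
    qed (use I'(2) in \<open>simp add: Q0\<close>)
    fix x assume x: "x \<in> J"
    have xG: "x \<in> sumV G" using x J'(1) by blast
    then obtain N k where N: "u [^] (N :: nat) \<otimes> x \<in> Q k" using reach by blast
    then have "u [^] N \<otimes> x \<in> I" using * J'(4)[OF pS(1) x] by blast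
    then have "inv (u [^] N) \<otimes> (u [^] N \<otimes> x) \<in> I" by (rule I'(4)[OF pS(2)])
    then show "x \<in> I" using Gc(6)[OF xG] by simp
  qed
  show ?thesis
    unfolding left_noeth_def acc_on_def
  proof (intro allI impI, elim conjE)
    fix I :: "nat \<Rightarrow> 'a set"
    assume I: "\<forall>n. left_ideal (I n) (D\<lparr>carrier := sumV G\<rparr>)" and sub: "\<forall>n. I n \<subseteq> I (Suc n)"
    \<comment> \<open>The leading ideals grow with the degree and along the chain. A single bound
      has to serve for all degrees at once, which is what the two-dimensional stabilization
      provides.\<close>
    obtain N where N: "\<And>n m. m \<ge> N \<Longrightarrow> lead n (I m) = lead n (I N)"
    proof (rule acc_on_grid[of "\<lambda>J. left_ideal J (D\<lparr>carrier := sumV F\<rparr>)" "\<lambda>n m. lead n (I m)"])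
      show "acc_on (\<lambda>J. left_ideal J (D\<lparr>carrier := sumV F\<rparr>))" using noeth by (simp add: left_noeth_def)
      show "left_ideal (lead n (I m)) (D\<lparr>carrier := sumV F\<rparr>)" for n m using lead_ideal I by blast
      show "lead n (I m) \<subseteq> lead (Suc n) (I m)" for n m using lead_suc I by blast
      show "lead n (I m) \<subseteq> lead n (I (Suc m))" for n m using sub unfolding lead_def by blast
    qed blast
    have "I m = I N" if "m \<ge> N" for m
    proof
      show *: "I N \<subseteq> I m" using sub that by (meson lift_Suc_mono_le)
      show "I m \<subseteq> I N" by (rule lead_inj) (use I * N[OF that] in auto)
    qed
    then show "\<exists>n. \<forall>m\<ge>n. I m = I n" by blast
  qed
qed

section \<open>Finite generation of the group of weights\<close>

abbreviation Ev :: "'w monoid" where "Ev \<equiv> W\<lparr>carrier := wt\<rparr>"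

lemma Ev_comm_group: "comm_group Ev"
  by (rule W.subgroup_comm_group[OF wt_subgroup])

lemma Ev_subgroup: "subgroup F Ev \<Longrightarrow> subgroup F W"
  using W.incl_subgroup[OF wt_subgroup] .

lemma Ev_int_pow: "g \<in> wt \<Longrightarrow> g [^]\<^bsub>Ev\<^esub> (n :: int) = g [^]\<^bsub>W\<^esub> n"
  using W.int_pow_consistent[OF wt_subgroup] by simp

lemma left_noeth_fg: "fg_subgroup Ev F \<Longrightarrow> left_noeth F"
proof (induction rule: fg_subgroup.induct)
  case trivial
  then show ?case using left_noeth_trivial by simp
next
  case (adjoin F g)
  interpret E: comm_group Ev by (rule Ev_comm_group)
  have F: "subgroup F Ev" by (rule E.fg_subgroup_subgroup[OF adjoin(1)])
  note A = E.adjoin_subgroup[OF F adjoin(2)]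
  have "g \<in> wt" using adjoin by simp
  then show ?case
    by (intro left_noeth_adjoin[OF Ev_subgroup[OF F] Ev_subgroup[OF A(1)] A(2,3) _ _ adjoin(3)])
      (auto simp: Ev_int_pow)
qed

lemma noetherian_fg:
  assumes "fg_subgroup Ev F" shows "nc_noetherian_domain (D\<lparr>carrier := sumV F\<rparr>)"
proof -
  interpret O: graded_division K "opposite D" W V by (rule graded_division_opposite) unfold_locales
  interpret E: comm_group Ev by (rule Ev_comm_group)
  have F: "subgroup F W" by (rule Ev_subgroup[OF E.fg_subgroup_subgroup[OF assms]])
  have sum: "O.sumV F = sumV F" by (rule sumV_opposite) unfold_locales
  have "O.wt = wt" by (simp add: wt_def O.wt_def)
  then have "O.left_noeth F" using O.left_noeth_fg[of F] assms by simp
  then have "acc_on (\<lambda>I. right_ideal I (D\<lparr>carrier := sumV F\<rparr>))"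
    unfolding O.left_noeth_def sum by (simp add: left_ideal_opposite flip: opposite_update_carrier)
  then show ?thesis
    using left_noeth_fg[OF assms] sumV_closures(6)[OF F]
    by (intro subring_noetherian_domain[OF k_algebra_sumV[OF F]]) (auto simp: left_noeth_def)
qed

text \<open>Taking fractions creates no new weights, so \<open>F\<close> can be recovered from its
  fraction algebra. This makes the passage from subgroups to division subalgebras injective.\<close>

lemma fractions_weights:
  assumes F: "fg_subgroup Ev F" and l: "l \<in> wt"
  shows "V l \<subseteq> fractions D (sumV F) \<longleftrightarrow> l \<in> F"
proof
  interpret E: comm_group Ev by (rule Ev_comm_group)
  have FW: "subgroup F W" by (rule Ev_subgroup[OF E.fg_subgroup_subgroup[OF F]])
  note Fc = sumV_closures[OF FW]
  show "V l \<subseteq> fractions D (sumV F)" if "l \<in> F"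
    using Fc(9)[OF that] fractions_division_algebra(3)[OF _ k_algebra_sumV[OF FW] noetherian_fg[OF F]] Fc(6) by blast
  assume "V l \<subseteq> fractions D (sumV F)"
  moreover obtain v where "v \<in> V l" "v \<noteq> \<zero>" "l \<in> carrier W" using l by (auto simp: wt_def)
  ultimately show "l \<in> F" using fractions_homogeneous[OF FW, of v l] by blast
qed

lemma fractions_mono: "L \<subseteq> L' \<Longrightarrow> fractions D (sumV L) \<subseteq> fractions D (sumV L')"
  using sumV_mono[of L L'] unfolding fractions_def by blast

text \<open>A maximal fraction algebra is chosen among those of the finitely generated subgroups of
  \<open>F\<close>. Adjoining some \<open>g \<in> F\<close> to the corresponding \<open>F'\<close>
  leaves the fractions unchanged; so \<open>g\<close> is already a weight of the old fractions, and
  hence lies in \<open>F'\<close>.\<close>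

lemma all_subgroups_fg:
  assumes acc: "acc_on (division_subalgebra K D)" and F: "subgroup F Ev"
  shows "fg_subgroup Ev F"
proof -
  interpret E: comm_group Ev by (rule Ev_comm_group)
  let ?Fs = "{F'. fg_subgroup Ev F' \<and> F' \<subseteq> F}"
  have div: "division_subalgebra K D (fractions D (sumV F'))" if "fg_subgroup Ev F'" for F'
    using fractions_division_algebra(1)[OF _ k_algebra_sumV noetherian_fg[OF that]]
      sumV_closures(6)[of F'] Ev_subgroup[OF E.fg_subgroup_subgroup[OF that]] by blast
  have triv: "{\<one>\<^bsub>Ev\<^esub>} \<in> ?Fs" using fg_subgroup.trivial[of Ev] subgroup.one_closed[OF F] by simp
  obtain M where M: "M \<in> (\<lambda>F'. fractions D (sumV F')) ` ?Fs"
    and max: "\<And>M'. M' \<in> (\<lambda>F'. fractions D (sumV F')) ` ?Fs \<Longrightarrow> M \<subseteq> M' \<Longrightarrow> M' = M"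
    by (rule acc_on_maximal[OF acc, of "(\<lambda>F'. fractions D (sumV F')) ` ?Fs"]) (use triv div in blast)+
  then obtain F' where F': "fg_subgroup Ev F'" "F' \<subseteq> F" "M = fractions D (sumV F')" by blast
  have "F \<subseteq> F'"
  proof
    fix g assume g: "g \<in> F"
    then have gw: "g \<in> carrier Ev" using subgroup.subset[OF F] by blast
    let ?F = "{f \<otimes>\<^bsub>Ev\<^esub> g [^]\<^bsub>Ev\<^esub> (n :: int) | f n. f \<in> F'}"
    note A = E.adjoin_subgroup[OF E.fg_subgroup_subgroup[OF F'(1)] gw]
    have fg: "fg_subgroup Ev ?F" by (rule fg_subgroup.adjoin[OF F'(1) gw])
    have "?F \<subseteq> F"
      using F'(2) subgroup.m_closed[OF F] E.subgroup_int_pow_closed[OF F g] by blast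
    then have "fractions D (sumV ?F) = fractions D (sumV F')"
      using max[of "fractions D (sumV ?F)"] fg fractions_mono[OF A(2)] unfolding F'(3) by blast
    then show "g \<in> F'"
      using fractions_weights[OF fg] fractions_weights[OF F'(1)] A(3) gw by simp
  qed
  then show ?thesis using F' by simp
qed

section \<open>Finite groups of weights: inverses and dimension\<close>

text \<open>For a subspace of the finite-dimensional \<open>sumV F\<close>, the positions of the leading components
  determine it among its subspaces; so the chain \<open>S x \<supseteq> S x\<^sup>2 \<supseteq> \<dots>\<close> is eventually constant.\<close>

lemma finite_sumV_inverse:
  assumes F: "subgroup F W" and fin: "finite F" and x: "x \<in> sumV F" "x \<noteq> \<zero>"
  shows "inv x \<in> sumV F"
proof -
  note Fc = sumV_closures[OF F]
  have xD: "x \<in> carrier D" using Fc(6) x by blast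
  have FS: "y \<in> S" if "y \<in> sumV F" for y using that sumV_iff[OF Fc(1)] by blast
  obtain e where e: "bij_betw e {..<card F} F"
    using ex_bij_betw_nat_finite[OF fin] by (metis atLeast0LessThan)
  have eF: "e i \<in> F" if "i < card F" for i using e that by (auto simp: bij_betw_def)
  have eW: "e i \<in> carrier W" if "i < card F" for i using eF[OF that] Fc(1) by blast
  \<comment> \<open>The positions, in the enumeration \<open>e\<close> of \<open>F\<close>, of the
    last nonzero component of members of \<open>J\<close>; they are the pivots of an echelon
    form.\<close>
  define piv where "piv J = {i. i < card F \<and> (\<exists>y\<in>J. cmp y (e i) \<noteq> \<zero> \<and> (\<forall>j. i < j \<and> j < card F \<longrightarrow> cmp y (e j) = \<zero>))}" for J
  have piv_fin: "finite (piv J)" "card (piv J) \<le> card F" for J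
  proof -
    have "piv J \<subseteq> {..<card F}" by (auto simp: piv_def)
    then show "finite (piv J)" "card (piv J) \<le> card F"
      using finite_subset card_mono[of "{..<card F}" "piv J"] by auto
  qed
  have key: "J' \<subseteq> J" if J: "J \<subseteq> J'" "J' \<subseteq> sumV F" "\<zero> \<in> J" and piv: "piv J' = piv J"
    and sub: "\<And>y z. y \<in> J \<Longrightarrow> z \<in> J \<Longrightarrow> y \<oplus> z \<in> J" "\<And>c y. c \<in> V \<one>\<^bsub>W\<^esub> \<Longrightarrow> y \<in> J \<Longrightarrow> c \<otimes> y \<in> J"
      "\<And>y z. y \<in> J' \<Longrightarrow> z \<in> J' \<Longrightarrow> y \<oplus> z \<in> J'" for J J'
  proof
    have *: "y \<in> J" if "y \<in> J'" "m \<le> card F" "\<And>j. m \<le> j \<Longrightarrow> j < card F \<Longrightarrow> cmp y (e j) = \<zero>" for y m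
      using that
    proof (induction m arbitrary: y)
      case 0
      have yF: "y \<in> sumV F" using 0 J by blast
      have "cmp y l = \<zero>" for l
      proof (rule ccontr)
        assume "cmp y l \<noteq> \<zero>"
        then have "l \<in> F" using yF sumV_iff[OF Fc(1)] by blast
        then obtain j where "j < card F" "l = e j" using e by (auto simp: bij_betw_def)
        then show False using 0 \<open>cmp y l \<noteq> \<zero>\<close> by simp
      qed
      then have "y = \<zero>" using cmp_sum[OF FS[OF yF], of "{}"] by simp
      then show ?case using J by simp
    next
      case (Suc m)
      have m: "m < card F" using Suc.prems by simp
      show ?case
      proof (cases "cmp y (e m) = \<zero>")
        case True
        then have "cmp y (e j) = \<zero>" if "m \<le> j" "j < card F" for j
          using Suc.prems(3)[of j] that by (cases "j = m") auto
        then show ?thesis using Suc.IH[of y] Suc.prems m by auto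
      next
        case False
        then have "m \<in> piv J'" unfolding piv_def using Suc.prems m by (auto simp: Suc_le_eq)
        then obtain z where z: "z \<in> J" "cmp z (e m) \<noteq> \<zero>" "\<And>j. m < j \<Longrightarrow> j < card F \<Longrightarrow> cmp z (e j) = \<zero>"
          unfolding piv by (auto simp: piv_def)
        have yz: "y \<in> S" "z \<in> S" using Suc.prems z J FS by auto
        \<comment> \<open>The quotient of the two components has degree zero, so multiplying
          \<open>z\<close> by it stays in \<open>J\<close> and preserves the vanishing of later
          components; subtracting the result removes the component of \<open>y\<close> at
          \<open>e m\<close>.\<close>
        let ?c = "cmp y (e m) \<otimes> inv (cmp z (e m))"
        have yV: "cmp y (e m) \<in> V (e m)" and zV: "cmp z (e m) \<in> V (e m)"
          using cmp_V[OF yz(1) eW[OF m]] cmp_V[OF yz(2) eW[OF m]] .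
        have cl: "cmp y (e m) \<in> carrier D" "cmp z (e m) \<in> carrier D" using cmp_closed yz by auto
        have c: "?c \<in> V \<one>\<^bsub>W\<^esub>"
          using V_mult[OF eW[OF m] _ yV V_inv[OF eW[OF m] zV z(2)]] eW[OF m] by simp
        have mc: "\<ominus> ?c \<in> V \<one>\<^bsub>W\<^esub>" by (rule V_minus[OF W.one_closed c])
        have cz: "\<ominus> ?c \<otimes> z \<in> J" by (rule sub(2)[OF mc z(1)])
        have czS: "\<ominus> ?c \<otimes> z \<in> S" and cc: "\<And>l. l \<in> carrier W \<Longrightarrow> cmp (\<ominus> ?c \<otimes> z) l = \<ominus> ?c \<otimes> cmp z l"
          using cmp_lmult[OF W.one_closed mc yz(2)] by auto
        have cyz: "cmp (y \<oplus> \<ominus> ?c \<otimes> z) l = cmp y l \<oplus> \<ominus> ?c \<otimes> cmp z l" if "l \<in> carrier W" for l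
          using cmp_add(2)[OF yz(1) czS, of l] cc[OF that] by simp
        have "y \<oplus> \<ominus> ?c \<otimes> z \<in> J"
        proof (rule Suc.IH)
          show "y \<oplus> \<ominus> ?c \<otimes> z \<in> J'" using sub(3) Suc.prems(1) cz J(1) by blast
          show "cmp (y \<oplus> \<ominus> ?c \<otimes> z) (e j) = \<zero>" if j: "m \<le> j" "j < card F" for j
          proof (cases "j = m")
            case True
            then show ?thesis
              unfolding cyz[OF eW[OF j(2)]] using cl z(2) by (simp add: l_minus m_assoc r_neg)
          next
            case False
            then have "cmp y (e j) = \<zero>" "cmp z (e j) = \<zero>" using Suc.prems(3)[of j] z(3)[of j] j by auto
            then show ?thesis
              unfolding cyz[OF eW[OF j(2)]] using cl z(2) by simp
          qed
        qed (use Suc.prems in simp)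
        then have "y \<oplus> \<ominus> ?c \<otimes> z \<oplus> ?c \<otimes> z \<in> J" using sub(1) sub(2)[OF c z(1)] by blast
        moreover have "y \<oplus> \<ominus> ?c \<otimes> z \<oplus> ?c \<otimes> z = y"
          using cl z(2) S_carrier[OF yz(1)] S_carrier[OF yz(2)] by (simp add: l_minus a_assoc l_neg)
        ultimately show ?thesis by simp
      qed
    qed
    fix y assume "y \<in> J'"
    then show "y \<in> J" by (rule *[of _ "card F"]) auto
  qed
  define J where "J k = {s \<otimes> x [^] k | s. s \<in> sumV F}" for k :: nat
  have Jsub: "J (Suc k) \<subseteq> J k" for k
  proof
    fix y assume "y \<in> J (Suc k)"
    then obtain s where "y = s \<otimes> x [^] Suc k" "s \<in> sumV F" unfolding J_def by blast
    moreover then have "y = (s \<otimes> x) \<otimes> x [^] k"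
      using xD Fc(6) by (simp add: m_assoc pow_commute)
    ultimately show "y \<in> J k" using Fc(5)[OF _ x(1)] unfolding J_def by blast
  qed
  have xk: "x [^] k \<in> sumV F" for k :: nat
    by (induction k) (use Fc(2,5) x in auto)
  \<comment> \<open>The pivot sets decrease with \<open>k\<close> and have at most
    \<open>card F\<close> elements, so two consecutive ones coincide.\<close>
  have "\<exists>k. piv (J (Suc k)) = piv (J k)"
  proof (rule ccontr)
    assume "\<nexists>k. piv (J (Suc k)) = piv (J k)"
    moreover have "piv (J (Suc k)) \<subseteq> piv (J k)" for k using Jsub[of k] unfolding piv_def by blast
    ultimately have "piv (J (Suc k)) \<subset> piv (J k)" for k by blast
    then have less: "card (piv (J (Suc k))) < card (piv (J k))" for k by (rule psubset_card_mono[OF piv_fin(1)])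
    have "card (piv (J k)) + k \<le> card F" for k
    proof (induction k)
      case 0 then show ?case using piv_fin(2)[of "J 0"] by simp
    next
      case (Suc k) then show ?case using less[of k] by simp
    qed
    from this[of "Suc (card F)"] show False by simp
  qed
  then obtain k where k: "piv (J (Suc k)) = piv (J k)" by blast
  have Jadd: "y \<oplus> z \<in> J k" if yz: "y \<in> J k" "z \<in> J k" for y z k
  proof -
    obtain s t where "y = s \<otimes> x [^] k" "z = t \<otimes> x [^] k" "s \<in> sumV F" "t \<in> sumV F" using yz unfolding J_def by blast
    moreover then have "y \<oplus> z = (s \<oplus> t) \<otimes> x [^] k" using Fc(6) xD by (simp add: l_distr)
    ultimately show ?thesis unfolding J_def using Fc(4) by blast
  qed
  have "J k \<subseteq> J (Suc k)"
  proof (rule key[OF Jsub _ _ k[symmetric]])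
    show "J k \<subseteq> sumV F" using Fc(5) xk unfolding J_def by blast
    have "\<zero> = \<zero> \<otimes> x [^] Suc k" using xD by simp
    then show "\<zero> \<in> J (Suc k)" using Fc(3) unfolding J_def by blast
    show "c \<otimes> y \<in> J (Suc k)" if cy: "c \<in> V \<one>\<^bsub>W\<^esub>" "y \<in> J (Suc k)" for c y
    proof -
      obtain s where s: "y = s \<otimes> x [^] Suc k" "s \<in> sumV F" using cy unfolding J_def by blast
      have cF: "c \<in> sumV F" using Fc(9)[OF subgroup.one_closed[OF F] cy(1)] .
      have "c \<otimes> y = (c \<otimes> s) \<otimes> x [^] Suc k" using s xD Fc(6)[OF cF] Fc(6)[OF s(2)] by (simp add: m_assoc)
      then show ?thesis unfolding J_def using Fc(5)[OF cF s(2)] by blast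
    qed
  qed (fact Jadd)+
  moreover have "x [^] k = \<one> \<otimes> x [^] k" using xD by simp
  then have "x [^] k \<in> J k" unfolding J_def using Fc(2) by blast
  \<comment> \<open>Cancelling \<open>x^k\<close> in \<open>x^k = s x^(k+1)\<close> leaves
    \<open>s x = 1\<close>, so the inverse of \<open>x\<close> is the element \<open>s\<close> of
    \<open>sumV F\<close>.\<close>
  ultimately obtain s where s: "x [^] k = s \<otimes> x [^] Suc k" "s \<in> sumV F" unfolding J_def by blast
  have sD: "s \<in> carrier D" using Fc(6) s by blast
  have "s \<otimes> x \<otimes> x [^] k = s \<otimes> x [^] Suc k"
    using sD xD by (simp add: m_assoc pow_commute)
  also have "\<dots> = x [^] k" by (rule s(1)[symmetric])
  finally have "s \<otimes> x \<otimes> x [^] k = \<one> \<otimes> x [^] k" using xD by simp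
  then have "(s \<otimes> x \<otimes> x [^] k) \<otimes> inv (x [^] k) = (\<one> \<otimes> x [^] k) \<otimes> inv (x [^] k)" by simp
  then have "s \<otimes> x = \<one>" using sD xD pow_nonzero[OF xD x(2)] by simp
  then have "s = inv x" using inv_cancel(3)[OF xD x(2) sD] xD x by simp
  then show ?thesis using s by simp
qed

lemma finite_sumV_division: "subgroup F W \<Longrightarrow> finite F \<Longrightarrow> division_subalgebra K D (sumV F)"
  using sumV_closures[of F] sumV_smult finite_sumV_inverse
  by (intro division_algebra_subset[OF division_algebra]) auto

text \<open>\<open>finsum\<close> depends on the carrier of its structure; this identifies sums
  formed in the subalgebra with sums formed in \<open>D\<close>.\<close>

lemma finsum_sumV:
  assumes F: "subgroup F W" and f: "\<And>b. b \<in> B \<Longrightarrow> f b \<in> sumV F" and B: "finite B"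
  shows "finsum (D\<lparr>carrier := sumV F\<rparr>) f B = finsum D f B"
proof -
  interpret A: ring "D\<lparr>carrier := sumV F\<rparr>" by (rule sumV_closures(8)[OF F])
  show ?thesis
    using B f
  proof (induction B rule: finite_induct)
    case empty
    then show ?case by simp
  next
    case (insert b B)
    then have "f \<in> B \<rightarrow> sumV F" "f b \<in> sumV F" "f \<in> B \<rightarrow> carrier D" "f b \<in> carrier D"
      using sumV_closures(6)[OF F] by auto
    then show ?case
      using A.finsum_insert[of B b f] insert finsum_insert[of B b f] by simp
  qed
qed

lemma finprod_sumV:
  assumes "subgroup F W" "\<And>b. b \<in> B \<Longrightarrow> f b \<in> sumV F" "finite B"
  shows "finprod (add_monoid (D\<lparr>carrier := sumV F\<rparr>)) f B = finsum D f B"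
  using finsum_sumV[OF assms] by (simp only: finsum_def)

lemma cmp_of_sum:
  assumes "finite M" "M \<subseteq> carrier W" "\<And>l. l \<in> M \<Longrightarrow> f l \<in> V l"
  shows "cmp (\<Oplus>l\<in>M. f l) = (\<lambda>l. if l \<in> M then f l else \<zero>)"
  using cmp_total[OF family_of(1)[OF assms]] family_of(2)[OF assms] by simp

text \<open>One nonzero vector \<open>b l\<close> for each degree gives a basis: the coordinate of
  \<open>v\<close> at \<open>b l\<close> is \<open>cmp v l\<close> times the inverse of
  \<open>b l\<close>, an element of degree zero.\<close>

lemma sumV_dimension:
  assumes F: "subgroup F W" and fin: "finite F" and Fw: "F \<subseteq> wt"
  shows "has_dimension (V \<one>\<^bsub>W\<^esub>) (\<lambda>c v. c \<otimes> v) (add_monoid (D\<lparr>carrier := sumV F\<rparr>)) (card F)"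
proof -
  note Fc = sumV_closures[OF F]
  have "\<forall>l\<in>F. \<exists>u\<in>V l. u \<noteq> \<zero>" using Fw by (auto simp: wt_def)
  then obtain b where b: "\<And>l. l \<in> F \<Longrightarrow> b l \<in> V l \<and> b l \<noteq> \<zero>" by metis
  have FW: "l \<in> carrier W" if "l \<in> F" for l using that Fc(1) by blast
  have bD: "b l \<in> carrier D" if "l \<in> F" for l using b that FW VD by blast
  have inj: "inj_on b F"
  proof (rule inj_onI)
    fix l m assume lm: "l \<in> F" "m \<in> F" "b l = b m"
    show "l = m"
      using V_sumV(2)[OF FW[OF lm(1)] conjunct1[OF b[OF lm(1)]], of l]
        V_sumV(2)[OF FW[OF lm(2)] conjunct1[OF b[OF lm(2)]], of l] b[OF lm(1)] lm(3) by (auto split: if_splits)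
  qed
  have cV: "c \<otimes> b l \<in> V l" if "c \<in> V \<one>\<^bsub>W\<^esub>" "l \<in> F" for c l
    using V_mult[OF W.one_closed FW[OF that(2)] that(1)] b[OF that(2)] FW[OF that(2)] by simp
  have sum: "(\<Otimes>\<^bsub>add_monoid (D\<lparr>carrier := sumV F\<rparr>)\<^esub>v\<in>b ` F. c v \<otimes> v) = (\<Oplus>l\<in>F. c (b l) \<otimes> b l)"
    if c: "c \<in> b ` F \<rightarrow>\<^sub>E V \<one>\<^bsub>W\<^esub>" for c
  proof -
    have cb: "c (b l) \<in> V \<one>\<^bsub>W\<^esub>" if "l \<in> F" for l using c that by auto
    have "c v \<otimes> v \<in> sumV F" if "v \<in> b ` F" for v
      using that cV[OF cb] Fc(9) by auto
    then have "(\<Otimes>\<^bsub>add_monoid (D\<lparr>carrier := sumV F\<rparr>)\<^esub>v\<in>b ` F. c v \<otimes> v) = (\<Oplus>v\<in>b ` F. c v \<otimes> v)"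
      using fin by (intro finprod_sumV[OF F]) auto
    also have "\<dots> = (\<Oplus>l\<in>F. c (b l) \<otimes> b l)"
      by (rule finsum_reindex[OF _ inj]) (use cb bD VD[OF W.one_closed] in auto)
    finally show ?thesis .
  qed
  show ?thesis
    unfolding has_dimension_def
  proof (intro exI[of _ "b ` F"] conjI ballI)
    show "b ` F \<subseteq> carrier (add_monoid (D\<lparr>carrier := sumV F\<rparr>))" using b Fc(9) by auto
    show "finite (b ` F)" using fin by simp
    show "card (b ` F) = card F" by (rule card_image[OF inj])
    fix v assume "v \<in> carrier (add_monoid (D\<lparr>carrier := sumV F\<rparr>))"
    then have v: "v \<in> sumV F" by simp
    then have vS: "v \<in> S" and supp: "{l. cmp v l \<noteq> \<zero>} \<subseteq> F" using sumV_iff[OF Fc(1)] by auto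
    define k where "k = inv_into F b"
    have kb: "k (b l) = l" if "l \<in> F" for l using inv_into_f_f[OF inj that] by (simp add: k_def)
    let ?c = "\<lambda>w\<in>b ` F. cmp v (k w) \<otimes> inv w"
    have cc: "?c (b l) = cmp v l \<otimes> inv (b l)" if "l \<in> F" for l using that kb by simp
    show "\<exists>!c. c \<in> b ` F \<rightarrow>\<^sub>E V \<one>\<^bsub>W\<^esub> \<and> v = (\<Otimes>\<^bsub>add_monoid (D\<lparr>carrier := sumV F\<rparr>)\<^esub>w\<in>b ` F. c w \<otimes> w)"
    proof (rule ex1I[of _ ?c], intro conjI)
      have "cmp v l \<otimes> inv (b l) \<in> V \<one>\<^bsub>W\<^esub>" if "l \<in> F" for l
        using V_mult[OF FW[OF that] _ cmp_V[OF vS FW[OF that]] V_inv[OF FW[OF that], of "b l"]] b[OF that] FW[OF that] by simp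
      then show cE: "?c \<in> b ` F \<rightarrow>\<^sub>E V \<one>\<^bsub>W\<^esub>" using kb by auto
      have "(\<Oplus>l\<in>F. ?c (b l) \<otimes> b l) = (\<Oplus>l\<in>F. cmp v l)"
        by (rule finsum_cong') (use cc b bD cmp_closed[OF vS] in auto)
      then show "v = (\<Otimes>\<^bsub>add_monoid (D\<lparr>carrier := sumV F\<rparr>)\<^esub>w\<in>b ` F. ?c w \<otimes> w)"
        unfolding sum[OF cE] using cmp_sum[OF vS fin supp] by simp
    next
      fix c assume *: "c \<in> b ` F \<rightarrow>\<^sub>E V \<one>\<^bsub>W\<^esub> \<and> v = (\<Otimes>\<^bsub>add_monoid (D\<lparr>carrier := sumV F\<rparr>)\<^esub>w\<in>b ` F. c w \<otimes> w)"
      then have cE: "c \<in> b ` F \<rightarrow>\<^sub>E V \<one>\<^bsub>W\<^esub>" by blast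
      have cb: "c (b l) \<in> V \<one>\<^bsub>W\<^esub>" if "l \<in> F" for l using cE that by auto
      have "v = (\<Oplus>l\<in>F. c (b l) \<otimes> b l)" using * sum[OF cE] by simp
      then have cv: "cmp v l = c (b l) \<otimes> b l" if "l \<in> F" for l
        using cmp_of_sum[OF fin Fc(1), of "\<lambda>l. c (b l) \<otimes> b l"] cV[OF cb] that by simp
      show "c = ?c"
      proof (rule PiE_ext[OF cE])
        show "?c \<in> b ` F \<rightarrow>\<^sub>E V \<one>\<^bsub>W\<^esub>"
        proof (rule restrict_PiE_iff[THEN iffD2], rule ballI)
          fix w assume "w \<in> b ` F"
          then obtain l where l: "l \<in> F" "w = b l" by blast
          then show "cmp v (k w) \<otimes> inv w \<in> V \<one>\<^bsub>W\<^esub>"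
            using cv[OF l(1)] cb[OF l(1)] b[OF l(1)] bD[OF l(1)] VD[OF W.one_closed cb[OF l(1)]] by (simp add: kb)
        qed
        fix w assume "w \<in> b ` F"
        then obtain l where l: "l \<in> F" "w = b l" by blast
        show "c w = ?c w"
          unfolding l(2) cc[OF l(1)] cv[OF l(1)]
          using b[OF l(1)] bD[OF l(1)] VD[OF W.one_closed cb[OF l(1)]] by simp
      qed
    qed
  qed
qed

lemma sumV_dimension_right:
  assumes F: "subgroup F W" and fin: "finite F" and Fw: "F \<subseteq> wt"
  shows "has_dimension (V \<one>\<^bsub>W\<^esub>) (\<lambda>c v. v \<otimes> c) (add_monoid (D\<lparr>carrier := sumV F\<rparr>)) (card F)"
proof -
  interpret O: graded_division K "opposite D" W V by (rule graded_division_opposite) unfold_locales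
  have sum: "O.sumV F = sumV F" by (rule sumV_opposite) unfold_locales
  have "O.wt = wt" by (simp add: wt_def O.wt_def)
  then show ?thesis
    using O.sumV_dimension[OF F fin] Fw unfolding sum by simp
qed

end

section \<open>Finitely generated abelian groups\<close>

context comm_group
begin

lemma torsion_subgroup: "subgroup (torsion G) G"
proof (rule subgroupI)
  show "torsion G \<subseteq> carrier G" by (auto simp: torsion_def)
  have "\<one> \<in> torsion G" unfolding torsion_def by (auto intro!: exI[of _ "1 :: nat"])
  then show "torsion G \<noteq> {}" by blast
next
  fix x assume "x \<in> torsion G"
  then obtain n where "x \<in> carrier G" "n > 0" "x [^] (n :: nat) = \<one>" by (auto simp: torsion_def)
  then show "inv x \<in> torsion G" unfolding torsion_def by (auto simp: nat_pow_inv intro!: exI[of _ n])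
next
  fix x y assume "x \<in> torsion G" "y \<in> torsion G"
  then obtain n m where *: "x \<in> carrier G" "n > 0" "x [^] (n :: nat) = \<one>" "y \<in> carrier G" "m > 0" "y [^] (m :: nat) = \<one>"
    by (auto simp: torsion_def)
  have "x [^] (n * m) = \<one>" "y [^] (m * n) = \<one>"
    using *(1,3,4,6) by (metis nat_pow_pow nat_pow_one)+
  then have "(x \<otimes> y) [^] (n * m) = \<one>" using * by (simp add: pow_mult_distrib m_comm mult.commute)
  then show "x \<otimes> y \<in> torsion G" using * unfolding torsion_def by (auto intro!: exI[of _ "n * m"])
qed

lemma torsion_carrier: "x \<in> torsion G \<Longrightarrow> x \<in> carrier G"
  by (simp add: torsion_def)

lemma torsion_closed:
  "\<one> \<in> torsion G" "\<And>x y. x \<in> torsion G \<Longrightarrow> y \<in> torsion G \<Longrightarrow> x \<otimes> y \<in> torsion G"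
  "\<And>x. x \<in> torsion G \<Longrightarrow> inv x \<in> torsion G" "\<And>x. x \<in> torsion G \<Longrightarrow> x [^] (n :: int) \<in> torsion G"
  using torsion_subgroup subgroup.one_closed subgroup.m_closed subgroup.m_inv_closed
    subgroup_int_pow_closed by metis+

lemma torsion_root:
  assumes x: "x \<in> carrier G" and n: "n \<noteq> 0" "x [^] (n :: int) \<in> torsion G"
  shows "x \<in> torsion G"
proof -
  have "x [^] \<bar>n\<bar> \<in> torsion G"
    using n torsion_closed(3)[OF n(2)] x by (cases "n \<ge> 0") (simp_all add: int_pow_neg)
  then have "x [^] nat \<bar>n\<bar> \<in> torsion G"
    using int_pow_int[of G x "nat \<bar>n\<bar>"] by simp
  then obtain k where k: "k > 0" "(x [^] nat \<bar>n\<bar>) [^] (k :: nat) = \<one>" by (auto simp: torsion_def)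
  then have "x [^] (nat \<bar>n\<bar> * k) = \<one>" by (metis nat_pow_pow[OF x])
  moreover have "nat \<bar>n\<bar> * k > 0" using n k by simp
  ultimately show ?thesis using x unfolding torsion_def by blast
qed

text \<open>Each adjoined generator has finite order \<open>k\<close>, so its exponents matter only
  modulo \<open>k\<close>, and a step multiplies the number of elements by at most
  \<open>k\<close>.\<close>

lemma finite_torsion_fg:
  assumes "fg_subgroup G F" "F \<subseteq> torsion G" shows "finite F"
  using assms
proof (induction rule: fg_subgroup.induct)
  case (adjoin F y)
  note A = adjoin_subgroup[OF fg_subgroup_subgroup[OF adjoin(1)] adjoin(2)]
  have "finite F" using adjoin A(2) by blast
  have "y \<in> torsion G" using adjoin(4) A(3) by blast
  then obtain k where k: "k > 0" "y [^] (k :: nat) = \<one>" by (auto simp: torsion_def)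
  have "y [^] (n :: int) = y [^] nat (n mod int k)" for n
  proof -
    have "y [^] n = y [^] (int k * (n div int k) + n mod int k)" by simp
    also have "\<dots> = (y [^] int k) [^] (n div int k) \<otimes> y [^] (n mod int k)"
      using adjoin(2) by (simp only: int_pow_mult int_pow_pow)
    also have "\<dots> = y [^] (n mod int k)" using k adjoin(2) by (simp add: int_pow_int)
    also have "\<dots> = y [^] nat (n mod int k)"
      using k by (metis int_nat_eq int_pow_int of_nat_0_less_iff pos_mod_sign)
    finally show ?thesis .
  qed
  moreover have "nat (n mod int k) < k" for n using k by (simp add: nat_less_iff)
  ultimately have "{f \<otimes> y [^] (n :: int) | f n. f \<in> F} \<subseteq> (\<lambda>(f, m). f \<otimes> y [^] m) ` (F \<times> {..<k})"
    by fastforce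
  then show ?case by (rule finite_subset) (simp add: \<open>finite F\<close>)
qed simp

section \<open>Bases modulo torsion\<close>

definition lincomb :: "nat set \<Rightarrow> (nat \<Rightarrow> 'a) \<Rightarrow> (nat \<Rightarrow> int) \<Rightarrow> 'a" where
  "lincomb I g n = (\<Otimes>i\<in>I. g i [^] n i)"

text \<open>Together with independence this describes a basis of \<open>G\<close> modulo torsion,
  formulated inside \<open>G\<close> to avoid the quotient group. The indices are natural numbers,
  so that generators can be added, dropped and renumbered.\<close>

definition generates_mod_torsion :: "nat set \<Rightarrow> (nat \<Rightarrow> 'a) \<Rightarrow> bool" where
  "generates_mod_torsion I g \<longleftrightarrow> finite I \<and> g \<in> I \<rightarrow> carrier G \<and>
     (\<forall>x\<in>carrier G. \<exists>t\<in>torsion G. \<exists>n. x = t \<otimes> lincomb I g n)"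

definition independent_mod_torsion :: "nat set \<Rightarrow> (nat \<Rightarrow> 'a) \<Rightarrow> bool" where
  "independent_mod_torsion I g \<longleftrightarrow> (\<forall>n. lincomb I g n \<in> torsion G \<longrightarrow> (\<forall>i\<in>I. n i = 0))"

lemma lincomb_closed [simp]: "g \<in> I \<rightarrow> carrier G \<Longrightarrow> lincomb I g n \<in> carrier G"
  unfolding lincomb_def by (rule finprod_closed) auto

lemma lincomb_cong:
  assumes "g \<in> I \<rightarrow> carrier G" "\<And>i. i \<in> I \<Longrightarrow> g i = h i" "\<And>i. i \<in> I \<Longrightarrow> n i = m i"
  shows "lincomb I g n = lincomb I h m"
  unfolding lincomb_def by (rule finprod_cong') (use assms in \<open>auto simp: Pi_iff\<close>)

lemma lincomb_insert:
  "finite I \<Longrightarrow> i \<notin> I \<Longrightarrow> g \<in> insert i I \<rightarrow> carrier G \<Longrightarrow> lincomb (insert i I) g n = g i [^] n i \<otimes> lincomb I g n"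
  unfolding lincomb_def by (rule finprod_insert) auto

lemma lincomb_remove:
  assumes "finite I" "i \<in> I" "g \<in> I \<rightarrow> carrier G"
  shows "lincomb I g n = g i [^] n i \<otimes> lincomb (I - {i}) g n"
  using lincomb_insert[of "I - {i}" i g n] assms by (simp add: insert_absorb)

lemma lincomb_add:
  assumes "g \<in> I \<rightarrow> carrier G"
  shows "lincomb I g (\<lambda>i. n i + m i) = lincomb I g n \<otimes> lincomb I g m"
proof -
  have "lincomb I g (\<lambda>i. n i + m i) = (\<Otimes>i\<in>I. g i [^] n i \<otimes> g i [^] m i)"
    unfolding lincomb_def by (rule finprod_cong') (use assms in \<open>auto simp: Pi_iff int_pow_mult\<close>)
  also have "\<dots> = lincomb I g n \<otimes> lincomb I g m"
    unfolding lincomb_def by (rule finprod_multf) (use assms in auto)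
  finally show ?thesis .
qed

lemma lincomb_zero: "lincomb I g (\<lambda>i. 0) = \<one>"
  by (simp add: lincomb_def)

lemma lincomb_neg:
  assumes "g \<in> I \<rightarrow> carrier G" shows "lincomb I g (\<lambda>i. - n i) = inv (lincomb I g n)"
  using lincomb_add[OF assms, of "\<lambda>i. - n i" n] assms lincomb_zero[of I g]
  by (intro inv_equality[symmetric]) simp_all

lemma lincomb_single:
  assumes "finite I" "j \<in> I" "g \<in> I \<rightarrow> carrier G" "\<And>i. i \<in> I \<Longrightarrow> i \<noteq> j \<Longrightarrow> n i = 0"
  shows "lincomb I g n = g j [^] n j"
proof -
  have "lincomb (I - {j}) g n = lincomb (I - {j}) g (\<lambda>i. 0)"
    by (rule lincomb_cong) (use assms in auto)
  then show ?thesis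
    using assms lincomb_remove[OF assms(1-3), of n] lincomb_zero by (auto simp: Pi_iff)
qed

text \<open>An elementary column operation on the generators is compensated by an elementary row
  operation on the exponents.\<close>

lemma lincomb_transvection:
  assumes I: "finite I" "i \<in> I" "j \<in> I" "i \<noteq> j" and g: "g \<in> I \<rightarrow> carrier G"
  shows "lincomb I (g(j := g j \<otimes> g i [^] e)) (m(i := m i - e * m j)) = lincomb I g m"
proof -
  let ?g = "g(j := g j \<otimes> g i [^] e)" and ?m = "m(i := m i - e * m j)"
  have gc: "g i \<in> carrier G" "g j \<in> carrier G" using g I by auto
  have g': "?g \<in> I \<rightarrow> carrier G" using g gc by auto
  have r: "lincomb (I - {i} - {j}) ?g ?m = lincomb (I - {i} - {j}) g m"
    by (rule lincomb_cong) (use g g' in auto)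
  have c: "lincomb (I - {i} - {j}) g m \<in> carrier G" by (rule lincomb_closed) (use g in auto)
  have "lincomb I ?g ?m = ?g i [^] ?m i \<otimes> (?g j [^] ?m j \<otimes> lincomb (I - {i} - {j}) ?g ?m)"
    using I g' by (subst lincomb_remove[of I i], simp_all, subst lincomb_remove[of "I - {i}" j]) auto
  also have "\<dots> = g i [^] (m i - e * m j) \<otimes> ((g j [^] m j \<otimes> g i [^] (e * m j)) \<otimes> lincomb (I - {i} - {j}) g m)"
    unfolding r using I gc by (simp add: int_pow_distrib int_pow_pow)
  also have "\<dots> = (g i [^] (m i - e * m j) \<otimes> g i [^] (e * m j)) \<otimes> (g j [^] m j \<otimes> lincomb (I - {i} - {j}) g m)"
    using gc c by (simp add: m_ac)
  also have "g i [^] (m i - e * m j) \<otimes> g i [^] (e * m j) = g i [^] m i"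
    using gc by (simp add: int_pow_mult[symmetric])
  also have "g i [^] m i \<otimes> (g j [^] m j \<otimes> lincomb (I - {i} - {j}) g m) = lincomb I g m"
    using I g by (subst lincomb_remove[of I i], simp_all, subst lincomb_remove[of "I - {i}" j]) auto
  finally show ?thesis .
qed

lemma fg_subgroup_lincomb:
  assumes "fg_subgroup G F"
  shows "\<exists>I g. finite I \<and> g \<in> I \<rightarrow> carrier G \<and> (\<forall>x\<in>F. \<exists>n. x = lincomb I g n)"
  using assms
proof (induction rule: fg_subgroup.induct)
  case trivial
  show ?case by (intro exI[of _ "{}"]) (simp add: lincomb_def)
next
  case (adjoin F y)
  then obtain I g where I: "finite I" "g \<in> I \<rightarrow> carrier G" "\<And>x. x \<in> F \<Longrightarrow> \<exists>n. x = lincomb I g n" by blast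
  obtain k :: nat where k: "k \<notin> I" using ex_new_if_finite[OF infinite_UNIV_nat I(1)] by blast
  have g': "g(k := y) \<in> insert k I \<rightarrow> carrier G" using I adjoin(2) by auto
  have "\<exists>m. x = lincomb (insert k I) (g(k := y)) m" if x: "x \<in> {f \<otimes> y [^] (n :: int) | f n. f \<in> F}" for x
  proof -
    obtain f n where f: "x = f \<otimes> y [^] (n :: int)" "f \<in> F" using x by blast
    obtain m where m: "f = lincomb I g m" using I(3)[OF f(2)] by blast
    have "lincomb (insert k I) (g(k := y)) (m(k := n)) = y [^] n \<otimes> lincomb I (g(k := y)) (m(k := n))"
      using lincomb_insert[OF I(1) k g'] by simp
    also have "lincomb I (g(k := y)) (m(k := n)) = lincomb I g m"
      by (rule lincomb_cong) (use g' k in auto)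
    finally have e: "lincomb (insert k I) (g(k := y)) (m(k := n)) = y [^] n \<otimes> lincomb I g m" .
    have "x = lincomb (insert k I) (g(k := y)) (m(k := n))"
      unfolding e f(1) m by (rule m_comm) (use adjoin(2) I(2) in auto)
    then show ?thesis by blast
  qed
  then have "\<forall>x\<in>{f \<otimes> y [^] (n :: int) | f n. f \<in> F}. \<exists>m. x = lincomb (insert k I) (g(k := y)) m"
    by (intro ballI)
  moreover have "finite (insert k I)" using I(1) by simp
  ultimately show ?case using g' by (intro exI conjI)
qed

text \<open>The Euclidean algorithm on the exponents of a relation makes all but one of them vanish; then
  the remaining generator is torsion and can be dropped.\<close>

lemma independent_generators:
  assumes "generates_mod_torsion I g"
  shows "\<exists>I g. generates_mod_torsion I g \<and> independent_mod_torsion I g"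
  using assms
proof (induction "card I" arbitrary: I g rule: less_induct)
  case (less I g)
  \<comment> \<open>A nontrivial relation allows a generator to be dropped. This is an induction on
    the sum of the absolute values of the exponents, inside the induction on the number of
    generators.\<close>
  have drop: ?case if rel: "lincomb I g n \<in> torsion G" "i \<in> I" "n i \<noteq> 0" and gen: "generates_mod_torsion I g" for g n i
    using rel gen
  proof (induction "\<Sum>i\<in>I. nat \<bar>n i\<bar>" arbitrary: g n i rule: less_induct)
    case (less n g i)
    note inner = less.hyps
    have I: "finite I" and g: "g \<in> I \<rightarrow> carrier G"
      and gen: "\<And>x. x \<in> carrier G \<Longrightarrow> \<exists>t\<in>torsion G. \<exists>n. x = t \<otimes> lincomb I g n"
      using less.prems by (auto simp: generates_mod_torsion_def)
    show ?case
    proof (cases "\<exists>j\<in>I. j \<noteq> i \<and> n j \<noteq> 0")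
      case False
      have "lincomb I g n = g i [^] n i"
        by (rule lincomb_single[OF I less.prems(2) g]) (use False in auto)
      then have "g i [^] n i \<in> torsion G" using less.prems(1) by simp
      \<comment> \<open>Only one exponent is left, so a nontrivial power of \<open>g i\<close> is
        torsion; then \<open>g i\<close> itself is torsion and its powers move into the torsion
        factor.\<close>
      then have gi: "g i \<in> torsion G" using torsion_root[of "g i" "n i"] less.prems g by auto
      have "\<exists>t\<in>torsion G. \<exists>m. x = t \<otimes> lincomb (I - {i}) g m" if x: "x \<in> carrier G" for x
      proof -
        obtain t m where t: "t \<in> torsion G" "x = t \<otimes> lincomb I g m" using gen[OF x] by blast
        have "x = (t \<otimes> g i [^] m i) \<otimes> lincomb (I - {i}) g m"
          unfolding t(2) lincomb_remove[OF I less.prems(2) g, of m]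
          using torsion_carrier[OF t(1)] torsion_carrier[OF gi] g by (simp add: m_assoc Pi_iff)
        then show ?thesis using torsion_closed(2)[OF t(1) torsion_closed(4)[OF gi]] by blast
      qed
      then have "generates_mod_torsion (I - {i}) g" using I g by (auto simp: generates_mod_torsion_def)
      moreover have "card (I - {i}) < card I" using I less.prems(2) by (meson card_Diff1_less)
      ultimately show ?thesis using \<open>\<And>I' g. card I' < card I \<Longrightarrow> generates_mod_torsion I' g \<Longrightarrow> _\<close> by blast
    next
      case True
      then obtain j where j: "j \<in> I" "j \<noteq> i" "n j \<noteq> 0" by blast
      have "\<exists>p q. p \<in> I \<and> q \<in> I \<and> p \<noteq> q \<and> n q \<noteq> 0 \<and> \<bar>n q\<bar> \<le> \<bar>n p\<bar>"
        using j less.prems(2,3) by (metis nle_le)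
      then obtain p q where pq: "p \<in> I" "q \<in> I" "p \<noteq> q" "n q \<noteq> 0" "\<bar>n q\<bar> \<le> \<bar>n p\<bar>" by blast
      \<comment> \<open>The sign makes \<open>e * n q\<close> agree in sign with \<open>n p\<close>,
        so the subtraction lowers the absolute value of \<open>n p\<close> by that of
        \<open>n q\<close>, which is nonzero and not larger. The exponent at \<open>q\<close> is
        untouched and witnesses that the new relation is nontrivial.\<close>
      define e where "e = sgn (n p) * sgn (n q)"
      let ?g = "g(q := g q \<otimes> g p [^] e)" and ?n = "n(p := n p - e * n q)"
      have eq: "lincomb I ?g (m(p := m p - e * m q)) = lincomb I g m" for m
        by (rule lincomb_transvection[OF I pq(1-3) g])
      have np: "\<bar>n p - e * n q\<bar> < \<bar>n p\<bar>"
        using pq(4,5) by (auto simp: e_def sgn_if abs_if split: if_splits)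
      have "(\<Sum>k\<in>I. nat \<bar>?n k\<bar>) < (\<Sum>k\<in>I. nat \<bar>n k\<bar>)"
        by (rule sum_strict_mono_ex1[OF I]) (use np pq(1) in auto)
      moreover have "lincomb I ?g ?n \<in> torsion G" using eq[of n] less.prems(1) by simp
      moreover have "?n q \<noteq> 0" using pq by simp
      moreover have "generates_mod_torsion I ?g"
        unfolding generates_mod_torsion_def
      proof (intro conjI ballI)
        show "?g \<in> I \<rightarrow> carrier G" using g pq by (auto simp: Pi_iff)
        fix x assume "x \<in> carrier G"
        then obtain t m where "t \<in> torsion G" "x = t \<otimes> lincomb I g m" using gen by blast
        then show "\<exists>t\<in>torsion G. \<exists>n. x = t \<otimes> lincomb I ?g n" using eq[of m] by metis
      qed (rule I)
      ultimately show ?thesis using inner[of ?n ?g q] pq(2) by blast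
    qed
  qed
  show ?case
  proof (cases "independent_mod_torsion I g")
    case False
    then obtain n i where "lincomb I g n \<in> torsion G" "i \<in> I" "n i \<noteq> 0"
      by (auto simp: independent_mod_torsion_def)
    then show ?thesis using drop less.prems by blast
  qed (use less.prems in blast)
qed

lemma lincomb_reindex:
  assumes e: "bij_betw e J I" and g: "g \<in> I \<rightarrow> carrier G"
  shows "lincomb I g n = lincomb J (g \<circ> e) (n \<circ> e)"
proof -
  have "lincomb (e ` J) g n = (\<Otimes>j\<in>J. g (e j) [^] n (e j))"
    unfolding lincomb_def by (rule finprod_reindex) (use e g in \<open>auto simp: bij_betw_def\<close>)
  then show ?thesis using e by (simp add: lincomb_def bij_betw_def)
qed

lemma structure_mod_torsion:
  assumes "fg_subgroup G (carrier G)"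
  obtains r g where "generates_mod_torsion {1..r} g" "independent_mod_torsion {1..r} g"
proof -
  obtain I g where "finite I" "g \<in> I \<rightarrow> carrier G" "\<And>x. x \<in> carrier G \<Longrightarrow> \<exists>n. x = lincomb I g n"
    using fg_subgroup_lincomb[OF assms] by blast
  then have "generates_mod_torsion I g"
    using torsion_closed(1) by (auto simp: generates_mod_torsion_def intro!: bexI[of _ \<one>])
  then obtain I g where gen: "generates_mod_torsion I g" and ind: "independent_mod_torsion I g"
    using independent_generators by blast
  have I: "finite I" "g \<in> I \<rightarrow> carrier G" using gen by (auto simp: generates_mod_torsion_def)
  obtain e where e: "bij_betw e {1..card I} I" using ex_bij_betw_nat_finite_1[OF I(1)] by blast
  have eI: "e i \<in> I" if "i \<in> {1..card I}" for i using e that by (auto simp: bij_betw_def)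
  show thesis
  proof (rule that[of "card I" "g \<circ> e"])
    show "generates_mod_torsion {1..card I} (g \<circ> e)"
      using gen eI unfolding generates_mod_torsion_def lincomb_reindex[OF e I(2)] by (auto simp: Pi_iff) metis
    show "independent_mod_torsion {1..card I} (g \<circ> e)"
      unfolding independent_mod_torsion_def
    proof (intro allI impI ballI)
      fix n i assume n: "lincomb {1..card I} (g \<circ> e) n \<in> torsion G" and i: "i \<in> {1..card I}"
      define n' where "n' = n \<circ> inv_into {1..card I} e"
      have ne: "(n' \<circ> e) k = n k" if "k \<in> {1..card I}" for k
        using e that by (simp add: n'_def bij_betw_def)
      have "lincomb {1..card I} (g \<circ> e) (n' \<circ> e) = lincomb {1..card I} (g \<circ> e) n"
        by (rule lincomb_cong) (use I(2) eI ne in auto)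
      then have "lincomb I g n' \<in> torsion G" using n lincomb_reindex[OF e I(2), of n'] by simp
      then have "n' (e i) = 0" using ind eI[OF i] by (simp add: independent_mod_torsion_def)
      then show "n i = 0" using ne[OF i] by simp
    qed
  qed
qed

text \<open>Dividing the two expressions leaves a combination that is torsion; independence equates
  the exponents, and then the torsion parts agree by cancellation.\<close>

lemma lincomb_unique:
  assumes gen: "generates_mod_torsion I g" and ind: "independent_mod_torsion I g"
    and eq: "t \<otimes> lincomb I g n = s \<otimes> lincomb I g m" and ts: "t \<in> torsion G" "s \<in> torsion G"
  shows "t = s" "\<And>i. i \<in> I \<Longrightarrow> n i = m i"
proof -
  have g: "g \<in> I \<rightarrow> carrier G" using gen by (simp add: generates_mod_torsion_def)
  note c = torsion_carrier[OF ts(1)] torsion_carrier[OF ts(2)] lincomb_closed[OF g]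
  have "lincomb I g (\<lambda>i. n i + - m i) = lincomb I g n \<otimes> inv (lincomb I g m)"
    using lincomb_add[OF g, of n "\<lambda>i. - m i"] lincomb_neg[OF g] by simp
  also have "\<dots> = inv t \<otimes> s"
  proof -
    have "lincomb I g n = inv t \<otimes> (s \<otimes> lincomb I g m)"
      unfolding eq[symmetric] using c by (simp add: m_assoc[symmetric])
    then show ?thesis using c by (simp add: m_assoc)
  qed
  finally have "lincomb I g (\<lambda>i. n i + - m i) \<in> torsion G"
    using torsion_closed(2)[OF torsion_closed(3)[OF ts(1)] ts(2)] by simp
  then show nm: "n i = m i" if "i \<in> I" for i
    using ind that by (auto simp: independent_mod_torsion_def dest!: spec[of _ "\<lambda>i. n i + - m i"])
  have "lincomb I g n = lincomb I g m" by (rule lincomb_cong[OF g]) (use nm in auto)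
  then show "t = s" using eq c by simp
qed

lemma torsion_times_free_iso:
  assumes gen: "generates_mod_torsion {1..r} g" and ind: "independent_mod_torsion {1..r} g"
  shows "(\<lambda>(t, n). t \<otimes> lincomb {1..r} g n) \<in>
    iso (G\<lparr>carrier := torsion G\<rparr> \<times>\<times> product_group {1..r} (\<lambda>i. integer_group)) G"
proof -
  have g: "g \<in> {1..r} \<rightarrow> carrier G" using gen by (simp add: generates_mod_torsion_def)
  let ?h = "\<lambda>(t, n). t \<otimes> lincomb {1..r} g n"
  have hom: "?h \<in> hom (G\<lparr>carrier := torsion G\<rparr> \<times>\<times> product_group {1..r} (\<lambda>i. integer_group)) G"
  proof (rule homI)
    fix x assume "x \<in> carrier (G\<lparr>carrier := torsion G\<rparr> \<times>\<times> product_group {1..r} (\<lambda>i. integer_group))"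
    then show "?h x \<in> carrier G" using torsion_carrier lincomb_closed[OF g] by (auto simp: DirProd_def)
  next
    fix x y assume "x \<in> carrier (G\<lparr>carrier := torsion G\<rparr> \<times>\<times> product_group {1..r} (\<lambda>i. integer_group))"
      "y \<in> carrier (G\<lparr>carrier := torsion G\<rparr> \<times>\<times> product_group {1..r} (\<lambda>i. integer_group))"
    then obtain t n s m where *: "x = (t, n)" "y = (s, m)" "t \<in> torsion G" "s \<in> torsion G" by (auto simp: DirProd_def)
    have "lincomb {1..r} g (\<lambda>i\<in>{1..r}. n i + m i) = lincomb {1..r} g (\<lambda>i. n i + m i)"
      by (rule lincomb_cong[OF g]) auto
    then have l: "lincomb {1..r} g (\<lambda>i\<in>{1..r}. n i + m i) = lincomb {1..r} g n \<otimes> lincomb {1..r} g m"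
      using lincomb_add[OF g] by simp
    show "?h (x \<otimes>\<^bsub>G\<lparr>carrier := torsion G\<rparr> \<times>\<times> product_group {1..r} (\<lambda>i. integer_group)\<^esub> y) = ?h x \<otimes> ?h y"
      unfolding *(1,2) using l torsion_carrier[OF *(3)] torsion_carrier[OF *(4)] lincomb_closed[OF g]
      by (simp add: DirProd_def integer_group_def m_ac)
  qed
  moreover have "bij_betw ?h (carrier (G\<lparr>carrier := torsion G\<rparr> \<times>\<times> product_group {1..r} (\<lambda>i. integer_group))) (carrier G)"
    unfolding bij_betw_def
  proof
    show "inj_on ?h (carrier (G\<lparr>carrier := torsion G\<rparr> \<times>\<times> product_group {1..r} (\<lambda>i. integer_group)))"
    proof (rule inj_onI)
      fix x y assume "x \<in> carrier (G\<lparr>carrier := torsion G\<rparr> \<times>\<times> product_group {1..r} (\<lambda>i. integer_group))"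
        "y \<in> carrier (G\<lparr>carrier := torsion G\<rparr> \<times>\<times> product_group {1..r} (\<lambda>i. integer_group))" and eq: "?h x = ?h y"
      then obtain t n s m where *: "x = (t, n)" "y = (s, m)" "t \<in> torsion G" "s \<in> torsion G"
        "n \<in> extensional {1..r}" "m \<in> extensional {1..r}" by (auto simp: DirProd_def PiE_def)
      then show "x = y"
        using lincomb_unique[OF gen ind, of t n s m] eq by (auto intro: extensionalityI)
    qed
    show "?h ` carrier (G\<lparr>carrier := torsion G\<rparr> \<times>\<times> product_group {1..r} (\<lambda>i. integer_group)) = carrier G"
    proof
      show "carrier G \<subseteq> ?h ` carrier (G\<lparr>carrier := torsion G\<rparr> \<times>\<times> product_group {1..r} (\<lambda>i. integer_group))"
      proof
        fix x assume "x \<in> carrier G"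
        then obtain t n where t: "t \<in> torsion G" "x = t \<otimes> lincomb {1..r} g n"
          using gen by (auto simp: generates_mod_torsion_def)
        have "lincomb {1..r} g n = lincomb {1..r} g (restrict n {1..r})" by (rule lincomb_cong[OF g]) auto
        then have "x = ?h (t, restrict n {1..r})" using t by simp
        moreover have "(t, restrict n {1..r}) \<in> carrier (G\<lparr>carrier := torsion G\<rparr> \<times>\<times> product_group {1..r} (\<lambda>i. integer_group))"
          using t by (auto simp: DirProd_def integer_group_def)
        ultimately show "x \<in> ?h ` carrier (G\<lparr>carrier := torsion G\<rparr> \<times>\<times> product_group {1..r} (\<lambda>i. integer_group))" by blast
      qed
    qed (use hom_carrier[OF hom] in blast)
  qed
  ultimately show ?thesis by (simp add: iso_def)
qed

end

section \<open>Rank over the rationals\<close>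

lemma rat_group_simps [simp]:
  "carrier rat_group = UNIV" "x \<otimes>\<^bsub>rat_group\<^esub> y = x + y" "\<one>\<^bsub>rat_group\<^esub> = 0"
  by (simp_all add: rat_group_def)

lemma comm_group_rat_group: "comm_group rat_group"
  by (rule comm_groupI) (auto intro: exI[of _ "- _"] simp: add.assoc add.commute)

text \<open>The elements \<open>1 \<otimes> g i\<close> form a basis of the rational vector space.
  They span because torsion dies in the tensor product and integer exponents move to the rational
  factor. They are independent because the exponent functions on \<open>G\<close> extend to
  functionals dual to them.\<close>

lemma (in comm_group) has_rank_independent:
  assumes gen: "generates_mod_torsion {1..r} g" and ind: "independent_mod_torsion {1..r} g"
  shows "has_rank G r"
proof -
  let ?I = "{1..r}" and ?l = "\<lambda>(n :: int) (q :: rat). of_int n * q" and ?a = "\<lambda>(n :: int) x. x [^] n"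
  have g: "g \<in> ?I \<rightarrow> carrier G" using gen by (simp add: generates_mod_torsion_def)
  have gc: "g i \<in> carrier G" if "i \<in> ?I" for i using g that by blast
  interpret T: tensor rat_group G "UNIV :: int set" ?l ?a
    by (intro tensor.intro comm_group_rat_group tensor_axioms.intro) (unfold_locales, auto)
  \<comment> \<open>The exponents of \<open>x\<close> modulo torsion. Independence makes them unique
    on the index set; elsewhere the chosen values are arbitrary.\<close>
  define co where "co x = (SOME n. \<exists>t\<in>torsion G. x = t \<otimes> lincomb ?I g n)" for x
  have co: "\<exists>t\<in>torsion G. x = t \<otimes> lincomb ?I g (co x)" if "x \<in> carrier G" for x
  proof -
    have "\<exists>n. \<exists>t\<in>torsion G. x = t \<otimes> lincomb ?I g n"
      using gen that unfolding generates_mod_torsion_def by blast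
    then show ?thesis unfolding co_def by (rule someI_ex)
  qed
  have co_eq: "co x i = n i" if "x = t \<otimes> lincomb ?I g n" "t \<in> torsion G" "i \<in> ?I" for x t n i
  proof -
    have "x \<in> carrier G" using that torsion_carrier lincomb_closed[OF g] by auto
    then obtain s where "s \<in> torsion G" "x = s \<otimes> lincomb ?I g (co x)" using co by blast
    then show ?thesis using lincomb_unique(2)[OF gen ind, of s "co x" t n i] that by metis
  qed
  have co_mult: "co (x \<otimes> y) i = co x i + co y i" if x: "x \<in> carrier G" and y: "y \<in> carrier G" and i: "i \<in> ?I" for x y i
  proof -
    obtain s t where s: "s \<in> torsion G" "x = s \<otimes> lincomb ?I g (co x)" and t: "t \<in> torsion G" "y = t \<otimes> lincomb ?I g (co y)"
      using co[OF x] co[OF y] by blast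
    have "x \<otimes> y = (s \<otimes> lincomb ?I g (co x)) \<otimes> (t \<otimes> lincomb ?I g (co y))"
      using s(2) t(2) by simp
    also have "\<dots> = (s \<otimes> t) \<otimes> lincomb ?I g (\<lambda>i. co x i + co y i)"
      using torsion_carrier[OF s(1)] torsion_carrier[OF t(1)] lincomb_closed[OF g]
      using lincomb_add[OF g, of "co x" "co y"] by (simp add: m_ac)
    finally show ?thesis using co_eq[OF _ torsion_closed(2)[OF s(1) t(1)] i] by blast
  qed
  have co_hom: "(\<lambda>x. co x i) \<in> hom G integer_group" if "i \<in> ?I" for i
    using co_mult that by (auto intro!: homI simp: integer_group_def)
  have co_pow: "co (x [^] n) i = n * co x i" if x: "x \<in> carrier G" and i: "i \<in> ?I" for x i and n :: int
  proof -
    interpret h: group_hom G integer_group "\<lambda>x. co x i"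
      by (simp add: group_hom_def group_hom_axioms_def co_hom[OF i] is_group)
    have "co (x [^] n) i = co x i [^]\<^bsub>integer_group\<^esub> n" by (rule h.hom_int_pow[OF x])
    then show ?thesis by simp
  qed
  have co_g: "co (g i) j = (if i = j then 1 else 0)" if "i \<in> ?I" "j \<in> ?I" for i j
  proof -
    have "lincomb ?I g (\<lambda>k. if i = k then 1 else 0) = g i [^] (1 :: int)"
      using lincomb_single[OF _ that(1) g, of "\<lambda>k. if i = k then 1 else 0"] by simp
    then have "g i = \<one> \<otimes> lincomb ?I g (\<lambda>k. if i = k then 1 else 0)" using gc[OF that(1)] by simp
    then show ?thesis using co_eq[OF _ torsion_closed(1) that(2)] by simp
  qed
  have "\<exists>\<Phi>. \<Phi> \<in> hom T.T rat_group \<and> (\<forall>q. \<forall>x\<in>carrier G. \<Phi> (T.pure q x) = q * of_int (co x j))" if j: "j \<in> ?I" for j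
  proof -
    obtain \<Phi> where "\<Phi> \<in> hom T.T rat_group" "\<And>q x. q \<in> carrier rat_group \<Longrightarrow> x \<in> carrier G \<Longrightarrow> \<Phi> (T.pure q x) = q * of_int (co x j)"
      by (rule T.tensor_lift[OF comm_group_rat_group, of "\<lambda>q x. q * of_int (co x j)"])
         (use j in \<open>auto simp: co_mult co_pow algebra_simps\<close>)
    then show ?thesis by auto
  qed
  then obtain \<Phi> where \<Phi>: "\<And>j. j \<in> ?I \<Longrightarrow> \<Phi> j \<in> hom T.T rat_group"
    "\<And>j q x. j \<in> ?I \<Longrightarrow> x \<in> carrier G \<Longrightarrow> \<Phi> j (T.pure q x) = q * of_int (co x j)" by metis
  have pc: "T.pure q (g i) \<in> carrier T.T" if "i \<in> ?I" for q i using gc[OF that] by auto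
  let ?S = "\<lambda>c J. finprod T.T (\<lambda>i. T.pure (c i) (g i)) J"
  have \<Phi>_sum: "\<Phi> j (?S c J) = (if j \<in> J then c j else 0)" if j: "j \<in> ?I" and J: "J \<subseteq> ?I" for j c J
  proof -
    have "finite J" using J by (rule finite_subset) simp
    then show ?thesis
      using J
    proof (induction J rule: finite_induct)
      case empty
      interpret h: group_hom T.T rat_group "\<Phi> j"
        using comm_group_rat_group by (simp add: group_hom_def group_hom_axioms_def \<Phi>(1)[OF j] T.T.is_group comm_group_def)
      show ?case using h.hom_one by simp
    next
      case (insert i J)
      then have i: "i \<in> ?I" and J: "J \<subseteq> ?I" by auto
      have fin: "(\<lambda>i. T.pure (c i) (g i)) \<in> J \<rightarrow> carrier T.T" using J pc by blast
      have "?S c (insert i J) = T.pure (c i) (g i) \<otimes>\<^bsub>T.T\<^esub> ?S c J"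
        using insert pc[OF i] fin by (intro T.T.finprod_insert) auto
      then have "\<Phi> j (?S c (insert i J)) = \<Phi> j (T.pure (c i) (g i)) + \<Phi> j (?S c J)"
        using hom_mult[OF \<Phi>(1)[OF j] pc[OF i] T.T.finprod_closed[OF fin]] by simp
      also have "\<dots> = c i * of_int (co (g i) j) + (if j \<in> J then c j else 0)"
        using insert.IH[OF J] \<Phi>(2)[OF j gc[OF i]] by simp
      finally show ?case using co_g[OF i j] insert(2) by auto
    qed
  qed
  \<comment> \<open>If \<open>t^k\<close> is trivial, then
    \<open>q \<otimes> t = (q/k) \<otimes> t^k\<close> is trivial too; this is where divisibility of
    the rationals enters.\<close>
  have tors: "T.pure q t = \<one>\<^bsub>T.T\<^esub>" if t: "t \<in> torsion G" for q t
  proof -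
    obtain k where k: "t \<in> carrier G" "k > 0" "t [^] (k :: nat) = \<one>" using t by (auto simp: torsion_def)
    have "T.pure q t = T.pure (?l (int k) (q / of_nat k)) t" using k by simp
    also have "\<dots> = T.pure (q / of_nat k) (t [^] int k)" using k by (intro T.pure_scalar) auto
    finally show ?thesis using k T.pure_one by (simp add: int_pow_int)
  qed
  have lin: "T.pure q (lincomb J g n) = ?S (\<lambda>i. q * of_int (n i)) J" if "J \<subseteq> ?I" for q n J
  proof -
    have "finite J" using that by (rule finite_subset) simp
    then show ?thesis
      using that
    proof (induction J rule: finite_induct)
      case empty
      then show ?case using T.pure_one(2)[of q] by (simp add: lincomb_def)
    next
      case (insert i J)
      then have i: "i \<in> ?I" and J: "J \<subseteq> ?I" by auto
      have gJ: "g \<in> insert i J \<rightarrow> carrier G" "g \<in> J \<rightarrow> carrier G" using g insert.prems by auto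
      have fin: "(\<lambda>i. T.pure (q * of_int (n i)) (g i)) \<in> J \<rightarrow> carrier T.T" using J pc by blast
      have "T.pure q (lincomb (insert i J) g n) = T.pure q (g i [^] n i) \<otimes>\<^bsub>T.T\<^esub> T.pure q (lincomb J g n)"
        using lincomb_insert[OF insert(1,2) gJ(1)] gc[OF i] lincomb_closed[OF gJ(2)] T.pure_right[of q "g i [^] n i" "lincomb J g n"] by simp
      also have "T.pure q (g i [^] n i) = T.pure (q * of_int (n i)) (g i)"
        using T.pure_scalar[of "n i" q "g i"] gc[OF i] by (simp add: mult.commute)
      also have "T.pure (q * of_int (n i)) (g i) \<otimes>\<^bsub>T.T\<^esub> T.pure q (lincomb J g n) = ?S (\<lambda>i. q * of_int (n i)) (insert i J)"
        unfolding insert.IH[OF J] using insert pc[OF i] fin by (intro T.T.finprod_insert[symmetric]) auto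
      finally show ?case .
    qed
  qed
  have ex: "\<exists>c. v = ?S c ?I" if "v \<in> carrier T.T" for v
    using that
  proof (induction rule: T.tensor_induct)
    case (pure q x)
    then obtain t where t: "t \<in> torsion G" "x = t \<otimes> lincomb ?I g (co x)" using co by blast
    then have "T.pure q x = T.pure q t \<otimes>\<^bsub>T.T\<^esub> T.pure q (lincomb ?I g (co x))"
      using T.pure_right[of q t "lincomb ?I g (co x)"] torsion_carrier[OF t(1)] lincomb_closed[OF g] by simp
    also have "\<dots> = ?S (\<lambda>i. q * of_int (co x i)) ?I"
      unfolding tors[OF t(1)] lin[OF subset_refl] by (rule T.T.l_one, rule T.T.finprod_closed) (use pc in blast)
    finally show ?case by (intro exI[of _ "\<lambda>i. q * of_int (co x i)"])
  next
    case (mult s t)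
    then obtain c d where cd: "s = ?S c ?I" "t = ?S d ?I" by blast
    have "?S (\<lambda>i. c i + d i) ?I = finprod T.T (\<lambda>i. T.pure (c i) (g i) \<otimes>\<^bsub>T.T\<^esub> T.pure (d i) (g i)) ?I"
      by (rule T.T.finprod_cong') (use T.pure_left[of _ _ "g _"] gc pc in auto)
    also have "\<dots> = s \<otimes>\<^bsub>T.T\<^esub> t"
      unfolding cd by (rule T.T.finprod_multf) (use pc in blast)+
    finally show ?case by (intro exI[of _ "\<lambda>i. c i + d i"]) simp
  qed
  define b where "b i = T.pure 1 (g i)" for i
  have inj: "inj_on b ?I"
  proof (rule inj_onI)
    fix i j assume ij: "i \<in> ?I" "j \<in> ?I" "b i = b j"
    have "\<Phi> i (b i) = of_int (co (g i) i)" "\<Phi> i (b j) = of_int (co (g j) i)"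
      using \<Phi>(2)[OF ij(1) gc[OF ij(1)], of 1] \<Phi>(2)[OF ij(1) gc[OF ij(2)], of 1] by (simp_all add: b_def)
    then have "co (g i) i = co (g j) i" using ij(3) by simp
    then show "i = j" using co_g[OF ij(1) ij(1)] co_g[OF ij(2) ij(1)] by (auto split: if_splits)
  qed
  let ?act = "\<lambda>q. tensor_act_left rat_group G UNIV ?l ?a ((*) q)"
  have act: "?act q (b i) = T.pure q (g i)" if "i \<in> ?I" for q i
    using T.tensor_act_left_hom(2)[of "(*) q" 1 "g i"] gc[OF that] by (simp add: b_def hom_def algebra_simps)
  have sum: "(\<Otimes>\<^bsub>T.T\<^esub>v\<in>b ` ?I. ?act (c v) v) = ?S (c \<circ> b) ?I" for c
  proof -
    have "(\<Otimes>\<^bsub>T.T\<^esub>v\<in>b ` ?I. ?act (c v) v) = (\<Otimes>\<^bsub>T.T\<^esub>i\<in>?I. ?act (c (b i)) (b i))"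
      by (rule T.T.finprod_reindex[OF _ inj]) (use act pc in auto)
    also have "\<dots> = ?S (c \<circ> b) ?I"
      by (rule T.T.finprod_cong') (use act pc in auto)
    finally show ?thesis .
  qed
  have "has_dimension UNIV ?act T.T r"
    unfolding has_dimension_def
  proof (intro exI[of _ "b ` ?I"] conjI ballI)
    show "b ` ?I \<subseteq> carrier T.T" using pc by (auto simp: b_def)
    show "card (b ` ?I) = r" using card_image[OF inj] by simp
    fix v assume "v \<in> carrier T.T"
    then obtain d where d: "v = ?S d ?I" using ex by blast
    define k where "k = inv_into ?I b"
    have kb: "k (b i) = i" if "i \<in> ?I" for i using inv_into_f_f[OF inj that] by (simp add: k_def)
    show "\<exists>!c. c \<in> b ` ?I \<rightarrow>\<^sub>E UNIV \<and> v = (\<Otimes>\<^bsub>T.T\<^esub>w\<in>b ` ?I. ?act (c w) w)"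
    proof (rule ex1I[of _ "\<lambda>w\<in>b ` ?I. d (k w)"], intro conjI)
      show "v = (\<Otimes>\<^bsub>T.T\<^esub>w\<in>b ` ?I. ?act ((\<lambda>w\<in>b ` ?I. d (k w)) w) w)"
        unfolding sum d by (rule T.T.finprod_cong') (use kb pc in auto)
    next
      fix c assume *: "c \<in> b ` ?I \<rightarrow>\<^sub>E UNIV \<and> v = (\<Otimes>\<^bsub>T.T\<^esub>w\<in>b ` ?I. ?act (c w) w)"
      then have eq: "?S d ?I = ?S (c \<circ> b) ?I" using sum d by simp
      have "c (b j) = d j" if "j \<in> ?I" for j
        using \<Phi>_sum[OF that subset_refl, of d] \<Phi>_sum[OF that subset_refl, of "c \<circ> b"] eq that by simp
      then show "c = (\<lambda>w\<in>b ` ?I. d (k w))"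
        using * kb by (intro extensionalityI[of _ "b ` ?I"]) (auto simp: PiE_def)
    qed auto
  qed simp
  then show ?thesis by (simp add: has_rank_def Let_def)
qed

section \<open>Iterated skew Laurent extensions\<close>

lemma (in abelian_monoid) finsum_swap:
  assumes A: "finite A" and B: "finite B" and f: "\<And>i j. i \<in> A \<Longrightarrow> j \<in> B \<Longrightarrow> f i j \<in> carrier G"
  shows "(\<Oplus>i\<in>A. \<Oplus>j\<in>B. f i j) = (\<Oplus>j\<in>B. \<Oplus>i\<in>A. f i j)"
  using A f
proof (induction A rule: finite_induct)
  case empty
  then show ?case using finsum_zero[of B] by simp
next
  case (insert a A)
  have 1: "(\<lambda>i. \<Oplus>j\<in>B. f i j) \<in> A \<rightarrow> carrier G" "(\<Oplus>j\<in>B. f a j) \<in> carrier G"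
    using insert.prems by (auto intro!: finsum_closed)
  have 2: "(\<lambda>j. f a j) \<in> B \<rightarrow> carrier G" "(\<lambda>j. \<Oplus>i\<in>A. f i j) \<in> B \<rightarrow> carrier G"
    using insert.prems by (auto intro!: finsum_closed)
  have "(\<Oplus>i\<in>insert a A. \<Oplus>j\<in>B. f i j) = (\<Oplus>j\<in>B. f a j) \<oplus> (\<Oplus>j\<in>B. \<Oplus>i\<in>A. f i j)"
    using insert 1 by (simp add: finsum_insert)
  also have "\<dots> = (\<Oplus>j\<in>B. f a j \<oplus> (\<Oplus>i\<in>A. f i j))"
    using finsum_addf[OF 2] by simp
  also have "\<dots> = (\<Oplus>j\<in>B. \<Oplus>i\<in>insert a A. f i j)"
    by (rule finsum_cong') (use insert in \<open>auto simp: finsum_insert intro!: finsum_closed\<close>)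
  finally show ?case .
qed

context graded_division
begin

text \<open>Conjugation by a nonzero \<open>u\<close> of degree \<open>g\<close> gives
  \<open>\<sigma>\<close>, and the isomorphism evaluates Laurent polynomials at \<open>u\<close>. As
  no nontrivial power of \<open>g\<close> lies in \<open>F\<close>, the cosets of \<open>F\<close>
  by the powers of \<open>g\<close> are disjoint; different powers of \<open>u\<close> contribute to
  different degrees, whence injectivity.\<close>

lemma skew_laurent_step:
  assumes F: "subgroup F W" and G: "subgroup G W" and g: "g \<in> wt"
    and G_eq: "G = {f \<otimes>\<^bsub>W\<^esub> g [^]\<^bsub>W\<^esub> (n :: int) | f n. f \<in> F}"
    and free: "\<And>n :: int. g [^]\<^bsub>W\<^esub> n \<in> F \<Longrightarrow> n = 0"
  shows "\<exists>\<sigma> \<in> algebra_iso K (D\<lparr>carrier := sumV F\<rparr>) (D\<lparr>carrier := sumV F\<rparr>).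
    algebra_iso K (skew_laurent (D\<lparr>carrier := sumV F\<rparr>) \<sigma>) (D\<lparr>carrier := sumV G\<rparr>) \<noteq> {}"
proof -
  let ?A = "D\<lparr>carrier := sumV F\<rparr>"
  note Fc = sumV_closures[OF F] and Gc = sumV_closures[OF G]
  obtain u where gW: "g \<in> carrier W" and u: "u \<in> V g" "u \<noteq> \<zero>" using g by (auto simp: wt_def)
  have uD: "u \<in> carrier D" using VD[OF gW u(1)] .
  have uU: "u \<in> carrier (units_of D)" using uD u(2) by (simp add: units_of_carrier Units_D)
  interpret U: group "units_of D" by (rule units_group)
  \<comment> \<open>Integer powers are taken in the unit group of \<open>D\<close>, where the laws
    of exponents hold for all signs.\<close>
  define P where "P n = u [^]\<^bsub>units_of D\<^esub> (n :: int)" for n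
  have PU: "P n \<in> Units D" for n
    using U.int_pow_closed[OF uU, of n] by (simp add: P_def units_of_carrier)
  have PD [simp]: "P n \<in> carrier D" for n using PU[of n] by auto
  have Pnz [simp]: "P n \<noteq> \<zero>" for n using PU[of n] by (simp add: Units_D)
  have P_add: "P (n + m) = P n \<otimes> P m" for n m
    using U.int_pow_mult[OF uU, of n m] by (simp add: P_def units_of_mult)
  have P0: "P 0 = \<one>" by (simp add: P_def units_of_one)
  have P1: "P 1 = u" using U.int_pow_1[OF uU] by (simp add: P_def)
  have Pn [simp]: "P n \<otimes> P (- n) = \<one>" "P (- n) \<otimes> P n = \<one>" for n
    using P_add[of n "- n"] P_add[of "- n" n] P0 by simp_all
  have Pcancel [simp]: "P n \<otimes> (P (- n) \<otimes> x) = x" "P (- n) \<otimes> (P n \<otimes> x) = x" if "x \<in> carrier D" for n x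
    using that by (simp_all add: m_assoc[symmetric])
  have Pnat: "P (int k) \<in> V (g [^]\<^bsub>W\<^esub> int k)" for k
  proof (induction k)
    case 0
    then show ?case by (simp add: P0 V_one)
  next
    case (Suc k)
    have "P (int k) \<otimes> P 1 \<in> V (g [^]\<^bsub>W\<^esub> int k \<otimes>\<^bsub>W\<^esub> g)" using V_mult[OF _ gW Suc u(1)] gW P1 by simp
    moreover have "g [^]\<^bsub>W\<^esub> int k \<otimes>\<^bsub>W\<^esub> g = g [^]\<^bsub>W\<^esub> int (Suc k)"
      using W.int_pow_mult[OF gW, of "int k" 1] gW by (simp add: add.commute)
    ultimately show ?case using P_add[of "int k" 1] by (simp add: add.commute)
  qed
  have PV: "P n \<in> V (g [^]\<^bsub>W\<^esub> n)" for n
  proof (cases "n \<ge> 0")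
    case True
    then show ?thesis using Pnat[of "nat n"] by simp
  next
    case False
    then have "P (- n) \<in> V (g [^]\<^bsub>W\<^esub> (- n))" using Pnat[of "nat (- n)"] by simp
    then have "inv (P (- n)) \<in> V (inv\<^bsub>W\<^esub> (g [^]\<^bsub>W\<^esub> (- n)))" using V_inv gW by simp
    moreover have "inv (P (- n)) = P n" using Pn(2)[of n] by (intro inv_unique') auto
    ultimately show ?thesis using gW by (simp add: W.int_pow_neg)
  qed
  have gn: "g [^]\<^bsub>W\<^esub> (n :: int) \<in> carrier W" for n using gW by simp
  have PG: "P n \<in> sumV G" for n
  proof (rule Gc(9)[OF _ PV])
    have "g [^]\<^bsub>W\<^esub> n = \<one>\<^bsub>W\<^esub> \<otimes>\<^bsub>W\<^esub> g [^]\<^bsub>W\<^esub> n" using gn by simp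
    then show "g [^]\<^bsub>W\<^esub> n \<in> G" unfolding G_eq using subgroup.one_closed[OF F] by blast
  qed
  have FG: "F \<subseteq> G"
  proof
    fix f assume "f \<in> F"
    moreover then have "f = f \<otimes>\<^bsub>W\<^esub> g [^]\<^bsub>W\<^esub> (0 :: int)" using Fc(1) by auto
    ultimately show "f \<in> G" unfolding G_eq by blast
  qed
  have cj: "P n \<otimes> a \<otimes> P (- n) \<in> sumV F" if "a \<in> sumV F" for a n
    using conj_sumV[OF Fc(1) gn PV[of n] _ that, of "P (- n)"] PV[of "- n"] gW by (simp add: W.int_pow_neg)
  define \<sigma> where "\<sigma> a = P 1 \<otimes> a \<otimes> P (- 1)" for a
  have bij: "bij_betw \<sigma> (sumV F) (sumV F)"
  proof (rule bij_betwI[where g = "\<lambda>a. P (- 1) \<otimes> a \<otimes> P 1"])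
    show "\<sigma> \<in> sumV F \<rightarrow> sumV F" using cj[of _ 1] by (simp add: \<sigma>_def)
    show "(\<lambda>a. P (- 1) \<otimes> a \<otimes> P 1) \<in> sumV F \<rightarrow> sumV F" using cj[of _ "- 1"] by simp
  qed (use Fc(6) Pn[of 1] in \<open>simp_all add: \<sigma>_def m_assoc\<close>)
  have \<sigma>iso: "\<sigma> \<in> algebra_iso K ?A ?A"
  proof -
    have "\<sigma> (a \<otimes> b) = \<sigma> a \<otimes> \<sigma> b" if "a \<in> sumV F" "b \<in> sumV F" for a b
      using Fc(6)[OF that(1)] Fc(6)[OF that(2)] Pcancel(2)[of _ 1] by (simp add: \<sigma>_def m_assoc)
    moreover have "\<sigma> (a \<oplus> b) = \<sigma> a \<oplus> \<sigma> b" if "a \<in> sumV F" "b \<in> sumV F" for a b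
      using Fc(6)[OF that(1)] Fc(6)[OF that(2)] by (simp add: \<sigma>_def l_distr r_distr)
    moreover have "\<sigma> (c \<odot> a) = c \<odot> \<sigma> a" if "c \<in> carrier K" "a \<in> sumV F" for c a
      using Fc(6)[OF that(2)] that(1) by (simp add: \<sigma>_def smult_mult_left smult_mult_right)
    moreover have "\<sigma> \<one> = \<one>" using Pn(1)[of 1] by (simp add: \<sigma>_def)
    ultimately show ?thesis
      using bij bij_betw_apply[OF bij] by (auto simp: algebra_iso_def algebra_hom_def ring_hom_def)
  qed
  have inv\<sigma>: "inv_into (sumV F) \<sigma> a = P (- 1) \<otimes> a \<otimes> P 1" if "a \<in> sumV F" for a
  proof (rule inv_into_f_eq)
    show "inj_on \<sigma> (sumV F)" using bij by (simp add: bij_betw_def)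
    show "P (- 1) \<otimes> a \<otimes> P 1 \<in> sumV F" using cj[OF that, of "- 1"] by simp
    show "\<sigma> (P (- 1) \<otimes> a \<otimes> P 1) = a"
      using Fc(6)[OF that] Pcancel(1)[of _ 1] Pn(1)[of 1] by (simp add: \<sigma>_def m_assoc)
  qed
  have up: "(\<sigma> ^^ k) a = P (int k) \<otimes> a \<otimes> P (- int k)" if "a \<in> sumV F" for k a
  proof (induction k)
    case 0
    then show ?case using Fc(6)[OF that] by (simp add: P0)
  next
    case (Suc k)
    have "\<sigma> (P (int k) \<otimes> a \<otimes> P (- int k)) = P (1 + int k) \<otimes> a \<otimes> P (- int k + - 1)"
      unfolding P_add using Fc(6)[OF that] by (simp add: \<sigma>_def m_assoc)
    then show ?case using Suc by (simp add: algebra_simps)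
  qed
  have down: "(inv_into (sumV F) \<sigma> ^^ k) a = P (- int k) \<otimes> a \<otimes> P (int k)" if "a \<in> sumV F" for k a
  proof (induction k)
    case 0
    then show ?case using Fc(6)[OF that] by (simp add: P0)
  next
    case (Suc k)
    have "P (- int k) \<otimes> a \<otimes> P (int k) \<in> sumV F" using cj[OF that, of "- int k"] by simp
    then have "(inv_into (sumV F) \<sigma> ^^ Suc k) a = P (- 1) \<otimes> (P (- int k) \<otimes> a \<otimes> P (int k)) \<otimes> P 1"
      using Suc inv\<sigma> by simp
    also have "\<dots> = P (- 1 + - int k) \<otimes> a \<otimes> P (int k + 1)"
      unfolding P_add using Fc(6)[OF that] by (simp add: m_assoc)
    finally show ?case by (simp add: algebra_simps)
  qed
  \<comment> \<open>The powers of \<open>\<sigma>\<close>, for exponents of either sign, are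
    uniformly conjugation by \<open>P n\<close>; so \<open>P n a = \<sigma>^n(a) P n\<close>, the
    commutation rule of the skew Laurent extension.\<close>
  have ap: "auto_power ?A \<sigma> n a = P n \<otimes> a \<otimes> P (- n)" if "a \<in> sumV F" for n a
    using up[OF that, of "nat n"] down[OF that, of "nat (- n)"] by (auto simp: auto_power_def)
  let ?L = "skew_laurent ?A \<sigma>"
  have Lc: "f \<in> carrier ?L \<longleftrightarrow> (\<forall>n. f n \<in> sumV F) \<and> finite {n. f n \<noteq> \<zero>}" for f
    by (simp add: skew_laurent_def)
  define h where "h f = (\<Oplus>n\<in>{n. f n \<noteq> \<zero>}. f n \<otimes> P n)" for f
  have fD: "f n \<in> carrier D" if "f \<in> carrier ?L" for f n using that Fc(6) by (simp add: Lc)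
  have h_eq: "h f = (\<Oplus>n\<in>N. f n \<otimes> P n)" if f: "\<And>n. f n \<in> carrier D" and N: "finite N" "{n. f n \<noteq> \<zero>} \<subseteq> N" for f N
    unfolding h_def by (rule add.finprod_mono_neutral_cong_left[OF N]) (use f in auto)
  have hG: "h f \<in> sumV G" if f: "f \<in> carrier ?L" for f
  proof -
    have "(\<Oplus>n\<in>N. f n \<otimes> P n) \<in> sumV G" if "finite N" for N
      using that
    proof (induction N rule: finite_induct)
      case empty
      then show ?case using Gc(3) by simp
    next
      case (insert n N)
      have "f n \<in> sumV G" using f subsetD[OF sumV_mono[OF FG]] by (simp add: Lc)
      then have "f n \<otimes> P n \<in> sumV G" by (intro Gc(5) PG)
      then show ?case using insert Gc(4) fD[OF f] by (simp add: finsum_insert)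
    qed
    then show ?thesis using f by (simp add: h_def Lc)
  qed
  have h_add: "h (\<lambda>n. a n \<oplus> b n) = h a \<oplus> h b" if a: "a \<in> carrier ?L" and b: "b \<in> carrier ?L" for a b
  proof -
    let ?N = "{n. a n \<noteq> \<zero>} \<union> {n. b n \<noteq> \<zero>}"
    have N: "finite ?N" using a b by (simp add: Lc)
    have sub: "{n. a n \<oplus> b n \<noteq> \<zero>} \<subseteq> ?N" by auto
    have "h (\<lambda>n. a n \<oplus> b n) = (\<Oplus>n\<in>?N. (a n \<oplus> b n) \<otimes> P n)"
      by (rule h_eq[OF _ N sub]) (use fD a b in simp)
    also have "\<dots> = (\<Oplus>n\<in>?N. a n \<otimes> P n \<oplus> b n \<otimes> P n)"
      by (rule finsum_cong') (use fD[OF a] fD[OF b] in \<open>auto simp: l_distr\<close>)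
    also have "\<dots> = (\<Oplus>n\<in>?N. a n \<otimes> P n) \<oplus> (\<Oplus>n\<in>?N. b n \<otimes> P n)"
      by (rule finsum_addf) (use fD[OF a] fD[OF b] in auto)
    also have "\<dots> = h a \<oplus> h b"
      using h_eq[OF fD[OF a] N] h_eq[OF fD[OF b] N] by simp
    finally show ?thesis .
  qed
  have h_smult: "h (\<lambda>n. c \<odot> a n) = c \<odot> h a" if c: "c \<in> carrier K" and a: "a \<in> carrier ?L" for a c
  proof -
    let ?N = "{n. a n \<noteq> \<zero>}"
    have N: "finite ?N" using a by (simp add: Lc)
    have sub: "{n. c \<odot> a n \<noteq> \<zero>} \<subseteq> ?N" using c by auto
    have "h (\<lambda>n. c \<odot> a n) = (\<Oplus>n\<in>?N. (c \<odot> a n) \<otimes> P n)"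
      by (rule h_eq[OF _ N sub]) (use c fD[OF a] in simp)
    also have "\<dots> = (\<Oplus>n\<in>?N. c \<odot> (a n \<otimes> P n))"
      by (rule finsum_cong') (use c fD[OF a] in \<open>auto simp: smult_mult_left\<close>)
    also have "\<dots> = c \<odot> h a"
      unfolding h_def using KD.finsum_smult_ldistr[OF N c, of "\<lambda>n. a n \<otimes> P n"] fD[OF a] by auto
    finally show ?thesis .
  qed
  have h_mult: "h (a \<otimes>\<^bsub>?L\<^esub> b) = h a \<otimes> h b" if a: "a \<in> carrier ?L" and b: "b \<in> carrier ?L" for a b
  proof -
    let ?N = "{n. a n \<noteq> \<zero>}" and ?M = "{n. b n \<noteq> \<zero>}"
    \<comment> \<open>The sums of exponents contain the support of the product but may exceed it
      when coefficients cancel; hence \<open>h\<close> is computed over any finite set containing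
      the support.\<close>
    let ?C = "(\<lambda>(i, j). i + j) ` (?N \<times> ?M)"
    have fin: "finite ?N" "finite ?M" "finite ?C" using a b by (simp_all add: Lc)
    have aF: "a i \<in> sumV F" "b i \<in> sumV F" for i using a b by (simp_all add: Lc)
    have aD: "a i \<in> carrier D" "b i \<in> carrier D" for i using fD a b by simp_all
    have tF: "a i \<otimes> (P i \<otimes> b j \<otimes> P (- i)) \<in> sumV F" for i j using Fc(5) aF cj by blast
    have val: "(a \<otimes>\<^bsub>?L\<^esub> b) n = (\<Oplus>i\<in>?N. a i \<otimes> (P i \<otimes> b (n - i) \<otimes> P (- i)))" for n
      using finsum_sumV[OF F _ fin(1), of "\<lambda>i. a i \<otimes> (P i \<otimes> b (n - i) \<otimes> P (- i))"] tF ap[OF aF(2)]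
      by (simp add: skew_laurent_def)
    have valD: "(a \<otimes>\<^bsub>?L\<^esub> b) n \<in> carrier D" for n
      unfolding val by (rule finsum_closed) (use aD in auto)
    have "(a \<otimes>\<^bsub>?L\<^esub> b) n = \<zero>" if "n \<notin> ?C" for n
    proof -
      have "b (n - i) = \<zero>" if "i \<in> ?N" for i
      proof (rule ccontr)
        assume "b (n - i) \<noteq> \<zero>"
        then have "(i, n - i) \<in> ?N \<times> ?M" using that by simp
        then have "i + (n - i) \<in> ?C" by (metis (mono_tags, lifting) case_prod_conv imageI)
        then show False using \<open>n \<notin> ?C\<close> by simp
      qed
      then have "(\<Oplus>i\<in>?N. a i \<otimes> (P i \<otimes> b (n - i) \<otimes> P (- i))) = (\<Oplus>i\<in>?N. \<zero>)"
        by (intro finsum_cong') (use aD in auto)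
      then show ?thesis unfolding val by (simp add: finsum_zero)
    qed
    then have sub: "{n. (a \<otimes>\<^bsub>?L\<^esub> b) n \<noteq> \<zero>} \<subseteq> ?C" by blast
    have "h (a \<otimes>\<^bsub>?L\<^esub> b) = (\<Oplus>n\<in>?C. (a \<otimes>\<^bsub>?L\<^esub> b) n \<otimes> P n)"
      by (rule h_eq[OF valD fin(3) sub])
    also have "\<dots> = (\<Oplus>n\<in>?C. \<Oplus>i\<in>?N. (a i \<otimes> P i) \<otimes> (b (n - i) \<otimes> P (n - i)))"
    proof (rule finsum_cong')
      fix n assume "n \<in> ?C"
      have "(a \<otimes>\<^bsub>?L\<^esub> b) n \<otimes> P n = (\<Oplus>i\<in>?N. a i \<otimes> (P i \<otimes> b (n - i) \<otimes> P (- i)) \<otimes> P n)"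
        unfolding val by (rule finsum_ldistr[OF fin(1)]) (use aD in auto)
      also have "\<dots> = (\<Oplus>i\<in>?N. (a i \<otimes> P i) \<otimes> (b (n - i) \<otimes> P (n - i)))"
      proof (rule finsum_cong')
        fix i assume "i \<in> ?N"
        have "P (n - i) = P (- i) \<otimes> P n" using P_add[of "- i" n] by simp
        then show "a i \<otimes> (P i \<otimes> b (n - i) \<otimes> P (- i)) \<otimes> P n = (a i \<otimes> P i) \<otimes> (b (n - i) \<otimes> P (n - i))"
          using aD by (simp add: m_assoc)
      qed (use aD in auto)
      finally show "(a \<otimes>\<^bsub>?L\<^esub> b) n \<otimes> P n = (\<Oplus>i\<in>?N. (a i \<otimes> P i) \<otimes> (b (n - i) \<otimes> P (n - i)))" .
    qed (use aD in \<open>auto intro!: finsum_closed\<close>)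
    also have "\<dots> = (\<Oplus>i\<in>?N. \<Oplus>n\<in>?C. (a i \<otimes> P i) \<otimes> (b (n - i) \<otimes> P (n - i)))"
      by (rule finsum_swap[OF fin(3,1)]) (use aD in simp)
    also have "\<dots> = (\<Oplus>i\<in>?N. (a i \<otimes> P i) \<otimes> h b)"
    proof (rule finsum_cong')
      fix i assume i: "i \<in> ?N"
      have inj: "inj_on (\<lambda>j. i + j) ?M" by (simp add: inj_on_def)
      \<comment> \<open>For fixed \<open>i\<close> only the exponents \<open>n = i + j\<close> with
        \<open>j\<close> in the support of \<open>b\<close> contribute.\<close>
      have "(\<Oplus>n\<in>?C. (a i \<otimes> P i) \<otimes> (b (n - i) \<otimes> P (n - i))) = (\<Oplus>n\<in>(\<lambda>j. i + j) ` ?M. (a i \<otimes> P i) \<otimes> (b (n - i) \<otimes> P (n - i)))"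
      proof (rule add.finprod_mono_neutral_cong_right)
        show "(\<lambda>j. i + j) ` ?M \<subseteq> ?C" using i by force
        show "(a i \<otimes> P i) \<otimes> (b (n - i) \<otimes> P (n - i)) = \<zero>" if "n \<in> ?C - (\<lambda>j. i + j) ` ?M" for n
        proof -
          have "b (n - i) = \<zero>"
          proof (rule ccontr)
            assume "b (n - i) \<noteq> \<zero>"
            then have "i + (n - i) \<in> (\<lambda>j. i + j) ` ?M" by blast
            then show False using that by simp
          qed
          then show ?thesis using aD by simp
        qed
      qed (use aD fin in auto)
      also have "\<dots> = (\<Oplus>j\<in>?M. (a i \<otimes> P i) \<otimes> (b j \<otimes> P j))"
        using finsum_reindex[OF _ inj, of "\<lambda>n. (a i \<otimes> P i) \<otimes> (b (n - i) \<otimes> P (n - i))"] aD by auto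
      also have "\<dots> = (a i \<otimes> P i) \<otimes> h b"
        unfolding h_def by (rule finsum_rdistr[OF fin(2), symmetric]) (use aD in auto)
      finally show "(\<Oplus>n\<in>?C. (a i \<otimes> P i) \<otimes> (b (n - i) \<otimes> P (n - i))) = (a i \<otimes> P i) \<otimes> h b" .
    qed (use aD Gc(6)[OF hG[OF b]] in auto)
    also have "\<dots> = h a \<otimes> h b"
      unfolding h_def[of a] by (rule finsum_ldistr[OF fin(1), symmetric]) (use aD Gc(6)[OF hG[OF b]] in auto)
    finally show ?thesis .
  qed
  \<comment> \<open>The component in degree \<open>\<phi> g^n\<close> comes from the
    \<open>n\<close>-th coefficient alone: a contribution from another \<open>m\<close> would put
    \<open>g^(n - m)\<close> into \<open>F\<close>.\<close>
  have h_cmp: "cmp (h f) (\<phi> \<otimes>\<^bsub>W\<^esub> g [^]\<^bsub>W\<^esub> n) = cmp (f n) \<phi> \<otimes> P n"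
    if f: "f \<in> carrier ?L" and \<phi>: "\<phi> \<in> F" for f n \<phi>
  proof -
    have \<phi>W: "\<phi> \<in> carrier W" using \<phi> Fc(1) by blast
    have fS: "f m \<in> S" for m using f sumV_iff[OF Fc(1)] by (simp add: Lc)
    have "(\<Oplus>m\<in>N. f m \<otimes> P m) \<in> S \<and> cmp (\<Oplus>m\<in>N. f m \<otimes> P m) (\<phi> \<otimes>\<^bsub>W\<^esub> g [^]\<^bsub>W\<^esub> n) =
       (if n \<in> N then cmp (f n) \<phi> \<otimes> P n else \<zero>)" if "finite N" for N
      using that
    proof (induction N rule: finite_induct)
      case empty
      have "cmp \<zero> l = \<zero>" for l
        using V_sumV(2)[OF W.one_closed V_zero[OF W.one_closed], of l] by simp
      then show ?case using sumV_zero[of "carrier W"] by simp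
    next
      case (insert m N)
      have e: "(\<Oplus>m\<in>insert m N. f m \<otimes> P m) = f m \<otimes> P m \<oplus> (\<Oplus>m\<in>N. f m \<otimes> P m)"
        using insert fD[OF f] by (simp add: finsum_insert)
      note r = cmp_rmult[OF gn PV[of m] fS[of m]]
      let ?l = "\<phi> \<otimes>\<^bsub>W\<^esub> g [^]\<^bsub>W\<^esub> (n - m)"
      have lW: "?l \<in> carrier W" using \<phi>W gn by simp
      have "?l \<otimes>\<^bsub>W\<^esub> g [^]\<^bsub>W\<^esub> m = \<phi> \<otimes>\<^bsub>W\<^esub> g [^]\<^bsub>W\<^esub> n"
        using \<phi>W gn gW by (simp add: W.m_assoc W.int_pow_mult[symmetric])
      then have c: "cmp (f m \<otimes> P m) (\<phi> \<otimes>\<^bsub>W\<^esub> g [^]\<^bsub>W\<^esub> n) = cmp (f m) ?l \<otimes> P m"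
        using r(2)[OF lW] by simp
      have z: "cmp (f m) ?l = \<zero>" if "n \<noteq> m"
      proof (rule ccontr)
        assume "cmp (f m) ?l \<noteq> \<zero>"
        then have "?l \<in> F" using f sumV_iff[OF Fc(1)] by (auto simp: Lc)
        then have "inv\<^bsub>W\<^esub> \<phi> \<otimes>\<^bsub>W\<^esub> ?l \<in> F" using \<phi> subgroup.m_closed[OF F] subgroup.m_inv_closed[OF F] by blast
        then have "g [^]\<^bsub>W\<^esub> (n - m) \<in> F" using \<phi>W gn by (simp add: W.m_assoc[symmetric])
        then show False using free[of "n - m"] that by simp
      qed
      have s: "f m \<otimes> P m \<in> S" using r(1)[OF lW] .
      show ?case
        unfolding e using cmp_add[OF s, of "\<Oplus>m\<in>N. f m \<otimes> P m"] insert c z \<phi>W cmp_closed[OF fS]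
        by (cases "n = m") auto
    qed
    from this[of "{n. f n \<noteq> \<zero>}"] have "cmp (h f) (\<phi> \<otimes>\<^bsub>W\<^esub> g [^]\<^bsub>W\<^esub> n) = (if f n \<noteq> \<zero> then cmp (f n) \<phi> \<otimes> P n else \<zero>)"
      using f by (simp add: h_def Lc)
    moreover have "cmp \<zero> \<phi> = \<zero>"
      using V_sumV(2)[OF W.one_closed V_zero[OF W.one_closed], of \<phi>] by simp
    ultimately show ?thesis by (cases "f n = \<zero>") simp_all
  qed
  have inj: "inj_on h (carrier ?L)"
  proof (rule inj_onI, rule ext)
    fix a b n assume a: "a \<in> carrier ?L" and b: "b \<in> carrier ?L" and eq: "h a = h b"
    have aS: "a n \<in> S" "{l. cmp (a n) l \<noteq> \<zero>} \<subseteq> F" and bS: "b n \<in> S" "{l. cmp (b n) l \<noteq> \<zero>} \<subseteq> F"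
      using a b sumV_iff[OF Fc(1)] by (simp_all add: Lc)
    have "cmp (a n) l = cmp (b n) l" for l
    proof (cases "l \<in> F")
      case True
      have "cmp (a n) l \<otimes> P n = cmp (b n) l \<otimes> P n"
        using h_cmp[OF a True, of n] h_cmp[OF b True, of n] eq by simp
      then have "cmp (a n) l \<otimes> P n \<otimes> inv (P n) = cmp (b n) l \<otimes> P n \<otimes> inv (P n)" by simp
      then show ?thesis using cmp_closed[OF aS(1)] cmp_closed[OF bS(1)] by simp
    next
      case False
      then have "cmp (a n) l = \<zero>" "cmp (b n) l = \<zero>" using aS bS by blast+
      then show ?thesis by simp
    qed
    then show "a n = b n" using total_cmp[OF aS(1)] total_cmp[OF bS(1)] by (metis ext)
  qed
  have surj: "x \<in> h ` carrier ?L" if "x \<in> sumV G" for x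
    using that Gc(1)
  proof (induction x rule: sumV_induct)
    case zero
    have "(\<lambda>n. \<zero>) \<in> carrier ?L" using Fc(3) by (simp add: Lc)
    moreover have "h (\<lambda>n. \<zero>) = \<zero>" by (simp add: h_def)
    ultimately show ?case by (intro image_eqI[of \<zero> h "\<lambda>n. \<zero>"]) simp_all
  next
    case (hom l x)
    then obtain f n where fn: "l = f \<otimes>\<^bsub>W\<^esub> g [^]\<^bsub>W\<^esub> (n :: int)" "f \<in> F" unfolding G_eq by blast
    have fW: "f \<in> carrier W" using fn Fc(1) by blast
    have xD: "x \<in> carrier D" using hom VD by blast
    have "x \<otimes> P (- n) \<in> V (l \<otimes>\<^bsub>W\<^esub> g [^]\<^bsub>W\<^esub> (- n))" by (rule V_mult[OF hom(2) gn hom(3) PV])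
    also have "l \<otimes>\<^bsub>W\<^esub> g [^]\<^bsub>W\<^esub> (- n) = f"
      unfolding fn(1) using fW gn gW by (simp add: W.m_assoc W.int_pow_mult[symmetric])
    finally have xF: "x \<otimes> P (- n) \<in> sumV F" by (rule Fc(9)[OF fn(2)])
    let ?f = "\<lambda>k. if k = n then x \<otimes> P (- n) else \<zero>"
    have "finite {k. ?f k \<noteq> \<zero>}" by (rule finite_subset[of _ "{n}"]) auto
    then have fL: "?f \<in> carrier ?L" using xF Fc(3) by (simp add: Lc)
    have "h ?f = (\<Oplus>k\<in>{n}. ?f k \<otimes> P k)"
      by (rule h_eq[OF fD[OF fL]]) (simp_all add: subset_eq)
    also have "\<dots> = x" using xD by (simp add: finsum_insert m_assoc)
    finally have "x = h ?f" by (rule sym)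
    then show ?case by (rule image_eqI[OF _ fL])
  next
    case (add x y)
    then obtain a b where ab: "a \<in> carrier ?L" "b \<in> carrier ?L" "x = h a" "y = h b" by blast
    have "{n. a n \<oplus> b n \<noteq> \<zero>} \<subseteq> {n. a n \<noteq> \<zero>} \<union> {n. b n \<noteq> \<zero>}" by auto
    then have "finite {n. a n \<oplus> b n \<noteq> \<zero>}" by (rule finite_subset) (use ab in \<open>simp add: Lc\<close>)
    then have "(\<lambda>n. a n \<oplus> b n) \<in> carrier ?L" using ab Fc(4) by (simp add: Lc)
    from image_eqI[OF _ this, of "x \<oplus> y" h] show ?case using h_add[OF ab(1,2)] ab(3,4) by simp
  qed
  have "h \<one>\<^bsub>?L\<^esub> = \<one>"
  proof -
    have "h \<one>\<^bsub>?L\<^esub> = (\<Oplus>k\<in>{0}. \<one>\<^bsub>?L\<^esub> k \<otimes> P k)"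
      by (rule h_eq) (auto simp: skew_laurent_def)
    then show ?thesis by (simp add: finsum_insert P0 skew_laurent_def)
  qed
  then have "h \<in> algebra_iso K ?L (D\<lparr>carrier := sumV G\<rparr>)"
    using hG h_add h_mult h_smult inj surj
    by (auto simp: algebra_iso_def algebra_hom_def ring_hom_def bij_betw_def skew_laurent_def)
  then show ?thesis using \<sigma>iso by blast
qed

text \<open>Starting from the torsion subgroup, the generators \<open>g 1, ..., g r\<close> are
  adjoined one by one. Independence modulo torsion says that no nontrivial power of the next
  generator lies in the subgroup reached so far, which is what a single skew Laurent step asks
  for.\<close>

lemma iterated_skew_laurent_sumV:
  assumes gen: "comm_group.generates_mod_torsion Ev {1..r} g" and ind: "comm_group.independent_mod_torsion Ev {1..r} g"
  shows "iterated_skew_laurent K (D\<lparr>carrier := sumV (torsion Ev)\<rparr>) r (D\<lparr>carrier := sumV wt\<rparr>)"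
proof -
  interpret E: comm_group Ev by (rule Ev_comm_group)
  have g: "g i \<in> carrier Ev" if "i \<in> {1..r}" for i using gen that by (auto simp: E.generates_mod_torsion_def)
  define F where "F = rec_nat (torsion Ev) (\<lambda>k F. {f \<otimes>\<^bsub>Ev\<^esub> g (Suc k) [^]\<^bsub>Ev\<^esub> (n :: int) | f n. f \<in> F})"
  have F0: "F 0 = torsion Ev" and FS: "F (Suc k) = {f \<otimes>\<^bsub>Ev\<^esub> g (Suc k) [^]\<^bsub>Ev\<^esub> (n :: int) | f n. f \<in> F k}" for k
    by (simp_all add: F_def)
  have Fsub: "subgroup (F k) Ev" if "k \<le> r" for k
    using that
  proof (induction k)
    case (Suc k)
    then show ?case unfolding FS using g by (intro E.adjoin_subgroup(1)) auto
  qed (simp add: F0 E.torsion_subgroup)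
  have Fiff: "F k = {t \<otimes>\<^bsub>Ev\<^esub> E.lincomb {1..k} g n | t n. t \<in> torsion Ev}" if "k \<le> r" for k
    using that
  proof (induction k)
    case 0
    have e: "t \<otimes>\<^bsub>Ev\<^esub> E.lincomb {1..0} g n = t" if "t \<in> torsion Ev" for t n
    proof -
      have "E.lincomb {1..0} g n = \<one>\<^bsub>Ev\<^esub>" by (simp add: E.lincomb_def)
      then show ?thesis using E.r_one[OF E.torsion_carrier[OF that]] by (simp only:)
    qed
    show ?case
      unfolding F0
    proof (intro equalityI subsetI)
      fix x assume x: "x \<in> torsion Ev"
      then have "x = x \<otimes>\<^bsub>Ev\<^esub> E.lincomb {1..0} g (\<lambda>_. 0)" using e by (simp only:)
      with x show "x \<in> {t \<otimes>\<^bsub>Ev\<^esub> E.lincomb {1..0} g n | t n. t \<in> torsion Ev}" by blast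
    next
      fix x assume "x \<in> {t \<otimes>\<^bsub>Ev\<^esub> E.lincomb {1..0} g n | t n. t \<in> torsion Ev}"
      then show "x \<in> torsion Ev" using e by (elim CollectE exE conjE) (simp only:)
    qed
  next
    case (Suc k)
    then have IH: "F k = {t \<otimes>\<^bsub>Ev\<^esub> E.lincomb {1..k} g n | t n. t \<in> torsion Ev}" by simp
    have gk: "g \<in> {1..k} \<rightarrow> carrier Ev" "g \<in> insert (Suc k) {1..k} \<rightarrow> carrier Ev" "g (Suc k) \<in> carrier Ev"
      using g Suc.prems by auto
    have step: "E.lincomb {1..Suc k} g n = g (Suc k) [^]\<^bsub>Ev\<^esub> n (Suc k) \<otimes>\<^bsub>Ev\<^esub> E.lincomb {1..k} g n" for n
      using E.lincomb_insert[OF _ _ gk(2), of n] by (simp add: atLeastAtMostSuc_conv)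
    show ?case
    proof
      show "F (Suc k) \<subseteq> {t \<otimes>\<^bsub>Ev\<^esub> E.lincomb {1..Suc k} g n | t n. t \<in> torsion Ev}"
      proof
        fix x assume "x \<in> F (Suc k)"
        then obtain t n m where x: "x = (t \<otimes>\<^bsub>Ev\<^esub> E.lincomb {1..k} g n) \<otimes>\<^bsub>Ev\<^esub> g (Suc k) [^]\<^bsub>Ev\<^esub> (m :: int)" "t \<in> torsion Ev"
          unfolding FS IH by blast
        have "E.lincomb {1..k} g (n(Suc k := m)) = E.lincomb {1..k} g n"
          by (rule E.lincomb_cong) (use gk(1) in auto)
        then have "x = t \<otimes>\<^bsub>Ev\<^esub> E.lincomb {1..Suc k} g (n(Suc k := m))"
          unfolding x(1) step
          using E.torsion_carrier[OF x(2)] E.lincomb_closed[OF gk(1), of n] E.int_pow_closed[OF gk(3), of m]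
          by (simp only: fun_upd_same E.m_assoc E.m_comm[of "E.lincomb {1..k} g n"] E.m_closed)
        then show "x \<in> {t \<otimes>\<^bsub>Ev\<^esub> E.lincomb {1..Suc k} g n | t n. t \<in> torsion Ev}" using x(2) by blast
      qed
      show "{t \<otimes>\<^bsub>Ev\<^esub> E.lincomb {1..Suc k} g n | t n. t \<in> torsion Ev} \<subseteq> F (Suc k)"
      proof
        fix x assume "x \<in> {t \<otimes>\<^bsub>Ev\<^esub> E.lincomb {1..Suc k} g n | t n. t \<in> torsion Ev}"
        then obtain t n where x: "x = t \<otimes>\<^bsub>Ev\<^esub> E.lincomb {1..Suc k} g n" "t \<in> torsion Ev" by blast
        have "x = (t \<otimes>\<^bsub>Ev\<^esub> E.lincomb {1..k} g n) \<otimes>\<^bsub>Ev\<^esub> g (Suc k) [^]\<^bsub>Ev\<^esub> n (Suc k)"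
          unfolding x(1) step
          using E.torsion_carrier[OF x(2)] E.lincomb_closed[OF gk(1), of n] E.int_pow_closed[OF gk(3), of "n (Suc k)"]
          by (simp only: E.m_assoc E.m_comm[of "E.lincomb {1..k} g n"] E.m_closed)
        then show "x \<in> F (Suc k)" unfolding FS IH using x(2) by blast
      qed
    qed
  qed
  have free: "n = 0" if k: "Suc k \<le> r" and n: "g (Suc k) [^]\<^bsub>Ev\<^esub> (n :: int) \<in> F k" for k n
  proof -
    have gk: "g \<in> {1..k} \<rightarrow> carrier Ev" "g \<in> {1..r} \<rightarrow> carrier Ev" using g k by auto
    obtain t m where t: "t \<in> torsion Ev" "g (Suc k) [^]\<^bsub>Ev\<^esub> n = t \<otimes>\<^bsub>Ev\<^esub> E.lincomb {1..k} g m"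
      using n Fiff[of k] k by auto
    \<comment> \<open>Padding with zeros turns both sides into combinations of all \<open>r\<close>
      generators, and uniqueness of exponents is read at index \<open>Suc k\<close>, where the
      padded side has exponent zero.\<close>
    let ?m = "\<lambda>i. if i \<in> {1..k} then m i else 0"
    have "E.lincomb {1..r} g ?m = E.lincomb {1..k} g m"
      unfolding E.lincomb_def
      by (rule E.finprod_mono_neutral_cong_right) (use E.int_pow_closed[OF g] E.one_closed k in auto)
    then have "t \<otimes>\<^bsub>Ev\<^esub> E.lincomb {1..r} g ?m = g (Suc k) [^]\<^bsub>Ev\<^esub> n"
      using t(2) by (simp only:)
    also have "\<dots> = \<one>\<^bsub>Ev\<^esub> \<otimes>\<^bsub>Ev\<^esub> g (Suc k) [^]\<^bsub>Ev\<^esub> n"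
      by (rule E.l_one[symmetric], rule E.int_pow_closed[OF g]) (use k in simp)
    also have "g (Suc k) [^]\<^bsub>Ev\<^esub> n = E.lincomb {1..r} g (\<lambda>i. if i = Suc k then n else 0)"
      using E.lincomb_single[OF _ _ gk(2), of "Suc k" "\<lambda>i. if i = Suc k then n else 0"] k by simp
    finally have "t \<otimes>\<^bsub>Ev\<^esub> E.lincomb {1..r} g ?m =
      \<one>\<^bsub>Ev\<^esub> \<otimes>\<^bsub>Ev\<^esub> E.lincomb {1..r} g (\<lambda>i. if i = Suc k then n else 0)" .
    then have "?m (Suc k) = (if Suc k = Suc k then n else 0)"
      by (rule E.lincomb_unique(2)[OF gen ind _ t(1) E.torsion_closed(1)]) (use k in auto)
    then show ?thesis by simp
  qed
  have FW: "subgroup (F k) W" if "k \<le> r" for k by (rule Ev_subgroup[OF Fsub[OF that]])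
  have "iterated_skew_laurent K (D\<lparr>carrier := sumV (torsion Ev)\<rparr>) k (D\<lparr>carrier := sumV (F k)\<rparr>)" if "k \<le> r" for k
    using that
  proof (induction k)
    case 0
    have "(\<lambda>x. x) \<in> algebra_iso K (D\<lparr>carrier := sumV (F 0)\<rparr>) (D\<lparr>carrier := sumV (F 0)\<rparr>)"
      by (auto simp: algebra_iso_def algebra_hom_def ring_hom_def bij_betw_def)
    then show ?case
      using k_algebra_sumV[OF FW[of 0]] unfolding F0 by (intro iterated_skew_laurent.base) auto
  next
    case (Suc k)
    have gS: "g (Suc k) \<in> wt" using g[of "Suc k"] Suc.prems by simp
    have "F (Suc k) = {f \<otimes>\<^bsub>W\<^esub> g (Suc k) [^]\<^bsub>W\<^esub> (n :: int) | f n. f \<in> F k}"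
      unfolding FS by (simp add: Ev_int_pow[OF gS])
    note eq = this
    have "\<exists>\<sigma> \<in> algebra_iso K (D\<lparr>carrier := sumV (F k)\<rparr>) (D\<lparr>carrier := sumV (F k)\<rparr>).
      algebra_iso K (skew_laurent (D\<lparr>carrier := sumV (F k)\<rparr>) \<sigma>) (D\<lparr>carrier := sumV (F (Suc k))\<rparr>) \<noteq> {}"
      by (rule skew_laurent_step[OF FW FW gS eq])
        (use free[OF Suc.prems] Ev_int_pow[OF gS] Suc.prems in simp_all)
    then obtain \<sigma> where "\<sigma> \<in> algebra_iso K (D\<lparr>carrier := sumV (F k)\<rparr>) (D\<lparr>carrier := sumV (F k)\<rparr>)"
      "algebra_iso K (skew_laurent (D\<lparr>carrier := sumV (F k)\<rparr>) \<sigma>) (D\<lparr>carrier := sumV (F (Suc k))\<rparr>) \<noteq> {}"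
      by blast
    then show ?case
      using Suc k_algebra_sumV[OF FW] by (intro iterated_skew_laurent.step[where A = "D\<lparr>carrier := sumV (F k)\<rparr>"]) auto
  qed
  moreover have "F r = wt"
  proof
    show "F r \<subseteq> wt" using subgroup.subset[OF Fsub[of r]] by simp
    have *: "\<forall>x\<in>carrier Ev. \<exists>t\<in>torsion Ev. \<exists>n. x = t \<otimes>\<^bsub>Ev\<^esub> E.lincomb {1..r} g n"
      using gen unfolding E.generates_mod_torsion_def by (elim conjE)
    show "wt \<subseteq> F r"
    proof
      fix x assume "x \<in> wt"
      then have "x \<in> carrier Ev" by simp
      then obtain t n where "t \<in> torsion Ev" "x = t \<otimes>\<^bsub>Ev\<^esub> E.lincomb {1..r} g n" using * by blast
      then show "x \<in> F r" unfolding Fiff[OF order_refl] by blast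
    qed
  qed
  ultimately show ?thesis by (metis order_refl)
qed

end

section \<open>Eigenspaces\<close>

text \<open>\<open>H\<close> is the additive group of \<open>K\<close> for derivations and the unit group for automorphisms.  The
  product rule is required for eigenvectors only, where it is the same in both cases.\<close>

locale weight_operators = division_alg K D + H: comm_group H
  for K :: "'k ring" and D :: "('k, 'a) module" (structure) and H :: "'k monoid" +
  fixes t :: nat and \<delta> :: "nat \<Rightarrow> 'a \<Rightarrow> 'a"
  assumes H_K: "carrier H \<subseteq> carrier K"
    and closed: "i \<in> {1..t} \<Longrightarrow> x \<in> carrier D \<Longrightarrow> \<delta> i x \<in> carrier D"
    and add: "i \<in> {1..t} \<Longrightarrow> x \<in> carrier D \<Longrightarrow> y \<in> carrier D \<Longrightarrow> \<delta> i (x \<oplus> y) = \<delta> i x \<oplus> \<delta> i y"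
    and smult: "i \<in> {1..t} \<Longrightarrow> c \<in> carrier K \<Longrightarrow> x \<in> carrier D \<Longrightarrow> \<delta> i (c \<odot> x) = c \<odot> \<delta> i x"
    and one: "i \<in> {1..t} \<Longrightarrow> \<delta> i \<one> = \<one>\<^bsub>H\<^esub> \<odot> \<one>"
    and mult: "i \<in> {1..t} \<Longrightarrow> x \<in> carrier D \<Longrightarrow> y \<in> carrier D \<Longrightarrow> a \<in> carrier H \<Longrightarrow> b \<in> carrier H \<Longrightarrow>
      \<delta> i x = a \<odot> x \<Longrightarrow> \<delta> i y = b \<odot> y \<Longrightarrow> \<delta> i (x \<otimes> y) = (a \<otimes>\<^bsub>H\<^esub> b) \<odot> (x \<otimes> y)"
    and inv: "i \<in> {1..t} \<Longrightarrow> x \<in> carrier D \<Longrightarrow> x \<noteq> \<zero> \<Longrightarrow> a \<in> carrier H \<Longrightarrow>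
      \<delta> i x = a \<odot> x \<Longrightarrow> \<delta> i (inv x) = (inv\<^bsub>H\<^esub> a) \<odot> inv x"
    and quotient: "i \<in> {1..t} \<Longrightarrow> division_subalgebra K D Q \<Longrightarrow> u \<in> Q \<Longrightarrow> x \<in> Q \<Longrightarrow> u \<noteq> \<zero> \<Longrightarrow>
      \<delta> i u \<in> Q \<Longrightarrow> \<delta> i (u \<otimes> x) \<in> Q \<Longrightarrow> \<delta> i x \<in> Q"
begin

abbreviation W :: "(nat \<Rightarrow> 'k) monoid" where "W \<equiv> weight_group H t"

lemma comm_group_W: "comm_group W"
proof -
  have "group W" unfolding weight_group_def by (rule product_group) (rule H.is_group)
  then show ?thesis
    by (rule group.group_comm_groupI) (auto simp: weight_group_def PiE_iff intro!: restrict_ext H.m_comm)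
qed

lemma W_simps:
  "l \<in> carrier W \<Longrightarrow> i \<in> {1..t} \<Longrightarrow> l i \<in> carrier H"
  "i \<in> {1..t} \<Longrightarrow> \<one>\<^bsub>W\<^esub> i = \<one>\<^bsub>H\<^esub>"
  "i \<in> {1..t} \<Longrightarrow> (l \<otimes>\<^bsub>W\<^esub> m) i = l i \<otimes>\<^bsub>H\<^esub> m i"
  "l \<in> carrier W \<Longrightarrow> i \<in> {1..t} \<Longrightarrow> (inv\<^bsub>W\<^esub> l) i = inv\<^bsub>H\<^esub> (l i)"
  using H.is_group by (auto simp: weight_group_def)

lemma W_K: "l \<in> carrier W \<Longrightarrow> i \<in> {1..t} \<Longrightarrow> l i \<in> carrier K"
  using W_simps(1) H_K by blast

lemma delta_zero: "i \<in> {1..t} \<Longrightarrow> \<delta> i \<zero> = \<zero>"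
  by (rule add_hom_zero[OF add_homI]) (use closed add is_abelian_group in auto)

lemma additive_finsum:
  assumes h: "h \<in> hom (add_monoid D) (add_monoid D)" and M: "finite M" "f \<in> M \<rightarrow> carrier D"
  shows "h (\<Oplus>l\<in>M. f l) = (\<Oplus>l\<in>M. h (f l))"
  using M
proof (induction M rule: finite_induct)
  case empty
  have "h \<zero> = \<zero>" by (rule add_hom_zero[OF h]) unfold_locales
  then show ?case by simp
next
  case (insert l M)
  then have "f l \<in> carrier D" "f \<in> M \<rightarrow> carrier D" "(\<lambda>l. h (f l)) \<in> M \<rightarrow> carrier D" "h (f l) \<in> carrier D"
    using add_hom_simps(1)[OF h] by auto
  then show ?case using insert by (simp add: finsum_insert add_hom_simps(2)[OF h])
qed

text \<open>The classical elimination. For \<open>k \<noteq> m\<close> some operator separates the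
  two weights; subtracting its eigenvalue at \<open>m\<close> removes the summand \<open>f m\<close>
  and rescales every other summand within its eigenspace. The factor at \<open>f k\<close> is a
  nonzero element of the field and can be cancelled.\<close>

lemma eigenspaces_independent:
  assumes "finite M" "M \<subseteq> carrier W" "\<And>l. l \<in> M \<Longrightarrow> f l \<in> eigenspace D t \<delta> l" "(\<Oplus>l\<in>M. f l) = \<zero>" "l \<in> M"
  shows "f l = \<zero>"
  using assms
proof (induction M arbitrary: f l rule: finite_induct)
  case (insert m M)
  have fD: "f k \<in> carrier D" if "k \<in> insert m M" for k using insert.prems(2)[OF that] by (simp add: eigenspace_def)
  have mW: "m \<in> carrier W" and MW: "M \<subseteq> carrier W" using insert.prems by auto
  have M0: "f k = \<zero>" if k: "k \<in> M" for k
  proof -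
    have kW: "k \<in> carrier W" using MW k by blast
    have "k \<noteq> m" using k insert.hyps by blast
    then obtain i where i: "i \<in> {1..t}" "k i \<noteq> m i"
      using kW mW PiE_ext[of k "{1..t}" "\<lambda>_. carrier H" m] by (auto simp: weight_group_def)
    have mi: "m i \<in> carrier K" by (rule W_K[OF mW i(1)])
    define h where "h x = \<delta> i x \<ominus> m i \<odot> x" for x
    have h: "h \<in> hom (add_monoid D) (add_monoid D)"
    proof (rule add_homI)
      fix x y assume xy: "x \<in> carrier D" "y \<in> carrier D"
      then show "h (x \<oplus> y) = h x \<oplus> h y"
        using closed[OF i(1)] mi by (simp add: h_def add[OF i(1)] KD.smult_r_distr a_minus_def minus_add a_ac)
    qed (use closed[OF i(1)] mi in \<open>simp add: h_def\<close>)
    have hf: "h (f j) = (j i \<ominus>\<^bsub>K\<^esub> m i) \<odot> f j" if "j \<in> insert m M" for j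
    proof -
      have "j i \<in> carrier K" using W_K[OF _ i(1)] that insert.prems(1) by blast
      moreover have "\<delta> i (f j) = j i \<odot> f j" using insert.prems(2)[OF that] i by (simp add: eigenspace_def)
      ultimately show ?thesis
        using mi fD[OF that] by (simp add: h_def a_minus_def KD.smult_l_distr KD.smult_l_minus)
    qed
    have "m i \<ominus>\<^bsub>K\<^esub> m i = \<zero>\<^bsub>K\<^esub>" using mi by (simp add: a_minus_def KD.R.r_neg)
    then have "h (f m) = \<zero>" using hf[of m] fD[of m] by simp
    have "\<zero> = h (\<Oplus>l\<in>insert m M. f l)"
      using insert.prems(3) add_hom_zero[OF h] is_abelian_group by simp
    also have "\<dots> = (\<Oplus>l\<in>insert m M. h (f l))"
      by (rule additive_finsum[OF h]) (use insert.hyps fD in auto)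
    also have "\<dots> = h (f m) \<oplus> (\<Oplus>l\<in>M. h (f l))"
      using insert.hyps fD add_hom_simps(1)[OF h] by (intro finsum_insert) auto
    also have "\<dots> = (\<Oplus>l\<in>M. h (f l))"
      using \<open>h (f m) = \<zero>\<close> fD add_hom_simps(1)[OF h] by (simp add: finsum_closed Pi_iff)
    finally have "(\<Oplus>l\<in>M. h (f l)) = \<zero>" by simp
    then have "h (f k) = \<zero>"
    proof (rule insert.IH[OF MW, rotated, OF _ k])
      fix j assume j: "j \<in> M"
      then have jc: "j i \<ominus>\<^bsub>K\<^esub> m i \<in> carrier K" using W_K[OF _ i(1)] MW mi by auto
      have fj: "f j \<in> carrier D" using fD j by blast
      have "\<delta> p (f j) = j p \<odot> f j" if "p \<in> {1..t}" for p
        using insert.prems(2)[of j] j that by (simp add: eigenspace_def)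
      then show "h (f j) \<in> eigenspace D t \<delta> j"
        using jc fj j W_K[of j] MW hf[of j]
        by (auto simp: eigenspace_def smult KD.smult_assoc1[symmetric] KD.R.m_comm)
    qed
    then have eq: "(k i \<ominus>\<^bsub>K\<^esub> m i) \<odot> f k = \<zero>" using hf k by simp
    have kc: "k i \<ominus>\<^bsub>K\<^esub> m i \<in> carrier K" using W_K[OF kW i(1)] mi by simp
    interpret Kf: field K by (rule field)
    have "k i \<ominus>\<^bsub>K\<^esub> m i \<in> Units K"
      using kc i(2) W_K[OF kW i(1)] mi by (simp add: Kf.field_Units KD.R.r_right_minus_eq)
    then have "inv\<^bsub>K\<^esub> (k i \<ominus>\<^bsub>K\<^esub> m i) \<odot> ((k i \<ominus>\<^bsub>K\<^esub> m i) \<odot> f k) = f k"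
      using kc fD[of k] k by (simp add: KD.smult_assoc1[symmetric])
    then show ?thesis unfolding eq using \<open>k i \<ominus>\<^bsub>K\<^esub> m i \<in> Units K\<close> by simp
  qed
  have "(\<Oplus>l\<in>insert m M. f l) = f m \<oplus> (\<Oplus>l\<in>M. f l)"
    using insert.hyps fD by (intro finsum_insert) auto
  also have "(\<Oplus>l\<in>M. f l) = (\<Oplus>l\<in>M. \<zero>)"
    by (rule finsum_cong') (use M0 in auto)
  finally have "f m = \<zero>" using insert.prems(3) fD[of m] by (simp add: finsum_zero)
  then show ?case using M0 insert.prems(4) by blast
qed simp

sublocale graded_division K D W "eigenspace D t \<delta>"
proof (intro graded_division.intro graded_division_axioms.intro comm_group_W division_alg_axioms)
  show "eigenspace D t \<delta> l \<subseteq> carrier D" for l by (auto simp: eigenspace_def)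
  show "\<zero> \<in> eigenspace D t \<delta> l" if l: "l \<in> carrier W" for l
  proof -
    show ?thesis using W_K[OF l] delta_zero by (simp add: eigenspace_def)
  qed
  show "x \<oplus> y \<in> eigenspace D t \<delta> l" if "l \<in> carrier W" "x \<in> eigenspace D t \<delta> l" "y \<in> eigenspace D t \<delta> l" for l x y
    using that W_K[of l] by (simp add: eigenspace_def add KD.smult_r_distr)
  show "c \<odot> x \<in> eigenspace D t \<delta> l" if "l \<in> carrier W" "c \<in> carrier K" "x \<in> eigenspace D t \<delta> l" for l c x
    using that W_K[of l] by (auto simp: eigenspace_def smult KD.smult_assoc1[symmetric] KD.R.m_comm)
  show "\<one> \<in> eigenspace D t \<delta> \<one>\<^bsub>W\<^esub>"
    using one W_simps(2) by (simp add: eigenspace_def)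
  show "x \<otimes> y \<in> eigenspace D t \<delta> (l \<otimes>\<^bsub>W\<^esub> m)"
    if "l \<in> carrier W" "m \<in> carrier W" "x \<in> eigenspace D t \<delta> l" "y \<in> eigenspace D t \<delta> m" for l m x y
    using that W_simps(1) by (simp add: eigenspace_def mult W_simps(3))
  show "inv x \<in> eigenspace D t \<delta> (inv\<^bsub>W\<^esub> l)"
    if "l \<in> carrier W" "x \<in> eigenspace D t \<delta> l" "x \<noteq> \<zero>" for l x
    using that W_simps(1) by (simp add: eigenspace_def inv W_simps(4))
qed (rule eigenspaces_independent)

lemma eigen_sum_eq: "eigen_sum D t \<delta> L = sumV L"
  by (simp add: eigen_sum_def sumV_def)

lemma eigenvalues_eq: "eigenvalues H D t \<delta> = wt"
  by (simp add: eigenvalues_def wt_def)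

lemma eigenvalue_group_eq: "eigenvalue_group H D t \<delta> = Ev"
  by (simp add: eigenvalue_group_def eigenvalues_eq)

lemma sumV_invariant: "L \<subseteq> carrier W \<Longrightarrow> x \<in> sumV L \<Longrightarrow> i \<in> {1..t} \<Longrightarrow> \<delta> i x \<in> sumV L"
proof -
  assume L: "L \<subseteq> carrier W" and x: "x \<in> sumV L" and i: "i \<in> {1..t}"
  show ?thesis
    using x L
  proof (induction x rule: sumV_induct)
    case zero
    show ?case using sumV_zero[OF L] delta_zero[OF i] by simp
  next
    case (hom l x)
    have "\<delta> i x = l i \<odot> x" using hom(3) i by (simp add: eigenspace_def)
    then show ?case using V_sumV(1)[OF hom(2) V_smult[OF hom(2) W_K[OF hom(2) i] hom(3)]] hom(1) by simp
  next
    case (add x y)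
    then show ?case
      using sumV_D[OF _ L] sumV_add[OF L] weight_operators.add[OF weight_operators_axioms i] by simp
  qed
qed

lemma subgroup_fractions:
  assumes F: "fg_subgroup Ev F"
  defines "Q \<equiv> fractions D (sumV F)"
  shows "nc_noetherian_domain (D\<lparr>carrier := sumV F\<rparr>)" "division_subalgebra K D Q"
    "quotient_division_algebra K (D\<lparr>carrier := sumV F\<rparr>) (D\<lparr>carrier := Q\<rparr>) (\<lambda>x. x)"
    "invariant t \<delta> Q" "eigenvalues H (D\<lparr>carrier := Q\<rparr>) t \<delta> = F"
    "\<And>l v. l \<in> carrier W \<Longrightarrow> v \<in> eigenspace (D\<lparr>carrier := Q\<rparr>) t \<delta> l \<Longrightarrow> v \<noteq> \<zero> \<Longrightarrow>
      l \<in> F \<and> (\<exists>\<mu>\<in>F. \<exists>u\<in>eigenspace D t \<delta> \<mu>. \<exists>w\<in>eigenspace D t \<delta> (l \<otimes>\<^bsub>W\<^esub> \<mu>). u \<noteq> \<zero> \<and> v = m_inv D u \<otimes> w)"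
proof -
  interpret E: comm_group Ev by (rule Ev_comm_group)
  have FE: "subgroup F Ev" by (rule E.fg_subgroup_subgroup[OF F])
  have FW: "subgroup F W" by (rule Ev_subgroup[OF FE])
  have Fw: "F \<subseteq> wt" using subgroup.subset[OF FE] by simp
  note Fc = sumV_closures[OF FW]
  have FD: "sumV F \<subseteq> carrier D" using Fc(6) by blast
  show n: "nc_noetherian_domain (D\<lparr>carrier := sumV F\<rparr>)" by (rule noetherian_fg[OF F])
  note fr = fractions_division_algebra[OF FD k_algebra_sumV[OF FW] n]
  show Q: "division_subalgebra K D Q"
    and "quotient_division_algebra K (D\<lparr>carrier := sumV F\<rparr>) (D\<lparr>carrier := Q\<rparr>) (\<lambda>x. x)"
    using fr unfolding Q_def by blast+
  have FQ: "sumV F \<subseteq> Q" using fr unfolding Q_def by blast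
  have QD: "x \<in> carrier D" if "x \<in> Q" for x using that division_subalgebraD(1)[OF division_algebra Q] by blast
  show "invariant t \<delta> Q"
    unfolding invariant_def
  proof (intro ballI subsetI, elim imageE)
    fix i x y assume i: "i \<in> {1..t}" and x: "x \<in> Q" and y: "y = \<delta> i x"
    obtain u where u: "u \<in> sumV F" "u \<noteq> \<zero>" "u \<otimes> x \<in> sumV F"
      using x fractions_iff[OF FD] unfolding Q_def by blast
    \<comment> \<open>Both \<open>u\<close> and \<open>u x\<close> lie in \<open>sumV F\<close>,
      which the operators preserve, so the rule for quotients applies.\<close>
    have "\<delta> i x \<in> Q"
      by (rule quotient[OF i Q _ x u(2)]) (use u FQ sumV_invariant[OF Fc(1) _ i] in blast)+
    then show "y \<in> Q" using y by simp
  qed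
  have es: "eigenspace (D\<lparr>carrier := Q\<rparr>) t \<delta> l = eigenspace D t \<delta> l \<inter> Q" for l
    using QD by (auto simp: eigenspace_def)
  show hom: "l \<in> F \<and> (\<exists>\<mu>\<in>F. \<exists>u\<in>eigenspace D t \<delta> \<mu>. \<exists>w\<in>eigenspace D t \<delta> (l \<otimes>\<^bsub>W\<^esub> \<mu>). u \<noteq> \<zero> \<and> v = m_inv D u \<otimes> w)"
    if "l \<in> carrier W" "v \<in> eigenspace (D\<lparr>carrier := Q\<rparr>) t \<delta> l" "v \<noteq> \<zero>" for l v
  proof -
    have "v \<in> eigenspace D t \<delta> l" "v \<in> fractions D (sumV F)" using that(2) unfolding es by (auto simp: Q_def)
    then show ?thesis using fractions_homogeneous[OF FW, of v l] that(1,3) by blast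
  qed
  show "eigenvalues H (D\<lparr>carrier := Q\<rparr>) t \<delta> = F"
  proof
    show "eigenvalues H (D\<lparr>carrier := Q\<rparr>) t \<delta> \<subseteq> F"
      using hom by (auto simp: eigenvalues_def)
    show "F \<subseteq> eigenvalues H (D\<lparr>carrier := Q\<rparr>) t \<delta>"
    proof
      fix l assume l: "l \<in> F"
      then obtain u where "l \<in> carrier W" "u \<in> eigenspace D t \<delta> l" "u \<noteq> \<zero>" using Fw by (auto simp: wt_def)
      then show "l \<in> eigenvalues H (D\<lparr>carrier := Q\<rparr>) t \<delta>"
        using Fc(9)[OF l] FQ by (auto simp: eigenvalues_def es)
    qed
  qed
qed

end

text \<open>The Leibniz rule solved for \<open>\<delta> x\<close> reads
  \<open>u^-1 (\<delta>(u x) - \<delta>(u) x)\<close>. This one formula yields the eigenvalue of an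
  inverse as well as the rule for quotients.\<close>

lemma weight_operators_derivations:
  assumes D: "division_algebra K D" and \<delta>: "\<forall>i\<in>{1..t}. \<delta> i \<in> derivations K D"
  shows "weight_operators K D (add_monoid K) t \<delta>"
proof -
  interpret division_alg K D by (simp add: division_alg_def D)
  have d: "\<delta> i x \<in> carrier D" "y \<in> carrier D \<Longrightarrow> \<delta> i (x \<oplus>\<^bsub>D\<^esub> y) = \<delta> i x \<oplus>\<^bsub>D\<^esub> \<delta> i y"
    "y \<in> carrier D \<Longrightarrow> \<delta> i (x \<otimes>\<^bsub>D\<^esub> y) = \<delta> i x \<otimes>\<^bsub>D\<^esub> y \<oplus>\<^bsub>D\<^esub> x \<otimes>\<^bsub>D\<^esub> \<delta> i y"
    "c \<in> carrier K \<Longrightarrow> \<delta> i (c \<odot>\<^bsub>D\<^esub> x) = c \<odot>\<^bsub>D\<^esub> \<delta> i x"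
    if "i \<in> {1..t}" "x \<in> carrier D" for i x y c
    using \<delta> that by (auto simp: derivations_def)
  have one: "\<delta> i \<one>\<^bsub>D\<^esub> = \<zero>\<^bsub>D\<^esub>" if "i \<in> {1..t}" for i
    using d(3)[OF that one_closed one_closed] d(1)[OF that one_closed] by (simp add: add.l_cancel_one')
  have solve: "\<delta> i x = inv\<^bsub>D\<^esub> u \<otimes>\<^bsub>D\<^esub> (\<delta> i (u \<otimes>\<^bsub>D\<^esub> x) \<ominus>\<^bsub>D\<^esub> \<delta> i u \<otimes>\<^bsub>D\<^esub> x)"
    if i: "i \<in> {1..t}" and ux: "u \<in> carrier D" "x \<in> carrier D" "u \<noteq> \<zero>\<^bsub>D\<^esub>" for i u x
  proof -
    have "\<delta> i (u \<otimes>\<^bsub>D\<^esub> x) \<ominus>\<^bsub>D\<^esub> \<delta> i u \<otimes>\<^bsub>D\<^esub> x = u \<otimes>\<^bsub>D\<^esub> \<delta> i x"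
      using ux d(1)[OF i] by (simp add: d(3)[OF i ux(1,2)] a_minus_def a_ac r_neg1 r_neg2 r_neg)
    then show ?thesis using ux d(1)[OF i] by simp
  qed
  have abK: "comm_group (add_monoid K)" using KD.R.a_comm_group by simp
  show ?thesis
  proof (intro weight_operators.intro weight_operators_axioms.intro abK division_alg_axioms)
    fix i x a assume i: "i \<in> {1..t}" and x: "x \<in> carrier D" "x \<noteq> \<zero>\<^bsub>D\<^esub>" and a: "a \<in> carrier (add_monoid K)"
      and dx: "\<delta> i x = a \<odot>\<^bsub>D\<^esub> x"
    have "\<delta> i (inv\<^bsub>D\<^esub> x) = inv\<^bsub>D\<^esub> x \<otimes>\<^bsub>D\<^esub> (\<zero>\<^bsub>D\<^esub> \<ominus>\<^bsub>D\<^esub> (a \<odot>\<^bsub>D\<^esub> x) \<otimes>\<^bsub>D\<^esub> inv\<^bsub>D\<^esub> x)"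
      using solve[OF i x(1) inv_simps(1)[OF x] x(2)] x by (simp add: one[OF i] dx)
    also have "\<dots> = (\<ominus>\<^bsub>K\<^esub> a) \<odot>\<^bsub>D\<^esub> inv\<^bsub>D\<^esub> x"
      using x a by (simp add: smult_mult_left a_minus_def r_minus smult_mult_right KD.smult_l_minus)
    finally show "\<delta> i (inv\<^bsub>D\<^esub> x) = (inv\<^bsub>add_monoid K\<^esub> a) \<odot>\<^bsub>D\<^esub> inv\<^bsub>D\<^esub> x" by (simp add: a_inv_def)
  next
    fix i Q u x assume i: "i \<in> {1..t}" and Q: "division_subalgebra K D Q" and ux: "u \<in> Q" "x \<in> Q" "u \<noteq> \<zero>\<^bsub>D\<^esub>"
      and dQ: "\<delta> i u \<in> Q" "\<delta> i (u \<otimes>\<^bsub>D\<^esub> x) \<in> Q"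
    note Q' = division_subalgebraD[OF D Q]
    have m: "\<ominus>\<^bsub>D\<^esub> y \<in> Q" if "y \<in> Q" for y
    proof -
      have "y \<in> carrier D" using that Q'(1) by blast
      then show ?thesis using Q'(6)[OF _ that, of "\<ominus>\<^bsub>K\<^esub> \<one>\<^bsub>K\<^esub>"] by (simp add: KD.smult_l_minus)
    qed
    have "u \<in> carrier D" "x \<in> carrier D" using ux Q'(1) by auto
    from solve[OF i this ux(3)] show "\<delta> i x \<in> Q"
      using Q'(4,5,7) m ux dQ by (simp add: a_minus_def)
  qed (simp_all add: d one KD.smult_l_distr smult_mult_left smult_mult_right)
qed

text \<open>The rule for quotients is \<open>\<delta>(u)^-1 \<delta>(u x) = \<delta> x\<close>,
  where \<open>\<delta> u\<close> is nonzero by injectivity. The eigenvalue of an inverse comes from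
  computing the inverse of \<open>\<delta> x\<close> in two ways.\<close>

lemma weight_operators_automorphisms:
  assumes D: "division_algebra K D" and \<delta>: "\<forall>i\<in>{1..t}. \<delta> i \<in> algebra_iso K D D"
  shows "weight_operators K D (units_of K) t \<delta>"
proof -
  interpret division_alg K D by (simp add: division_alg_def D)
  have h: "\<delta> i \<in> algebra_hom K D D" and inj: "inj_on (\<delta> i) (carrier D)" if "i \<in> {1..t}" for i
    using \<delta> that by (auto simp: algebra_iso_def bij_betw_def)
  note d = algebra_homD[OF h]
  have zero: "\<delta> i \<zero>\<^bsub>D\<^esub> = \<zero>\<^bsub>D\<^esub>" if "i \<in> {1..t}" for i
    by (rule add_hom_zero[OF add_homI]) (use d(1,2)[OF that] is_abelian_group in auto)
  have nz: "\<delta> i u \<noteq> \<zero>\<^bsub>D\<^esub>" if "i \<in> {1..t}" "u \<in> carrier D" "u \<noteq> \<zero>\<^bsub>D\<^esub>" for i u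
    using inj[OF that(1)] zero[OF that(1)] that by (metis inj_onD zero_closed)
  have UK: "comm_group (units_of K)" by (rule KD.R.units_comm_group)
  interpret UK: comm_group "units_of K" by (rule UK)
  have uc: "a \<in> carrier K" if "a \<in> carrier (units_of K)" for a using that by (simp add: units_of_carrier KD.R.Units_closed)
  show ?thesis
  proof (intro weight_operators.intro weight_operators_axioms.intro UK division_alg_axioms)
    show "carrier (units_of K) \<subseteq> carrier K" using uc by blast
    show "\<delta> i \<one>\<^bsub>D\<^esub> = \<one>\<^bsub>units_of K\<^esub> \<odot>\<^bsub>D\<^esub> \<one>\<^bsub>D\<^esub>" if "i \<in> {1..t}" for i
      using d(4)[OF that] by (simp add: units_of_one)
    show "\<delta> i (x \<otimes>\<^bsub>D\<^esub> y) = (a \<otimes>\<^bsub>units_of K\<^esub> b) \<odot>\<^bsub>D\<^esub> (x \<otimes>\<^bsub>D\<^esub> y)"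
      if "i \<in> {1..t}" "x \<in> carrier D" "y \<in> carrier D" "a \<in> carrier (units_of K)" "b \<in> carrier (units_of K)"
        "\<delta> i x = a \<odot>\<^bsub>D\<^esub> x" "\<delta> i y = b \<odot>\<^bsub>D\<^esub> y" for i x y a b
      using that uc d(3)[OF that(1-3)]
      by (simp add: units_of_mult smult_mult_left smult_mult_right KD.smult_assoc1[symmetric] KD.R.m_comm)
  next
    fix i x a assume i: "i \<in> {1..t}" and x: "x \<in> carrier D" "x \<noteq> \<zero>\<^bsub>D\<^esub>" and a: "a \<in> carrier (units_of K)"
      and dx: "\<delta> i x = a \<odot>\<^bsub>D\<^esub> x"
    let ?b = "inv\<^bsub>units_of K\<^esub> a"
    have b: "?b \<in> carrier K" "a \<otimes>\<^bsub>K\<^esub> ?b = \<one>\<^bsub>K\<^esub>"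
      using uc[OF UK.inv_closed[OF a]] UK.r_inv[OF a] by (simp_all add: units_of_mult units_of_one)
    then have b': "?b \<otimes>\<^bsub>K\<^esub> a = \<one>\<^bsub>K\<^esub>" using KD.R.m_comm[OF uc[OF a] b(1)] by simp
    have "\<delta> i x \<otimes>\<^bsub>D\<^esub> (?b \<odot>\<^bsub>D\<^esub> inv\<^bsub>D\<^esub> x) = \<one>\<^bsub>D\<^esub>"
      unfolding dx using x b b' uc[OF a] by (simp add: smult_mult_left smult_mult_right KD.smult_assoc1[symmetric])
    then have 1: "inv\<^bsub>D\<^esub> (\<delta> i x) = ?b \<odot>\<^bsub>D\<^esub> inv\<^bsub>D\<^esub> x"
      using x b d(1)[OF i x(1)] by (intro inv_unique') auto
    have "\<delta> i x \<otimes>\<^bsub>D\<^esub> \<delta> i (inv\<^bsub>D\<^esub> x) = \<one>\<^bsub>D\<^esub>"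
      using d(3)[OF i x(1) inv_simps(1)[OF x]] x d(4)[OF i] by simp
    then have "inv\<^bsub>D\<^esub> (\<delta> i x) = \<delta> i (inv\<^bsub>D\<^esub> x)"
      using x d(1)[OF i] by (intro inv_unique') auto
    then show "\<delta> i (inv\<^bsub>D\<^esub> x) = ?b \<odot>\<^bsub>D\<^esub> inv\<^bsub>D\<^esub> x" using 1 by simp
  next
    fix i Q u x assume i: "i \<in> {1..t}" and Q: "division_subalgebra K D Q" and ux: "u \<in> Q" "x \<in> Q" "u \<noteq> \<zero>\<^bsub>D\<^esub>"
      and dQ: "\<delta> i u \<in> Q" "\<delta> i (u \<otimes>\<^bsub>D\<^esub> x) \<in> Q"
    note Q' = division_subalgebraD[OF D Q]
    have c: "u \<in> carrier D" "x \<in> carrier D" using ux Q'(1) by auto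
    have "inv\<^bsub>D\<^esub> (\<delta> i u) \<otimes>\<^bsub>D\<^esub> \<delta> i (u \<otimes>\<^bsub>D\<^esub> x) = \<delta> i x"
      using d(3)[OF i c] d(1)[OF i] c nz[OF i c(1) ux(3)] by simp
    then show "\<delta> i x \<in> Q"
      using Q'(5)[OF Q'(7)[OF dQ(1) nz[OF i c(1) ux(3)]] dQ(2)] by simp
  qed (simp_all add: d)
qed

section \<open>The theorem\<close>

lemma nc_noetherian_domain_iso:
  assumes T: "nc_noetherian_domain T" and R: "ring R" and h: "h \<in> ring_hom R T" "bij_betw h (carrier R) (carrier T)"
  shows "nc_noetherian_domain R"
proof -
  have Tr: "ring T" and one: "\<one>\<^bsub>T\<^esub> \<noteq> \<zero>\<^bsub>T\<^esub>"
    and dom: "\<And>x y. x \<in> carrier T \<Longrightarrow> y \<in> carrier T \<Longrightarrow> x \<otimes>\<^bsub>T\<^esub> y = \<zero>\<^bsub>T\<^esub> \<Longrightarrow> x = \<zero>\<^bsub>T\<^esub> \<or> y = \<zero>\<^bsub>T\<^esub>"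
    and acc: "acc_on (\<lambda>I. left_ideal I T)" "acc_on (\<lambda>I. right_ideal I T)"
    using T by (auto simp: nc_noetherian_domain_def)
  interpret R: ring R by fact
  interpret T: ring T by fact
  note c = ring_hom_closed[OF h(1)] and m = ring_hom_mult[OF h(1)] and a = ring_hom_add[OF h(1)]
    and z = ring_hom_zero[OF h(1) R Tr]
  have inj: "x = y" if "h x = h y" "x \<in> carrier R" "y \<in> carrier R" for x y
    using h(2) that by (auto simp: bij_betw_def dest: inj_onD)
  have surj: "\<exists>x\<in>carrier R. y = h x" if "y \<in> carrier T" for y
    using h(2) that by (auto simp: bij_betw_def)
  have add: "additive_subgroup (h ` I) T" if I: "additive_subgroup I R" for I
  proof -
    interpret I: additive_subgroup I R by (rule I)
    interpret hg: group_hom "add_monoid R" "add_monoid T" h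
      using c a by (simp add: group_hom_def group_hom_axioms_def R.a_group T.a_group hom_def Pi_def)
    show ?thesis
      using hg.subgroup_img_is_subgroup[OF I.a_subgroup] by (rule additive_subgroup.intro)
  qed
  have sub: "I \<subseteq> carrier R" if "additive_subgroup I R" for I
    using that by (rule additive_subgroup.a_subset)
  have image_inj: "I = J" if "I \<subseteq> carrier R" "J \<subseteq> carrier R" "h ` I = h ` J" for I J
    using that h(2) by (meson bij_betw_def inj_on_image_eq_iff)
  have accl: "acc_on (\<lambda>I. left_ideal I R)"
  proof (rule acc_on_transfer[OF acc(1), of _ "image h"])
    fix I assume I: "left_ideal I R"
    then have "additive_subgroup I R" and mI: "\<And>b x. b \<in> carrier R \<Longrightarrow> x \<in> I \<Longrightarrow> b \<otimes>\<^bsub>R\<^esub> x \<in> I"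
      by (auto simp: left_ideal_def)
    moreover have "b \<otimes>\<^bsub>T\<^esub> y \<in> h ` I" if bI: "b \<in> carrier T" "y \<in> h ` I" for b y
    proof -
      obtain x where x: "x \<in> I" "y = h x" using bI by blast
      obtain b' where b': "b' \<in> carrier R" "b = h b'" using surj bI by blast
      have "b \<otimes>\<^bsub>T\<^esub> y = h (b' \<otimes>\<^bsub>R\<^esub> x)"
        using m b' x sub[OF \<open>additive_subgroup I R\<close>] by auto
      then show ?thesis using mI[OF b'(1) x(1)] by blast
    qed
    ultimately show "left_ideal (h ` I) T" using add by (simp add: left_ideal_def)
  next
    show "I = J" if "left_ideal I R" "left_ideal J R" "h ` I = h ` J" for I J
      by (rule image_inj[OF sub sub that(3)]) (use that in \<open>auto simp: left_ideal_def\<close>)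
  qed blast
  have accr: "acc_on (\<lambda>I. right_ideal I R)"
  proof (rule acc_on_transfer[OF acc(2), of _ "image h"])
    fix I assume I: "right_ideal I R"
    then have "additive_subgroup I R" and mI: "\<And>b x. b \<in> carrier R \<Longrightarrow> x \<in> I \<Longrightarrow> x \<otimes>\<^bsub>R\<^esub> b \<in> I"
      by (auto simp: right_ideal_def)
    moreover have "y \<otimes>\<^bsub>T\<^esub> b \<in> h ` I" if bI: "b \<in> carrier T" "y \<in> h ` I" for b y
    proof -
      obtain x where x: "x \<in> I" "y = h x" using bI by blast
      obtain b' where b': "b' \<in> carrier R" "b = h b'" using surj bI by blast
      have "y \<otimes>\<^bsub>T\<^esub> b = h (x \<otimes>\<^bsub>R\<^esub> b')"
        using m b' x sub[OF \<open>additive_subgroup I R\<close>] by auto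
      then show ?thesis using mI[OF b'(1) x(1)] by blast
    qed
    ultimately show "right_ideal (h ` I) T" using add by (simp add: right_ideal_def)
  next
    show "I = J" if "right_ideal I R" "right_ideal J R" "h ` I = h ` J" for I J
      by (rule image_inj[OF sub sub that(3)]) (use that in \<open>auto simp: right_ideal_def\<close>)
  qed blast
  have "x = \<zero>\<^bsub>R\<^esub> \<or> y = \<zero>\<^bsub>R\<^esub>" if "x \<in> carrier R" "y \<in> carrier R" "x \<otimes>\<^bsub>R\<^esub> y = \<zero>\<^bsub>R\<^esub>" for x y
  proof -
    have "h x = \<zero>\<^bsub>T\<^esub> \<or> h y = \<zero>\<^bsub>T\<^esub>" using dom[of "h x" "h y"] m[OF that(1,2)] c that z by simp
    then show ?thesis using inj[of x "\<zero>\<^bsub>R\<^esub>"] inj[of y "\<zero>\<^bsub>R\<^esub>"] that z by auto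
  qed
  moreover have "\<one>\<^bsub>R\<^esub> \<noteq> \<zero>\<^bsub>R\<^esub>"
    using one z ring_hom_one[OF h(1)] by auto
  ultimately show ?thesis using accl accr R by (simp add: nc_noetherian_domain_def)
qed

text \<open>The inverse bijection is a homomorphism, which reduces this direction to the other. Both
  occur: from the enveloping algebra of \<open>\<Gamma>\<close> to its copy, and from the copy of
  \<open>A \<otimes> A\<^sup>o\<close> back.\<close>

lemma nc_noetherian_domain_iso':
  assumes R: "nc_noetherian_domain R" and T: "ring T" and h: "h \<in> ring_hom R T" "bij_betw h (carrier R) (carrier T)"
  shows "nc_noetherian_domain T"
proof -
  define k where "k = inv_into (carrier R) h"
  have hk: "h (k y) = y" "k y \<in> carrier R" if "y \<in> carrier T" for y
    using h(2) that by (auto simp: k_def bij_betw_def f_inv_into_f inv_into_into)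
  have kh: "k (h x) = x" if "x \<in> carrier R" for x
    using h(2) that by (simp add: k_def bij_betw_def)
  interpret R: ring R using R by (simp add: nc_noetherian_domain_def)
  interpret T: ring T by fact
  have "k \<in> ring_hom T R"
  proof (rule ring_hom_memI)
    show "k (x \<otimes>\<^bsub>T\<^esub> y) = k x \<otimes>\<^bsub>R\<^esub> k y" if "x \<in> carrier T" "y \<in> carrier T" for x y
      using kh[of "k x \<otimes>\<^bsub>R\<^esub> k y"] hk that ring_hom_mult[OF h(1)] by simp
    show "k (x \<oplus>\<^bsub>T\<^esub> y) = k x \<oplus>\<^bsub>R\<^esub> k y" if "x \<in> carrier T" "y \<in> carrier T" for x y
      using kh[of "k x \<oplus>\<^bsub>R\<^esub> k y"] hk that ring_hom_add[OF h(1)] by simp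
    show "k \<one>\<^bsub>T\<^esub> = \<one>\<^bsub>R\<^esub>" using kh[of "\<one>\<^bsub>R\<^esub>"] ring_hom_one[OF h(1)] by simp
  qed (use hk in auto)
  moreover have "bij_betw k (carrier T) (carrier R)"
    unfolding k_def by (rule bij_betw_inv_into[OF h(2)])
  ultimately show ?thesis by (rule nc_noetherian_domain_iso[OF R T])
qed

text \<open>By (G2) \<open>A\<^sup>o\<close> belongs to the class of
  \<open>\<Gamma>\<^sup>o\<close>, so (G3) places a copy of \<open>A \<otimes> A\<^sup>o\<close> in
  the class of a copy of \<open>\<Gamma> \<otimes> \<Gamma>\<^sup>o\<close>, and (G1) applies to the
  latter. That \<open>\<Gamma>\<close> itself is a Noetherian domain, as (G1) requires for
  \<open>A\<close>, follows because it is a tensor factor.\<close>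

lemma good_construction_noetherian:
  assumes K: "k_algebra K \<Gamma>" and E: "nc_noetherian_domain (enveloping_algebra K \<Gamma>)"
    and good: "good_construction K \<A>" and A: "A \<in> \<A> \<Gamma>"
  shows "k_algebra K A" "nc_noetherian_domain A" "nc_noetherian_domain (enveloping_algebra K A)"
proof -
  note g = good[unfolded good_construction_def]
  have Ko: "k_algebra K (opposite \<Gamma>)" by (rule k_algebra_opposite[OF K])
  have "tensor_alg K \<Gamma> (opposite \<Gamma>)" by (simp add: tensor_alg_def K Ko)
  then have n: "nc_noetherian_domain \<Gamma>" using E by (rule nc_noetherian_domain_factor)
  show kA: "k_algebra K A" and "nc_noetherian_domain A"
    using g K n A by blast+
  have "opposite A \<in> \<A> (opposite \<Gamma>)" using g K A by blast
  then obtain G T where G: "k_algebra K G" "algebra_iso K (enveloping_algebra K \<Gamma>) G \<noteq> {}"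
    "algebra_iso K (enveloping_algebra K A) T \<noteq> {}" "T \<in> \<A> G"
    using g K Ko A by meson
  obtain h where h: "h \<in> ring_hom (enveloping_algebra K \<Gamma>) G" "bij_betw h (carrier (enveloping_algebra K \<Gamma>)) (carrier G)"
    using G(2) by (auto simp: algebra_iso_def algebra_hom_def)
  have "nc_noetherian_domain G"
    by (rule nc_noetherian_domain_iso'[OF E k_algebra.ring[OF G(1)] h])
  then have nT: "nc_noetherian_domain T" using g G by blast
  obtain k where k: "k \<in> ring_hom (enveloping_algebra K A) T" "bij_betw k (carrier (enveloping_algebra K A)) (carrier T)"
    using G(3) by (auto simp: algebra_iso_def algebra_hom_def)
  interpret TA: tensor_alg K A "opposite A" by (simp add: tensor_alg_def kA k_algebra_opposite)
  show "nc_noetherian_domain (enveloping_algebra K A)"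
    by (rule nc_noetherian_domain_iso[OF nT TA.ring_TA k])
qed

context weight_operators
begin

text \<open>A single choice of a basis modulo torsion serves for the rank, the splitting and the
  skew Laurent extension, so the same \<open>r\<close> occurs in all three.\<close>

lemma eigenvalue_structure:
  assumes acc: "acc_on (division_subalgebra K D)"
  defines "T \<equiv> torsion Ev"
  shows "fg_abelian_group Ev" "finite T"
    "\<exists>r. has_rank Ev r \<and>
      (\<exists>h \<in> iso (Ev\<lparr>carrier := T\<rparr> \<times>\<times> product_group {1..r} (\<lambda>i. integer_group)) Ev.
         \<forall>l\<in>T. h (l, \<one>\<^bsub>product_group {1..r} (\<lambda>i. integer_group)\<^esub>) = l) \<and>
      iterated_skew_laurent K (D\<lparr>carrier := sumV T\<rparr>) r (D\<lparr>carrier := sumV wt\<rparr>)"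
    "division_subalgebra K D (eigenspace D t \<delta> \<one>\<^bsub>W\<^esub>)" "division_subalgebra K D (sumV T)"
    "has_dimension (eigenspace D t \<delta> \<one>\<^bsub>W\<^esub>) (\<lambda>c v. c \<otimes> v) (add_monoid (D\<lparr>carrier := sumV T\<rparr>)) (card T)"
    "has_dimension (eigenspace D t \<delta> \<one>\<^bsub>W\<^esub>) (\<lambda>c v. v \<otimes> c) (add_monoid (D\<lparr>carrier := sumV T\<rparr>)) (card T)"
proof -
  interpret E: comm_group Ev by (rule Ev_comm_group)
  have fg: "fg_subgroup Ev (carrier Ev)" by (rule all_subgroups_fg[OF acc E.subgroup_self])
  show "fg_abelian_group Ev"
    using E.fg_subgroup_generate[OF fg] E.comm_group_axioms unfolding fg_abelian_group_def by blast
  have TE: "subgroup T Ev" unfolding T_def by (rule E.torsion_subgroup)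
  have TW: "subgroup T W" by (rule Ev_subgroup[OF TE])
  have Tw: "T \<subseteq> wt" using subgroup.subset[OF TE] by simp
  show fin: "finite T"
    using E.finite_torsion_fg[OF all_subgroups_fg[OF acc TE]] by (simp add: T_def)
  obtain r g where gen: "E.generates_mod_torsion {1..r} g" and ind: "E.independent_mod_torsion {1..r} g"
    using E.structure_mod_torsion[OF fg] .
  let ?Z = "product_group {1..r} (\<lambda>i. integer_group)"
  let ?h = "\<lambda>(l, n). l \<otimes>\<^bsub>Ev\<^esub> E.lincomb {1..r} g n"
  have "?h (l, \<one>\<^bsub>?Z\<^esub>) = l" if "l \<in> T" for l
  proof -
    have g: "g \<in> {1..r} \<rightarrow> carrier Ev" using gen by (simp add: E.generates_mod_torsion_def)
    have "E.lincomb {1..r} g \<one>\<^bsub>?Z\<^esub> = E.lincomb {1..r} g (\<lambda>i. 0)"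
      by (rule E.lincomb_cong[OF g]) auto
    also have "\<dots> = \<one>\<^bsub>Ev\<^esub>" by (rule E.lincomb_zero)
    finally show ?thesis
      using E.r_one[OF subsetD[OF subgroup.subset[OF TE] that]] by (simp only: case_prod_conv)
  qed
  moreover have "?h \<in> iso (Ev\<lparr>carrier := T\<rparr> \<times>\<times> ?Z) Ev"
    using E.torsion_times_free_iso[OF gen ind] by (simp only: T_def)
  ultimately show "\<exists>r. has_rank Ev r \<and>
      (\<exists>h \<in> iso (Ev\<lparr>carrier := T\<rparr> \<times>\<times> product_group {1..r} (\<lambda>i. integer_group)) Ev.
         \<forall>l\<in>T. h (l, \<one>\<^bsub>product_group {1..r} (\<lambda>i. integer_group)\<^esub>) = l) \<and>
      iterated_skew_laurent K (D\<lparr>carrier := sumV T\<rparr>) r (D\<lparr>carrier := sumV wt\<rparr>)"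
    using E.has_rank_independent[OF gen ind] iterated_skew_laurent_sumV[OF gen ind] unfolding T_def by blast
  \<comment> \<open>The constants are the sum over the trivial subgroup, a special case of finite
    subgroups.\<close>
  show "division_subalgebra K D (eigenspace D t \<delta> \<one>\<^bsub>W\<^esub>)"
    using finite_sumV_division[OF W.triv_subgroup] by (simp add: sumV_one)
  show "division_subalgebra K D (sumV T)" by (rule finite_sumV_division[OF TW fin])
  show "has_dimension (eigenspace D t \<delta> \<one>\<^bsub>W\<^esub>) (\<lambda>c v. c \<otimes> v) (add_monoid (D\<lparr>carrier := sumV T\<rparr>)) (card T)"
    by (rule sumV_dimension[OF TW fin Tw])
  show "has_dimension (eigenspace D t \<delta> \<one>\<^bsub>W\<^esub>) (\<lambda>c v. v \<otimes> c) (add_monoid (D\<lparr>carrier := sumV T\<rparr>)) (card T)"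
    by (rule sumV_dimension_right[OF TW fin Tw])
qed

lemma eigen_sum_direct_wt: "eigen_sum_direct D t \<delta> wt"
  unfolding eigen_sum_direct_def
proof (intro allI impI ballI, elim conjE)
  fix M f l assume "finite M" "M \<subseteq> wt" "\<forall>l\<in>M. f l \<in> eigenspace D t \<delta> l" "(\<Oplus>l\<in>M. f l) = \<zero>" "l \<in> M"
  moreover from \<open>M \<subseteq> wt\<close> have "M \<subseteq> carrier W" by (auto simp: wt_def)
  ultimately show "f l = \<zero>" using eigenspaces_independent by blast
qed

end

lemma quotient_acc:
  assumes "nc_noetherian_domain (enveloping_algebra K A)" "quotient_division_algebra K A D \<iota>"
  shows "acc_on (division_subalgebra K D)"
  using nc_noetherian_domain_enveloping_quotient[OF assms] assms(2)
  by (intro acc_division_subalgebra) (simp_all add: nc_noetherian_domain_def quotient_division_algebra_def)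

theorem proposition3p5:
  fixes K :: "'k ring"
    and \<Gamma> :: "('k, 'u) module"
    and \<A> :: "('k, 'u) module \<Rightarrow> ('k, 'u) module set"
  assumes "field K"
    and "k_algebra K \<Gamma>"
    and "nc_noetherian_domain (enveloping_algebra K \<Gamma>)"
    and "good_construction K \<A>"
  shows "\<forall>A\<in>\<A> \<Gamma>. nc_noetherian_domain A \<and>
    (\<forall>(D :: ('k, 'd) module) \<iota>. quotient_division_algebra K A D \<iota> \<longrightarrow>
      nc_noetherian_domain (enveloping_algebra K D) \<and>
      acc_on (division_subalgebra K D) \<and>
      (\<forall>E. division_subalgebra K D E \<longrightarrow> fg_division_algebra K (D\<lparr>carrier := E\<rparr>)) \<and>
      (\<forall>t \<delta> H.
        (H = add_monoid K \<and> (\<forall>i\<in>{1..t}. \<delta> i \<in> derivations K D) \<or>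
         H = units_of K \<and> (\<forall>i\<in>{1..t}. \<delta> i \<in> algebra_iso K D D)) \<and>
        commuting_maps D t \<delta> \<longrightarrow>
        (let W = weight_group H t; Ev = eigenvalue_group H D t \<delta>; T = torsion Ev;
             D0 = eigenspace D t \<delta> \<one>\<^bsub>W\<^esub>;
             DT = eigen_sum D t \<delta> T;
             DD = eigen_sum D t \<delta> (carrier Ev)
         in fg_abelian_group Ev \<and> finite T \<and>
            (\<exists>r. has_rank Ev r \<and>
              (\<exists>h \<in> iso (Ev\<lparr>carrier := T\<rparr> \<times>\<times> product_group {1..r} (\<lambda>i. integer_group)) Ev.
                 \<forall>l\<in>T. h (l, \<one>\<^bsub>product_group {1..r} (\<lambda>i. integer_group)\<^esub>) = l) \<and>
              iterated_skew_laurent K (D\<lparr>carrier := DT\<rparr>) r (D\<lparr>carrier := DD\<rparr>)) \<and>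
            eigen_sum_direct D t \<delta> (carrier Ev) \<and>
            nc_noetherian_domain (D\<lparr>carrier := DD\<rparr>) \<and>
            division_subalgebra K D D0 \<and>
            division_subalgebra K D DT \<and>
            has_dimension D0 (\<lambda>c v. c \<otimes>\<^bsub>D\<^esub> v) (add_monoid (D\<lparr>carrier := DT\<rparr>)) (card T) \<and>
            has_dimension D0 (\<lambda>c v. v \<otimes>\<^bsub>D\<^esub> c) (add_monoid (D\<lparr>carrier := DT\<rparr>)) (card T) \<and>
            (\<forall>F. subgroup F Ev \<longrightarrow>
              (let DF = eigen_sum D t \<delta> F; Q = fractions D DF
               in nc_noetherian_domain (D\<lparr>carrier := DF\<rparr>) \<and>
                  division_subalgebra K D Q \<and>
                  quotient_division_algebra K (D\<lparr>carrier := DF\<rparr>) (D\<lparr>carrier := Q\<rparr>) (\<lambda>x. x) \<and>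
                  invariant t \<delta> Q \<and>
                  eigenvalues H (D\<lparr>carrier := Q\<rparr>) t \<delta> = F \<and>
                  (\<forall>l\<in>carrier W. \<forall>v\<in>eigenspace (D\<lparr>carrier := Q\<rparr>) t \<delta> l. v \<noteq> \<zero>\<^bsub>D\<^esub> \<longrightarrow>
                     l \<in> F \<and>
                     (\<exists>\<mu>\<in>F. \<exists>u\<in>eigenspace D t \<delta> \<mu>. \<exists>w\<in>eigenspace D t \<delta> (l \<otimes>\<^bsub>W\<^esub> \<mu>).
                        u \<noteq> \<zero>\<^bsub>D\<^esub> \<and> v = inv\<^bsub>D\<^esub> u \<otimes>\<^bsub>D\<^esub> w)))))))"
proof (intro ballI conjI allI impI, goal_cases)
  case (1 A)
  then show ?case by (rule good_construction_noetherian(2)[OF assms(2-4)])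
next
  case (2 A D \<iota>)
  show ?case by (rule nc_noetherian_domain_enveloping_quotient[OF good_construction_noetherian(3)[OF assms(2-4) 2(1)] 2(2)])
next
  case (3 A D \<iota>)
  show ?case by (rule quotient_acc[OF good_construction_noetherian(3)[OF assms(2-4) 3(1)] 3(2)])
next
  case (4 A D \<iota> E)
  have "division_algebra K D" using 4(2) by (simp add: quotient_division_algebra_def)
  then show ?case
    using quotient_acc[OF good_construction_noetherian(3)[OF assms(2-4) 4(1)] 4(2)] 4(3) by (rule fg_division_subalgebra)
next
  case (5 A D \<iota> t \<delta> H)
  note acc = quotient_acc[OF good_construction_noetherian(3)[OF assms(2-4) 5(1)] 5(2)]
  have "division_algebra K D" using 5(2) by (simp add: quotient_division_algebra_def)
  \<comment> \<open>From here on the two possibilities for \<open>H\<close> are treated alike, each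
    supplying an instance of the same locale.\<close>
  then interpret weight_operators K D H t \<delta>
    using 5(3) weight_operators_derivations weight_operators_automorphisms by blast
  note st = eigenvalue_structure[OF acc]
  have Ev: "carrier Ev = wt" by simp
  have F: "fg_subgroup Ev F" if "subgroup F Ev" for F by (rule all_subgroups_fg[OF acc that])
  have wt: "subgroup wt Ev"
    using group.subgroup_self[OF comm_group.axioms(2)[OF Ev_comm_group]] by simp
  show ?case
    unfolding Let_def eigenvalue_group_eq eigen_sum_eq Ev
  proof (intro conjI allI impI, goal_cases)
    case 1 show ?case by (rule st(1))
  next
    case 2 show ?case by (rule st(2))
  next
    case 3 show ?case by (rule st(3))
  next
    case 4 show ?case by (rule eigen_sum_direct_wt)
  next
    case 5 show ?case by (rule noetherian_fg[OF F[OF wt]])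
  next
    case 6 show ?case by (rule st(4))
  next
    case 7 show ?case by (rule st(5))
  next
    case 8 show ?case by (rule st(6))
  next
    case 9 show ?case by (rule st(7))
  next
    case (10 F') then show ?case by (rule subgroup_fractions(1)[OF F])
  next
    case (11 F') then show ?case by (rule subgroup_fractions(2)[OF F])
  next
    case (12 F') then show ?case by (rule subgroup_fractions(3)[OF F])
  next
    case (13 F') then show ?case by (rule subgroup_fractions(4)[OF F])
  next
    case (14 F') then show ?case by (rule subgroup_fractions(5)[OF F])
  next
    case (15 F') show ?case by (intro ballI impI) (rule subgroup_fractions(6)[OF F[OF 15]])
  qed
qed

end
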